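(* Let $G_1$, $G_2$ be locally compact $[FC]^-$ groups and, for $i=1,2$, let $\omega_i$ be a weight on $G_i$ satisfying $\omega_i(gxg^{-1})\le c\,\omega_i(x)$ for all $x,g\in G_i$, where $c>0$ is a constant. Then, as Banach algebras, $$ZL^1(G_1\times G_2,\omega_1\times\omega_2)\simeq ZL^1(G_1,\omega_1)\,\widehat{\otimes}\,ZL^1(G_2,\omega_2).$$
   Context: A locally compact group $G$ is an $[FC]^-$ group if for every $x\in G$ the conjugacy class $\{gxg^{-1}:g\in G\}$ has compact closure in $G$. A weight on a locally compact group $G$ is a Borel measurable function $\omega:G\to\mathbb{R}^+=(0,\infty)$ with $\omega(xy)\le\omega(x)\omega(y)$ for all $x,y\in G$. The Beurling algebra $L^1(G,\omega)$ is the Banach algebra (under convolution) of (a.e.-classes of) complex Haar measurable functions $f$ on $G$ with $\|f\|_\omega=\int_G|f(x)|\omega(x)\,dx<\infty$, where $dx$ is a fixed left Haar measure. The central Beurling algebra $ZL^1(G,\omega)$ is the closed subalgebra of all $f\in L^1(G,\omega)$ such that $f^g=f$ (a.e.) for all $g\in G$, where $f^g(x)=f(g^{-1}xg)$; it is a commutative Banach algebra and is the center of $L^1(G,\omega)$. The weight $\omega_1\times\omega_2$ on $G_1\times G_2$ is $(\omega_1\times\omega_2)(x,y)=\omega_1(x)\omega_2(y)$. $\widehat{\otimes}$ denotes the projective tensor product of Banach algebras, and $\simeq$ means there is a bounded algebra isomorphism with bounded inverse. *)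

theory Defs
  imports "HOL-Analysis.Analysis"
begin

section \<open>Locally compact groups\<close>

text \<open>
  A topological group is a type of class \<^class>\<open>topological_group_add\<close>. The group operation is
  written additively but is not assumed to be commutative: the product \<open>xy\<close>, the inverse and
  the conjugate of \<open>x\<close> by \<open>g\<close> are \<open>x + y\<close>, \<open>- x\<close> and \<open>g + x - g\<close>. As usual, locally compact
  groups are Hausdorff.
\<close>

instance prod :: (topological_monoid_add, topological_monoid_add) topological_monoid_add
proof
  fix a b :: "'a \<times> 'b"
  have "((\<lambda>x. (fst (fst x) + fst (snd x), snd (fst x) + snd (snd x)))
      \<longlongrightarrow> (fst a + fst b, snd a + snd b)) (nhds a \<times>\<^sub>F nhds b)"
    by (intro tendsto_Pair tendsto_add tendsto_fst tendsto_snd filterlim_fst filterlim_snd)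
  then show "((\<lambda>x. fst x + snd x) \<longlongrightarrow> a + b) (nhds a \<times>\<^sub>F nhds b)"
    by (simp add: plus_prod_def)
qed

instance prod :: (topological_group_add, topological_group_add) topological_group_add
proof
  fix a :: "'a \<times> 'b"
  have "((\<lambda>x. (- fst x, - snd x)) \<longlongrightarrow> (- fst a, - snd a)) (nhds a)"
    by (intro tendsto_Pair tendsto_minus tendsto_fst tendsto_snd filterlim_ident)
  then show "(uminus \<longlongrightarrow> - a) (nhds a)"
    by (simp add: uminus_prod_def[abs_def])
qed

definition locally_compact_group :: "'g::{topological_group_add, t2_space} itself \<Rightarrow> bool" where
  "locally_compact_group _ \<longleftrightarrow> locally_compact_space (euclidean :: 'g topology)"

definition FC_minus_group :: "'g::{topological_group_add, t2_space} itself \<Rightarrow> bool" where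
  "FC_minus_group _ \<longleftrightarrow> (\<forall>x::'g. compact (closure (range (\<lambda>g. g + x - g))))"

text \<open>
  A left Haar measure is a nonzero left invariant Radon measure on the Borel sets. No countability
  is assumed, so it need not be \<open>\<sigma>\<close>-finite, and on a product group the Borel
  \<open>\<sigma>\<close>-algebra may be larger than the product \<open>\<sigma>\<close>-algebra.
\<close>

definition left_haar_measure :: "'g::{topological_group_add, t2_space} measure \<Rightarrow> bool" where
  "left_haar_measure \<mu> \<longleftrightarrow>
     sets \<mu> = sets borel \<and>
     (\<exists>A\<in>sets borel. emeasure \<mu> A \<noteq> 0) \<and>
     (\<forall>K. compact K \<longrightarrow> emeasure \<mu> K < \<infinity>) \<and>
     (\<forall>A\<in>sets borel. emeasure \<mu> A = (INF U\<in>{U. open U \<and> A \<subseteq> U}. emeasure \<mu> U)) \<and>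
     (\<forall>U. open U \<longrightarrow> emeasure \<mu> U = (SUP K\<in>{K. compact K \<and> K \<subseteq> U}. emeasure \<mu> K)) \<and>
     (\<forall>g. \<forall>A\<in>sets borel. emeasure \<mu> ((\<lambda>x. g + x) ` A) = emeasure \<mu> A)"


section \<open>Complex normed algebras with explicit carrier\<close>

record 'a normed_alg =
  carrier :: "'a set"
  vzero :: 'a
  vadd :: "'a \<Rightarrow> 'a \<Rightarrow> 'a"
  vscale :: "complex \<Rightarrow> 'a \<Rightarrow> 'a"
  vmult :: "'a \<Rightarrow> 'a \<Rightarrow> 'a"
  vnorm :: "'a \<Rightarrow> real"

definition vdiff :: "'a normed_alg \<Rightarrow> 'a \<Rightarrow> 'a \<Rightarrow> 'a" where
  "vdiff A x y = vadd A x (vscale A (- 1) y)"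

text \<open>
  The quotient by a congruence \<open>r\<close> on the carrier along which the norm is constant.
\<close>

definition quotient_alg :: "'a normed_alg \<Rightarrow> ('a \<times> 'a) set \<Rightarrow> 'a set normed_alg" where
  "quotient_alg A r =
     \<lparr> carrier = carrier A // r,
       vzero = r `` {vzero A},
       vadd = (\<lambda>X Y. \<Union>x\<in>X. \<Union>y\<in>Y. r `` {vadd A x y}),
       vscale = (\<lambda>c X. \<Union>x\<in>X. r `` {vscale A c x}),
       vmult = (\<lambda>X Y. \<Union>x\<in>X. \<Union>y\<in>Y. r `` {vmult A x y}),
       vnorm = (\<lambda>X. vnorm A (SOME x. x \<in> X)) \<rparr>"

text \<open>
  The completion, as the Cauchy sequences modulo the null sequences. On Cauchy sequences the
  field \<^const>\<open>vnorm\<close> is only a seminorm before passing to the quotient.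
\<close>

definition cauchy_seqs :: "'a normed_alg \<Rightarrow> (nat \<Rightarrow> 'a) normed_alg" where
  "cauchy_seqs A =
     \<lparr> carrier = {s. (\<forall>n. s n \<in> carrier A) \<and>
         (\<forall>e>0. \<exists>N. \<forall>m\<ge>N. \<forall>n\<ge>N. vnorm A (vdiff A (s m) (s n)) < e)},
       vzero = (\<lambda>n. vzero A),
       vadd = (\<lambda>s t n. vadd A (s n) (t n)),
       vscale = (\<lambda>c s n. vscale A c (s n)),
       vmult = (\<lambda>s t n. vmult A (s n) (t n)),
       vnorm = (\<lambda>s. lim (\<lambda>n. vnorm A (s n))) \<rparr>"

definition completion_alg :: "'a normed_alg \<Rightarrow> (nat \<Rightarrow> 'a) set normed_alg" where
  "completion_alg A = quotient_alg (cauchy_seqs A)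
     {(s, t). s \<in> carrier (cauchy_seqs A) \<and> t \<in> carrier (cauchy_seqs A) \<and>
        (\<lambda>n. vnorm A (vdiff A (s n) (t n))) \<longlonglongrightarrow> 0}"

definition bounded_alg_hom :: "'a normed_alg \<Rightarrow> 'b normed_alg \<Rightarrow> ('a \<Rightarrow> 'b) \<Rightarrow> bool" where
  "bounded_alg_hom A B \<phi> \<longleftrightarrow>
     (\<forall>x\<in>carrier A. \<phi> x \<in> carrier B) \<and>
     (\<forall>x\<in>carrier A. \<forall>y\<in>carrier A. \<phi> (vadd A x y) = vadd B (\<phi> x) (\<phi> y)) \<and>
     (\<forall>c. \<forall>x\<in>carrier A. \<phi> (vscale A c x) = vscale B c (\<phi> x)) \<and>
     (\<forall>x\<in>carrier A. \<forall>y\<in>carrier A. \<phi> (vmult A x y) = vmult B (\<phi> x) (\<phi> y)) \<and>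
     (\<exists>C. \<forall>x\<in>carrier A. vnorm B (\<phi> x) \<le> C * vnorm A x)"

definition banach_alg_iso :: "'a normed_alg \<Rightarrow> 'b normed_alg \<Rightarrow> bool" (infix "\<simeq>\<^sub>B" 50) where
  "A \<simeq>\<^sub>B B \<longleftrightarrow>
     (\<exists>\<phi> \<psi>. bounded_alg_hom A B \<phi> \<and> bounded_alg_hom B A \<psi> \<and>
        (\<forall>x\<in>carrier A. \<psi> (\<phi> x) = x) \<and> (\<forall>y\<in>carrier B. \<phi> (\<psi> y) = y))"


section \<open>The projective tensor product\<close>

definition linear_form :: "'a normed_alg \<Rightarrow> ('a \<Rightarrow> complex) \<Rightarrow> bool" where
  "linear_form A f \<longleftrightarrow>
     (\<forall>x\<in>carrier A. \<forall>y\<in>carrier A. f (vadd A x y) = f x + f y) \<and>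
     (\<forall>c. \<forall>x\<in>carrier A. f (vscale A c x) = c * f x)"

definition bilinear_form ::
    "'a normed_alg \<Rightarrow> 'b normed_alg \<Rightarrow> ('a \<Rightarrow> 'b \<Rightarrow> complex) \<Rightarrow> bool" where
  "bilinear_form A B \<beta> \<longleftrightarrow>
     (\<forall>a\<in>carrier A. linear_form B (\<lambda>b. \<beta> a b)) \<and>
     (\<forall>b\<in>carrier B. linear_form A (\<lambda>a. \<beta> a b))"

text \<open>
  The algebraic tensor product is realised inside the dual of the space of all (not necessarily
  bounded) bilinear forms: \<open>a \<otimes> b\<close> is the evaluation \<open>\<beta> \<mapsto> \<beta> a b\<close>. Off the bilinear forms the
  functional is set to 0, so that equality of functions is equality of tensors.
\<close>

definition elem_tensor ::
    "'a normed_alg \<Rightarrow> 'b normed_alg \<Rightarrow> 'a \<Rightarrow> 'b \<Rightarrow> (('a \<Rightarrow> 'b \<Rightarrow> complex) \<Rightarrow> complex)" where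
  "elem_tensor A B a b = (\<lambda>\<beta>. if bilinear_form A B \<beta> then \<beta> a b else 0)"

definition tensor_sum ::
    "'a normed_alg \<Rightarrow> 'b normed_alg \<Rightarrow> ('a \<times> 'b) list \<Rightarrow> (('a \<Rightarrow> 'b \<Rightarrow> complex) \<Rightarrow> complex)" where
  "tensor_sum A B ps = (\<lambda>\<beta>. \<Sum>(a, b)\<leftarrow>ps. elem_tensor A B a b \<beta>)"

text \<open>
  The product is the bilinear extension of \<open>(a \<otimes> b)(a' \<otimes> b') = aa' \<otimes> bb'\<close>, see
  \<open>vmult_alg_tensor\<close> below; the norm is the projective norm.
\<close>

definition alg_tensor ::
    "'a normed_alg \<Rightarrow> 'b normed_alg \<Rightarrow> (('a \<Rightarrow> 'b \<Rightarrow> complex) \<Rightarrow> complex) normed_alg" where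
  "alg_tensor A B =
     \<lparr> carrier = tensor_sum A B ` {ps. set ps \<subseteq> carrier A \<times> carrier B},
       vzero = (\<lambda>\<beta>. 0),
       vadd = (\<lambda>u v \<beta>. u \<beta> + v \<beta>),
       vscale = (\<lambda>c u \<beta>. c * u \<beta>),
       vmult = (\<lambda>u v \<beta>. if bilinear_form A B \<beta>
          then u (\<lambda>a b. v (\<lambda>a' b'. \<beta> (vmult A a a') (vmult B b b'))) else 0),
       vnorm = (\<lambda>u. INF ps\<in>{ps. set ps \<subseteq> carrier A \<times> carrier B \<and> tensor_sum A B ps = u}.
          \<Sum>(a, b)\<leftarrow>ps. vnorm A a * vnorm B b) \<rparr>"

definition bilinear_mult :: "'a normed_alg \<Rightarrow> bool" where
  "bilinear_mult A \<longleftrightarrow>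
     (\<forall>x\<in>carrier A. \<forall>y\<in>carrier A. vadd A x y \<in> carrier A \<and> vmult A x y \<in> carrier A) \<and>
     (\<forall>c. \<forall>x\<in>carrier A. vscale A c x \<in> carrier A) \<and>
     (\<forall>x\<in>carrier A. \<forall>y\<in>carrier A. \<forall>z\<in>carrier A.
        vmult A x (vadd A y z) = vadd A (vmult A x y) (vmult A x z) \<and>
        vmult A (vadd A y z) x = vadd A (vmult A y x) (vmult A z x)) \<and>
     (\<forall>c. \<forall>x\<in>carrier A. \<forall>y\<in>carrier A.
        vmult A x (vscale A c y) = vscale A c (vmult A x y) \<and>
        vmult A (vscale A c x) y = vscale A c (vmult A x y))"

lemma vmult_alg_tensor:
  assumes "bilinear_mult A" "bilinear_mult B"
    and "a \<in> carrier A" "a' \<in> carrier A" "b \<in> carrier B" "b' \<in> carrier B"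
  shows "vmult (alg_tensor A B) (elem_tensor A B a b) (elem_tensor A B a' b') =
    elem_tensor A B (vmult A a a') (vmult B b b')"
proof
  fix \<beta>
  show "vmult (alg_tensor A B) (elem_tensor A B a b) (elem_tensor A B a' b') \<beta> =
    elem_tensor A B (vmult A a a') (vmult B b b') \<beta>"
  proof (cases "bilinear_form A B \<beta>")
    case True
    have inner: "bilinear_form A B (\<lambda>x' y'. \<beta> (vmult A x x') (vmult B y y'))"
      if "x \<in> carrier A" "y \<in> carrier B" for x y
      using True that assms(1,2)
      by (simp add: bilinear_form_def linear_form_def bilinear_mult_def)
    define \<gamma> where "\<gamma> = (\<lambda>x y. elem_tensor A B a' b'
      (\<lambda>x' y'. \<beta> (vmult A x x') (vmult B y y')))"
    have \<gamma>: "\<gamma> x y = \<beta> (vmult A x a') (vmult B y b')"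
      if "x \<in> carrier A" "y \<in> carrier B" for x y
      using inner[OF that] by (simp add: elem_tensor_def \<gamma>_def)
    have "bilinear_form A B \<gamma>"
      using True assms
      by (simp add: bilinear_form_def linear_form_def bilinear_mult_def \<gamma>)
    then show ?thesis
      using True assms \<gamma>[of a b, unfolded \<gamma>_def]
      by (simp add: alg_tensor_def elem_tensor_def[of A B a b]
        elem_tensor_def[of A B "vmult A a a'"] flip: \<gamma>_def)
  qed (simp add: alg_tensor_def elem_tensor_def)
qed

definition projective_tensor ::
    "'a normed_alg \<Rightarrow> 'b normed_alg \<Rightarrow> (nat \<Rightarrow> ('a \<Rightarrow> 'b \<Rightarrow> complex) \<Rightarrow> complex) set normed_alg"
    (infixl "\<otimes>\<^sub>\<pi>" 70) where
  "A \<otimes>\<^sub>\<pi> B = completion_alg (alg_tensor A B)"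


section \<open>Beurling algebras\<close>

definition weight :: "('g::{topological_group_add, t2_space} \<Rightarrow> real) \<Rightarrow> bool" where
  "weight \<omega> \<longleftrightarrow>
     \<omega> \<in> borel_measurable borel \<and> (\<forall>x. 0 < \<omega> x) \<and> (\<forall>x y. \<omega> (x + y) \<le> \<omega> x * \<omega> y)"

definition product_weight :: "('g \<Rightarrow> real) \<Rightarrow> ('h \<Rightarrow> real) \<Rightarrow> 'g \<times> 'h \<Rightarrow> real" (infixl "\<times>\<^sub>w" 80) where
  "\<omega>\<^sub>1 \<times>\<^sub>w \<omega>\<^sub>2 = (\<lambda>(x, y). \<omega>\<^sub>1 x * \<omega>\<^sub>2 y)"

text \<open>
  Haar measurable means measurable for the completion of the Haar measure. A function with
  finite \<open>\<omega>\<close>-norm lives on a \<open>\<sigma>\<close>-finite set because \<open>\<omega> > 0\<close>, so enlarging the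
  completion by locally measurable sets would give the same classes.
\<close>

definition beurling_fun ::
    "'g::{topological_group_add, t2_space} measure \<Rightarrow> ('g \<Rightarrow> real) \<Rightarrow> ('g \<Rightarrow> complex) normed_alg" where
  "beurling_fun \<mu> \<omega> =
     \<lparr> carrier = {f. f \<in> borel_measurable (completion \<mu>) \<and>
          integrable (completion \<mu>) (\<lambda>x. norm (f x) * \<omega> x)},
       vzero = (\<lambda>x. 0),
       vadd = (\<lambda>f g x. f x + g x),
       vscale = (\<lambda>c f x. c * f x),
       vmult = (\<lambda>f g x. LINT y|completion \<mu>. f y * g (- y + x)),
       vnorm = (\<lambda>f. LINT x|completion \<mu>. norm (f x) * \<omega> x) \<rparr>"

definition beurling_alg ::
    "'g::{topological_group_add, t2_space} measure \<Rightarrow> ('g \<Rightarrow> real) \<Rightarrow> ('g \<Rightarrow> complex) set normed_alg" where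
  "beurling_alg \<mu> \<omega> = quotient_alg (beurling_fun \<mu> \<omega>)
     {(f, h). f \<in> carrier (beurling_fun \<mu> \<omega>) \<and> h \<in> carrier (beurling_fun \<mu> \<omega>) \<and>
        (AE x in completion \<mu>. f x = h x)}"

definition central_beurling_alg ::
    "'g::{topological_group_add, t2_space} measure \<Rightarrow> ('g \<Rightarrow> real) \<Rightarrow> ('g \<Rightarrow> complex) set normed_alg" where
  "central_beurling_alg \<mu> \<omega> = (beurling_alg \<mu> \<omega>)
     \<lparr> carrier := {F \<in> carrier (beurling_alg \<mu> \<omega>).
         \<forall>f\<in>F. \<forall>g. AE x in completion \<mu>. f (- g + x + g) = f x} \<rparr>"

end

theory Submission
  imports Defs
begin

text \<open>
  Up to null sets \<open>ZL\<^sup>1(G, \<omega>)\<close> is a weighted \<open>L\<^sup>1\<close> space: if finitely many functions are central,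
  so are the indicators of the level sets of suitable simple approximations. Hence the argument
  for \<open>L\<^sup>1 \<otimes>\<^sub>\<pi> L\<^sup>1 = L\<^sup>1\<close> applies: on tensors \<open>\<Sum> 1\<^sub>E \<otimes> u\<^sub>E\<close> with disjoint \<open>E\<close> the projective norm
  is the norm of the function \<open>\<Sum> 1\<^sub>E(x) u\<^sub>E(y)\<close>. By uniqueness of Haar measure
  \<open>\<mu>(A \<times> B) = k \<mu>\<^sub>1(A) \<mu>\<^sub>2(B)\<close> for a constant \<open>k\<close>, and \<open>(f, h) \<mapsto> k\<^sup>-\<^sup>1 f(x) h(y)\<close> is then isometric and
  multiplicative. To approximate a central function of two variables by such tensors, approximate it
  by any tensors, make their first factors simple, and replace the second factors by averages of the
  given function over the level sets, which are central; then exchange the variables and repeat.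
\<close>

section \<open>Compact \<open>G\<^sub>\<delta>\<close> sets\<close>

text \<open>The groups need be neither \<sigma>-finite nor second countable, and this shapes the
  measure theory. The group operation is continuous but may fail to be measurable for the product of
  the Borel \<sigma>-algebras, so Tonelli's theorem does not apply directly to convolutions, and the
  Haar measure of the product group lives on a possibly larger \<sigma>-algebra. Compact
  \<open>G\<^sub>\<delta>\<close> sets overcome both obstacles: by compactness such a subset of a
  product lies in the product \<sigma>-algebra, there are enough of them in a locally compact space,
  and every integrable function agrees almost everywhere with one built from countably many of them.
  Passing to such versions inside a convolution requires that \<open>y \<mapsto> - y + x\<close>
  pull null sets back to null sets on \<sigma>-finite sets. Elements of the algebras have
  \<sigma>-finite supports because the weights are positive.\<close>

definition compact_gdelta :: "'a::topological_space set \<Rightarrow> bool" where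
  "compact_gdelta B \<longleftrightarrow> compact B \<and> (\<exists>U::nat \<Rightarrow> 'a set. (\<forall>n. open (U n)) \<and> B = (\<Inter>n. U n))"

lemma compact_gdelta_imp_compact: "compact_gdelta B \<Longrightarrow> compact B"
  by (simp add: compact_gdelta_def)

lemma compact_gdelta_borel [measurable]: "compact_gdelta B \<Longrightarrow> B \<in> sets borel"
  by (auto simp: compact_gdelta_def)

lemma UN_prod_decode: "(\<Union>k. g (fst (prod_decode k)) (snd (prod_decode k))) = (\<Union>n m. g n m)"
proof -
  have "(\<Union>k. g (fst (prod_decode k)) (snd (prod_decode k))) = (\<Union>p\<in>range prod_decode. g (fst p) (snd p))"
    by simp
  then show ?thesis by (auto simp: surj_prod_decode)
qed

lemma INT_prod_decode: "(\<Inter>k. g (fst (prod_decode k)) (snd (prod_decode k))) = (\<Inter>n m. g n m)"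
proof -
  have "(\<Inter>k. g (fst (prod_decode k)) (snd (prod_decode k))) = (\<Inter>p\<in>range prod_decode. g (fst p) (snd p))"
    by simp
  then show ?thesis by (auto simp: surj_prod_decode)
qed

lemma compact_INT:
  fixes B :: "nat \<Rightarrow> 'a::t2_space set"
  assumes "\<And>n. compact (B n)"
  shows "compact (\<Inter>n. B n)"
proof -
  have "compact (B 0 \<inter> (\<Inter>n. B n))"
    using assms by (intro compact_Int_closed closed_INT) (auto intro: compact_imp_closed)
  moreover have "B 0 \<inter> (\<Inter>n. B n) = (\<Inter>n. B n)" by auto
  ultimately show ?thesis by simp
qed

lemma Hausdorff_space_euclidean_t2: "Hausdorff_space (euclidean :: 'a::t2_space topology)"
  unfolding Hausdorff_space_def disjnt_def
proof (intro allI impI)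
  fix x y :: 'a assume "x \<in> topspace euclidean \<and> y \<in> topspace euclidean \<and> x \<noteq> y"
  then show "\<exists>U V. openin euclidean U \<and> openin euclidean V \<and> x \<in> U \<and> y \<in> V \<and> U \<inter> V = {}"
    using hausdorff[of x y] by simp
qed

lemma compact_gdelta_INT:
  assumes "\<And>n::nat. compact_gdelta (B n :: 'a::t2_space set)"
  shows "compact_gdelta (\<Inter>n. B n)"
proof -
  obtain U where U: "\<And>n m::nat. open (U n m)" "\<And>n. B n = (\<Inter>m. U n m)"
    using assms unfolding compact_gdelta_def by metis
  have "compact (\<Inter>n. B n)"
    using assms by (intro compact_INT) (auto simp: compact_gdelta_def)
  moreover have "(\<Inter>n. B n) = (\<Inter>k. U (fst (prod_decode k)) (snd (prod_decode k)))"
    by (simp add: U(2) INT_prod_decode[of U])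
  ultimately show ?thesis
    unfolding compact_gdelta_def using U(1)
    by (intro conjI exI[of _ "\<lambda>k. U (fst (prod_decode k)) (snd (prod_decode k))"]) simp_all
qed

text \<open>Local compactness gives a compact neighbourhood \<open>L0\<close> of \<open>C\<close>
  that may stick out of \<open>U\<close>. The part \<open>L0 - U\<close> is compact and disjoint
  from \<open>C\<close>, so an open set \<open>V2\<close> around it, separated from
  \<open>C\<close>, can be cut away.\<close>

lemma compact_open_shrink:
  fixes C U :: "'a::t2_space set"
  assumes lc: "locally_compact_space (euclidean :: 'a topology)"
    and "compact C" "open U" "C \<subseteq> U"
  obtains V L where "open V" "compact L" "C \<subseteq> V" "V \<subseteq> L" "L \<subseteq> U"
proof -
  obtain V0 L0 where V0: "open V0" "compact L0" "C \<subseteq> V0" "V0 \<subseteq> L0"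
    using lc assms(2) locally_compact_space_compact_closed_compact[of "euclidean :: 'a topology"]
      Hausdorff_space_euclidean_t2[where 'a='a]
    by auto
  have "compact (L0 - U)" using V0 assms by (simp add: compact_diff)
  moreover have "disjnt C (L0 - U)" using assms by (auto simp: disjnt_def)
  ultimately obtain V1 V2 where V: "open V1" "open V2" "C \<subseteq> V1" "L0 - U \<subseteq> V2" "disjnt V1 V2"
    using Hausdorff_space_euclidean_t2[where 'a='a, unfolded Hausdorff_space_compact_sets,
        rule_format, of C "L0 - U"] assms(2) by auto
  show ?thesis
    by (rule that[of "V0 \<inter> V1" "L0 - V2"])
      (use V V0 assms in \<open>auto simp: compact_diff disjnt_def\<close>)
qed

text \<open>Open and compact sets are interleaved, each compact set lying inside the preceding open
  one. The open sets and the compact sets then have the same intersection, which is compact and a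
  \<open>G\<^sub>\<delta>\<close> at once; it contains a neighbourhood of \<open>C\<close> because
  every stage contains \<open>L0\<close>.\<close>

lemma compact_gdelta_between:
  fixes C U :: "'a::t2_space set"
  assumes lc: "locally_compact_space (euclidean :: 'a topology)"
    and C: "compact C" and U: "open U" "C \<subseteq> U"
  obtains B V where "compact_gdelta B" "open V" "C \<subseteq> V" "V \<subseteq> B" "B \<subseteq> U"
proof -
  obtain V0 L0 where V0: "open V0" "compact L0" "C \<subseteq> V0" "V0 \<subseteq> L0" "L0 \<subseteq> U"
    using compact_open_shrink[OF lc C U] by metis
  have step: "\<exists>W L. open W \<and> compact L \<and> L0 \<subseteq> W \<and> W \<subseteq> L \<and> L \<subseteq> U'"
    if "open U'" "L0 \<subseteq> U'" for U'
    using compact_open_shrink[OF lc V0(2) that] by metis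
  have "\<exists>P :: nat \<Rightarrow> 'a set \<times> 'a set. \<forall>n. (open (fst (P n)) \<and> compact (snd (P n)) \<and> L0 \<subseteq> fst (P n) \<and>
     fst (P n) \<subseteq> snd (P n) \<and> snd (P n) \<subseteq> U) \<and> snd (P (Suc n)) \<subseteq> fst (P n)"
    using step[OF U(1) V0(5)]
  proof (intro dependent_nat_choice, goal_cases)
    case 1
    then obtain W L where "open W" "compact L" "L0 \<subseteq> W" "W \<subseteq> L" "L \<subseteq> U" by blast
    then show ?case by (intro exI[of _ "(W, L)"]) simp
  next
    case (2 x n)
    then obtain W L where "open W" "compact L" "L0 \<subseteq> W" "W \<subseteq> L" "L \<subseteq> fst x"
      using step[of "fst x"] by blast
    with 2 show ?case by (intro exI[of _ "(W, L)"]) auto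
  qed
  then obtain P :: "nat \<Rightarrow> 'a set \<times> 'a set" where
    P0: "\<forall>n. (open (fst (P n)) \<and> compact (snd (P n)) \<and> L0 \<subseteq> fst (P n) \<and>
     fst (P n) \<subseteq> snd (P n) \<and> snd (P n) \<subseteq> U) \<and> snd (P (Suc n)) \<subseteq> fst (P n)" ..
  have P: "open (fst (P n))" "compact (snd (P n))" "L0 \<subseteq> fst (P n)"
    "fst (P n) \<subseteq> snd (P n)" "snd (P n) \<subseteq> U" "snd (P (Suc n)) \<subseteq> fst (P n)" for n
    using P0[rule_format, of n] by simp_all
  define B where "B = (\<Inter>n. fst (P n))"
  have B2: "B = (\<Inter>n. snd (P n))"
    unfolding B_def
  proof (intro equalityI INT_greatest)
    show "(\<Inter>n. fst (P n)) \<subseteq> snd (P n)" for n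
      by (rule subset_trans[OF _ P(4)]) (rule INT_lower[OF UNIV_I])
    show "(\<Inter>n. snd (P n)) \<subseteq> fst (P n)" for n
      by (rule subset_trans[OF _ P(6)]) (rule INT_lower[OF UNIV_I])
  qed
  have "compact B" unfolding B2 using P(2) by (rule compact_INT)
  then have "compact_gdelta B" unfolding compact_gdelta_def B_def using P(1)
    by (intro conjI exI[of _ "\<lambda>n. fst (P n)"]) simp_all
  moreover have "L0 \<subseteq> B" unfolding B_def using P(3) by (rule INT_greatest)
  moreover have "B \<subseteq> U" unfolding B2
    by (rule subset_trans[OF _ P(5)]) (rule INT_lower[OF UNIV_I])
  ultimately show ?thesis using V0 that[of B V0] by blast
qed


section \<open>Compact sets in product \<open>\<sigma>\<close>-algebras\<close>

text \<open>An open set need not belong to a product of Borel \<sigma>-algebras, but open boxes do,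
  and they form a base. This is enough for covering arguments.\<close>

definition open_base_in :: "'a::topological_space measure \<Rightarrow> bool" where
  "open_base_in M \<longleftrightarrow> (\<forall>x P. open P \<and> x \<in> P \<longrightarrow> (\<exists>R\<in>sets M. open R \<and> x \<in> R \<and> R \<subseteq> P))"

lemma open_base_in_borel: "sets M = sets borel \<Longrightarrow> open_base_in M"
  unfolding open_base_in_def by (metis borel_open order_refl)

lemma open_base_in_pair:
  assumes "open_base_in M" "open_base_in N"
  shows "open_base_in (M \<Otimes>\<^sub>M N)"
  unfolding open_base_in_def
proof (intro allI impI)
  fix x :: "'a \<times> 'b" and P assume "open P \<and> x \<in> P"
  then obtain A B where "open A" "open B" "x \<in> A \<times> B" "A \<times> B \<subseteq> P"
    using open_prod_elim by metis
  moreover obtain A' where "A' \<in> sets M" "open A'" "fst x \<in> A'" "A' \<subseteq> A"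
    using assms(1) calculation unfolding open_base_in_def by (metis mem_Times_iff)
  moreover obtain B' where "B' \<in> sets N" "open B'" "snd x \<in> B'" "B' \<subseteq> B"
    using assms(2) calculation unfolding open_base_in_def by (metis mem_Times_iff)
  ultimately show "\<exists>R\<in>sets (M \<Otimes>\<^sub>M N). open R \<and> x \<in> R \<and> R \<subseteq> P"
    by (intro bexI[of _ "A' \<times> B'"]) (auto simp: open_Times mem_Times_iff)
qed

lemma compact_between_measurable:
  assumes M: "open_base_in M" and W: "compact W" "open P" "W \<subseteq> P"
  shows "\<exists>R\<in>sets M. W \<subseteq> R \<and> R \<subseteq> P"
proof -
  let ?C = "{R\<in>sets M. open R \<and> R \<subseteq> P}"
  have "W \<subseteq> \<Union>?C"
  proof
    fix x assume "x \<in> W"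
    then obtain R where "R \<in> sets M" "open R" "x \<in> R" "R \<subseteq> P"
      using M W unfolding open_base_in_def by blast
    then show "x \<in> \<Union>?C" by blast
  qed
  then obtain D where "D \<subseteq> ?C" "finite D" "W \<subseteq> \<Union>D"
    using compactE[OF W(1), of ?C] by blast
  then show ?thesis by (intro bexI[of _ "\<Union>D"]) auto
qed

text \<open>By compactness a finite union of basic open sets from \<open>M\<close> fits between
  \<open>W\<close> and each \<open>P n\<close>, so \<open>W\<close> is the countable intersection of
  the measurable sets \<open>R n\<close>, cut down to \<open>Q\<close>. The set \<open>Q\<close>
  serves regions such as strips, which are intersections of open sets only inside a given measurable
  set.\<close>

lemma compact_gdelta_sets:
  assumes M: "open_base_in M" and W: "compact W" "\<And>n::nat. open (P n)" "W = (\<Inter>n. P n) \<inter> Q" "Q \<in> sets M"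
  shows "W \<in> sets M"
proof -
  have "\<exists>R\<in>sets M. W \<subseteq> R \<and> R \<subseteq> P n" for n
    using W by (intro compact_between_measurable[OF M]) auto
  then obtain R where R: "\<And>n. R n \<in> sets M" "\<And>n. W \<subseteq> R n" "\<And>n. R n \<subseteq> P n" by metis
  have "W = (\<Inter>n. R n) \<inter> Q" using R W(3) by blast
  then show ?thesis using R W(4) by auto
qed

lemma compact_open_boxes:
  fixes W :: "('a::topological_space \<times> 'b::topological_space) set"
  assumes W: "compact W" "open P" "W \<subseteq> P"
  obtains D where "finite D" "\<And>A B. (A, B) \<in> D \<Longrightarrow> open A \<and> open B" 
    "W \<subseteq> (\<Union>(A, B)\<in>D. A \<times> B)" "(\<Union>(A, B)\<in>D. A \<times> B) \<subseteq> P"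
proof -
  let ?C = "{(A, B). open A \<and> open B \<and> A \<times> B \<subseteq> P}"
  have cover: "W \<subseteq> (\<Union>p\<in>?C. fst p \<times> snd p)"
  proof
    fix x assume "x \<in> W"
    then obtain A B where "open A" "open B" "x \<in> A \<times> B" "A \<times> B \<subseteq> P"
      using W open_prod_elim by (metis subsetD)
    then show "x \<in> (\<Union>p\<in>?C. fst p \<times> snd p)" by (intro UN_I[of "(A, B)"]) auto
  qed
  have "open (fst p \<times> snd p)" if "p \<in> ?C" for p using that by (auto intro: open_Times)
  from compactE_image[OF W(1) this cover] obtain D where
    D: "D \<subseteq> ?C" "finite D" "W \<subseteq> (\<Union>p\<in>D. fst p \<times> snd p)" .
  show ?thesis by (rule that[of D]) (use D in \<open>auto simp: case_prod_beta dest!: subsetD\<close>)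
qed


section \<open>\<open>\<sigma>\<close>-finite sets and Tonelli's theorem\<close>

text \<open>Haar measures need not be \<sigma>-finite here, so \<sigma>-finiteness becomes a
  property of sets. A measure is then restricted by the density \<open>indicator S\<close>, which
  keeps the underlying space unchanged.\<close>

definition sigma_finite_set :: "'a measure \<Rightarrow> 'a set \<Rightarrow> bool" where
  "sigma_finite_set M S \<longleftrightarrow>
     (\<exists>A::nat \<Rightarrow> 'a set. (\<forall>n. A n \<in> sets M \<and> emeasure M (A n) < \<infinity>) \<and> S = (\<Union>n. A n))"

lemma sigma_finite_set_sets: "sigma_finite_set M S \<Longrightarrow> S \<in> sets M"
  unfolding sigma_finite_set_def by blast

lemma sigma_finite_setI: "A \<in> sets M \<Longrightarrow> emeasure M A < \<infinity> \<Longrightarrow> sigma_finite_set M A"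
  unfolding sigma_finite_set_def by (intro exI[of _ "\<lambda>_. A"]) auto

lemma sigma_finite_set_UN:
  assumes "\<And>n::nat. sigma_finite_set M (S n)"
  shows "sigma_finite_set M (\<Union>n. S n)"
proof -
  obtain A where A: "\<And>n m::nat. A n m \<in> sets M \<and> emeasure M (A n m) < \<infinity>" "\<And>n. S n = (\<Union>m. A n m)"
    using assms unfolding sigma_finite_set_def by metis
  have "(\<Union>k. A (fst (prod_decode k)) (snd (prod_decode k))) = (\<Union>n. S n)"
    by (simp add: A(2) UN_prod_decode[of A])
  then show ?thesis unfolding sigma_finite_set_def using A(1)
    by (intro exI[of _ "\<lambda>k. A (fst (prod_decode k)) (snd (prod_decode k))"]) auto
qed

lemma sigma_finite_set_Un:
  assumes "sigma_finite_set M S" "sigma_finite_set M T"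
  shows "sigma_finite_set M (S \<union> T)"
proof -
  have "S \<union> T = (\<Union>n::nat. if n = 0 then S else T)"
    by (auto split: if_splits)
  moreover have "sigma_finite_set M (\<Union>n::nat. if n = 0 then S else T)"
    using assms by (intro sigma_finite_set_UN) simp
  ultimately show ?thesis by simp
qed

lemma sigma_finite_set_subset:
  assumes "sigma_finite_set M S" "T \<subseteq> S" "T \<in> sets M"
  shows "sigma_finite_set M T"
proof -
  obtain A where A: "\<And>n::nat. A n \<in> sets M \<and> emeasure M (A n) < \<infinity>" "S = (\<Union>n. A n)"
    using assms unfolding sigma_finite_set_def by metis
  have "T = (\<Union>n. A n \<inter> T)" using A(2) assms(2) by auto
  moreover have "A n \<inter> T \<in> sets M \<and> emeasure M (A n \<inter> T) < \<infinity>" for n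
    using A(1)[of n] assms(3) by (auto intro: le_less_trans[OF emeasure_mono])
  ultimately show ?thesis unfolding sigma_finite_set_def by (intro exI[of _ "\<lambda>n. A n \<inter> T"]) auto
qed

text \<open>The complement of \<open>S\<close> is null for the restricted measure and joins the
  cover as one more set of finite measure.\<close>

lemma sigma_finite_density:
  assumes "sigma_finite_set M S"
  shows "sigma_finite_measure (density M (indicator S))"
proof
  obtain A where A: "\<And>n::nat. A n \<in> sets M \<and> emeasure M (A n) < \<infinity>" "S = (\<Union>n. A n)"
    using assms unfolding sigma_finite_set_def by metis
  have S: "S \<in> sets M" using sigma_finite_set_sets[OF assms] .
  have "emeasure (density M (indicator S)) (A n) < \<infinity>" for n
  proof -
    have "emeasure (density M (indicator S)) (A n) = emeasure M (S \<inter> A n)"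
      using S A(1) by (simp add: emeasure_restricted)
    also have "S \<inter> A n = A n" using A(2) by auto
    finally show ?thesis using A(1) by simp
  qed
  moreover have "emeasure (density M (indicator S)) (space M - S) = 0"
    using S by (simp add: emeasure_restricted)
  moreover have "(\<Union>a\<in>insert (space M - S) (range A). a) = space M"
    using A S sets.sets_into_space by fastforce
  ultimately show "\<exists>A. countable A \<and> A \<subseteq> sets (density M (indicator S)) \<and>
    \<Union> A = space (density M (indicator S)) \<and> (\<forall>a\<in>A. emeasure (density M (indicator S)) a \<noteq> \<infinity>)"
    using A S by (intro exI[of _ "insert (space M - S) (range A)"]) (auto simp: less_top)
qed

lemma nn_integral_density_support:
  assumes "S \<in> sets M" "f \<in> borel_measurable M" "\<And>x. x \<in> space M \<Longrightarrow> x \<notin> S \<Longrightarrow> f x = 0"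
  shows "(\<integral>\<^sup>+x. f x \<partial>density M (indicator S)) = (\<integral>\<^sup>+x. f x \<partial>M)"
  using assms by (subst nn_integral_density) (auto intro!: nn_integral_cong split: split_indicator)

text \<open>A function that vanishes off \<open>S \<times> T\<close> has the same integrals for the
  restricted measures, and these are \<sigma>-finite. The slice integrals vanish off
  \<open>S\<close> and \<open>T\<close>, so the outer integrals do not change either.\<close>

lemma tonelli_support:
  fixes f :: "'a \<times> 'b \<Rightarrow> ennreal"
  assumes S: "sigma_finite_set M S" and T: "sigma_finite_set N T"
    and f [measurable]: "f \<in> borel_measurable (M \<Otimes>\<^sub>M N)"
    and supp: "\<And>x y. x \<in> space M \<Longrightarrow> y \<in> space N \<Longrightarrow> f (x, y) \<noteq> 0 \<Longrightarrow> x \<in> S \<and> y \<in> T"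
  shows "(\<lambda>x. \<integral>\<^sup>+y. f (x, y) \<partial>N) \<in> borel_measurable M"
    and "(\<integral>\<^sup>+y. (\<integral>\<^sup>+x. f (x, y) \<partial>M) \<partial>N) = (\<integral>\<^sup>+x. (\<integral>\<^sup>+y. f (x, y) \<partial>N) \<partial>M)"
    and "(\<integral>\<^sup>+x. (\<integral>\<^sup>+y. f (x, y) \<partial>N) \<partial>M) =
      (\<integral>\<^sup>+p. f p \<partial>(density M (indicator S) \<Otimes>\<^sub>M density N (indicator T)))"
    and "(\<lambda>y. \<integral>\<^sup>+x. f (x, y) \<partial>M) \<in> borel_measurable N"
proof -
  interpret S: sigma_finite_measure "density M (indicator S)" by (rule sigma_finite_density[OF S])
  interpret T: sigma_finite_measure "density N (indicator T)" by (rule sigma_finite_density[OF T])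
  interpret pair_sigma_finite "density M (indicator S)" "density N (indicator T)" ..
  have [measurable]: "S \<in> sets M" "T \<in> sets N" using S T by (auto intro: sigma_finite_set_sets)
  have f' [measurable]: "f \<in> borel_measurable (density M (indicator S) \<Otimes>\<^sub>M density N (indicator T))"
    using f by (subst measurable_cong_sets[OF sets_pair_measure_cong]) auto
  have y: "(\<integral>\<^sup>+y. f (x, y) \<partial>N) = (\<integral>\<^sup>+y. f (x, y) \<partial>density N (indicator T))" if "x \<in> space M" for x
    using supp[OF that] that by (subst nn_integral_density_support) auto
  have x: "(\<integral>\<^sup>+x. f (x, y) \<partial>M) = (\<integral>\<^sup>+x. f (x, y) \<partial>density M (indicator S))" if "y \<in> space N" for y
    using supp[OF _ that] that by (subst nn_integral_density_support) auto
  have "(\<lambda>x. \<integral>\<^sup>+y. f (x, y) \<partial>density N (indicator T)) \<in> borel_measurable (density M (indicator S))"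
    using T.borel_measurable_nn_integral_fst[OF f'] by simp
  then show m1: "(\<lambda>x. \<integral>\<^sup>+y. f (x, y) \<partial>N) \<in> borel_measurable M"
    by (simp add: y cong: measurable_cong)
  have "(\<lambda>y. \<integral>\<^sup>+x. f (x, y) \<partial>density M (indicator S)) \<in> borel_measurable (density N (indicator T))"
    by measurable
  then show m2: "(\<lambda>y. \<integral>\<^sup>+x. f (x, y) \<partial>M) \<in> borel_measurable N"
    by (simp add: x cong: measurable_cong)
  have z1: "(\<integral>\<^sup>+x. f (x, y) \<partial>M) = 0" if "y \<in> space N" "y \<notin> T" for y
    using supp that by (subst nn_integral_cong[of _ _ "\<lambda>_. 0"]) auto
  have z2: "(\<integral>\<^sup>+y. f (x, y) \<partial>N) = 0" if "x \<in> space M" "x \<notin> S" for x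
    using supp that by (subst nn_integral_cong[of _ _ "\<lambda>_. 0"]) auto
  have "(\<integral>\<^sup>+y. (\<integral>\<^sup>+x. f (x, y) \<partial>M) \<partial>N) = (\<integral>\<^sup>+y. (\<integral>\<^sup>+x. f (x, y) \<partial>M) \<partial>density N (indicator T))"
    using m2 z1 by (intro nn_integral_density_support[symmetric]) auto
  also have "\<dots> = (\<integral>\<^sup>+y. (\<integral>\<^sup>+x. f (x, y) \<partial>density M (indicator S)) \<partial>density N (indicator T))"
    by (intro nn_integral_cong) (simp add: x)
  finally have e1: "(\<integral>\<^sup>+y. (\<integral>\<^sup>+x. f (x, y) \<partial>M) \<partial>N) = \<dots>" .
  have "(\<integral>\<^sup>+x. (\<integral>\<^sup>+y. f (x, y) \<partial>N) \<partial>M) = (\<integral>\<^sup>+x. (\<integral>\<^sup>+y. f (x, y) \<partial>N) \<partial>density M (indicator S))"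
    using m1 z2 by (intro nn_integral_density_support[symmetric]) auto
  also have "\<dots> = (\<integral>\<^sup>+x. (\<integral>\<^sup>+y. f (x, y) \<partial>density N (indicator T)) \<partial>density M (indicator S))"
    by (intro nn_integral_cong) (simp add: y)
  finally have e2: "(\<integral>\<^sup>+x. (\<integral>\<^sup>+y. f (x, y) \<partial>N) \<partial>M) = \<dots>" .
  show "(\<integral>\<^sup>+y. (\<integral>\<^sup>+x. f (x, y) \<partial>M) \<partial>N) = (\<integral>\<^sup>+x. (\<integral>\<^sup>+y. f (x, y) \<partial>N) \<partial>M)"
    unfolding e1 e2 using Fubini'[of "\<lambda>x y. f (x, y)"] f' by simp
  show "(\<integral>\<^sup>+x. (\<integral>\<^sup>+y. f (x, y) \<partial>N) \<partial>M) =
      (\<integral>\<^sup>+p. f p \<partial>(density M (indicator S) \<Otimes>\<^sub>M density N (indicator T)))"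
    unfolding e2 using T.nn_integral_fst[OF f'] by simp
qed

section \<open>Uniqueness of Haar measure\<close>

text \<open>Haar measures without nontriviality and regularity. The slices of a Haar measure on a
  product group are shown to satisfy only these conditions.\<close>

definition left_invariant :: "'g::{topological_group_add, t2_space} measure \<Rightarrow> bool" where
  "left_invariant \<mu> \<longleftrightarrow> sets \<mu> = sets borel \<and> (\<forall>K. compact K \<longrightarrow> emeasure \<mu> K < \<infinity>) \<and>
     (\<forall>g. \<forall>A\<in>sets borel. emeasure \<mu> ((\<lambda>x. g + x) ` A) = emeasure \<mu> A)"

lemma left_haar_imp_left_invariant: "left_haar_measure \<mu> \<Longrightarrow> left_invariant \<mu>"
  by (simp add: left_haar_measure_def left_invariant_def)

lemma borel_measurable_translation [measurable]:
  fixes g :: "'g::topological_group_add"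
  shows "(\<lambda>x. g + x) \<in> borel \<rightarrow>\<^sub>M borel" "(\<lambda>x. x + g) \<in> borel \<rightarrow>\<^sub>M borel"
    "(\<lambda>x. - x :: 'g) \<in> borel \<rightarrow>\<^sub>M borel" "(\<lambda>x. x - g) \<in> borel \<rightarrow>\<^sub>M borel" "(\<lambda>x. g - x) \<in> borel \<rightarrow>\<^sub>M borel"
proof -
  have [simp]: "continuous_on UNIV (\<lambda>x. x - g)"
    using continuous_on_add[OF continuous_on_id continuous_on_const[of UNIV "- g"]] by simp
  have [simp]: "continuous_on UNIV (\<lambda>x. g - x)"
    by (rule continuous_on_op_minus)
  show "(\<lambda>x. g + x) \<in> borel \<rightarrow>\<^sub>M borel" "(\<lambda>x. x + g) \<in> borel \<rightarrow>\<^sub>M borel"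
    "(\<lambda>x. - x :: 'g) \<in> borel \<rightarrow>\<^sub>M borel" "(\<lambda>x. x - g) \<in> borel \<rightarrow>\<^sub>M borel" "(\<lambda>x. g - x) \<in> borel \<rightarrow>\<^sub>M borel"
    by (auto intro!: borel_measurable_continuous_onI continuous_intros)
qed

lemma left_translation_image: "(\<lambda>x. g + x) ` A = (\<lambda>x. - g + x) -` A" for g :: "'g::group_add"
  by (force simp: image_iff add.assoc[symmetric])

lemma distr_left_translation:
  assumes "left_invariant \<mu>"
  shows "distr \<mu> borel (\<lambda>x. g + x) = \<mu>"
proof (rule measure_eqI)
  have s: "sets \<mu> = sets borel" using assms by (simp add: left_invariant_def)
  then have sp: "space \<mu> = UNIV" by (simp add: sets_eq_imp_space_eq)
  show "sets (distr \<mu> borel ((+) g)) = sets \<mu>" using s by simp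
  fix A assume "A \<in> sets (distr \<mu> borel ((+) g))"
  then have A: "A \<in> sets borel" by simp
  have "emeasure (distr \<mu> borel ((+) g)) A = emeasure \<mu> ((\<lambda>x. g + x) -` A)"
    using A s sp by (subst emeasure_distr) (auto cong: measurable_cong_sets)
  also have "(\<lambda>x. g + x) -` A = (\<lambda>x. - g + x) ` A" by (simp add: left_translation_image)
  also have "emeasure \<mu> \<dots> = emeasure \<mu> A" using assms A by (simp add: left_invariant_def)
  finally show "emeasure (distr \<mu> borel ((+) g)) A = emeasure \<mu> A" .
qed

lemma nn_integral_left_translation:
  assumes "left_invariant \<mu>" "f \<in> borel_measurable borel"
  shows "(\<integral>\<^sup>+x. f (g + x) \<partial>\<mu>) = (\<integral>\<^sup>+x. f x \<partial>\<mu>)"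
proof -
  have s: "sets \<mu> = sets borel" using assms by (simp add: left_invariant_def)
  have "(\<integral>\<^sup>+x. f x \<partial>\<mu>) = (\<integral>\<^sup>+x. f x \<partial>distr \<mu> borel (\<lambda>x. g + x))"
    by (simp add: distr_left_translation[OF assms(1)])
  also have "\<dots> = (\<integral>\<^sup>+x. f (g + x) \<partial>\<mu>)"
    using s assms(2) by (intro nn_integral_distr) (auto cong: measurable_cong_sets)
  finally show ?thesis by simp
qed

text \<open>Measurability in the parameter requires \<sigma>-finiteness only in the variable of
  integration, hence a support condition on that variable alone.\<close>

lemma borel_measurable_nn_integral_support:
  assumes S: "sigma_finite_set M S" and f: "f \<in> borel_measurable (M \<Otimes>\<^sub>M N)"
    and supp: "\<And>x y. x \<in> space M \<Longrightarrow> y \<in> space N \<Longrightarrow> f (x, y) \<noteq> (0::ennreal) \<Longrightarrow> x \<in> S"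
  shows "(\<lambda>y. \<integral>\<^sup>+x. f (x, y) \<partial>M) \<in> borel_measurable N"
proof -
  interpret S: sigma_finite_measure "density M (indicator S)" by (rule sigma_finite_density[OF S])
  have [measurable]: "f \<in> borel_measurable (density M (indicator S) \<Otimes>\<^sub>M N)"
    using f by (subst measurable_cong_sets[OF sets_pair_measure_cong]) auto
  have x: "(\<integral>\<^sup>+x. f (x, y) \<partial>M) = (\<integral>\<^sup>+x. f (x, y) \<partial>density M (indicator S))" if "y \<in> space N" for y
    using supp[OF _ that] that f S by (subst nn_integral_density_support) (auto intro: sigma_finite_set_sets)
  have "(\<lambda>y. \<integral>\<^sup>+x. f (x, y) \<partial>density M (indicator S)) \<in> borel_measurable N"
    by measurable
  then show ?thesis by (simp add: x cong: measurable_cong)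
qed

lemma compact_differences:
  fixes A B :: "'g::topological_group_add set"
  assumes "compact A" "compact B"
  shows "compact ((\<lambda>(b, a). b - a) ` (B \<times> A))" "compact ((\<lambda>(b, a). b + a) ` (B \<times> A))"
proof -
  have "continuous_on (B \<times> A) (\<lambda>p. fst p + - snd p)" by (intro continuous_intros)
  then show "compact ((\<lambda>(b, a). b - a) ` (B \<times> A))"
    using assms by (intro compact_continuous_image compact_Times) (simp_all add: case_prod_beta)
  show "compact ((\<lambda>(b, a). b + a) ` (B \<times> A))"
    using assms by (intro compact_continuous_image compact_Times) (auto intro!: continuous_intros simp: case_prod_beta)
qed

text \<open>Right translation can change a left Haar measure. Dividing by the measure of the right
  translate of \<open>B\<close> compensates for this without introducing the modular
  function.\<close>

definition haar_ratio :: "'g::{topological_group_add, t2_space} measure \<Rightarrow> 'g set \<Rightarrow> 'g set \<Rightarrow> ennreal" where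
  "haar_ratio \<nu> A B = (\<integral>\<^sup>+y. indicator A (- y) / emeasure \<nu> {t. t + - y \<in> B} \<partial>\<nu>)"

text \<open>
  The right-hand side depends on \<open>\<mu>\<close> only through \<open>B\<close>; applied to \<open>\<mu>\<close> and to \<open>\<nu>\<close> itself it shows
  that the two measures are proportional. It comes from integrating
  \<open>1\<^sub>A(x) 1\<^sub>B(y + x) / \<nu>(B - x)\<close> in both orders.
\<close>

lemma emeasure_eq_haar_ratio:
  fixes \<mu> \<nu> :: "'g::{topological_group_add, t2_space} measure"
  assumes \<mu>: "left_invariant \<mu>" and \<nu>: "left_invariant \<nu>"
    and A: "compact_gdelta A" and B: "compact_gdelta B"
    and V: "open V" "V \<noteq> {}" "V \<subseteq> B"
    and pos: "\<And>U. open U \<Longrightarrow> U \<noteq> {} \<Longrightarrow> emeasure \<nu> U > 0"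
  shows "emeasure \<mu> A = emeasure \<mu> B * haar_ratio \<nu> A B"
proof -
  have s [measurable_cong, simp]: "sets \<mu> = sets borel" "sets \<nu> = sets borel"
    using \<mu> \<nu> by (simp_all add: left_invariant_def)
  then have [simp]: "space \<mu> = UNIV" "space \<nu> = UNIV" by (simp_all add: sets_eq_imp_space_eq)
  have fin: "sigma_finite_set \<mu> K" "sigma_finite_set \<nu> K" if "compact K" for K
    using that \<mu> \<nu> by (auto intro!: sigma_finite_setI simp: left_invariant_def compact_imp_closed)
  have cA: "compact A" and cB: "compact B" using A B by (auto simp: compact_gdelta_def)
  have [measurable]: "A \<in> sets borel" "B \<in> sets borel" using A B by auto
  obtain P Q :: "nat \<Rightarrow> 'g set" where P: "\<And>n. open (P n)" "A = (\<Inter>n. P n)"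
    and Q: "\<And>n. open (Q n)" "B = (\<Inter>n. Q n)"
    using A B unfolding compact_gdelta_def by metis
  define C where "C = (\<lambda>(b, a). b - a) ` (B \<times> A)"
  have cC: "compact C" unfolding C_def by (rule compact_differences[OF cA cB])
  have base: "open_base_in (\<nu> \<Otimes>\<^sub>M \<mu>)" "open_base_in (\<nu> \<Otimes>\<^sub>M (\<nu> \<Otimes>\<^sub>M \<mu>))"
    by (intro open_base_in_pair open_base_in_borel s)+

  \<comment> \<open>The support of the integrand. It is compact and a
    \<open>G\<^sub>\<delta>\<close>, hence in the product \<sigma>-algebra, although addition is
    merely continuous.\<close>
  define W where "W = {(y, x). x \<in> A \<and> y + x \<in> B}"
  have W [measurable]: "W \<in> sets (\<nu> \<Otimes>\<^sub>M \<mu>)"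
  proof (rule compact_gdelta_sets[OF base(1), where P = "\<lambda>n. {p. snd p \<in> P n \<and> fst p + snd p \<in> Q n}" and Q = "space (\<nu> \<Otimes>\<^sub>M \<mu>)"])
    have "W = (\<lambda>p. (fst p + - snd p, snd p)) ` (B \<times> A)"
      by (force simp: W_def image_iff add.assoc)
    moreover have "compact \<dots>" 
      by (intro compact_continuous_image compact_Times cA cB continuous_intros)
    ultimately show "compact W" by simp
    show "open {p :: 'g \<times> 'g. snd p \<in> P n \<and> fst p + snd p \<in> Q n}" for n
      by (intro open_Collect_conj open_vimage[OF P(1), unfolded vimage_def] open_vimage[OF Q(1), unfolded vimage_def] continuous_intros)
    show "W = (\<Inter>n. {p. snd p \<in> P n \<and> fst p + snd p \<in> Q n}) \<inter> space (\<nu> \<Otimes>\<^sub>M \<mu>)"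
      by (auto simp: W_def P(2) Q(2) space_pair_measure)
  qed (rule sets.top)
  have WC: "y \<in> C" if "(y, x) \<in> W" for x y
    using that unfolding C_def
    by (intro image_eqI[of _ _ "(y + x, x)"]) (auto simp: W_def)

  \<comment> \<open>After the substitution of \<open>- y + x\<close> for \<open>x\<close> the
    denominator depends on both variables. Writing it, on \<open>W2\<close>, as an integral over
    \<open>t\<close> of the indicator of \<open>W3\<close> makes it jointly measurable.\<close>
  define W3 where "W3 = {(t, y, x). - y + x \<in> A \<and> x \<in> B \<and> t + (- y + x) \<in> B}"
  have W3 [measurable]: "W3 \<in> sets (\<nu> \<Otimes>\<^sub>M (\<nu> \<Otimes>\<^sub>M \<mu>))"
  proof (rule compact_gdelta_sets[OF base(2), where P = "\<lambda>n. {p. - fst (snd p) + snd (snd p) \<in> P n \<and> snd (snd p) \<in> Q n \<and> fst p + (- fst (snd p) + snd (snd p)) \<in> Q n}" and Q = "space (\<nu> \<Otimes>\<^sub>M (\<nu> \<Otimes>\<^sub>M \<mu>))"])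
    have "W3 = (\<lambda>p. (snd (snd p) + - fst (snd p), fst p + - fst (snd p), fst p)) ` (B \<times> A \<times> B)"
    proof (intro equalityI subsetI)
      fix p assume "p \<in> W3"
      then show "p \<in> (\<lambda>p. (snd (snd p) + - fst (snd p), fst p + - fst (snd p), fst p)) ` (B \<times> A \<times> B)"
        by (intro image_eqI[of _ _ "(snd (snd p), - fst (snd p) + snd (snd p), fst p + (- fst (snd p) + snd (snd p)))"])
          (auto simp: W3_def minus_add add.assoc)
    qed (auto simp: W3_def minus_add add.assoc)
    moreover have "compact \<dots>" 
      by (intro compact_continuous_image compact_Times cA cB continuous_intros)
    ultimately show "compact W3" by simp
    show "open {p :: 'g \<times> 'g \<times> 'g. - fst (snd p) + snd (snd p) \<in> P n \<and> snd (snd p) \<in> Q n \<and> fst p + (- fst (snd p) + snd (snd p)) \<in> Q n}" for n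
      by (intro open_Collect_conj open_vimage[OF P(1), unfolded vimage_def] open_vimage[OF Q(1), unfolded vimage_def] continuous_intros)
    show "W3 = (\<Inter>n. {p. - fst (snd p) + snd (snd p) \<in> P n \<and> snd (snd p) \<in> Q n \<and> fst p + (- fst (snd p) + snd (snd p)) \<in> Q n}) \<inter> space (\<nu> \<Otimes>\<^sub>M (\<nu> \<Otimes>\<^sub>M \<mu>))"
      by (auto simp: W3_def P(2) Q(2) space_pair_measure)
  qed (rule sets.top)
  define W2 where "W2 = {(y, x). - y + x \<in> A \<and> x \<in> B}"
  have W2 [measurable]: "W2 \<in> sets (\<nu> \<Otimes>\<^sub>M \<mu>)"
  proof (rule compact_gdelta_sets[OF base(1), where P = "\<lambda>n. {p. - fst p + snd p \<in> P n \<and> snd p \<in> Q n}" and Q = "space (\<nu> \<Otimes>\<^sub>M \<mu>)"])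
    have "W2 = (\<lambda>p. (fst p + - snd p, fst p)) ` (B \<times> A)"
    proof (intro equalityI subsetI)
      fix p assume "p \<in> W2"
      then show "p \<in> (\<lambda>p. (fst p + - snd p, fst p)) ` (B \<times> A)"
        by (intro image_eqI[of _ _ "(snd p, - fst p + snd p)"]) (auto simp: W2_def minus_add add.assoc)
    qed (auto simp: W2_def minus_add add.assoc)
    moreover have "compact \<dots>" 
      by (intro compact_continuous_image compact_Times cA cB continuous_intros)
    ultimately show "compact W2" by simp
    show "open {p :: 'g \<times> 'g. - fst p + snd p \<in> P n \<and> snd p \<in> Q n}" for n
      by (intro open_Collect_conj open_vimage[OF P(1), unfolded vimage_def] open_vimage[OF Q(1), unfolded vimage_def] continuous_intros)
    show "W2 = (\<Inter>n. {p. - fst p + snd p \<in> P n \<and> snd p \<in> Q n}) \<inter> space (\<nu> \<Otimes>\<^sub>M \<mu>)"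
      by (auto simp: W2_def P(2) Q(2) space_pair_measure)
  qed (rule sets.top)
  have W2C: "y \<in> C" if "(y, x) \<in> W2" for x y
    using that unfolding C_def
    by (intro image_eqI[of _ _ "(x, - y + x)"])
      (auto simp: W2_def diff_conv_add_uminus minus_add add.assoc[symmetric] simp del: add_uminus_conv_diff)
  have W3C: "t \<in> C" if "(t, p) \<in> W3" for t p
    using that unfolding C_def
    by (intro image_eqI[of _ _ "(t + (- fst p + snd p), - fst p + snd p)"]) (auto simp: W3_def)

  \<comment> \<open>\<open>G x\<close> is the measure of \<open>B - x\<close>. \<open>G1 x\<close>
    and \<open>G2 (y, x)\<close> are visibly measurable versions of \<open>G x\<close> and
    \<open>G (- y + x)\<close>, which agree with them wherever the respective numerator is
    nonzero.\<close>
  define G where "G = (\<lambda>x. emeasure \<nu> {t. t + x \<in> B})"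
  define G1 where "G1 = (\<lambda>x. \<integral>\<^sup>+y. indicator W (y, x) \<partial>\<nu>)"
  define G2 where "G2 = (\<lambda>p. \<integral>\<^sup>+t. indicator W3 (t, p) \<partial>\<nu>)"
  have G1m [measurable]: "G1 \<in> borel_measurable \<mu>"
    unfolding G1_def by (rule borel_measurable_nn_integral_support[OF fin(2)[OF cC]])
      (auto simp: indicator_def WC split: if_splits)
  have G2m [measurable]: "G2 \<in> borel_measurable (\<nu> \<Otimes>\<^sub>M \<mu>)"
    unfolding G2_def by (rule borel_measurable_nn_integral_support[OF fin(2)[OF cC]])
      (auto simp: indicator_def W3C split: if_splits)
  have Bx [measurable]: "{t. t + x \<in> B} \<in> sets borel" for x
    using measurable_sets[OF borel_measurable_translation(2)[of x], of B] by (simp add: vimage_def)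
  have G1: "G1 x = G x" if "x \<in> A" for x
  proof -
    have "G1 x = (\<integral>\<^sup>+y. indicator {t. t + x \<in> B} y \<partial>\<nu>)"
      unfolding G1_def using that by (intro nn_integral_cong) (auto simp: W_def indicator_def)
    then show ?thesis by (simp add: G_def)
  qed
  have G2: "G2 (y, x) = G (- y + x)" if "(y, x) \<in> W2" for x y
  proof -
    have "G2 (y, x) = (\<integral>\<^sup>+t. indicator {t. t + (- y + x) \<in> B} t \<partial>\<nu>)"
      unfolding G2_def using that by (intro nn_integral_cong) (auto simp: W3_def W2_def indicator_def)
    then show ?thesis by (simp add: G_def)
  qed
  have G_pos: "G x \<noteq> 0" for x
  proof -
    have "open {t. t + x \<in> V}"
      by (intro open_vimage[OF V(1), unfolded vimage_def] continuous_intros)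
    moreover have "{t. t + x \<in> V} \<noteq> {}"
      using V(2) by (metis (mono_tags, lifting) diff_add_cancel empty_iff ex_in_conv mem_Collect_eq)
    ultimately have "0 < emeasure \<nu> {t. t + x \<in> V}" by (rule pos)
    also have "\<dots> \<le> G x" unfolding G_def using V(3) by (intro emeasure_mono) auto
    finally show ?thesis by simp
  qed
  have G_fin: "G x \<noteq> \<infinity>" for x
  proof -
    have "{t. t + x \<in> B} = (\<lambda>(b, a). b - a) ` (B \<times> {x})"
      by (force simp: image_iff)
    moreover have "compact \<dots>" by (intro compact_differences cB) simp
    ultimately show ?thesis using \<nu> unfolding G_def left_invariant_def by (metis less_irrefl)
  qed

  define f where "f = (\<lambda>p. indicator W p / G1 (snd p))"
  have f [measurable]: "f \<in> borel_measurable (\<nu> \<Otimes>\<^sub>M \<mu>)" unfolding f_def by measurable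
  define h where "h = (\<lambda>p. indicator W2 p / G2 p)"
  have h [measurable]: "h \<in> borel_measurable (\<nu> \<Otimes>\<^sub>M \<mu>)" unfolding h_def by measurable
  have fW: "x \<in> C \<and> y \<in> A" if "f (x, y) \<noteq> 0" for x y
    using that WC[of x y] by (auto simp: f_def W_def indicator_def split: if_splits)
  have hW: "x \<in> C \<and> y \<in> B" if "h (x, y) \<noteq> 0" for x y
    using that W2C[of x y] by (auto simp: h_def W2_def indicator_def split: if_splits)

  have "emeasure \<mu> A = (\<integral>\<^sup>+x. indicator A x \<partial>\<mu>)" by simp
  also have "\<dots> = (\<integral>\<^sup>+x. (\<integral>\<^sup>+y. f (y, x) \<partial>\<nu>) \<partial>\<mu>)"
  proof (rule nn_integral_cong)
    fix x
    have "(\<integral>\<^sup>+y. f (y, x) \<partial>\<nu>) = G1 x / G1 x"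
      unfolding f_def G1_def by (simp add: nn_integral_divide)
    moreover have z: "f (y, x) = 0" if "x \<notin> A" for y using that fW by blast
    ultimately show "indicator A x = (\<integral>\<^sup>+y. f (y, x) \<partial>\<nu>)"
      using G1[of x] G_pos[of x] G_fin[of x] z by (cases "x \<in> A") (simp_all add: ennreal_divide_self less_top)
  qed
  also have "\<dots> = (\<integral>\<^sup>+y. (\<integral>\<^sup>+x. f (y, x) \<partial>\<mu>) \<partial>\<nu>)"
    by (rule tonelli_support(2)[OF fin(2)[OF cC] fin(1)[OF cA] f fW])
  also have "\<dots> = (\<integral>\<^sup>+y. (\<integral>\<^sup>+x. h (y, x) \<partial>\<mu>) \<partial>\<nu>)"
  proof (rule nn_integral_cong)
    fix y
    have "(\<integral>\<^sup>+x. f (y, x) \<partial>\<mu>) = (\<integral>\<^sup>+x. f (y, - y + x) \<partial>\<mu>)"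
      by (rule nn_integral_left_translation[OF \<mu>, symmetric]) simp
    also have "\<dots> = (\<integral>\<^sup>+x. h (y, x) \<partial>\<mu>)"
    proof (rule nn_integral_cong)
      fix x
      show "f (y, - y + x) = h (y, x)"
      proof (cases "(y, x) \<in> W2")
        case True
        then have "(y, - y + x) \<in> W" by (auto simp: W_def W2_def add.assoc[symmetric])
        with True G2[OF True] G1[of "- y + x"] show ?thesis
          by (auto simp: f_def h_def W2_def)
      next
        case False
        then have "(y, - y + x) \<notin> W" by (auto simp: W_def W2_def add.assoc[symmetric])
        with False show ?thesis by (auto simp: f_def h_def)
      qed
    qed
    finally show "(\<integral>\<^sup>+x. f (y, x) \<partial>\<mu>) = (\<integral>\<^sup>+x. h (y, x) \<partial>\<mu>)" .
  qed
  also have "\<dots> = (\<integral>\<^sup>+x. (\<integral>\<^sup>+y. h (y, x) \<partial>\<nu>) \<partial>\<mu>)"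
    by (rule tonelli_support(2)[OF fin(2)[OF cC] fin(1)[OF cB] h hW, symmetric])
  also have "\<dots> = (\<integral>\<^sup>+x. indicator B x * haar_ratio \<nu> A B \<partial>\<mu>)"
  proof (rule nn_integral_cong)
    fix x
    \<comment> \<open>With \<open>x + y\<close> in place of \<open>y\<close> the term
      \<open>- y + x\<close> becomes \<open>- y\<close>, so the integrand splits into a function of
      \<open>x\<close> times a function of \<open>y\<close>.\<close>
    have "(\<integral>\<^sup>+y. h (y, x) \<partial>\<nu>) = (\<integral>\<^sup>+y. h (x + y, x) \<partial>\<nu>)"
      by (rule nn_integral_left_translation[OF \<nu>, symmetric]) simp
    also have "\<dots> = (\<integral>\<^sup>+y. indicator B x * (indicator A (- y) / emeasure \<nu> {t. t + - y \<in> B}) \<partial>\<nu>)"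
    proof (rule nn_integral_cong)
      fix y
      have *: "- (x + y) + x = - y" by (simp add: minus_add add.assoc)
      then have "(x + y, x) \<in> W2 \<longleftrightarrow> x \<in> B \<and> - y \<in> A" unfolding W2_def by auto
      then show "h (x + y, x) = indicator B x * (indicator A (- y) / emeasure \<nu> {t. t + - y \<in> B})"
        using G2[of "x + y" x] unfolding h_def * G_def by (auto simp: indicator_def)
    qed
    also have "\<dots> = indicator B x * haar_ratio \<nu> A B"
      unfolding haar_ratio_def by (cases "x \<in> B") simp_all
    finally show "(\<integral>\<^sup>+y. h (y, x) \<partial>\<nu>) = indicator B x * haar_ratio \<nu> A B" .
  qed
  also have "\<dots> = emeasure \<mu> B * haar_ratio \<nu> A B"
    by (subst nn_integral_multc) auto
  finally show ?thesis .
qed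


text \<open>If \<open>U\<close> were null, finitely many of its null translates would cover any
  given compact set. All compact sets would be null, and by inner regularity the whole
  group.\<close>

lemma left_haar_pos:
  fixes \<mu> :: "'g::{topological_group_add, t2_space} measure"
  assumes h: "left_haar_measure \<mu>" and U: "open U" "U \<noteq> {}"
  shows "emeasure \<mu> U > 0"
proof (rule ccontr)
  assume "\<not> emeasure \<mu> U > 0"
  then have U0: "emeasure \<mu> U = 0" by simp
  have s: "sets \<mu> = sets borel" using h by (simp add: left_haar_measure_def)
  have op: "open ((\<lambda>x. g + x) ` U)" for g
    unfolding left_translation_image using U by (intro open_vimage continuous_intros)
  have K0: "emeasure \<mu> K = 0" if "compact K" for K
  proof -
    obtain u where u: "u \<in> U" using U by auto
    have "K \<subseteq> (\<Union>g\<in>UNIV. (\<lambda>x. g + x) ` U)"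
      using u by (auto intro!: exI[of _ "_ - u"] image_eqI[of _ _ u])
    from compactE_image[OF that op this] obtain D where D: "finite D" "K \<subseteq> (\<Union>g\<in>D. (\<lambda>x. g + x) ` U)"
      by metis
    have "emeasure \<mu> K \<le> emeasure \<mu> (\<Union>g\<in>D. (\<lambda>x. g + x) ` U)"
      using D op s by (intro emeasure_mono) auto
    also have "\<dots> \<le> (\<Sum>g\<in>D. emeasure \<mu> ((\<lambda>x. g + x) ` U))"
      using D op s by (intro emeasure_subadditive_finite) auto
    also have "\<dots> = 0"
      using h U U0 unfolding left_haar_measure_def by simp
    finally show ?thesis by simp
  qed
  have "emeasure \<mu> UNIV = (SUP K\<in>{K. compact K \<and> K \<subseteq> UNIV}. emeasure \<mu> K)"
    using h open_UNIV unfolding left_haar_measure_def by metis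
  also have "\<dots> \<le> 0" using K0 by (intro SUP_least) auto
  finally have "emeasure \<mu> UNIV = 0" by simp
  moreover obtain A where "A \<in> sets borel" "emeasure \<mu> A \<noteq> 0" using h unfolding left_haar_measure_def by metis
  ultimately show False
    using emeasure_mono[of A UNIV \<mu>] s by auto
qed

text \<open>The instances of \<open>emeasure_eq_haar_ratio\<close> for \<mu> and for \<nu> share the
  ratio, which is eliminated; \<open>B\<close> is a compact neighbourhood of 0. Since \<mu> need not
  be regular, the conclusion is confined to compact \<open>G\<^sub>\<delta>\<close> sets, and the
  factor may be 0.\<close>

lemma compact_gdelta_proportional:
  fixes \<mu> \<nu> :: "'g::{topological_group_add, t2_space} measure"
  assumes "locally_compact_group TYPE('g)" "left_invariant \<mu>" "left_haar_measure \<nu>"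
  obtains c where "c \<noteq> \<infinity>" "\<And>A. compact_gdelta A \<Longrightarrow> emeasure \<mu> A = c * emeasure \<nu> A"
proof -
  obtain B V where B: "compact_gdelta B" "open V" "{0::'g} \<subseteq> V" "V \<subseteq> B"
    using compact_gdelta_between[of "{0::'g}" UNIV] assms(1) unfolding locally_compact_group_def by auto
  have \<nu>: "left_invariant \<nu>" by (rule left_haar_imp_left_invariant[OF assms(3)])
  have sn: "sets \<nu> = sets borel" using \<nu> by (simp add: left_invariant_def)
  have pos: "\<And>U. open U \<Longrightarrow> U \<noteq> {} \<Longrightarrow> emeasure \<nu> U > 0" by (rule left_haar_pos[OF assms(3)])
  have "emeasure \<nu> V > 0" using B pos by auto
  then have nB: "emeasure \<nu> B \<noteq> 0"
    using emeasure_mono[OF B(4), of \<nu>] B(1) sn by auto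
  have nB2: "emeasure \<nu> B < \<infinity>" "emeasure \<mu> B < \<infinity>"
    using B(1) \<nu> assms(2) by (auto simp: left_invariant_def compact_gdelta_def)
  show ?thesis
  proof (rule that[of "emeasure \<mu> B / emeasure \<nu> B"])
    show "emeasure \<mu> B / emeasure \<nu> B \<noteq> \<infinity>"
      using nB nB2 by (auto simp: ennreal_divide_eq_top_iff)
    fix A :: "'g set" assume A: "compact_gdelta A"
    have "emeasure \<mu> A = emeasure \<mu> B * haar_ratio \<nu> A B" "emeasure \<nu> A = emeasure \<nu> B * haar_ratio \<nu> A B"
      using emeasure_eq_haar_ratio[OF _ \<nu> A B(1) B(2) _ B(4) pos] B(3) assms(2) \<nu> by auto
    then show "emeasure \<mu> A = emeasure \<mu> B / emeasure \<nu> B * emeasure \<nu> A"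
      using nB nB2 by (metis ennreal_divide_times ennreal_mult_divide_eq infinity_ennreal_def less_irrefl mult.assoc mult.commute)
  qed
qed

text \<open>Every compact subset of \<open>U\<close> lies in a compact
  \<open>G\<^sub>\<delta>\<close> subset of \<open>U\<close>, so inner regularity can be tested on
  the latter.\<close>

lemma left_haar_inner_gdelta:
  fixes \<mu> :: "'g::{topological_group_add, t2_space} measure"
  assumes lc: "locally_compact_group TYPE('g)" and h: "left_haar_measure \<mu>" and U: "open U"
    and le: "\<And>B. compact_gdelta B \<Longrightarrow> B \<subseteq> U \<Longrightarrow> emeasure \<mu> B \<le> c"
  shows "emeasure \<mu> U \<le> c"
proof -
  have s: "sets \<mu> = sets borel" using h by (simp add: left_haar_measure_def)
  have "emeasure \<mu> U = (SUP K\<in>{K. compact K \<and> K \<subseteq> U}. emeasure \<mu> K)"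
    using h U unfolding left_haar_measure_def by metis
  also have "\<dots> \<le> c"
  proof (rule SUP_least)
    fix K assume "K \<in> {K. compact K \<and> K \<subseteq> U}"
    then obtain B where B: "compact_gdelta B" "K \<subseteq> B" "B \<subseteq> U"
      using compact_gdelta_between[of K U] lc U unfolding locally_compact_group_def
      by (metis mem_Collect_eq subset_trans)
    have "emeasure \<mu> K \<le> emeasure \<mu> B" using B s by (intro emeasure_mono) auto
    then show "emeasure \<mu> K \<le> c" using le[OF B(1,3)] by simp
  qed
  finally show ?thesis .
qed

text \<open>Inner regularity carries the bound from compact \<open>G\<^sub>\<delta>\<close> sets to
  open sets, and outer regularity from there to Borel sets. Being one-sided, the statement can be
  used a second time with the measures exchanged and the inverse factor.\<close>

lemma left_haar_le:
  fixes \<mu> \<nu> :: "'g::{topological_group_add, t2_space} measure"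
  assumes lc: "locally_compact_group TYPE('g)" and h: "left_haar_measure \<mu>" "left_haar_measure \<nu>"
    and le: "\<And>B. compact_gdelta B \<Longrightarrow> emeasure \<mu> B \<le> c * emeasure \<nu> B"
    and c: "c \<noteq> \<infinity>" "c \<noteq> 0" and A: "A \<in> sets borel"
  shows "emeasure \<mu> A \<le> c * emeasure \<nu> A"
proof -
  have s: "sets \<nu> = sets borel" "sets \<mu> = sets borel" using h by (simp_all add: left_haar_measure_def)
  have U: "emeasure \<mu> U \<le> c * emeasure \<nu> U" if "open U" for U
  proof (rule left_haar_inner_gdelta[OF lc h(1) that])
    fix B assume "compact_gdelta B" "B \<subseteq> U"
    then have "emeasure \<mu> B \<le> c * emeasure \<nu> B" "emeasure \<nu> B \<le> emeasure \<nu> U"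
      using le[of B] that s by (auto intro!: emeasure_mono)
    then show "emeasure \<mu> B \<le> c * emeasure \<nu> U"
      by (meson mult_left_mono order_trans zero_le)
  qed
  have "emeasure \<mu> A / c \<le> emeasure \<nu> A"
  proof -
    have "emeasure \<nu> A = (INF U\<in>{U. open U \<and> A \<subseteq> U}. emeasure \<nu> U)"
      using h A unfolding left_haar_measure_def by metis
    moreover have "emeasure \<mu> A / c \<le> (INF U\<in>{U. open U \<and> A \<subseteq> U}. emeasure \<nu> U)"
    proof (rule INF_greatest)
      fix U assume "U \<in> {U. open U \<and> A \<subseteq> U}"
      then have "emeasure \<mu> A \<le> emeasure \<mu> U" "emeasure \<mu> U \<le> c * emeasure \<nu> U"
        using U[of U] s by (auto intro!: emeasure_mono)
      then have "emeasure \<mu> A \<le> c * emeasure \<nu> U" by (rule order_trans)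
      then show "emeasure \<mu> A / c \<le> emeasure \<nu> U"
        using c by (intro divide_le_posI_ennreal) (auto simp: zero_less_iff_neq_zero)
    qed
    ultimately show ?thesis by simp
  qed
  then have "c * (emeasure \<mu> A / c) \<le> c * emeasure \<nu> A" by (intro mult_left_mono) auto
  moreover have "c * (emeasure \<mu> A / c) = emeasure \<mu> A"
    using c by (metis ennreal_mult_divide_eq ennreal_times_divide infinity_ennreal_def mult.commute)
  ultimately show ?thesis by simp
qed

text \<open>Proportionality on compact \<open>G\<^sub>\<delta>\<close> sets extends to Borel sets by
  two one-sided comparisons. The factor is not 0, since otherwise the whole group would be null for
  \<mu>.\<close>

lemma left_haar_unique:
  fixes \<mu> \<nu> :: "'g::{topological_group_add, t2_space} measure"
  assumes lc: "locally_compact_group TYPE('g)" and h: "left_haar_measure \<mu>" "left_haar_measure \<nu>"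
  obtains c where "c > 0" "\<And>A. A \<in> sets borel \<Longrightarrow> emeasure \<mu> A = ennreal c * emeasure \<nu> A"
proof -
  obtain c where c: "c \<noteq> \<infinity>" "\<And>A. compact_gdelta A \<Longrightarrow> emeasure \<mu> A = c * emeasure \<nu> A"
    using compact_gdelta_proportional[OF lc left_haar_imp_left_invariant[OF h(1)] h(2)] by metis
  have c0: "c \<noteq> 0"
  proof
    assume "c = 0"
    then have "emeasure \<mu> B \<le> 0" if "compact_gdelta B" for B using c(2)[OF that] by simp
    then have "emeasure \<mu> UNIV \<le> 0" by (rule left_haar_inner_gdelta[OF lc h(1) open_UNIV])
    then show False using left_haar_pos[OF h(1), of UNIV] by simp
  qed
  have inv: "inverse c \<noteq> \<infinity>" "inverse c \<noteq> 0" using c0 c(1) by (auto simp: ennreal_inverse_eq_top_iff)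
  have cc: "inverse c * c = 1" "c * inverse c = 1"
    using ennreal_divide_self[of c] c0 c(1) by (simp_all add: divide_ennreal_def less_top mult.commute)
  have "emeasure \<mu> A = c * emeasure \<nu> A" if A: "A \<in> sets borel" for A
  proof (rule antisym)
    show "emeasure \<mu> A \<le> c * emeasure \<nu> A"
      using c(2) by (intro left_haar_le[OF lc h _ c(1) c0 A]) simp
    have "emeasure \<nu> A \<le> inverse c * emeasure \<mu> A"
    proof (rule left_haar_le[OF lc h(2,1) _ inv A])
      fix B :: "'g set" assume "compact_gdelta B"
      then show "emeasure \<nu> B \<le> inverse c * emeasure \<mu> B"
        by (simp add: c(2) mult.assoc[symmetric] cc)
    qed
    then have "c * emeasure \<nu> A \<le> c * (inverse c * emeasure \<mu> A)" by (intro mult_left_mono) auto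
    then show "c * emeasure \<nu> A \<le> emeasure \<mu> A" by (simp add: mult.assoc[symmetric] cc)
  qed
  moreover obtain r where "c = ennreal r" "r > 0"
    using c(1) c0 by (cases c) (auto simp: less_le)
  ultimately show ?thesis using that by blast
qed

text \<open>The defining properties are topological or concern translations, so a homeomorphism that
  carries translations to translations preserves them. Conjugations and the exchange of the
  coordinates of a product are of this kind.\<close>

lemma left_haar_distr:
  fixes \<mu> :: "'g::{topological_group_add, t2_space} measure"
    and \<theta> :: "'g \<Rightarrow> 'h::{topological_group_add, t2_space}"
  assumes h: "left_haar_measure \<mu>"
    and c: "continuous_on UNIV \<theta>" "continuous_on UNIV \<theta>'"
    and inv: "\<And>x. \<theta>' (\<theta> x) = x" "\<And>y. \<theta> (\<theta>' y) = y"
    and tr: "\<And>g. \<exists>g'. \<forall>x. \<theta> (g' + x) = g + \<theta> x"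
  shows "left_haar_measure (distr \<mu> borel \<theta>)"
proof -
  have s: "sets \<mu> = sets borel" using h by (simp add: left_haar_measure_def)
  then have sp: "space \<mu> = UNIV" by (simp add: sets_eq_imp_space_eq)
  have m: "\<theta> \<in> \<mu> \<rightarrow>\<^sub>M borel"
    using borel_measurable_continuous_onI[OF c(1)] s by (simp cong: measurable_cong_sets)
  have e: "emeasure (distr \<mu> borel \<theta>) A = emeasure \<mu> (\<theta> -` A)" if "A \<in> sets borel" for A
    using m that sp by (simp add: emeasure_distr)
  have b: "\<theta> -` A \<in> sets borel" if "A \<in> sets borel" for A
    using measurable_sets[OF borel_measurable_continuous_onI[OF c(1)] that] by simp
  have b': "\<theta>' -` A \<in> sets borel" if "A \<in> sets borel" for A
    using measurable_sets[OF borel_measurable_continuous_onI[OF c(2)] that] by simp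
  have vv [simp]: "\<theta> -` \<theta>' -` A = A" "\<theta>' -` \<theta> -` A' = A'" for A A' using inv by (auto simp: vimage_def)
  have im: "\<theta> -` A = \<theta>' ` A" for A
    using inv by (auto intro!: image_eqI[of _ \<theta>' "\<theta> _"])
  have im': "\<theta> ` A' = \<theta>' -` A'" for A'
    using inv by (auto intro!: image_eqI[of _ \<theta> "\<theta>' _"])
  have vo: "open (\<theta> -` U)" "open (\<theta>' -` U')" if "open U" "open U'" for U U'
    using that c by (simp_all add: open_vimage)
  have vk: "compact (\<theta> -` K)" if "compact K" for K
    unfolding im using that c(2) by (intro compact_continuous_image) (auto intro: continuous_on_subset)
  have vk': "compact (\<theta>' -` K)" if "compact K" for K
    unfolding im'[symmetric] using that c(1) by (intro compact_continuous_image) (auto intro: continuous_on_subset)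
  have cb: "K \<in> sets borel" if "compact K" for K :: "'h set"
    using that by (intro borel_closed compact_imp_closed)
  show ?thesis
    unfolding left_haar_measure_def
  proof (intro conjI ballI allI impI)
    show "sets (distr \<mu> borel \<theta>) = sets borel" by simp
    obtain A where A: "A \<in> sets borel" "emeasure \<mu> A \<noteq> 0" using h unfolding left_haar_measure_def by metis
    then show "\<exists>A\<in>sets borel. emeasure (distr \<mu> borel \<theta>) A \<noteq> 0"
      using b'[OF A(1)] e by (intro bexI[of _ "\<theta>' -` A"]) auto
  next
    fix K :: "'h set" assume "compact K"
    then show "emeasure (distr \<mu> borel \<theta>) K < \<infinity>"
      using h vk[of K] by (simp add: e cb left_haar_measure_def)
  next
    fix A :: "'h set" assume A: "A \<in> sets borel"
    have "emeasure \<mu> (\<theta> -` A) = (INF U\<in>{U. open U \<and> \<theta> -` A \<subseteq> U}. emeasure \<mu> U)"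
      using h b[OF A] unfolding left_haar_measure_def by metis
    also have "\<dots> = (INF U\<in>{U. open U \<and> A \<subseteq> U}. emeasure (distr \<mu> borel \<theta>) U)"
    proof (intro antisym INF_greatest)
      fix U assume "U \<in> {U. open U \<and> A \<subseteq> U}"
      then show "(INF U\<in>{U. open U \<and> \<theta> -` A \<subseteq> U}. emeasure \<mu> U) \<le> emeasure (distr \<mu> borel \<theta>) U"
        using vo(1)[of U UNIV] by (intro INF_lower2[of "\<theta> -` U"]) (auto simp: e)
    next
      fix U assume "U \<in> {U. open U \<and> \<theta> -` A \<subseteq> U}"
      then show "(INF U\<in>{U. open U \<and> A \<subseteq> U}. emeasure (distr \<mu> borel \<theta>) U) \<le> emeasure \<mu> U"
        using vo(2)[of UNIV U] im[of A] by (intro INF_lower2[of "\<theta>' -` U"]) (auto simp: e)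
    qed
    finally show "emeasure (distr \<mu> borel \<theta>) A = (INF U\<in>{U. open U \<and> A \<subseteq> U}. emeasure (distr \<mu> borel \<theta>) U)"
      by (simp add: e A)
  next
    fix V :: "'h set" assume V: "open V"
    have "emeasure \<mu> (\<theta> -` V) = (SUP K\<in>{K. compact K \<and> K \<subseteq> \<theta> -` V}. emeasure \<mu> K)"
      using h vo(1)[OF V open_UNIV] unfolding left_haar_measure_def by metis
    also have "\<dots> = (SUP K\<in>{K. compact K \<and> K \<subseteq> V}. emeasure (distr \<mu> borel \<theta>) K)"
    proof (intro antisym SUP_least)
      fix K assume "K \<in> {K. compact K \<and> K \<subseteq> V}"
      then show "emeasure (distr \<mu> borel \<theta>) K \<le> (SUP K\<in>{K. compact K \<and> K \<subseteq> \<theta> -` V}. emeasure \<mu> K)"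
        using vk[of K] by (intro SUP_upper2[of "\<theta> -` K"]) (auto simp: e cb)
    next
      fix K assume "K \<in> {K. compact K \<and> K \<subseteq> \<theta> -` V}"
      then show "emeasure \<mu> K \<le> (SUP K\<in>{K. compact K \<and> K \<subseteq> V}. emeasure (distr \<mu> borel \<theta>) K)"
        using vk'[of K] inv by (intro SUP_upper2[of "\<theta>' -` K"]) (force simp: e cb)+
    qed
    finally show "emeasure (distr \<mu> borel \<theta>) V = (SUP K\<in>{K. compact K \<and> K \<subseteq> V}. emeasure (distr \<mu> borel \<theta>) K)"
      using V by (simp add: e)
  next
    fix g and A :: "'h set" assume A: "A \<in> sets borel"
    obtain g' where g': "\<And>x. \<theta> (g' + x) = g + \<theta> x" using tr by metis
    have "\<theta> -` ((\<lambda>x. g + x) ` A) = (\<lambda>x. g' + x) ` (\<theta> -` A)"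
    proof (intro equalityI subsetI)
      fix x assume "x \<in> \<theta> -` ((\<lambda>x. g + x) ` A)"
      then obtain a where a: "a \<in> A" "\<theta> x = g + a" by auto
      then have "\<theta> x = \<theta> (g' + \<theta>' a)" by (simp add: g' inv)
      then have "x = g' + \<theta>' a" using inv(1) by metis
      then show "x \<in> (\<lambda>x. g' + x) ` (\<theta> -` A)" using a inv by auto
    qed (auto simp: g')
    moreover have "(\<lambda>x. g + x) ` A \<in> sets borel"
      unfolding left_translation_image using measurable_sets[OF borel_measurable_translation(1) A, of "- g"] by simp
    ultimately show "emeasure (distr \<mu> borel \<theta>) ((\<lambda>x. g + x) ` A) = emeasure (distr \<mu> borel \<theta>) A"
      using h b[OF A] A by (simp add: e left_haar_measure_def)
  qed
qed

text \<open>The factor is the value of the modular function at \<open>g\<close> or its inverse.\<close>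

lemma left_haar_conjugation:
  fixes \<mu> :: "'g::{topological_group_add, t2_space} measure"
  assumes lc: "locally_compact_group TYPE('g)" and h: "left_haar_measure \<mu>"
  obtains d where "d > 0" "\<And>f. f \<in> borel_measurable borel \<Longrightarrow>
    (\<integral>\<^sup>+x. f (- g + x + g) \<partial>\<mu>) = ennreal d * (\<integral>\<^sup>+x. f x \<partial>\<mu>)"
    "distr \<mu> borel (\<lambda>x. - g + x + g) = density \<mu> (\<lambda>_. ennreal d)"
proof -
  let ?c = "\<lambda>x. - g + x + g"
  have s: "sets \<mu> = sets borel" using h by (simp add: left_haar_measure_def)
  have "left_haar_measure (distr \<mu> borel ?c)"
  proof (rule left_haar_distr[OF h, where \<theta>' = "\<lambda>x. g + x + - g"])
    show "continuous_on UNIV (\<lambda>x. - g + x + g)" "continuous_on UNIV (\<lambda>x. g + x + - g)"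
      by (intro continuous_intros)+
    show "\<exists>g'. \<forall>x. - g + (g' + x) + g = h + (- g + x + g)" for h
      by (intro exI[of _ "g + h + - g"] allI) (simp only: add.assoc minus_add_cancel)
  qed (simp_all add: add.assoc)
  then obtain d where d: "d > 0" "\<And>A. A \<in> sets borel \<Longrightarrow> emeasure (distr \<mu> borel ?c) A = ennreal d * emeasure \<mu> A"
    using left_haar_unique[OF lc _ h] by metis
  have eq: "distr \<mu> borel ?c = density \<mu> (\<lambda>_. ennreal d)"
    by (rule measure_eqI) (simp_all add: s d emeasure_density_const)
  have m: "?c \<in> borel \<rightarrow>\<^sub>M borel"
    by (intro borel_measurable_continuous_onI continuous_intros)
  show ?thesis
  proof (rule that[OF d(1) _ eq])
    fix f :: "'g \<Rightarrow> ennreal" assume f: "f \<in> borel_measurable borel"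
    have "(\<integral>\<^sup>+x. f (?c x) \<partial>\<mu>) = (\<integral>\<^sup>+x. f x \<partial>distr \<mu> borel ?c)"
      using m f s by (intro nn_integral_distr[symmetric]) (simp_all cong: measurable_cong_sets)
    also have "\<dots> = ennreal d * (\<integral>\<^sup>+x. f x \<partial>\<mu>)"
      unfolding eq using f s by (subst nn_integral_density) (simp_all cong: measurable_cong_sets add: nn_integral_cmult)
    finally show "(\<integral>\<^sup>+x. f (?c x) \<partial>\<mu>) = ennreal d * (\<integral>\<^sup>+x. f x \<partial>\<mu>)" .
  qed
qed

section \<open>Null sets and approximation\<close>

lemma left_haar_sets: "left_haar_measure \<mu> \<Longrightarrow> sets \<mu> = sets borel"
  by (simp add: left_haar_measure_def)

lemma left_haar_space: "left_haar_measure \<mu> \<Longrightarrow> space \<mu> = UNIV"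
  using sets_eq_imp_space_eq[OF left_haar_sets, of \<mu>] by simp

lemma left_haar_compact_finite: "left_haar_measure \<mu> \<Longrightarrow> compact K \<Longrightarrow> emeasure \<mu> K < \<infinity>"
  by (simp add: left_haar_measure_def)

lemma compact_borel: "compact K \<Longrightarrow> K \<in> sets borel" for K :: "'a::t2_space set"
  by (intro borel_closed compact_imp_closed)

lemma left_haar_sigma_finite_compact:
  assumes "left_haar_measure \<mu>" "compact K"
  shows "sigma_finite_set \<mu> K"
  by (rule sigma_finite_setI) (use assms in \<open>simp_all add: left_haar_sets compact_borel left_haar_compact_finite[simplified]\<close>)

lemma ennreal_less_add_pos: "a < top \<Longrightarrow> 0 < e \<Longrightarrow> a < a + (e::ennreal)"
  by (cases a; cases e) (auto simp: ennreal_less_iff simp flip: ennreal_plus)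

lemma left_haar_outer:
  assumes h: "left_haar_measure \<mu>" and A: "A \<in> sets borel" "emeasure \<mu> A < \<infinity>" and e: "0 < (e::ennreal)"
  obtains U where "open U" "A \<subseteq> U" "emeasure \<mu> U < \<infinity>" "emeasure \<mu> (U - A) < e"
proof -
  have s: "sets \<mu> = sets borel" using left_haar_sets[OF h] .
  \<comment> \<open>The minimum with 1 keeps the measure of \<open>U\<close> finite even for
    infinite \<open>e\<close>.\<close>
  define e' where "e' = min e 1"
  have e': "0 < e'" "e' \<le> e" "e' < top" unfolding e'_def using e by (auto simp: min_less_iff_disj)
  have "(INF U\<in>{U. open U \<and> A \<subseteq> U}. emeasure \<mu> U) = emeasure \<mu> A"
    using h A unfolding left_haar_measure_def by metis
  moreover have "emeasure \<mu> A < emeasure \<mu> A + e'"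
    using A(2) e'(1) by (intro ennreal_less_add_pos) auto
  ultimately obtain U where U: "open U" "A \<subseteq> U" "emeasure \<mu> U < emeasure \<mu> A + e'"
    by (metis (mono_tags, lifting) INF_less_iff mem_Collect_eq)
  have fin: "emeasure \<mu> U < \<infinity>"
    using U(3) A(2) e'(3) by (metis ennreal_add_less_top infinity_ennreal_def order_less_trans)
  have le: "emeasure \<mu> A \<le> emeasure \<mu> U" using U s by (intro emeasure_mono) auto
  have "emeasure \<mu> (U - A) = emeasure \<mu> U - emeasure \<mu> A"
    using U A s by (intro emeasure_Diff) auto
  also have "\<dots> < e'"
    using U(3) A(2) le by (simp add: minus_less_iff_ennreal add.commute)
  finally show ?thesis using that[OF U(1,2) fin] e'(2) by (meson less_le_trans)
qed

text \<open>Inner regularity is given only for open sets. A compact \<open>K1\<close> nearly fills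
  an open \<open>U\<close> around \<open>A\<close>; removing from it an open \<open>V\<close> that
  barely exceeds \<open>U - A\<close> leaves a compact subset of \<open>A\<close>, at the price of
  two small losses.\<close>

lemma left_haar_inner:
  assumes h: "left_haar_measure \<mu>" and A: "A \<in> sets borel" "emeasure \<mu> A < \<infinity>" and e: "0 < (e::ennreal)"
  obtains K where "compact K" "K \<subseteq> A" "emeasure \<mu> (A - K) < e"
proof -
  have s: "sets \<mu> = sets borel" using left_haar_sets[OF h] .
  have "\<exists>d>0. d + d \<le> e \<and> d < top"
  proof (cases e)
    case (real r)
    then show ?thesis using e
      by (intro exI[of _ "ennreal (r / 2)"]) (simp add: ennreal_less_zero_iff flip: ennreal_plus)
  next
    case top
    then show ?thesis by (intro exI[of _ 1]) simp
  qed
  then obtain e' where half: "0 < e'" "e' + e' \<le> e" "e' < top" by auto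
  then have e': "0 < e'" "e' + e' \<le> e" "e' < top"
    by auto
  obtain U where U: "open U" "A \<subseteq> U" "emeasure \<mu> U < \<infinity>" "emeasure \<mu> (U - A) < 1"
    by (rule left_haar_outer[OF h A zero_less_one])
  have "\<exists>K1. compact K1 \<and> K1 \<subseteq> U \<and> emeasure \<mu> (U - K1) < e'"
  proof (cases "emeasure \<mu> U = 0")
    case True
    then show ?thesis using e' by (intro exI[of _ "{}"]) simp
  next
    case False
    have "emeasure \<mu> U - e' < emeasure \<mu> U"
      using U(3) e'(1,3) False by (cases "emeasure \<mu> U"; cases e') (auto simp: ennreal_minus intro!: ennreal_lessI)
    also have "emeasure \<mu> U = (SUP K\<in>{K. compact K \<and> K \<subseteq> U}. emeasure \<mu> K)"
      using h U unfolding left_haar_measure_def by metis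
    finally obtain K1 where K1: "compact K1" "K1 \<subseteq> U" "emeasure \<mu> U - e' < emeasure \<mu> K1"
      by (metis (mono_tags, lifting) less_SUP_iff mem_Collect_eq)
    have K1s: "K1 \<in> sets borel" using K1 by (intro borel_closed compact_imp_closed)
    have le: "emeasure \<mu> K1 \<le> emeasure \<mu> U" using K1 U s by (intro emeasure_mono) auto
    have "emeasure \<mu> U < e' + emeasure \<mu> K1"
      using K1(3) U(3) e'(3) by (cases "emeasure \<mu> U"; cases "emeasure \<mu> K1"; cases e')
        (auto simp: ennreal_minus_if ennreal_less_iff split: if_splits simp flip: ennreal_plus)
    then have "emeasure \<mu> U - emeasure \<mu> K1 < e'"
      using le U(3) by (simp add: minus_less_iff_ennreal)
    moreover have "emeasure \<mu> (U - K1) = emeasure \<mu> U - emeasure \<mu> K1"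
      using U K1 K1s s le by (intro emeasure_Diff) auto
    ultimately show ?thesis using K1 by auto
  qed
  then obtain K1 where K1: "compact K1" "K1 \<subseteq> U" "emeasure \<mu> (U - K1) < e'" by auto
  have UA: "emeasure \<mu> (U - A) < \<infinity>" using U(4) by (simp add: order_less_trans)
  obtain V where V: "open V" "U - A \<subseteq> V" "emeasure \<mu> (V - (U - A)) < e'"
    by (rule left_haar_outer[OF h _ UA e'(1)]) (use U A in auto)
  have K1s: "K1 \<in> sets borel" using K1 by (intro borel_closed compact_imp_closed)
  show ?thesis
  proof (rule that[of "K1 - V"])
    show "compact (K1 - V)" using K1 V by (simp add: compact_diff)
    show "K1 - V \<subseteq> A" using K1 V by auto
    have "emeasure \<mu> (A - (K1 - V)) \<le> emeasure \<mu> ((U - K1) \<union> (V - (U - A)))"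
      using U V A K1 K1s s by (intro emeasure_mono) auto
    also have "\<dots> \<le> emeasure \<mu> (U - K1) + emeasure \<mu> (V - (U - A))"
      using U V A K1 K1s s by (intro emeasure_subadditive) auto
    also have "\<dots> < e' + e'" using K1(3) V(3) by (rule add_strict_mono)
    finally show "emeasure \<mu> (A - (K1 - V)) < e" using e'(2) by simp
  qed
qed

lemma compact_gdelta_hull:
  fixes \<mu> :: "'g::{topological_group_add, t2_space} measure"
  assumes lc: "locally_compact_group TYPE('g)" and h: "left_haar_measure \<mu>" and K: "compact K"
  obtains B where "compact_gdelta B" "K \<subseteq> B" "emeasure \<mu> (B - K) = 0"
proof -
  have s: "sets \<mu> = sets borel" using left_haar_sets[OF h] .
  have Ks: "K \<in> sets borel" using K by (intro borel_closed compact_imp_closed)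
  have "\<exists>B. compact_gdelta B \<and> K \<subseteq> B \<and> emeasure \<mu> (B - K) \<le> ennreal (1 / Suc n)" for n
  proof -
    have pos: "0 < ennreal (1 / Suc n)" by simp
    obtain U where U: "open U" "K \<subseteq> U" "emeasure \<mu> (U - K) < ennreal (1 / Suc n)"
      by (rule left_haar_outer[OF h Ks left_haar_compact_finite[OF h K] pos])
    obtain B V where B: "compact_gdelta B" "K \<subseteq> V" "V \<subseteq> B" "B \<subseteq> U"
      using compact_gdelta_between[OF _ K U(1,2)] lc unfolding locally_compact_group_def by metis
    have "emeasure \<mu> (B - K) \<le> emeasure \<mu> (U - K)" using B U Ks s by (intro emeasure_mono) auto
    then show ?thesis using B U by (meson less_imp_le order_trans)
  qed
  then obtain B where B: "\<And>n. compact_gdelta (B n)" "\<And>n. K \<subseteq> B n" "\<And>n. emeasure \<mu> (B n - K) \<le> ennreal (1 / Suc n)"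
    by metis
  have le: "emeasure \<mu> ((\<Inter>n. B n) - K) \<le> ennreal (1 / Suc n)" for n
    using B(3)[of n] by (rule order_trans[rotated]) (use B(1) Ks s in \<open>auto intro!: emeasure_mono\<close>)
  have "(\<lambda>n. ennreal (1 / Suc n)) \<longlonglongrightarrow> ennreal 0"
    by (intro tendsto_ennrealI) (use LIMSEQ_inverse_real_of_nat in \<open>simp add: inverse_eq_divide\<close>)
  then have "emeasure \<mu> ((\<Inter>n. B n) - K) \<le> 0"
    using le by (intro LIMSEQ_le_const) auto
  then show ?thesis using that[of "\<Inter>n. B n"] B by (auto intro: compact_gdelta_INT)
qed

text \<open>Sets of finite measure are exhausted from inside by compact sets, up to a null set, and
  each of these is enlarged by a null set to a compact \<open>G\<^sub>\<delta>\<close> set. Thus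
  every \<sigma>-finite set is a Baire set up to a null set.\<close>

lemma sigma_finite_gdelta:
  fixes \<mu> :: "'g::{topological_group_add, t2_space} measure"
  assumes lc: "locally_compact_group TYPE('g)" and h: "left_haar_measure \<mu>" and E: "sigma_finite_set \<mu> E"
  obtains B :: "nat \<Rightarrow> 'g set" where "\<And>n. compact_gdelta (B n)" "AE x in \<mu>. x \<in> E \<longleftrightarrow> x \<in> (\<Union>n. B n)"
proof -
  have s: "sets \<mu> = sets borel" using left_haar_sets[OF h] .
  have *: "\<exists>B :: nat \<Rightarrow> 'g set. (\<forall>n. compact_gdelta (B n)) \<and> (AE x in \<mu>. x \<in> A \<longleftrightarrow> x \<in> (\<Union>n. B n))"
    if A: "A \<in> sets borel" "emeasure \<mu> A < \<infinity>" for A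
  proof -
    have pos: "0 < ennreal (1 / Suc n)" for n by simp
    have "\<exists>K. compact K \<and> K \<subseteq> A \<and> emeasure \<mu> (A - K) < ennreal (1 / Suc n)" for n
      by (rule left_haar_inner[OF h A pos[of n]]) blast
    then obtain K where K: "\<And>n. compact (K n)" "\<And>n. K n \<subseteq> A" "\<And>n. emeasure \<mu> (A - K n) < ennreal (1 / Suc n)"
      by metis
    have "\<exists>B. compact_gdelta B \<and> K n \<subseteq> B \<and> emeasure \<mu> (B - K n) = 0" for n
      using compact_gdelta_hull[OF lc h K(1)[of n]] by metis
    then obtain B where B: "\<And>n. compact_gdelta (B n)" "\<And>n. K n \<subseteq> B n" "\<And>n. emeasure \<mu> (B n - K n) = 0"
      by metis
    have Ks: "K n \<in> sets borel" for n using K by (intro borel_closed compact_imp_closed)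
    have "B n - K n \<in> null_sets \<mu>" for n using B Ks s by (auto intro!: null_setsI)
    then have AE1: "AE x in \<mu>. \<forall>n. x \<notin> B n - K n"
      unfolding AE_all_countable using AE_not_in by blast
    have "emeasure \<mu> (A - (\<Union>n. K n)) \<le> ennreal (1 / Suc n)" for n
    proof -
      have "emeasure \<mu> (A - (\<Union>n. K n)) \<le> emeasure \<mu> (A - K n)"
        using A Ks s by (intro emeasure_mono) auto
      then show ?thesis using K(3)[of n] by simp
    qed
    moreover have "(\<lambda>n. ennreal (1 / Suc n)) \<longlonglongrightarrow> ennreal 0"
      by (intro tendsto_ennrealI) (use LIMSEQ_inverse_real_of_nat in \<open>simp add: inverse_eq_divide\<close>)
    ultimately have "emeasure \<mu> (A - (\<Union>n. K n)) \<le> 0" by (intro LIMSEQ_le_const) auto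
    then have "A - (\<Union>n. K n) \<in> null_sets \<mu>" using A Ks s by (auto intro!: null_setsI)
    then have AE2: "AE x in \<mu>. x \<notin> A - (\<Union>n. K n)" by (rule AE_not_in)
    have "AE x in \<mu>. x \<in> A \<longleftrightarrow> x \<in> (\<Union>n. B n)"
      using AE1 AE2 by eventually_elim (use K(2) B(2) in blast)
    then show ?thesis using B(1) by blast
  qed
  obtain A where A: "\<And>n::nat. A n \<in> sets \<mu> \<and> emeasure \<mu> (A n) < \<infinity>" "E = (\<Union>n. A n)"
    using E unfolding sigma_finite_set_def by metis
  have "\<exists>B :: nat \<Rightarrow> 'g set. (\<forall>n. compact_gdelta (B n)) \<and> (AE x in \<mu>. x \<in> A m \<longleftrightarrow> x \<in> (\<Union>n. B n))" for m
    using *[of "A m"] A(1)[of m] s by simp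
  then obtain B :: "nat \<Rightarrow> nat \<Rightarrow> 'g set" where B: "\<And>m n. compact_gdelta (B m n)" "\<And>m. AE x in \<mu>. x \<in> A m \<longleftrightarrow> x \<in> (\<Union>n. B m n)"
    by metis
  have "AE x in \<mu>. \<forall>m. x \<in> A m \<longleftrightarrow> x \<in> (\<Union>n. B m n)" using B(2) by (simp add: AE_all_countable)
  then have "AE x in \<mu>. x \<in> E \<longleftrightarrow> x \<in> (\<Union>k. B (fst (prod_decode k)) (snd (prod_decode k)))"
    by eventually_elim (simp add: UN_prod_decode[of B] A(2))
  then show ?thesis using that[of "\<lambda>k. B (fst (prod_decode k)) (snd (prod_decode k))"] B(1) by simp
qed

section \<open>Null sets under conjugation and reflection\<close>

lemma AE_conjugation:
  fixes \<mu> :: "'g::{topological_group_add, t2_space} measure"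
  assumes lc: "locally_compact_group TYPE('g)" and h: "left_haar_measure \<mu>" and P: "AE x in \<mu>. P x"
  shows "AE x in \<mu>. P (- g + x + g)"
proof -
  have s: "sets \<mu> = sets borel" using left_haar_sets[OF h] .
  have sp: "space \<mu> = UNIV" using left_haar_space[OF h] .
  obtain d where d: "distr \<mu> borel (\<lambda>x. - g + x + g) = density \<mu> (\<lambda>_. ennreal d)"
    using left_haar_conjugation[OF lc h] by metis
  obtain N where N: "{x. \<not> P x} \<subseteq> N" "N \<in> sets \<mu>" "emeasure \<mu> N = 0"
    using P sp by (auto elim!: AE_E)
  have m: "(\<lambda>x. - g + x + g) \<in> \<mu> \<rightarrow>\<^sub>M borel"
    using s by (intro measurable_compose[OF _ borel_measurable_translation(2)])
      (simp cong: measurable_cong_sets)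
  have "emeasure \<mu> ((\<lambda>x. - g + x + g) -` N) = emeasure (distr \<mu> borel (\<lambda>x. - g + x + g)) N"
    using m N s sp by (simp add: emeasure_distr)
  also have "\<dots> = 0" unfolding d using N by (simp add: emeasure_density_const)
  finally have "emeasure \<mu> ((\<lambda>x. - g + x + g) -` N) = 0" .
  moreover have "(\<lambda>x. - g + x + g) -` N \<in> sets \<mu>"
    using measurable_sets[OF m, of N] N s sp by simp
  ultimately show ?thesis using N(1)
    by (intro AE_I[of _ _ "(\<lambda>x. - g + x + g) -` N"]) auto
qed

text \<open>With \<open>y\<close> restricted to a compact set, the preimage of \<open>B\<close>
  under \<open>- y + x\<close> is compact, being an image of \<open>K \<times> B\<close>; the whole
  preimage need not belong to the product \<sigma>-algebra.\<close>

lemma sets_convolution_strip: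
  fixes B K :: "'g::{topological_group_add, t2_space} set"
  assumes B: "compact_gdelta B" and K: "compact K"
  shows "{(y, x). y \<in> K \<and> - y + x \<in> B} \<in> sets (borel \<Otimes>\<^sub>M borel)"
proof -
  obtain P :: "nat \<Rightarrow> 'g set" where P: "\<And>n. open (P n)" "B = (\<Inter>n. P n)"
    using B unfolding compact_gdelta_def by metis
  have cB: "compact B" using B by (simp add: compact_gdelta_def)
  show ?thesis
  proof (rule compact_gdelta_sets[where P = "\<lambda>n. {p. - fst p + snd p \<in> P n}" and Q = "K \<times> UNIV"])
    show "open_base_in (borel \<Otimes>\<^sub>M borel :: ('g \<times> 'g) measure)"
      by (intro open_base_in_pair open_base_in_borel refl)
    have "{(y, x). y \<in> K \<and> - y + x \<in> B} = (\<lambda>p. (fst p, fst p + snd p)) ` (K \<times> B)"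
    proof (intro equalityI subsetI)
      fix p assume "p \<in> {(y, x). y \<in> K \<and> - y + x \<in> B}"
      then show "p \<in> (\<lambda>p. (fst p, fst p + snd p)) ` (K \<times> B)"
        by (intro image_eqI[of _ _ "(fst p, - fst p + snd p)"]) (auto simp: add.assoc[symmetric])
    qed (auto simp: add.assoc[symmetric])
    moreover have "compact \<dots>" 
      by (intro compact_continuous_image compact_Times K cB continuous_intros)
    ultimately show "compact {(y, x). y \<in> K \<and> - y + x \<in> B}" by simp
    show "open {p :: 'g \<times> 'g. - fst p + snd p \<in> P n}" for n
      by (intro open_vimage[OF P(1), unfolded vimage_def] continuous_intros)
    show "{(y, x). y \<in> K \<and> - y + x \<in> B} = (\<Inter>n. {p. - fst p + snd p \<in> P n}) \<inter> K \<times> UNIV"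
      by (auto simp: P(2))
    show "K \<times> UNIV \<in> sets (borel \<Otimes>\<^sub>M borel)"
      using K by (intro pair_measureI borel_closed compact_imp_closed) auto
  qed
qed

text \<open>By Tonelli's theorem and left invariance, for almost every \<open>x\<close> the set of
  all \<open>y \<in> D\<close> with \<open>- y + x \<in> B\<close> is null. A set \<open>C\<close>
  of positive measure contains such an \<open>x\<close>, and a left translation turns that null set
  into the reflection of \<open>B\<close>.\<close>

lemma compact_null_inverse:
  fixes \<mu> :: "'g::{topological_group_add, t2_space} measure"
  assumes lc: "locally_compact_group TYPE('g)" and h: "left_haar_measure \<mu>"
    and K: "compact K" "emeasure \<mu> K = 0"
  shows "emeasure \<mu> {y. - y \<in> K} = 0"
proof -
  have s [measurable_cong]: "sets \<mu> = sets borel" using left_haar_sets[OF h] .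
  have sp: "space \<mu> = UNIV" using left_haar_space[OF h] .
  have li: "left_invariant \<mu>" using left_haar_imp_left_invariant[OF h] .
  have Ks: "K \<in> sets borel" using K by (intro borel_closed compact_imp_closed)
  obtain B where B: "compact_gdelta B" "K \<subseteq> B" "emeasure \<mu> (B - K) = 0"
    using compact_gdelta_hull[OF lc h K(1)] by metis
  have "emeasure \<mu> B \<le> emeasure \<mu> K + emeasure \<mu> (B - K)"
    using B Ks s by (subst emeasure_Un[symmetric]) (auto intro!: emeasure_mono)
  then have B0: "emeasure \<mu> B = 0" using K B by simp
  obtain C V where C: "compact_gdelta C" "open V" "{0::'g} \<subseteq> V" "V \<subseteq> C"
    using compact_gdelta_between[of "{0::'g}" UNIV] lc unfolding locally_compact_group_def
    by (metis compact_insert compact_empty open_UNIV subset_UNIV)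
  have "0 < emeasure \<mu> V" using C left_haar_pos[OF h] by auto
  also have "\<dots> \<le> emeasure \<mu> C" using C s by (intro emeasure_mono) auto
  finally have C0: "0 < emeasure \<mu> C" .
  \<comment> \<open>\<open>D\<close> contains every \<open>y\<close> with
    \<open>- y + x \<in> B\<close> for some \<open>x \<in> C\<close>, so restricting to
    \<open>D\<close> loses nothing at the point chosen from \<open>C\<close>.\<close>
  define D where "D = (\<lambda>(b, a). b - a) ` (C \<times> B)"
  have cD: "compact D" unfolding D_def using B C by (intro compact_differences) (auto simp: compact_gdelta_def)
  define S where "S = (\<lambda>(b, a). b + a) ` (D \<times> B)"
  have cS: "compact S" unfolding S_def using B cD by (intro compact_differences) (auto simp: compact_gdelta_def)
  define W where "W = {(y, x). y \<in> D \<and> - y + x \<in> B}"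
  have W: "W \<in> sets (borel \<Otimes>\<^sub>M borel)" unfolding W_def by (rule sets_convolution_strip[OF B(1) cD])
  have W': "indicator W \<in> borel_measurable (\<mu> \<Otimes>\<^sub>M \<mu>)"
    using W s by (intro borel_measurable_indicator) (simp cong: sets_pair_measure_cong)
  have Bs: "B \<in> sets borel" using B by simp
  have supp: "x \<in> D \<and> y \<in> S" if "(indicator W (x, y) :: ennreal) \<noteq> 0" for x y
  proof -
    have "(x, y) \<in> W" using that by (auto simp: indicator_def split: if_splits)
    then show ?thesis unfolding W_def S_def
      by (auto intro!: image_eqI[of _ _ "(x, - x + y)"] simp: add.assoc[symmetric])
  qed
  note fin = left_haar_sigma_finite_compact[OF h]
  have "(\<integral>\<^sup>+x. (\<integral>\<^sup>+y. indicator W (y, x) \<partial>\<mu>) \<partial>\<mu>) = (\<integral>\<^sup>+y. (\<integral>\<^sup>+x. indicator W (y, x) \<partial>\<mu>) \<partial>\<mu>)"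
    by (rule tonelli_support(2)[OF fin[OF cD] fin[OF cS] W' supp])
  also have "\<dots> \<le> (\<integral>\<^sup>+y. (\<integral>\<^sup>+x. indicator B (- y + x) \<partial>\<mu>) \<partial>\<mu>)"
    by (intro nn_integral_mono) (auto simp: W_def indicator_def)
  also have "\<dots> = (\<integral>\<^sup>+y. 0 \<partial>\<mu>)"
    using B0 s Bs by (intro nn_integral_cong) (simp add: nn_integral_left_translation[OF li])
  finally have "(\<integral>\<^sup>+x. (\<integral>\<^sup>+y. indicator W (y, x) \<partial>\<mu>) \<partial>\<mu>) = 0" by simp
  then have "AE x in \<mu>. (\<integral>\<^sup>+y. indicator W (y, x) \<partial>\<mu>) = 0"
    by (subst (asm) nn_integral_0_iff_AE) (auto intro: tonelli_support(4)[OF fin[OF cD] fin[OF cS] W' supp])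
  then have "\<exists>x\<in>C. (\<integral>\<^sup>+y. indicator W (y, x) \<partial>\<mu>) = 0"
  proof (rule contrapos_pp)
    assume "\<not> (\<exists>x\<in>C. (\<integral>\<^sup>+y. indicator W (y, x) \<partial>\<mu>) = 0)"
    then have *: "C \<subseteq> {x \<in> space \<mu>. \<not> (\<integral>\<^sup>+y. indicator W (y, x) \<partial>\<mu>) = 0}" using sp by auto
    show "\<not> (AE x in \<mu>. (\<integral>\<^sup>+y. indicator W (y, x) \<partial>\<mu>) = 0)"
    proof
      assume "AE x in \<mu>. (\<integral>\<^sup>+y. indicator W (y, x) \<partial>\<mu>) = 0"
      then obtain N where N: "{x \<in> space \<mu>. \<not> (\<integral>\<^sup>+y. indicator W (y, x) \<partial>\<mu>) = 0} \<subseteq> N" "N \<in> sets \<mu>" "emeasure \<mu> N = 0"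
        by (auto elim!: AE_E)
      have "emeasure \<mu> C \<le> emeasure \<mu> N" using * N by (intro emeasure_mono) auto
      then show False using C0 N by simp
    qed
  qed
  then obtain x where x: "x \<in> C" "(\<integral>\<^sup>+y. indicator W (y, x) \<partial>\<mu>) = 0" by auto
  have Em: "{y. - y \<in> B} \<in> sets borel"
    using measurable_sets[OF borel_measurable_translation(3), of B] Bs by (simp add: vimage_def)
  have "emeasure \<mu> {y. - y \<in> B} = (\<integral>\<^sup>+y. indicator {y. - y \<in> B} (- x + y) \<partial>\<mu>)"
    using Em s by (subst nn_integral_left_translation[OF li]) auto
  also have "\<dots> = (\<integral>\<^sup>+y. indicator W (y, x) \<partial>\<mu>)"
  proof (rule nn_integral_cong)
    fix y
    have "y \<in> D" if "- y + x \<in> B"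
      unfolding D_def using that x by (intro image_eqI[of _ _ "(x, - y + x)"])
        (auto simp only: diff_conv_add_uminus minus_add minus_minus add.assoc[symmetric] right_minus add_0_left prod.case mem_Times_iff fst_conv snd_conv)
    then show "indicator {y. - y \<in> B} (- x + y) = (indicator W (y, x) :: ennreal)"
      by (auto simp: W_def indicator_def minus_add)
  qed
  finally have "emeasure \<mu> {y. - y \<in> B} = 0" using x by simp
  moreover have "emeasure \<mu> {y. - y \<in> K} \<le> emeasure \<mu> {y. - y \<in> B}"
    using B Em s by (intro emeasure_mono) auto
  ultimately show ?thesis by simp
qed

text \<open>A non-null exceptional set of finite measure would contain a compact \<open>K\<close> of
  positive measure. Its image under \<open>- y + x\<close> is compact and null, and so is the
  reflection of that image by \<open>compact_null_inverse\<close>; but a left translate of the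
  reflection contains \<open>K\<close>. The set \<open>S\<close> supplies the finite measure for
  which inner regularity is available.\<close>

lemma AE_reflection:
  fixes \<mu> :: "'g::{topological_group_add, t2_space} measure"
  assumes lc: "locally_compact_group TYPE('g)" and h: "left_haar_measure \<mu>"
    and P: "AE x in \<mu>. P x" and S: "sigma_finite_set \<mu> S"
  shows "AE y in \<mu>. y \<in> S \<longrightarrow> P (- y + x)"
proof -
  have s: "sets \<mu> = sets borel" using left_haar_sets[OF h] .
  have sp: "space \<mu> = UNIV" using left_haar_space[OF h] .
  have inv: "\<And>g A. A \<in> sets borel \<Longrightarrow> emeasure \<mu> ((\<lambda>x. g + x) ` A) = emeasure \<mu> A"
    using h by (simp add: left_haar_measure_def)
  obtain N where N: "{x. \<not> P x} \<subseteq> N" "N \<in> sets \<mu>" "emeasure \<mu> N = 0"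
    using P sp by (auto elim!: AE_E)
  obtain A where A: "\<And>n::nat. A n \<in> sets \<mu> \<and> emeasure \<mu> (A n) < \<infinity>" "S = (\<Union>n. A n)"
    using S unfolding sigma_finite_set_def by metis
  have cont: "continuous_on UNIV (\<lambda>y. - y + x)" by (intro continuous_intros)
  have "{y\<in>A n. - y + x \<in> N} \<in> null_sets \<mu>" for n
  proof -
    let ?E = "{y\<in>A n. - y + x \<in> N}"
    have "(\<lambda>y. - y + x) -` N \<in> sets borel"
      using measurable_sets[OF borel_measurable_continuous_onI[OF cont], of N] N s by simp
    moreover have "?E = A n \<inter> (\<lambda>y. - y + x) -` N" by auto
    ultimately have E: "?E \<in> sets borel" using A(1)[of n] s by (simp add: sets.Int)
    have "emeasure \<mu> ?E \<le> emeasure \<mu> (A n)" using A(1)[of n] by (intro emeasure_mono) auto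
    then have Efin: "emeasure \<mu> ?E < \<infinity>" using A(1)[of n] by (simp add: order_le_less_trans)
    have "emeasure \<mu> ?E = 0"
    proof (rule ccontr)
      assume "emeasure \<mu> ?E \<noteq> 0"
      then have "0 < emeasure \<mu> ?E" by (simp add: zero_less_iff_neq_zero)
      from left_haar_inner[OF h E Efin this]
      obtain K where K: "compact K" "K \<subseteq> ?E" "emeasure \<mu> (?E - K) < emeasure \<mu> ?E" .
      have Ks: "K \<in> sets borel" using K by (intro borel_closed compact_imp_closed)
      let ?L = "(\<lambda>y. - y + x) ` K"
      have cL: "compact ?L" using K by (intro compact_continuous_image continuous_on_subset[OF cont]) auto
      then have Ls: "?L \<in> sets borel" by (intro borel_closed compact_imp_closed)
      have "emeasure \<mu> ?L \<le> emeasure \<mu> N" using K N by (intro emeasure_mono) auto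
      then have "emeasure \<mu> ?L = 0" using N by simp
      then have L0: "emeasure \<mu> {z. - z \<in> ?L} = 0" by (rule compact_null_inverse[OF lc h cL])
      have Lm: "{z. - z \<in> ?L} \<in> sets borel"
        using measurable_sets[OF borel_measurable_translation(3) Ls] by (simp add: vimage_def)
      have "K \<subseteq> (\<lambda>z. x + z) ` {z. - z \<in> ?L}"
      proof
        fix y assume "y \<in> K"
        then show "y \<in> (\<lambda>z. x + z) ` {z. - z \<in> ?L}"
          by (intro image_eqI[of _ _ "- x + y"]) (auto simp: minus_add add.assoc[symmetric])
      qed
      moreover have "(\<lambda>z. x + z) ` {z. - z \<in> ?L} \<in> sets borel"
        unfolding left_translation_image using measurable_sets[OF borel_measurable_translation(1) Lm, of "- x"] by simp
      ultimately have "emeasure \<mu> K \<le> emeasure \<mu> ((\<lambda>z. x + z) ` {z. - z \<in> ?L})"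
        using s by (intro emeasure_mono) auto
      then have "emeasure \<mu> K = 0" using inv[OF Lm] L0 by simp
      moreover have "emeasure \<mu> ?E = emeasure \<mu> K + emeasure \<mu> (?E - K)"
      proof -
        have "K \<union> (?E - K) = ?E" using K(2) by (rule Diff_partition)
        then show ?thesis using E Ks s by (subst plus_emeasure) simp_all
      qed
      ultimately show False using K(3) by simp
    qed
    then show ?thesis using E s by (auto intro: null_setsI)
  qed
  then have "AE y in \<mu>. \<forall>n. y \<notin> {y\<in>A n. - y + x \<in> N}"
    unfolding AE_all_countable using AE_not_in by blast
  then show ?thesis by eventually_elim (use A(2) N(1) in auto)
qed

section \<open>Baire measurable versions\<close>

text \<open>Functions measurable for this smaller \<sigma>-algebra have jointly measurable
  convolution kernels once the first one has \<sigma>-compact support; for general Borel functions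
  this can fail.\<close>

definition baire :: "'a::topological_space measure" where
  "baire = sigma UNIV {B. compact_gdelta B}"

lemma space_baire [simp]: "space baire = UNIV"
  by (simp add: baire_def)

lemma sets_baire: "sets baire = sigma_sets UNIV {B. compact_gdelta B}"
  unfolding baire_def by (rule sets_measure_of) auto

lemma compact_gdelta_baire: "compact_gdelta B \<Longrightarrow> B \<in> sets baire"
  unfolding sets_baire by (auto intro: sigma_sets.Basic)

lemma baire_subset_borel: "sets (baire :: 'a::t2_space measure) \<subseteq> sets borel"
  unfolding sets_baire using compact_gdelta_borel
  by (intro sets.sigma_sets_subset[of _ borel, simplified]) auto

lemma measurable_baire_imp_borel: "f \<in> baire \<rightarrow>\<^sub>M N \<Longrightarrow> f \<in> borel \<rightarrow>\<^sub>M N" for f :: "'a::t2_space \<Rightarrow> _"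
  using baire_subset_borel by (auto simp: measurable_def)

definition sigma_compact :: "'a::topological_space set \<Rightarrow> bool" where
  "sigma_compact S \<longleftrightarrow> (\<exists>K::nat \<Rightarrow> 'a set. (\<forall>n. compact (K n)) \<and> S = (\<Union>n. K n))"

lemma sigma_compact_borel: "sigma_compact S \<Longrightarrow> S \<in> sets borel" for S :: "'a::t2_space set"
  unfolding sigma_compact_def using compact_borel by blast

lemma left_haar_sigma_compact:
  assumes "left_haar_measure \<mu>" "sigma_compact S"
  shows "sigma_finite_set \<mu> S"
proof -
  obtain K :: "nat \<Rightarrow> _" where K: "\<And>n. compact (K n)" "S = (\<Union>n. K n)"
    using assms(2) unfolding sigma_compact_def by metis
  show ?thesis unfolding K(2) by (intro sigma_finite_set_UN left_haar_sigma_finite_compact[OF assms(1)] K(1))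
qed

lemma sigma_compact_plus:
  fixes S T :: "'g::topological_group_add set"
  assumes "sigma_compact S" "sigma_compact T"
  shows "sigma_compact {x + y |x y. x \<in> S \<and> y \<in> T}"
proof -
  obtain K L :: "nat \<Rightarrow> 'g set" where K: "\<And>n. compact (K n)" "S = (\<Union>n. K n)" and L: "\<And>n. compact (L n)" "T = (\<Union>n. L n)"
    using assms unfolding sigma_compact_def by metis
  define M where "M n m = (\<lambda>(b, a). b + a) ` (K n \<times> L m)" for n m
  have "compact (M n m)" for n m unfolding M_def by (intro compact_differences K L)
  moreover have "{x + y |x y. x \<in> S \<and> y \<in> T} = (\<Union>n m. M n m)"
    unfolding M_def K L by (auto intro: image_eqI)
  ultimately show ?thesis unfolding sigma_compact_def
    by (intro exI[of _ "\<lambda>k. M (fst (prod_decode k)) (snd (prod_decode k))"]) (simp add: UN_prod_decode[of M])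
qed

text \<open>The level sets of simple approximations at nonzero values are \<sigma>-finite, hence
  almost equal to countable unions of compact \<open>G\<^sub>\<delta>\<close> sets. Rebuilding the
  approximations from these unions changes them only on one common null set, and the limit is
  supported in the union of all the compact sets involved.\<close>

lemma baire_version:
  fixes \<mu> :: "'g::{topological_group_add, t2_space} measure" and f :: "'g \<Rightarrow> complex"
  assumes lc: "locally_compact_group TYPE('g)" and h: "left_haar_measure \<mu>"
    and f: "f \<in> borel_measurable borel" and S: "sigma_finite_set \<mu> {x. f x \<noteq> 0}"
  obtains f' S' where "f' \<in> borel_measurable baire" "sigma_compact S'" "{x. f' x \<noteq> 0} \<subseteq> S'"
    "AE x in \<mu>. f x = f' x"
proof -
  have s: "sets \<mu> = sets borel" using left_haar_sets[OF h] .
  obtain F :: "nat \<Rightarrow> 'g \<Rightarrow> complex" where F: "\<And>i. simple_function borel (F i)"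
    "\<And>x. (\<lambda>i. F i x) \<longlonglongrightarrow> f x" "\<And>i x. dist (F i x) 0 \<le> 2 * dist (f x) 0"
    using borel_measurable_implies_sequence_metric[OF f, of 0] by (auto simp del: dist_0_norm)
  \<comment> \<open>The value 0 is excluded because its level set need not be \<sigma>-finite. The
    bound on \<open>F\<close> makes \<open>F i\<close> vanish wherever \<open>f\<close> does, so the
    other level sets lie in the support of \<open>f\<close>.\<close>
  define R where "R i = F i ` UNIV - {0}" for i
  have finR: "finite (R i)" for i
    using simple_functionD(1)[OF F(1)[of i]] by (simp add: R_def)
  define Q where "Q i v B \<longleftrightarrow> (\<forall>n. compact_gdelta (B n)) \<and> (v \<in> R i \<longrightarrow> (AE x in \<mu>. F i x = v \<longleftrightarrow> x \<in> (\<Union>n. B n)))"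
    for i v and B :: "nat \<Rightarrow> 'g set"
  have "\<exists>B. Q i v B" for i v
  proof (cases "v \<in> R i")
    case True
    have "F i -` {v} \<inter> space borel \<in> sets borel"
      by (rule measurable_sets[OF borel_measurable_simple_function[OF F(1)]]) simp
    then have "{x. F i x = v} \<in> sets \<mu>" by (simp add: vimage_def s)
    moreover have "{x. F i x = v} \<subseteq> {x. f x \<noteq> 0}"
    proof
      fix x assume "x \<in> {x. F i x = v}"
      then show "x \<in> {x. f x \<noteq> 0}" using F(3)[of i x] True by (auto simp: R_def)
    qed
    ultimately have "sigma_finite_set \<mu> {x. F i x = v}" by (intro sigma_finite_set_subset[OF S])
    then show ?thesis
    proof (rule sigma_finite_gdelta[OF lc h])
      fix B :: "nat \<Rightarrow> 'g set"
      assume "\<And>n. compact_gdelta (B n)" "AE x in \<mu>. x \<in> {x. F i x = v} \<longleftrightarrow> x \<in> (\<Union>n. B n)"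
      then show ?thesis unfolding Q_def by (intro exI[of _ B]) simp
    qed
  next
    case False
    have "compact_gdelta {}" by (auto simp: compact_gdelta_def intro: exI[of _ "\<lambda>_. {}"])
    then show ?thesis unfolding Q_def using False by (intro exI[of _ "\<lambda>_. {}"]) simp
  qed
  then obtain B where B0: "\<And>i v. Q i v (B i v)" by metis
  have B: "compact_gdelta (B i v n)" "v \<in> R i \<Longrightarrow> AE x in \<mu>. F i x = v \<longleftrightarrow> x \<in> (\<Union>n. B i v n)" for i v n
    using B0[of i v] by (simp_all add: Q_def)
  define F' where "F' i x = (\<Sum>v\<in>R i. indicator (\<Union>n. B i v n) x *\<^sub>R v)" for i x
  \<comment> \<open>Taking \<open>lim\<close> at every point keeps \<open>f'\<close> Baire
    measurable, and where all \<open>F' i\<close> vanish it is 0, as the claim on the support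
    demands.\<close>
  define f' where "f' x = lim (\<lambda>i. F' i x)" for x
  define K where "K i n = (\<Union>v\<in>R i. B i v n)" for i n
  show ?thesis
  proof (rule that[of f' "\<Union>i n. K i n"])
    have "F' i \<in> borel_measurable baire" for i
      unfolding F'_def by (intro borel_measurable_sum borel_measurable_scaleR borel_measurable_indicator
        borel_measurable_const sets.countable_UN) (auto intro: compact_gdelta_baire B)
    then show "f' \<in> borel_measurable baire" unfolding f'_def by (rule borel_measurable_lim_metric)
    have "compact (K i n)" for i n
      unfolding K_def by (intro compact_UN finR compact_gdelta_imp_compact B)
    then show "sigma_compact (\<Union>i n. K i n)" unfolding sigma_compact_def
      by (intro exI[of _ "\<lambda>k. K (fst (prod_decode k)) (snd (prod_decode k))"]) (simp add: UN_prod_decode[of K])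
    show "{x. f' x \<noteq> 0} \<subseteq> (\<Union>i n. K i n)"
    proof (rule subsetI, rule ccontr)
      fix x assume that: "x \<in> {x. f' x \<noteq> 0}" and "x \<notin> (\<Union>i n. K i n)"
      then have "F' i x = 0" for i unfolding F'_def K_def by (intro sum.neutral) auto
      then show False using that by (simp add: f'_def)
    qed
    have "AE x in \<mu>. \<forall>i. \<forall>v\<in>R i. F i x = v \<longleftrightarrow> x \<in> (\<Union>n. B i v n)"
      unfolding AE_all_countable by (intro allI AE_finite_allI finR B(2))
    then show "AE x in \<mu>. f x = f' x"
    proof eventually_elim
      fix x assume x: "\<forall>i. \<forall>v\<in>R i. F i x = v \<longleftrightarrow> x \<in> (\<Union>n. B i v n)"
      have "F' i x = F i x" for i
      proof -
        have "F' i x = (\<Sum>v\<in>R i. if v = F i x then v else 0)"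
          unfolding F'_def
        proof (intro sum.cong refl)
          fix v assume "v \<in> R i"
          then have "F i x = v \<longleftrightarrow> x \<in> (\<Union>n. B i v n)" using x by metis
          then show "indicator (\<Union>n. B i v n) x *\<^sub>R v = (if v = F i x then v else 0)"
            unfolding indicator_def by (cases "F i x = v") simp_all
        qed
        also have "\<dots> = F i x" using finR by (auto simp: R_def)
        finally show ?thesis .
      qed
      then show "f x = f' x" using F(2)[of x] by (simp add: f'_def limI)
    qed
  qed
qed

section \<open>Convolution\<close>

text \<open>Compact strips over compact \<open>G\<^sub>\<delta>\<close> sets are measurable by
  \<open>sets_convolution_strip\<close>, and the Baire sets are generated by compact
  \<open>G\<^sub>\<delta>\<close> sets. Only \<open>y \<in> S\<close> matters since \<open>f\<close>
  vanishes elsewhere, and \<sigma>-compactness of \<open>S\<close> reduces this to compact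
  strips.\<close>

lemma measurable_convolution_kernel:
  fixes f h :: "'g::{topological_group_add, t2_space} \<Rightarrow> complex"
  assumes f: "f \<in> borel_measurable baire" and h: "h \<in> borel_measurable baire"
    and S: "sigma_compact S" "{x. f x \<noteq> 0} \<subseteq> S"
  shows "(\<lambda>p. f (fst p) * h (- fst p + snd p)) \<in> borel_measurable (borel \<Otimes>\<^sub>M borel)"
proof -
  obtain K :: "nat \<Rightarrow> 'g set" where K: "\<And>n. compact (K n)" "S = (\<Union>n. K n)"
    using S(1) unfolding sigma_compact_def by metis
  have Sb: "S \<in> sets borel" using sigma_compact_borel[OF S(1)] .
  have strip: "{p. fst p \<in> S \<and> - fst p + snd p \<in> A} \<in> sets (borel \<Otimes>\<^sub>M borel)" if "A \<in> sets baire" for A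
    using that unfolding sets_baire
  proof (induction rule: sigma_sets.induct)
    case (Basic B)
    then have "{(y, x). y \<in> K n \<and> - y + x \<in> B} \<in> sets (borel \<Otimes>\<^sub>M borel)" for n
      by (intro sets_convolution_strip K(1)) simp
    moreover have "{p. fst p \<in> S \<and> - fst p + snd p \<in> B} = (\<Union>n. {(y, x). y \<in> K n \<and> - y + x \<in> B})"
      by (auto simp: K(2))
    ultimately show ?case by auto
  next
    case (Compl A)
    have "{p. fst p \<in> S \<and> - fst p + snd p \<in> UNIV - A} = S \<times> UNIV - {p. fst p \<in> S \<and> - fst p + snd p \<in> A}"
      by auto
    then show ?case using Compl Sb by auto
  next
    case (Union A)
    have "{p. fst p \<in> S \<and> - fst p + snd p \<in> (\<Union>i. A i)} = (\<Union>i. {p. fst p \<in> S \<and> - fst p + snd p \<in> A i})"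
      by auto
    then show ?case using Union by auto
  qed simp
  define \<phi> where "\<phi> = (\<lambda>p. if fst p \<in> S then h (- fst p + snd p) else 0)"
  have [measurable]: "\<phi> \<in> borel_measurable (borel \<Otimes>\<^sub>M borel)"
  proof (rule measurableI)
    fix A :: "complex set" assume "A \<in> sets borel"
    then have "h -` A \<in> sets baire" using measurable_sets[OF h] by simp
    then have "{p. fst p \<in> S \<and> - fst p + snd p \<in> h -` A} \<union> (if 0 \<in> A then (UNIV - S) \<times> UNIV else {}) \<in> sets (borel \<Otimes>\<^sub>M borel)"
      using Sb by (intro sets.Un strip) auto
    also have "{p. fst p \<in> S \<and> - fst p + snd p \<in> h -` A} \<union> (if 0 \<in> A then (UNIV - S) \<times> UNIV else {}) =
      \<phi> -` A \<inter> space (borel \<Otimes>\<^sub>M borel)"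
      by (auto simp: \<phi>_def space_pair_measure split: if_splits)
    finally show "\<phi> -` A \<inter> space (borel \<Otimes>\<^sub>M borel) \<in> sets (borel \<Otimes>\<^sub>M borel)" .
  qed simp
  have [measurable]: "f \<in> borel_measurable borel" using measurable_baire_imp_borel[OF f] .
  have "(\<lambda>p. f (fst p) * h (- fst p + snd p)) = (\<lambda>p. f (fst p) * \<phi> p)"
    using S(2) unfolding \<phi>_def by (intro ext) force
  then show ?thesis by simp
qed

lemma nn_integral_convolution_kernel:
  fixes f h :: "'g::{topological_group_add, t2_space} \<Rightarrow> complex"
  assumes \<mu>: "left_haar_measure \<mu>"
    and f: "f \<in> borel_measurable baire" and h: "h \<in> borel_measurable baire"
    and S: "sigma_compact S" "{x. f x \<noteq> 0} \<subseteq> S"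
    and T: "sigma_compact T" "{x. h x \<noteq> 0} \<subseteq> T"
  shows "(\<integral>\<^sup>+x. (\<integral>\<^sup>+y. norm (f y) * norm (h (- y + x)) \<partial>\<mu>) \<partial>\<mu>) = (\<integral>\<^sup>+x. norm (f x) \<partial>\<mu>) * (\<integral>\<^sup>+x. norm (h x) \<partial>\<mu>)"
    and "(\<lambda>x. \<integral>\<^sup>+y. norm (f y) * norm (h (- y + x)) \<partial>\<mu>) \<in> borel_measurable borel"
proof -
  have s [measurable_cong]: "sets \<mu> = sets borel" using left_haar_sets[OF \<mu>] .
  have bf [measurable]: "f \<in> borel_measurable borel" and bh [measurable]: "h \<in> borel_measurable borel"
    using measurable_baire_imp_borel[OF f] measurable_baire_imp_borel[OF h] by auto
  define F where "F p = ennreal (norm (f (fst p) * h (- fst p + snd p)))" for p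
  have F0: "F \<in> borel_measurable (borel \<Otimes>\<^sub>M borel)"
    unfolding F_def using measurable_convolution_kernel[OF f h S] by measurable
  have F: "F \<in> borel_measurable (\<mu> \<Otimes>\<^sub>M \<mu>)"
    using F0 by (subst measurable_cong_sets[OF sets_pair_measure_cong[OF s s]]) auto
  \<comment> \<open>The kernel lives on \<open>S \<times> U\<close>, and \<open>U\<close> is again
    \<sigma>-compact, so Tonelli's theorem in the form \<open>tonelli_support\<close>
    applies.\<close>
  define U where "U = {x + y |x y. x \<in> S \<and> y \<in> T}"
  have U: "sigma_finite_set \<mu> U" unfolding U_def
    by (intro left_haar_sigma_compact[OF \<mu>] sigma_compact_plus S T)
  have S': "sigma_finite_set \<mu> S" by (intro left_haar_sigma_compact[OF \<mu>] S)
  have supp: "y \<in> S \<and> x \<in> U" if "F (y, x) \<noteq> 0" for x y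
  proof -
    have "f y \<noteq> 0" "h (- y + x) \<noteq> 0" using that by (auto simp: F_def)
    then have "y \<in> S" "- y + x \<in> T" using S T by auto
    moreover have "x = y + (- y + x)" by (simp add: add.assoc[symmetric])
    ultimately show ?thesis unfolding U_def by blast
  qed
  have eq: "(\<integral>\<^sup>+y. norm (f y) * norm (h (- y + x)) \<partial>\<mu>) = (\<integral>\<^sup>+y. F (y, x) \<partial>\<mu>)" for x
    by (simp add: F_def norm_mult)
  show "(\<lambda>x. \<integral>\<^sup>+y. norm (f y) * norm (h (- y + x)) \<partial>\<mu>) \<in> borel_measurable borel"
    unfolding eq using tonelli_support(4)[OF S' U F supp] s by (simp cong: measurable_cong_sets)
  have "(\<integral>\<^sup>+x. (\<integral>\<^sup>+y. F (y, x) \<partial>\<mu>) \<partial>\<mu>) = (\<integral>\<^sup>+y. (\<integral>\<^sup>+x. F (y, x) \<partial>\<mu>) \<partial>\<mu>)"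
    by (rule tonelli_support(2)[OF S' U F supp])
  also have "\<dots> = (\<integral>\<^sup>+y. norm (f y) * (\<integral>\<^sup>+x. norm (h x) \<partial>\<mu>) \<partial>\<mu>)"
  proof (rule nn_integral_cong)
    fix y
    have hm: "(\<lambda>x. ennreal (norm (h x))) \<in> borel_measurable borel" by measurable
    have "(\<integral>\<^sup>+x. F (y, x) \<partial>\<mu>) = (\<integral>\<^sup>+x. ennreal (norm (f y)) * ennreal (norm (h (- y + x))) \<partial>\<mu>)"
      by (simp add: F_def norm_mult ennreal_mult)
    also have "\<dots> = norm (f y) * (\<integral>\<^sup>+x. ennreal (norm (h (- y + x))) \<partial>\<mu>)"
      using s by (intro nn_integral_cmult) (simp cong: measurable_cong_sets)
    also have "(\<integral>\<^sup>+x. ennreal (norm (h (- y + x))) \<partial>\<mu>) = (\<integral>\<^sup>+x. norm (h x) \<partial>\<mu>)"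
      by (rule nn_integral_left_translation[OF left_haar_imp_left_invariant[OF \<mu>] hm])
    finally show "(\<integral>\<^sup>+x. F (y, x) \<partial>\<mu>) = norm (f y) * (\<integral>\<^sup>+x. norm (h x) \<partial>\<mu>)" .
  qed
  also have "\<dots> = (\<integral>\<^sup>+x. norm (f x) \<partial>\<mu>) * (\<integral>\<^sup>+x. norm (h x) \<partial>\<mu>)"
    using s by (intro nn_integral_multc) (simp cong: measurable_cong_sets)
  finally show "(\<integral>\<^sup>+x. (\<integral>\<^sup>+y. norm (f y) * norm (h (- y + x)) \<partial>\<mu>) \<partial>\<mu>) = (\<integral>\<^sup>+x. norm (f x) \<partial>\<mu>) * (\<integral>\<^sup>+x. norm (h x) \<partial>\<mu>)"
    unfolding eq .
qed

text \<open>Restricting the measure to \<open>S\<close> makes it \<sigma>-finite without changing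
  the integral, and integrals against a \<sigma>-finite measure are measurable in a
  parameter.\<close>

lemma borel_measurable_convolution:
  fixes f h :: "'g::{topological_group_add, t2_space} \<Rightarrow> complex"
  assumes \<mu>: "left_haar_measure \<mu>"
    and f: "f \<in> borel_measurable baire" and h: "h \<in> borel_measurable baire"
    and S: "sigma_compact S" "{x. f x \<noteq> 0} \<subseteq> S"
  shows "(\<lambda>x. LINT y|\<mu>. f y * h (- y + x)) \<in> borel_measurable borel"
    and "(\<lambda>y. f y * h (- y + x)) \<in> borel_measurable borel"
proof -
  have s [measurable_cong]: "sets \<mu> = sets borel" using left_haar_sets[OF \<mu>] .
  have S': "sigma_finite_set \<mu> S" by (intro left_haar_sigma_compact[OF \<mu>] S)
  interpret S: sigma_finite_measure "density \<mu> (indicator S)" by (rule sigma_finite_density[OF S'])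
  have Sb: "S \<in> sets borel" using sigma_compact_borel[OF S(1)] .
  have k: "(\<lambda>p. f (fst p) * h (- fst p + snd p)) \<in> borel_measurable (borel \<Otimes>\<^sub>M borel)"
    by (rule measurable_convolution_kernel[OF f h S])
  show ky: "(\<lambda>y. f y * h (- y + x)) \<in> borel_measurable borel" for x
    using measurable_compose[OF measurable_Pair2'[of x borel borel] k] by simp
  have "(\<lambda>(x, y). f y * h (- y + x)) \<in> borel_measurable (borel \<Otimes>\<^sub>M density \<mu> (indicator S))"
  proof -
    have "(\<lambda>p. (snd p, fst p)) \<in> borel \<Otimes>\<^sub>M density \<mu> (indicator S) \<rightarrow>\<^sub>M (borel \<Otimes>\<^sub>M borel)"
      using s by (intro measurable_Pair) (simp_all cong: measurable_cong_sets)
    from measurable_compose[OF this k] show ?thesis by (simp add: case_prod_beta)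
  qed
  from S.borel_measurable_lebesgue_integral[OF this]
  have "(\<lambda>x. LINT y|density \<mu> (indicator S). f y * h (- y + x)) \<in> borel_measurable borel" by simp
  also have "(\<lambda>x. LINT y|density \<mu> (indicator S). f y * h (- y + x)) = (\<lambda>x. LINT y|\<mu>. f y * h (- y + x))"
  proof
    fix x
    have "(LINT y|density \<mu> (\<lambda>y. ennreal (indicator S y)). f y * h (- y + x)) = (LINT y|\<mu>. indicator S y *\<^sub>R (f y * h (- y + x)))"
      using ky[of x] Sb s by (intro integral_density) (simp_all cong: measurable_cong_sets)
    also have "\<dots> = (LINT y|\<mu>. f y * h (- y + x))"
      using S(2) by (intro Bochner_Integration.integral_cong) (auto simp: indicator_def)
    finally show "(LINT y|density \<mu> (indicator S). f y * h (- y + x)) = (LINT y|\<mu>. f y * h (- y + x))"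
      by (simp add: ennreal_indicator)
  qed
  finally show "(\<lambda>x. LINT y|\<mu>. f y * h (- y + x)) \<in> borel_measurable borel" .
qed

section \<open>Beurling algebras of functions\<close>

lemma borel_measurable_completion_AE:
  fixes f g :: "'a \<Rightarrow> 'b::topological_space"
  assumes g: "g \<in> borel_measurable (completion M)" and eq: "AE x in M. f x = g x"
  shows "f \<in> borel_measurable (completion M)"
proof (rule measurableI)
  fix A :: "'b set" assume A: "A \<in> sets borel"
  obtain N where N: "{x\<in>space M. f x \<noteq> g x} \<subseteq> N" "N \<in> null_sets M"
    using eq by (auto elim!: AE_E simp: null_sets_def)
  have "f -` A \<inter> space (completion M) = (g -` A \<inter> space (completion M) - N) \<union> (f -` A \<inter> space M \<inter> N)"
    using N(1) by auto
  moreover have "g -` A \<inter> space (completion M) - N \<in> sets (completion M)"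
    using measurable_sets[OF g A] N(2) by (intro sets.Diff) auto
  moreover have "f -` A \<inter> space M \<inter> N \<in> sets (completion M)"
    using N(2) by (intro sets_completionI_sub[of N]) auto
  ultimately show "f -` A \<inter> space (completion M) \<in> sets (completion M)" by (metis sets.Un)
qed simp

lemma completion_ex_borel_measurable_complex:
  fixes f :: "'a \<Rightarrow> complex"
  assumes f: "f \<in> borel_measurable (completion M)"
  shows "\<exists>g\<in>borel_measurable M. AE x in M. f x = g x"
proof -
  have "(\<lambda>x. Re (f x)) \<in> borel_measurable (completion M)" "(\<lambda>x. Im (f x)) \<in> borel_measurable (completion M)"
    using f by measurable
  then obtain a b where a: "a \<in> borel_measurable M" "AE x in M. Re (f x) = a x"
    and b: "b \<in> borel_measurable M" "AE x in M. Im (f x) = b x"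
    using completion_ex_borel_measurable_real by metis
  show ?thesis
  proof (rule bexI[of _ "\<lambda>x. complex_of_real (a x) + \<i> * complex_of_real (b x)"])
    show "AE x in M. f x = complex_of_real (a x) + \<i> * complex_of_real (b x)"
      using a(2) b(2) by eventually_elim (simp add: complex_eq_iff)
    show "(\<lambda>x. complex_of_real (a x) + \<i> * complex_of_real (b x)) \<in> borel_measurable M"
      using a(1) b(1) by measurable
  qed
qed

section \<open>Weighted integrable functions on one group, their convolution and the central
  ones\<close>

locale beurling =
  fixes \<mu> :: "'g::{topological_group_add, t2_space} measure" and \<omega> :: "'g \<Rightarrow> real" and c :: real
  assumes lc: "locally_compact_group TYPE('g)"
    and haar: "left_haar_measure \<mu>"
    and weight: "weight \<omega>"
    and conj_bound: "\<And>g x. \<omega> (g + x - g) \<le> c * \<omega> x"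
begin

lemma sets_mu [simp, measurable_cong]: "sets \<mu> = sets borel"
  using left_haar_sets[OF haar] .

lemma space_mu [simp]: "space \<mu> = UNIV"
  using left_haar_space[OF haar] .

lemma weight_pos: "0 < \<omega> x" and weight_nonneg [simp]: "0 \<le> \<omega> x" and weight_nz [simp]: "\<omega> x \<noteq> 0"
  and weight_mult: "\<omega> (x + y) \<le> \<omega> x * \<omega> y"
  using weight by (auto simp: weight_def less_imp_le) (metis less_irrefl)

lemma weight_not_le_0 [simp]: "\<not> \<omega> x \<le> 0"
  using weight_pos[of x] by simp

lemma weight_measurable [measurable]: "\<omega> \<in> borel_measurable borel"
  using weight by (simp add: weight_def)

lemma weight_measurable_mu [measurable]: "\<omega> \<in> borel_measurable \<mu>" "\<omega> \<in> borel_measurable (completion \<mu>)"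
  using weight_measurable by (auto cong: measurable_cong_sets intro!: measurable_completion)

definition L :: "('g \<Rightarrow> complex) set" where "L = carrier (beurling_fun \<mu> \<omega>)"
definition nrm :: "('g \<Rightarrow> complex) \<Rightarrow> real" where "nrm = vnorm (beurling_fun \<mu> \<omega>)"
definition conv :: "('g \<Rightarrow> complex) \<Rightarrow> ('g \<Rightarrow> complex) \<Rightarrow> 'g \<Rightarrow> complex" where "conv = vmult (beurling_fun \<mu> \<omega>)"
text \<open>The norm as an extended integral over \<mu> itself. It is meaningful for every function,
  so estimates can precede membership of \<open>L\<close>.\<close>

definition nn :: "('g \<Rightarrow> complex) \<Rightarrow> ennreal" where "nn f = (\<integral>\<^sup>+x. norm (f x) * \<omega> x \<partial>\<mu>)"
text \<open>Each \<open>g\<close> has an exceptional null set of its own; the union of these over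
  all \<open>g\<close> need not be null.\<close>

definition Z :: "('g \<Rightarrow> complex) set" where "Z = {f\<in>L. \<forall>g. AE x in \<mu>. f (- g + x + g) = f x}"

lemma conv_def': "conv f h x = (LINT y|completion \<mu>. f y * h (- y + x))"
  by (simp add: conv_def beurling_fun_def)

lemma L_iff: "f \<in> L \<longleftrightarrow> f \<in> borel_measurable (completion \<mu>) \<and> nn f < \<infinity>"
  unfolding L_def beurling_fun_def nn_def
  by (auto simp: integrable_iff_bounded nn_integral_completion abs_mult)

lemma L_measurable: "f \<in> L \<Longrightarrow> f \<in> borel_measurable (completion \<mu>)"
  by (simp add: L_iff)

lemma nn_nrm: "f \<in> L \<Longrightarrow> nn f = ennreal (nrm f)"
  unfolding nn_def nrm_def L_def beurling_fun_def
  by (simp add: nn_integral_completion[of \<mu>, symmetric] nn_integral_eq_integral)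

lemma nrm_nonneg [simp]: "0 \<le> nrm f"
  by (simp add: nrm_def beurling_fun_def)

lemma nn_cong: "AE x in \<mu>. f x = g x \<Longrightarrow> nn f = nn g"
  unfolding nn_def by (intro nn_integral_cong_AE) auto

lemma L_cong: "f \<in> L \<Longrightarrow> AE x in \<mu>. f x = g x \<Longrightarrow> g \<in> L"
  using nn_cong[of f g] borel_measurable_completion_AE[of f \<mu> g] by (auto simp: L_iff eq_commute)

lemma nrm_cong:
  assumes "f \<in> L" "AE x in \<mu>. f x = g x"
  shows "nrm f = nrm g"
  using nn_nrm[OF assms(1)] nn_nrm[OF L_cong[OF assms]] nn_cong[OF assms(2)] by simp

lemma L_zero: "(\<lambda>x. 0) \<in> L"
  by (simp add: L_iff nn_def)

lemma nn_borel: "f \<in> borel_measurable (completion \<mu>) \<Longrightarrow> (\<lambda>x. ennreal (norm (f x) * \<omega> x)) \<in> borel_measurable (completion \<mu>)"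
proof -
  assume "f \<in> borel_measurable (completion \<mu>)"
  then have "(\<lambda>x. norm (f x)) \<in> borel_measurable (completion \<mu>)" by measurable
  from borel_measurable_times[OF this weight_measurable_mu(2)] show ?thesis by measurable
qed

lemma nn_triangle:
  assumes "f \<in> borel_measurable (completion \<mu>)" "g \<in> borel_measurable (completion \<mu>)"
    "\<And>x. norm (k x) \<le> norm (f x) + norm (g x)"
  shows "nn k \<le> nn f + nn g"
proof -
  have "nn k \<le> (\<integral>\<^sup>+x. ennreal (norm (f x) * \<omega> x) + ennreal (norm (g x) * \<omega> x) \<partial>completion \<mu>)"
    unfolding nn_def nn_integral_completion[of \<mu>, symmetric]
    using assms(3) by (intro nn_integral_mono) (simp flip: ennreal_plus distrib_right add: mult_right_mono)
  also have "\<dots> = nn f + nn g"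
    unfolding nn_def nn_integral_completion[of \<mu>, symmetric] by (intro nn_integral_add nn_borel assms)
  finally show ?thesis .
qed

lemma L_add:
  assumes "f \<in> L" "g \<in> L"
  shows "(\<lambda>x. f x + g x) \<in> L" "nrm (\<lambda>x. f x + g x) \<le> nrm f + nrm g"
proof -
  have le: "nn (\<lambda>x. f x + g x) \<le> nn f + nn g"
    using assms by (intro nn_triangle L_measurable norm_triangle_ineq)
  then show *: "(\<lambda>x. f x + g x) \<in> L"
    using assms by (auto simp: L_iff intro: order_le_less_trans)
  show "nrm (\<lambda>x. f x + g x) \<le> nrm f + nrm g"
    using le by (simp add: nn_nrm[OF assms(1)] nn_nrm[OF assms(2)] nn_nrm[OF *] ennreal_le_iff flip: ennreal_plus)
qed

lemma nn_scale: "f \<in> L \<Longrightarrow> nn (\<lambda>x. a * f x) = ennreal (norm a) * nn f"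
proof -
  assume "f \<in> L"
  then have "(\<integral>\<^sup>+x. ennreal (norm a) * ennreal (norm (f x) * \<omega> x) \<partial>completion \<mu>) =
    ennreal (norm a) * (\<integral>\<^sup>+x. ennreal (norm (f x) * \<omega> x) \<partial>completion \<mu>)"
    by (intro nn_integral_cmult nn_borel L_measurable)
  then show ?thesis by (simp add: nn_def nn_integral_completion norm_mult mult.assoc ennreal_mult)
qed

lemma L_scale:
  assumes "f \<in> L"
  shows "(\<lambda>x. a * f x) \<in> L" "nrm (\<lambda>x. a * f x) = norm a * nrm f"
proof -
  have m: "(\<lambda>x. a * f x) \<in> borel_measurable (completion \<mu>)"
    using L_measurable[OF assms] by measurable
  have "nn (\<lambda>x. a * f x) < \<infinity>"
    using nn_scale[OF assms, of a] nn_nrm[OF assms] by (simp add: ennreal_mult_less_top)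
  with m show *: "(\<lambda>x. a * f x) \<in> L" by (simp add: L_iff)
  show "nrm (\<lambda>x. a * f x) = norm a * nrm f"
    using nn_scale[OF assms, of a] by (simp add: nn_nrm[OF assms] nn_nrm[OF *] flip: ennreal_mult)
qed

lemma L_diff:
  assumes "f \<in> L" "g \<in> L"
  shows "(\<lambda>x. f x - g x) \<in> L"
  using L_add(1)[OF assms(1) L_scale(1)[OF assms(2), of "-1"]] by simp

lemma nrm_eq_0:
  assumes "f \<in> L"
  shows "nrm f = 0 \<longleftrightarrow> (AE x in \<mu>. f x = 0)"
proof -
  have "nrm f = 0 \<longleftrightarrow> (\<integral>\<^sup>+x. norm (f x) * \<omega> x \<partial>completion \<mu>) = 0"
    using nn_nrm[OF assms] by (simp add: nn_def nn_integral_completion)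
  also have "\<dots> \<longleftrightarrow> (AE x in completion \<mu>. ennreal (norm (f x) * \<omega> x) = 0)"
    using nn_integral_0_iff_AE[OF nn_borel[OF L_measurable[OF assms]]] by simp
  also have "\<dots> \<longleftrightarrow> (AE x in \<mu>. f x = 0)"
    by (simp add: AE_completion_iff ennreal_eq_0_iff mult_le_0_iff)
  finally show ?thesis .
qed

text \<open>Since \<omega> is positive, the support is the union of the sets where
  \<open>norm (g x) * \<omega> x \<ge> 1 / Suc n\<close>, and these have finite measure by Markov's
  inequality.\<close>

lemma L_borel:
  assumes "f \<in> L"
  obtains g where "g \<in> borel_measurable borel" "AE x in \<mu>. f x = g x" "sigma_finite_set \<mu> {x. g x \<noteq> 0}"
proof -
  obtain g where g: "g \<in> borel_measurable \<mu>" "AE x in \<mu>. f x = g x"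
    using completion_ex_borel_measurable_complex[OF L_measurable[OF assms]] by metis
  have gL: "g \<in> L" by (rule L_cong[OF assms g(2)])
  have int: "integrable \<mu> (\<lambda>x. norm (g x) * \<omega> x)"
    using g(1) gL by (auto simp: integrable_iff_bounded L_iff nn_def abs_mult)
  have "sigma_finite_set \<mu> {x. norm (g x) * \<omega> x \<ge> 1 / Suc n}" for n
  proof (rule sigma_finite_setI)
    have "{x\<in>space \<mu>. 1 / Suc n \<le> norm (g x) * \<omega> x} \<in> sets \<mu>"
      using g(1) by measurable
    then show "{x. norm (g x) * \<omega> x \<ge> 1 / Suc n} \<in> sets \<mu>" by simp
    have "emeasure \<mu> {x\<in>space \<mu>. norm (g x) * \<omega> x \<ge> 1 / Suc n} \<le> ennreal (1 / (1 / Suc n) * (\<integral>x. norm (g x) * \<omega> x \<partial>\<mu>))"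
      using integral_Markov_inequality[OF int, of "1 / Suc n"] by (simp add: ennreal_mult' )
    then show "emeasure \<mu> {x. norm (g x) * \<omega> x \<ge> 1 / Suc n} < \<infinity>"
      by (simp add: order_le_less_trans)
  qed
  then have "sigma_finite_set \<mu> (\<Union>n. {x. norm (g x) * \<omega> x \<ge> 1 / Suc n})" by (rule sigma_finite_set_UN)
  also have "(\<Union>n. {x. norm (g x) * \<omega> x \<ge> 1 / Suc n}) = {x. g x \<noteq> 0}"
  proof (intro equalityI subsetI)
    fix x assume "x \<in> {x. g x \<noteq> 0}"
    then have "0 < norm (g x) * \<omega> x" using weight_pos[of x] by simp
    then obtain n where "inverse (real (Suc n)) < norm (g x) * \<omega> x" using reals_Archimedean by blast
    then show "x \<in> (\<Union>n. {x. norm (g x) * \<omega> x \<ge> 1 / Suc n})"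
      by (auto simp: inverse_eq_divide intro!: exI[of _ n])
  next
    fix x assume "x \<in> (\<Union>n. {x. norm (g x) * \<omega> x \<ge> 1 / Suc n})"
    then obtain n where "norm (g x) * \<omega> x \<ge> 1 / Suc n" by auto
    then have "0 < norm (g x) * \<omega> x" by (rule less_le_trans[rotated]) simp
    then show "x \<in> {x. g x \<noteq> 0}" by auto
  qed
  finally show ?thesis using that[of g] g by simp
qed

lemma L_baire:
  assumes "f \<in> L"
  obtains f' S where "f' \<in> borel_measurable baire" "sigma_compact S" "{x. f' x \<noteq> 0} \<subseteq> S"
    "AE x in \<mu>. f x = f' x"
proof -
  obtain g where g: "g \<in> borel_measurable borel" "AE x in \<mu>. f x = g x" "sigma_finite_set \<mu> {x. g x \<noteq> 0}"
    by (rule L_borel[OF assms])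
  obtain f' S where f': "f' \<in> borel_measurable baire" "sigma_compact S" "{x. f' x \<noteq> 0} \<subseteq> S"
    "AE x in \<mu>. g x = f' x"
    by (rule baire_version[OF lc haar g(1,3)])
  have "AE x in \<mu>. f x = f' x" using g(2) f'(4) by eventually_elim simp
  then show ?thesis using that f' by metis
qed

text \<open>The weight is only Borel measurable, so a Baire version of the product with \<omega> is
  taken directly instead of multiplying a Baire version of \<open>f\<close> by \<omega>.\<close>

lemma L_baire_weighted:
  assumes "f \<in> L"
  obtains f' S where "f' \<in> borel_measurable baire" "sigma_compact S" "{x. f' x \<noteq> 0} \<subseteq> S"
    "AE x in \<mu>. f x * complex_of_real (\<omega> x) = f' x"
proof -
  obtain g where g: "g \<in> borel_measurable borel" "AE x in \<mu>. f x = g x" "sigma_finite_set \<mu> {x. g x \<noteq> 0}"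
    by (rule L_borel[OF assms])
  have m: "(\<lambda>x. g x * complex_of_real (\<omega> x)) \<in> borel_measurable borel" using g(1) by measurable
  have "{x. g x * complex_of_real (\<omega> x) \<noteq> 0} = {x. g x \<noteq> 0}" by simp
  then obtain f' S where f': "f' \<in> borel_measurable baire" "sigma_compact S" "{x. f' x \<noteq> 0} \<subseteq> S"
    "AE x in \<mu>. g x * complex_of_real (\<omega> x) = f' x"
    using baire_version[OF lc haar m] g(3) by metis
  have "AE x in \<mu>. f x * complex_of_real (\<omega> x) = f' x" using g(2) f'(4) by eventually_elim simp
  then show ?thesis using that f' by metis
qed

text \<open>The values of \<open>h\<close> at \<open>- y + x\<close> matter only where
  \<open>f\<close> does not vanish. Up to a null set this lies in the \<sigma>-finite set
  \<open>S\<close>, so \<open>AE_reflection\<close> applies, and it does so for every single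
  \<open>x\<close>.\<close>

lemma AE_product_version:
  fixes h h' :: "'g \<Rightarrow> complex"
  assumes "AE x in \<mu>. f x = f' x" "AE x in \<mu>. h x = h' x" "sigma_compact S" "{x. f' x \<noteq> 0} \<subseteq> S"
  shows "AE y in \<mu>. f y = f' y \<and> (f y = 0 \<or> h (- y + x) = h' (- y + x))"
  using assms(1) AE_reflection[OF lc haar assms(2) left_haar_sigma_compact[OF haar assms(3)], of x]
  by eventually_elim (use assms(4) in auto)

text \<open>The integrands agree for almost every \<open>y\<close> whatever \<open>x\<close> is, so
  passing to Baire versions does not change the convolution at any point. Hence \<open>conv\<close>
  depends only on the classes of its arguments, as a function and not only almost
  everywhere.\<close>

lemma conv_version:
  assumes f: "f' \<in> borel_measurable baire" "sigma_compact S" "{x. f' x \<noteq> 0} \<subseteq> S" "AE x in \<mu>. f x = f' x"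
    and h: "h' \<in> borel_measurable baire" "AE x in \<mu>. h x = h' x"
  shows "conv f h x = (LINT y|\<mu>. f' y * h' (- y + x))"
    and "(\<lambda>y. f y * h (- y + x)) \<in> borel_measurable (completion \<mu>)"
    and "integrable (completion \<mu>) (\<lambda>y. f y * h (- y + x)) \<longleftrightarrow> integrable \<mu> (\<lambda>y. f' y * h' (- y + x))"
proof -
  have eq: "AE y in \<mu>. f y * h (- y + x) = f' y * h' (- y + x)"
    using AE_product_version[OF f(4) h(2) f(2,3), of x] by eventually_elim auto
  have m: "(\<lambda>y. f' y * h' (- y + x)) \<in> borel_measurable \<mu>"
    using borel_measurable_convolution(2)[OF haar f(1) h(1) f(2,3)] by (simp cong: measurable_cong_sets)
  then have mc: "(\<lambda>y. f' y * h' (- y + x)) \<in> borel_measurable (completion \<mu>)" by (rule measurable_completion)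
  show mf: "(\<lambda>y. f y * h (- y + x)) \<in> borel_measurable (completion \<mu>)"
    by (rule borel_measurable_completion_AE[OF mc eq])
  show "conv f h x = (LINT y|\<mu>. f' y * h' (- y + x))"
    unfolding conv_def' integral_completion[OF m, symmetric]
    by (rule integral_cong_AE[OF mf mc]) (rule AE_completion[OF eq])
  show "integrable (completion \<mu>) (\<lambda>y. f y * h (- y + x)) \<longleftrightarrow> integrable \<mu> (\<lambda>y. f' y * h' (- y + x))"
    unfolding integrable_completion[OF m, symmetric]
    by (rule integrable_cong_AE[OF mf mc]) (rule AE_completion[OF eq])
qed

lemma conv_cong:
  assumes "f \<in> L" "h \<in> L" "AE x in \<mu>. f x = f2 x" "AE x in \<mu>. h x = h2 x"
  shows "conv f h = conv f2 h2"
proof -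
  obtain f' S where f': "f' \<in> borel_measurable baire" "sigma_compact S" "{x. f' x \<noteq> 0} \<subseteq> S"
    "AE x in \<mu>. f x = f' x" by (rule L_baire[OF assms(1)])
  obtain h' T where h': "h' \<in> borel_measurable baire" "sigma_compact T" "{x. h' x \<noteq> 0} \<subseteq> T"
    "AE x in \<mu>. h x = h' x" by (rule L_baire[OF assms(2)])
  have f2: "AE x in \<mu>. f2 x = f' x" using assms(3) f'(4) by eventually_elim simp
  have h2: "AE x in \<mu>. h2 x = h' x" using assms(4) h'(4) by eventually_elim simp
  show ?thesis
    using conv_version(1)[OF f' h'(1,4)] conv_version(1)[OF f'(1-3) f2 h'(1) h2] by (intro ext) simp
qed

text \<open>By \<open>\<omega> x \<le> \<omega> y * \<omega> (- y + x)\<close> the weighted kernel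
  is dominated by the kernel of Baire versions \<open>u\<close> and \<open>v\<close> of the weighted
  functions, whose double integral factorises. An extended-valued bound at every \<open>x\<close>
  yields both integrability almost everywhere and the norm estimate.\<close>

lemma conv_bound:
  assumes f: "f \<in> L" and h: "h \<in> L"
  obtains \<Phi> where "\<Phi> \<in> borel_measurable borel" "(\<integral>\<^sup>+x. \<Phi> x \<partial>\<mu>) = nn f * nn h"
    "\<forall>x. (\<integral>\<^sup>+y. norm (f y * h (- y + x)) \<partial>completion \<mu>) * \<omega> x \<le> \<Phi> x"
proof -
  obtain f' S where f': "f' \<in> borel_measurable baire" "sigma_compact S" "{x. f' x \<noteq> 0} \<subseteq> S"
    "AE x in \<mu>. f x = f' x" by (rule L_baire[OF f])
  obtain h' T where h': "h' \<in> borel_measurable baire" "sigma_compact T" "{x. h' x \<noteq> 0} \<subseteq> T"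
    "AE x in \<mu>. h x = h' x" by (rule L_baire[OF h])
  obtain u U where u: "u \<in> borel_measurable baire" "sigma_compact U" "{x. u x \<noteq> 0} \<subseteq> U"
    "AE x in \<mu>. f x * complex_of_real (\<omega> x) = u x" by (rule L_baire_weighted[OF f])
  obtain v V where v: "v \<in> borel_measurable baire" "sigma_compact V" "{x. v x \<noteq> 0} \<subseteq> V"
    "AE x in \<mu>. h x * complex_of_real (\<omega> x) = v x" by (rule L_baire_weighted[OF h])
  have nf: "nn f = (\<integral>\<^sup>+x. norm (u x) \<partial>\<mu>)" unfolding nn_def
  proof (rule nn_integral_cong_AE)
    show "AE x in \<mu>. ennreal (norm (f x) * \<omega> x) = ennreal (norm (u x))"
      using u(4) by eventually_elim (metis norm_mult norm_of_real abs_of_nonneg weight_nonneg)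
  qed
  have nh: "nn h = (\<integral>\<^sup>+x. norm (v x) \<partial>\<mu>)" unfolding nn_def
  proof (rule nn_integral_cong_AE)
    show "AE x in \<mu>. ennreal (norm (h x) * \<omega> x) = ennreal (norm (v x))"
      using v(4) by eventually_elim (metis norm_mult norm_of_real abs_of_nonneg weight_nonneg)
  qed
  show ?thesis
  proof (rule that[of "\<lambda>x. \<integral>\<^sup>+y. norm (u y) * norm (v (- y + x)) \<partial>\<mu>"])
    show "(\<lambda>x. \<integral>\<^sup>+y. norm (u y) * norm (v (- y + x)) \<partial>\<mu>) \<in> borel_measurable borel"
      by (rule nn_integral_convolution_kernel(2)[OF haar u(1) v(1) u(2,3) v(2,3)])
    show "(\<integral>\<^sup>+x. (\<integral>\<^sup>+y. norm (u y) * norm (v (- y + x)) \<partial>\<mu>) \<partial>\<mu>) = nn f * nn h"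
      unfolding nf nh by (rule nn_integral_convolution_kernel(1)[OF haar u(1) v(1) u(2,3) v(2,3)])
    show "\<forall>x. (\<integral>\<^sup>+y. norm (f y * h (- y + x)) \<partial>completion \<mu>) * \<omega> x \<le> (\<integral>\<^sup>+y. norm (u y) * norm (v (- y + x)) \<partial>\<mu>)"
    proof
    fix x
    have m: "(\<lambda>y. ennreal (norm (f y * h (- y + x)))) \<in> borel_measurable (completion \<mu>)"
      using conv_version(2)[OF f' h'(1,4), of x] by measurable
    have "(\<integral>\<^sup>+y. norm (f y * h (- y + x)) \<partial>completion \<mu>) * \<omega> x =
      (\<integral>\<^sup>+y. ennreal (norm (f y * h (- y + x))) * ennreal (\<omega> x) \<partial>completion \<mu>)"
      by (rule nn_integral_multc[OF m, symmetric])
    also have "\<dots> = (\<integral>\<^sup>+y. ennreal (norm (f y * h (- y + x)) * \<omega> x) \<partial>\<mu>)"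
      by (simp add: nn_integral_completion ennreal_mult)
    also have "\<dots> \<le> (\<integral>\<^sup>+y. norm (u y) * norm (v (- y + x)) \<partial>\<mu>)"
    proof (rule nn_integral_mono_AE)
      show "AE y in \<mu>. ennreal (norm (f y * h (- y + x)) * \<omega> x) \<le> ennreal (norm (u y) * norm (v (- y + x)))"
        using AE_product_version[OF u(4) v(4) u(2,3), of x]
      proof eventually_elim
        fix y assume y: "f y * complex_of_real (\<omega> y) = u y \<and> (f y * complex_of_real (\<omega> y) = 0 \<or>
          h (- y + x) * complex_of_real (\<omega> (- y + x)) = v (- y + x))"
        have w: "\<omega> x \<le> \<omega> y * \<omega> (- y + x)"
          using weight_mult[of y "- y + x"] by (simp add: add.assoc[symmetric])
        show "ennreal (norm (f y * h (- y + x)) * \<omega> x) \<le> ennreal (norm (u y) * norm (v (- y + x)))"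
        proof (cases "f y = 0")
          case False
          then have v: "v (- y + x) = h (- y + x) * complex_of_real (\<omega> (- y + x))" "u y = f y * complex_of_real (\<omega> y)"
            using y by auto
          have "norm (f y * h (- y + x)) * \<omega> x \<le> norm (f y * h (- y + x)) * (\<omega> y * \<omega> (- y + x))"
            using w by (intro mult_left_mono) auto
          also have "\<dots> = norm (u y) * norm (v (- y + x))"
            by (simp add: v norm_mult mult_ac)
          finally show ?thesis by (rule ennreal_leI)
        qed simp
      qed
    qed
    finally show "(\<integral>\<^sup>+y. norm (f y * h (- y + x)) \<partial>completion \<mu>) * \<omega> x \<le> (\<integral>\<^sup>+y. norm (u y) * norm (v (- y + x)) \<partial>\<mu>)" .
    qed
  qed
qed

lemma conv_integrable:
  assumes f: "f \<in> L" and h: "h \<in> L"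
  shows "AE x in \<mu>. integrable (completion \<mu>) (\<lambda>y. f y * h (- y + x))"
proof -
  obtain f' S where f': "f' \<in> borel_measurable baire" "sigma_compact S" "{x. f' x \<noteq> 0} \<subseteq> S"
    "AE x in \<mu>. f x = f' x" by (rule L_baire[OF f])
  obtain h' T where h': "h' \<in> borel_measurable baire" "sigma_compact T" "{x. h' x \<noteq> 0} \<subseteq> T"
    "AE x in \<mu>. h x = h' x" by (rule L_baire[OF h])
  obtain \<Phi> where \<Phi>: "\<Phi> \<in> borel_measurable borel" "(\<integral>\<^sup>+x. \<Phi> x \<partial>\<mu>) = nn f * nn h"
    "\<forall>x. (\<integral>\<^sup>+y. norm (f y * h (- y + x)) \<partial>completion \<mu>) * \<omega> x \<le> \<Phi> x"
    by (rule conv_bound[OF f h])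
  have "(\<integral>\<^sup>+x. \<Phi> x \<partial>\<mu>) \<noteq> \<infinity>"
    unfolding \<Phi>(2) nn_nrm[OF f] nn_nrm[OF h] by (simp add: ennreal_mult_eq_top_iff)
  moreover have "\<Phi> \<in> borel_measurable \<mu>" using \<Phi>(1) by (simp cong: measurable_cong_sets)
  ultimately have "AE x in \<mu>. \<Phi> x \<noteq> \<infinity>" by (intro nn_integral_noteq_infinite)
  then show ?thesis
  proof eventually_elim
    fix x assume "\<Phi> x \<noteq> \<infinity>"
    then have "(\<integral>\<^sup>+y. norm (f y * h (- y + x)) \<partial>completion \<mu>) * \<omega> x < \<infinity>"
      using \<Phi>(3)[rule_format, of x] by (simp add: order_le_less_trans less_top)
    then have "(\<integral>\<^sup>+y. norm (f y * h (- y + x)) \<partial>completion \<mu>) < \<infinity>"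
      using weight_pos[of x] by (auto simp: ennreal_mult_less_top)
    then show "integrable (completion \<mu>) (\<lambda>y. f y * h (- y + x))"
      using conv_version(2)[OF f' h'(1,4), of x] by (simp add: integrable_iff_bounded)
  qed
qed

lemma conv_L:
  assumes f: "f \<in> L" and h: "h \<in> L"
  shows "conv f h \<in> L" "nrm (conv f h) \<le> nrm f * nrm h"
proof -
  obtain f' S where f': "f' \<in> borel_measurable baire" "sigma_compact S" "{x. f' x \<noteq> 0} \<subseteq> S"
    "AE x in \<mu>. f x = f' x" by (rule L_baire[OF f])
  obtain h' T where h': "h' \<in> borel_measurable baire" "sigma_compact T" "{x. h' x \<noteq> 0} \<subseteq> T"
    "AE x in \<mu>. h x = h' x" by (rule L_baire[OF h])
  obtain \<Phi> where \<Phi>: "\<Phi> \<in> borel_measurable borel" "(\<integral>\<^sup>+x. \<Phi> x \<partial>\<mu>) = nn f * nn h"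
    "\<forall>x. (\<integral>\<^sup>+y. norm (f y * h (- y + x)) \<partial>completion \<mu>) * \<omega> x \<le> \<Phi> x"
    by (rule conv_bound[OF f h])
  have "conv f h = (\<lambda>x. LINT y|\<mu>. f' y * h' (- y + x))"
    using conv_version(1)[OF f' h'(1,4)] by auto
  then have "conv f h \<in> borel_measurable \<mu>"
    using borel_measurable_convolution(1)[OF haar f'(1) h'(1) f'(2,3)] by (simp cong: measurable_cong_sets)
  then have m: "conv f h \<in> borel_measurable (completion \<mu>)" by (rule measurable_completion)
  \<comment> \<open>Where the integrand is not integrable the convolution has the default value 0,
    so the bound holds at every \<open>x\<close>.\<close>
  have b: "ennreal (norm (conv f h x) * \<omega> x) \<le> \<Phi> x" for x
  proof -
    have "ennreal (norm (conv f h x)) \<le> (\<integral>\<^sup>+y. norm (f y * h (- y + x)) \<partial>completion \<mu>)"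
    proof (cases "integrable (completion \<mu>) (\<lambda>y. f y * h (- y + x))")
      case True
      then show ?thesis unfolding conv_def' by (rule integral_norm_bound_ennreal)
    next
      case False
      then show ?thesis unfolding conv_def' by (simp add: not_integrable_integral_eq)
    qed
    then have "ennreal (norm (conv f h x)) * ennreal (\<omega> x) \<le> (\<integral>\<^sup>+y. norm (f y * h (- y + x)) \<partial>completion \<mu>) * \<omega> x"
      by (rule mult_right_mono) simp
    also have "\<dots> \<le> \<Phi> x" by (rule \<Phi>(3)[rule_format])
    finally show ?thesis by (simp add: ennreal_mult)
  qed
  have le: "nn (conv f h) \<le> nn f * nn h"
    unfolding nn_def[of "conv f h"] \<Phi>(2)[symmetric] by (intro nn_integral_mono b)
  also have "\<dots> = ennreal (nrm f * nrm h)"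
    by (simp add: nn_nrm[OF f] nn_nrm[OF h] ennreal_mult)
  finally have le2: "nn (conv f h) \<le> ennreal (nrm f * nrm h)" .
  then show *: "conv f h \<in> L" using m by (auto simp: L_iff intro: order_le_less_trans)
  show "nrm (conv f h) \<le> nrm f * nrm h"
    using le2 by (simp add: nn_nrm[OF *] ennreal_le_iff)
qed

text \<open>Only almost everywhere: where a kernel fails to be integrable, its integral has the
  default value 0 and additivity can break down.\<close>

lemma conv_add_right:
  assumes "f \<in> L" "h \<in> L" "k \<in> L"
  shows "AE x in \<mu>. conv f (\<lambda>x. h x + k x) x = conv f h x + conv f k x"
  using conv_integrable[OF assms(1,2)] conv_integrable[OF assms(1,3)]
  by eventually_elim (simp add: conv_def' distrib_left)

lemma conv_add_left:
  assumes "f \<in> L" "h \<in> L" "k \<in> L"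
  shows "AE x in \<mu>. conv (\<lambda>x. h x + k x) f x = conv h f x + conv k f x"
  using conv_integrable[OF assms(2,1)] conv_integrable[OF assms(3,1)]
  by eventually_elim (simp add: conv_def' distrib_right)

lemma conv_scale: "conv f (\<lambda>x. a * h x) = (\<lambda>x. a * conv f h x)" "conv (\<lambda>x. a * f x) h = (\<lambda>x. a * conv f h x)"
  by (auto simp: conv_def' mult.assoc mult.left_commute[of _ a])

lemma Z_subset_L: "f \<in> Z \<Longrightarrow> f \<in> L"
  by (simp add: Z_def)

lemma Z_cong:
  assumes "f \<in> Z" "AE x in \<mu>. f x = g x"
  shows "g \<in> Z"
proof -
  have "AE x in \<mu>. g (- k + x + k) = g x" for k
  proof -
    have "AE x in \<mu>. f (- k + x + k) = f x" using assms(1) by (simp add: Z_def)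
    then show ?thesis using assms(2) AE_conjugation[OF lc haar assms(2), of k] by eventually_elim simp
  qed
  then show ?thesis using L_cong[OF Z_subset_L[OF assms(1)] assms(2)] by (simp add: Z_def)
qed

lemma Z_zero: "(\<lambda>x. 0) \<in> Z"
  by (simp add: Z_def L_zero)

lemma Z_add:
  assumes "f \<in> Z" "h \<in> Z"
  shows "(\<lambda>x. f x + h x) \<in> Z"
proof -
  have "AE x in \<mu>. f (- g + x + g) + h (- g + x + g) = f x + h x" for g
  proof -
    have "AE x in \<mu>. f (- g + x + g) = f x" "AE x in \<mu>. h (- g + x + g) = h x" using assms by (simp_all add: Z_def)
    then show ?thesis by eventually_elim simp
  qed
  then show ?thesis using assms by (simp add: Z_def L_add)
qed

lemma Z_scale:
  assumes "f \<in> Z"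
  shows "(\<lambda>x. a * f x) \<in> Z"
proof -
  have "AE x in \<mu>. a * f (- g + x + g) = a * f x" for g
  proof -
    have "AE x in \<mu>. f (- g + x + g) = f x" using assms by (simp add: Z_def)
    then show ?thesis by eventually_elim simp
  qed
  then show ?thesis using assms by (simp add: Z_def L_scale)
qed

text \<open>
  A nonzero central function forces the modular function to be trivial: the factors by which
  conjugations scale \<open>\<mu>\<close> form a group, and the bound on the weight makes this group bounded.
\<close>

lemma conjugation_invariant:
  assumes f: "f \<in> Z" and nz: "nrm f \<noteq> 0" and k: "k \<in> borel_measurable borel"
  shows "(\<integral>\<^sup>+x. k (- g + x + g) \<partial>\<mu>) = (\<integral>\<^sup>+x. k x \<partial>\<mu>)"
proof -
  define scales where "scales g d \<longleftrightarrow> 0 < d \<and> (\<forall>k\<in>borel_measurable borel.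
      (\<integral>\<^sup>+x. k (- g + x + g) \<partial>\<mu>) = ennreal d * (\<integral>\<^sup>+x. k x \<partial>\<mu>))" for g and d :: real
  have sD: "(\<integral>\<^sup>+x. k (- g + x + g) \<partial>\<mu>) = ennreal d * (\<integral>\<^sup>+x. k x \<partial>\<mu>)"
    if "scales g d" "k \<in> borel_measurable borel" for g d k
    using that by (simp add: scales_def)
  obtain f' where f': "f' \<in> borel_measurable borel" "AE x in \<mu>. f x = f' x"
    using L_borel[OF Z_subset_L[OF f]] by metis
  have f'Z: "f' \<in> Z" by (rule Z_cong[OF f f'(2)])
  define F where "F x = ennreal (norm (f' x) * \<omega> x)" for x
  have Fm: "F \<in> borel_measurable borel" unfolding F_def using f'(1) by measurable
  define I where "I = nrm f"
  have I: "0 < I" using nz nrm_nonneg[of f] unfolding I_def by linarith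
  have FI: "(\<integral>\<^sup>+x. F x \<partial>\<mu>) = ennreal I"
    using nn_nrm[OF Z_subset_L[OF f]] nn_cong[OF f'(2)] by (simp add: nn_def F_def I_def)
  have c: "0 \<le> c"
  proof -
    have "0 < c * \<omega> 0" using conj_bound[of 0 0] weight_pos[of 0] by simp
    then show ?thesis using weight_pos[of 0] by (simp add: zero_less_mult_iff)
  qed
  have ex: "\<exists>d. scales g d" for g
    unfolding scales_def by (rule left_haar_conjugation[OF lc haar, of g]) metis
  have comp: "scales (g + h) (d * e)" if "scales g d" "scales h e" for g h d e
    unfolding scales_def
  proof (intro conjI ballI)
    show "0 < d * e" using that by (simp add: scales_def)
    fix k :: "'g \<Rightarrow> ennreal" assume k: "k \<in> borel_measurable borel"
    have km: "(\<lambda>x. k (- h + x + h)) \<in> borel_measurable borel"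
      using k by (intro measurable_compose[OF _ k] measurable_compose[OF _ borel_measurable_translation(2)]) simp
    have "(\<integral>\<^sup>+x. k (- (g + h) + x + (g + h)) \<partial>\<mu>) = (\<integral>\<^sup>+x. k (- h + (- g + x + g) + h) \<partial>\<mu>)"
      by (simp only: minus_add add.assoc)
    also have "\<dots> = ennreal d * (\<integral>\<^sup>+x. k (- h + x + h) \<partial>\<mu>)"
      by (rule sD[OF that(1) km])
    also have "\<dots> = ennreal d * (ennreal e * (\<integral>\<^sup>+x. k x \<partial>\<mu>))"
      using that(2) k unfolding scales_def by simp
    also have "\<dots> = ennreal (d * e) * (\<integral>\<^sup>+x. k x \<partial>\<mu>)"
      using that by (simp add: scales_def ennreal_mult mult.assoc less_imp_le)
    finally show "(\<integral>\<^sup>+x. k (- (g + h) + x + (g + h)) \<partial>\<mu>) = ennreal (d * e) * (\<integral>\<^sup>+x. k x \<partial>\<mu>)" .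
  qed
  \<comment> \<open>Conjugation multiplies \<open>F\<close>, whose integral \<open>I\<close> is
    positive and finite, by at most \<open>c\<close>, because \<open>f'\<close> is invariant and
    only the weight changes.\<close>
  have bound: "d \<le> c" if "scales g d" for g d
  proof -
    have "ennreal d * ennreal I = (\<integral>\<^sup>+x. F (- g + x + g) \<partial>\<mu>)"
      using that Fm FI unfolding scales_def by simp
    also have "\<dots> \<le> (\<integral>\<^sup>+x. ennreal c * F x \<partial>\<mu>)"
    proof (rule nn_integral_mono_AE)
      have "AE x in \<mu>. f' (- g + x + g) = f' x" using f'Z by (simp add: Z_def)
      then show "AE x in \<mu>. F (- g + x + g) \<le> ennreal c * F x"
      proof eventually_elim
        fix x assume eq: "f' (- g + x + g) = f' x"
        have "norm (f' x) * \<omega> (- g + x + g) \<le> norm (f' x) * (c * \<omega> x)"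
          using conj_bound[of "- g" x] by (intro mult_left_mono) simp_all
        then show "F (- g + x + g) \<le> ennreal c * F x"
          unfolding F_def eq using c by (simp add: mult_ac flip: ennreal_mult)
      qed
    qed
    also have "\<dots> = ennreal c * ennreal I"
      using Fm FI by (subst nn_integral_cmult) (simp_all cong: measurable_cong_sets)
    finally have "d * I \<le> c * I"
      using that c I by (simp add: scales_def less_imp_le flip: ennreal_mult)
    then show ?thesis using I by simp
  qed
  \<comment> \<open>All powers of \<open>d\<close> are factors of conjugations as well, so they stay
    below \<open>c\<close>.\<close>
  have le1: "d \<le> 1" if d: "scales g d" for g d
  proof (rule ccontr)
    assume "\<not> d \<le> 1"
    then have d1: "1 < d" by simp
    have "\<exists>h. scales h (d ^ Suc n)" for n
    proof (induction n)
      case 0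
      then show ?case using d by auto
    next
      case (Suc n)
      then obtain h where "scales h (d ^ Suc n)" by auto
      from comp[OF d this] show ?case by auto
    qed
    then have "d ^ Suc n \<le> c" for n using bound by metis
    moreover obtain n where "c < d ^ n" using real_arch_pow[OF d1] by metis
    moreover have "d ^ n \<le> d ^ Suc n" using d1 by (intro power_increasing) auto
    ultimately show False by (meson leD order_trans)
  qed
  \<comment> \<open>Conjugations by \<open>g\<close> and \<open>- g\<close> cancel, so their factors
    are inverse to each other; both being at most 1, they equal 1.\<close>
  obtain d e where d: "scales g d" and e: "scales (- g) e" using ex by metis
  have "scales (g + - g) (d * e)" by (rule comp[OF d e])
  then have "ennreal I = ennreal (d * e) * ennreal I"
    using sD[of "g + - g" "d * e" F] Fm FI by simp
  then have "I = d * e * I" using I d e by (simp add: scales_def less_imp_le flip: ennreal_mult)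
  then have de: "d * e = 1" using I by simp
  have "0 < d" "0 < e" using d e by (simp_all add: scales_def)
  then have "d = 1" using le1[OF d] le1[OF e] de
    by (metis antisym mult.commute mult.right_neutral mult_left_mono less_imp_le)
  then show ?thesis using d k by (simp add: scales_def)
qed

text \<open>Unless \<open>f\<close> is null, conjugation preserves \<mu> by
  \<open>conjugation_invariant\<close>. Substituting the conjugate of \<open>y\<close> in the
  convolution integral and using the invariance of both functions gives equality at every
  point.\<close>

lemma Z_conv:
  assumes f: "f \<in> Z" and h: "h \<in> Z"
  shows "conv f h \<in> Z"
proof (cases "nrm f = 0")
  case True
  then have "AE x in \<mu>. f x = 0" using nrm_eq_0 Z_subset_L[OF f] by blast
  then have "conv f h = conv (\<lambda>x. 0) h"
    using Z_subset_L[OF f] Z_subset_L[OF h] by (intro conv_cong) auto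
  also have "\<dots> = (\<lambda>x. 0)" by (auto simp: conv_def')
  finally show ?thesis by (simp add: Z_zero)
next
  case nz: False
  note fL = Z_subset_L[OF f] and hL = Z_subset_L[OF h]
  obtain f' S where f': "f' \<in> borel_measurable baire" "sigma_compact S" "{x. f' x \<noteq> 0} \<subseteq> S"
    "AE x in \<mu>. f x = f' x" by (rule L_baire[OF fL])
  obtain h' T where h': "h' \<in> borel_measurable baire" "sigma_compact T" "{x. h' x \<noteq> 0} \<subseteq> T"
    "AE x in \<mu>. h x = h' x" by (rule L_baire[OF hL])
  have f'Z: "f' \<in> Z" and h'Z: "h' \<in> Z" using Z_cong[OF f f'(4)] Z_cong[OF h h'(4)] by auto
  have "conv f h (- g + x + g) = conv f h x" for g x
  proof -
    let ?c = "\<lambda>y. - g + y + g"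
    have cm: "?c \<in> \<mu> \<rightarrow>\<^sub>M borel"
      by (intro measurable_compose[OF _ borel_measurable_translation(2)]) (simp cong: measurable_cong_sets)
    have eq: "distr \<mu> borel ?c = \<mu>"
    proof (rule measure_eqI)
      fix A assume A: "A \<in> sets (distr \<mu> borel ?c)"
      then have "emeasure (distr \<mu> borel ?c) A = (\<integral>\<^sup>+y. indicator A y \<partial>distr \<mu> borel ?c)" by simp
      also have "\<dots> = (\<integral>\<^sup>+y. indicator A (?c y) \<partial>\<mu>)" using A cm by (intro nn_integral_distr) simp_all
      also have "\<dots> = (\<integral>\<^sup>+y. indicator A y \<partial>\<mu>)" using A by (intro conjugation_invariant[OF f nz]) simp
      also have "\<dots> = emeasure \<mu> A" using A by simp
      finally show "emeasure (distr \<mu> borel ?c) A = emeasure \<mu> A" .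
    qed simp
    have m: "(\<lambda>y. f' y * h' (- y + (- g + x + g))) \<in> borel_measurable borel" "(\<lambda>y. f' y * h' (- y + x)) \<in> borel_measurable borel"
      using borel_measurable_convolution(2)[OF haar f'(1) h'(1) f'(2,3)] by auto
    have "conv f h (- g + x + g) = (LINT y|\<mu>. f' y * h' (- y + (- g + x + g)))"
      by (rule conv_version(1)[OF f' h'(1,4)])
    also have "\<dots> = (LINT y|distr \<mu> borel ?c. f' y * h' (- y + (- g + x + g)))" by (simp only: eq)
    also have "\<dots> = (LINT y|\<mu>. f' (?c y) * h' (- ?c y + (- g + x + g)))"
      using cm m(1) by (rule integral_distr)
    also have "\<dots> = (LINT y|\<mu>. f' y * h' (- y + x))"
    proof (rule integral_cong_AE)
      show "(\<lambda>y. f' (?c y) * h' (- ?c y + (- g + x + g))) \<in> borel_measurable \<mu>"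
        using measurable_compose[OF cm m(1)] .
      show "(\<lambda>y. f' y * h' (- y + x)) \<in> borel_measurable \<mu>" using m(2) by (simp cong: measurable_cong_sets)
      have ff: "AE y in \<mu>. f' (?c y) = f' y" using f'Z by (simp add: Z_def)
      have "AE y in \<mu>. h' (?c y) = h' y" using h'Z by (simp add: Z_def)
      from AE_product_version[OF ff this f'(2,3), of x]
      show "AE y in \<mu>. f' (?c y) * h' (- ?c y + (- g + x + g)) = f' y * h' (- y + x)"
      proof eventually_elim
        fix y assume y: "f' (?c y) = f' y \<and> (f' (?c y) = 0 \<or> h' (?c (- y + x)) = h' (- y + x))"
        have "- ?c y + (- g + x + g) = ?c (- y + x)"
          by (simp only: minus_add add.assoc minus_minus add_minus_cancel)
        then show "f' (?c y) * h' (- ?c y + (- g + x + g)) = f' y * h' (- y + x)" using y by auto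
      qed
    qed
    also have "\<dots> = conv f h x"
      by (rule conv_version(1)[OF f' h'(1,4), symmetric])
    finally show ?thesis .
  qed
  then show ?thesis using conv_L[OF fL hL] by (simp add: Z_def)
qed

text \<open>The functions multiplied by the weight form a Cauchy sequence in the unweighted
  \<open>L^1\<close> space, so a subsequence converges almost everywhere, and Fatou's lemma turns
  this into norm convergence. The same pointwise limit shows that the central functions are
  closed.\<close>

lemma L_complete:
  assumes f: "\<And>n. f n \<in> L"
    and Cauchy: "\<And>e. e > 0 \<Longrightarrow> \<exists>N. \<forall>m\<ge>N. \<forall>n\<ge>N. nrm (\<lambda>x. f m x - f n x) < e"
  obtains k where "k \<in> L" "(\<lambda>n. nrm (\<lambda>x. f n x - k x)) \<longlonglongrightarrow> 0" "(\<forall>n. f n \<in> Z) \<longrightarrow> k \<in> Z"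
proof -
  let ?M = "completion \<mu>"
  have fm: "f n \<in> borel_measurable ?M" for n using f by (rule L_measurable)
  define s where "s n x = f n x * complex_of_real (\<omega> x)" for n x
  have wm: "(\<lambda>x. complex_of_real (\<omega> x)) \<in> borel_measurable ?M"
    by (rule measurable_compose[OF weight_measurable_mu(2)]) simp
  have sm: "s n \<in> borel_measurable ?M" for n
    unfolding s_def by (intro borel_measurable_times fm wm)
  have si: "integrable ?M (s n)" for n
    using sm[of n] f[of n] by (simp add: integrable_iff_bounded s_def norm_mult nn_integral_completion L_iff nn_def)
  have nrm_int: "nrm (\<lambda>x. f i x - f j x) = (LINT x|?M. norm (s i x - s j x))" for i j
    unfolding nrm_def beurling_fun_def s_def by (simp add: norm_mult flip: left_diff_distrib)
  have "\<exists>N. \<forall>i\<ge>N. \<forall>j\<ge>N. LINT x|?M. norm (s i x - s j x) < e" if "e > 0" for e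
    using Cauchy[OF that] unfolding nrm_int .
  from cauchy_L1_AE_cauchy_subseq[OF si this] obtain r where
    r: "strict_mono r" "AE x in ?M. Cauchy (\<lambda>i. s (r i) x)" by metis
  \<comment> \<open>With \<open>lim\<close> taken at every point, \<open>k\<close> has equal values
    at \<open>x\<close> and its conjugate as soon as all the \<open>f (r i)\<close> do, whether or
    not they converge there.\<close>
  define k where "k x = lim (\<lambda>i. f (r i) x)" for x
  have km: "k \<in> borel_measurable ?M" unfolding k_def by (intro borel_measurable_lim_metric fm)
  have "AE x in \<mu>. Cauchy (\<lambda>i. s (r i) x)" using r(2) by (simp add: AE_completion_iff)
  then have conv: "AE x in \<mu>. (\<lambda>i. f (r i) x) \<longlonglongrightarrow> k x"
  proof eventually_elim
    fix x assume "Cauchy (\<lambda>i. s (r i) x)"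
    then have "convergent (\<lambda>i. s (r i) x)" by (rule Cauchy_convergent)
    then obtain l where "(\<lambda>i. s (r i) x) \<longlonglongrightarrow> l" by (auto simp: convergent_def)
    then have "(\<lambda>i. s (r i) x / complex_of_real (\<omega> x)) \<longlonglongrightarrow> l / complex_of_real (\<omega> x)"
      by (intro tendsto_divide tendsto_const) auto
    then have "(\<lambda>i. f (r i) x) \<longlonglongrightarrow> l / complex_of_real (\<omega> x)" by (simp add: s_def)
    then show "(\<lambda>i. f (r i) x) \<longlonglongrightarrow> k x" unfolding k_def using limI by metis
  qed
  have fatou: "nn (\<lambda>x. f n x - k x) \<le> ennreal e" if N: "\<And>m. m \<ge> N \<Longrightarrow> nrm (\<lambda>x. f n x - f m x) < e" for n N e
  proof -
    have "nn (\<lambda>x. f n x - k x) \<le> (\<integral>\<^sup>+x. liminf (\<lambda>i. ennreal (norm (f n x - f (r i) x) * \<omega> x)) \<partial>\<mu>)"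
      unfolding nn_def
    proof (rule nn_integral_mono_AE)
      show "AE x in \<mu>. ennreal (norm (f n x - k x) * \<omega> x) \<le> liminf (\<lambda>i. ennreal (norm (f n x - f (r i) x) * \<omega> x))"
        using conv
      proof eventually_elim
        fix x assume "(\<lambda>i. f (r i) x) \<longlonglongrightarrow> k x"
        then have "(\<lambda>i. ennreal (norm (f n x - f (r i) x) * \<omega> x)) \<longlonglongrightarrow> ennreal (norm (f n x - k x) * \<omega> x)"
          by (intro tendsto_ennrealI tendsto_intros)
        then show "ennreal (norm (f n x - k x) * \<omega> x) \<le> liminf (\<lambda>i. ennreal (norm (f n x - f (r i) x) * \<omega> x))"
          using lim_imp_Liminf[OF sequentially_bot] by (metis order_refl)
      qed
    qed
    also have "\<dots> = (\<integral>\<^sup>+x. liminf (\<lambda>i. ennreal (norm (f n x - f (r i) x) * \<omega> x)) \<partial>?M)"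
      by (simp add: nn_integral_completion)
    also have "\<dots> \<le> liminf (\<lambda>i. (\<integral>\<^sup>+x. ennreal (norm (f n x - f (r i) x) * \<omega> x) \<partial>?M))"
      by (intro nn_integral_liminf nn_borel borel_measurable_diff fm)
    also have "\<dots> = liminf (\<lambda>i. ennreal (nrm (\<lambda>x. f n x - f (r i) x)))"
      using nn_nrm[OF L_diff[OF f f]] by (simp add: nn_def nn_integral_completion)
    also have "\<dots> \<le> ennreal e"
    proof (rule Liminf_le)
      have "eventually (\<lambda>i. i \<ge> N) sequentially" by (rule eventually_ge_at_top)
      then show "\<forall>\<^sub>F i in sequentially. ennreal (nrm (\<lambda>x. f n x - f (r i) x)) \<le> ennreal e"
      proof eventually_elim
        fix i assume "N \<le> i"
        then have "N \<le> r i" using seq_suble[OF r(1), of i] by simp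
        then show "ennreal (nrm (\<lambda>x. f n x - f (r i) x)) \<le> ennreal e"
          using N by (intro ennreal_leI) (simp add: less_imp_le)
      qed
    qed simp
    finally show ?thesis .
  qed
  have dL: "\<exists>N. \<forall>n\<ge>N. (\<lambda>x. f n x - k x) \<in> L \<and> nrm (\<lambda>x. f n x - k x) \<le> e" if e: "e > 0" for e
  proof -
    obtain N where N: "\<And>m n. m \<ge> N \<Longrightarrow> n \<ge> N \<Longrightarrow> nrm (\<lambda>x. f m x - f n x) < e"
      using Cauchy[OF e] by metis
    show ?thesis
    proof (intro exI allI impI)
      fix n assume n: "n \<ge> N"
      have le: "nn (\<lambda>x. f n x - k x) \<le> ennreal e" using N n by (intro fatou) auto
      moreover have "(\<lambda>x. f n x - k x) \<in> borel_measurable ?M" by (intro borel_measurable_diff fm km)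
      ultimately have *: "(\<lambda>x. f n x - k x) \<in> L" by (auto simp: L_iff intro: order_le_less_trans)
      then show "(\<lambda>x. f n x - k x) \<in> L \<and> nrm (\<lambda>x. f n x - k x) \<le> e"
        using le e by (simp add: nn_nrm)
    qed
  qed
  have kL: "k \<in> L"
  proof -
    obtain N where "(\<lambda>x. f N x - k x) \<in> L" using dL[of 1] by auto
    from L_diff[OF f[of N] this] show ?thesis by simp
  qed
  have "(\<lambda>n. nrm (\<lambda>x. f n x - k x)) \<longlonglongrightarrow> 0"
  proof (rule LIMSEQ_I)
    fix e :: real assume e: "0 < e"
    obtain N where "\<And>n. n \<ge> N \<Longrightarrow> nrm (\<lambda>x. f n x - k x) \<le> e / 2" using dL[of "e / 2"] e by auto
    then show "\<exists>no. \<forall>n\<ge>no. norm (nrm (\<lambda>x. f n x - k x) - 0) < e"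
      using e by (intro exI[of _ N]) (fastforce intro: order_le_less_trans[of _ "e / 2"])
  qed
  moreover have "(\<forall>n. f n \<in> Z) \<longrightarrow> k \<in> Z"
  proof
    assume Z: "\<forall>n. f n \<in> Z"
    have "AE x in \<mu>. k (- g + x + g) = k x" for g
    proof -
      have "AE x in \<mu>. \<forall>i. f (r i) (- g + x + g) = f (r i) x"
        unfolding AE_all_countable using Z by (simp add: Z_def)
      then show ?thesis
      proof eventually_elim
        fix x assume "\<forall>i. f (r i) (- g + x + g) = f (r i) x"
        then show "k (- g + x + g) = k x" unfolding k_def by simp
      qed
    qed
    then show "k \<in> Z" using kL by (simp add: Z_def)
  qed
  ultimately show ?thesis using that kL by metis
qed

end

section \<open>Products\<close>

lemma left_haar_inner_SUP:
  assumes h: "left_haar_measure \<mu>" and A: "A \<in> sets borel" "emeasure \<mu> A < \<infinity>"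
  shows "emeasure \<mu> A = (SUP K\<in>{K. compact K \<and> K \<subseteq> A}. emeasure \<mu> K)"
proof (rule antisym)
  have s: "sets \<mu> = sets borel" using left_haar_sets[OF h] .
  show "emeasure \<mu> A \<le> (SUP K\<in>{K. compact K \<and> K \<subseteq> A}. emeasure \<mu> K)"
  proof (rule ennreal_le_epsilon)
    fix e :: real assume "0 < e"
    then have e: "0 < ennreal e" by simp
    obtain K where K: "compact K" "K \<subseteq> A" "emeasure \<mu> (A - K) < ennreal e"
      by (rule left_haar_inner[OF h A e])
    have "emeasure \<mu> A = emeasure \<mu> (K \<union> (A - K))" using K(2) by (simp add: Un_absorb1)
    also have "\<dots> \<le> emeasure \<mu> K + emeasure \<mu> (A - K)"
      using A K compact_borel[OF K(1)] s by (intro emeasure_subadditive) auto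
    also have "\<dots> \<le> (SUP K\<in>{K. compact K \<and> K \<subseteq> A}. emeasure \<mu> K) + ennreal e"
      using K by (intro add_mono SUP_upper) auto
    finally show "emeasure \<mu> A \<le> (SUP K\<in>{K. compact K \<and> K \<subseteq> A}. emeasure \<mu> K) + ennreal e" .
  qed
  show "(SUP K\<in>{K. compact K \<and> K \<subseteq> A}. emeasure \<mu> K) \<le> emeasure \<mu> A"
    using A s by (intro SUP_least emeasure_mono) auto
qed

text \<open>With one side of the box fixed and compact, the measure of the box is an image under a
  projection of a restriction of \<mu>. Translations in one coordinate are translations of the
  product, which gives invariance, whereas regularity is not asserted; hence the comparison of
  measures that are merely \<open>left_invariant\<close>.\<close>

lemma left_invariant_slices:
  fixes \<mu> :: "('g::{topological_group_add, t2_space} \<times> 'h::{topological_group_add, t2_space}) measure"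
  assumes \<mu>: "left_haar_measure \<mu>" and C: "compact C" and D: "compact D"
  shows "left_invariant (distr (density \<mu> (indicator (UNIV \<times> D))) borel fst)" (is "left_invariant ?M1")
    and "A \<in> sets borel \<Longrightarrow> emeasure (distr (density \<mu> (indicator (UNIV \<times> D))) borel fst) A = emeasure \<mu> (A \<times> D)"
    and "left_invariant (distr (density \<mu> (indicator (C \<times> UNIV))) borel snd)" (is "left_invariant ?M2")
    and "B \<in> sets borel \<Longrightarrow> emeasure (distr (density \<mu> (indicator (C \<times> UNIV))) borel snd) B = emeasure \<mu> (C \<times> B)"
proof -
  have s: "sets \<mu> = sets borel" using left_haar_sets[OF \<mu>] .
  have sp: "space \<mu> = UNIV" using left_haar_space[OF \<mu>] .
  have inv: "emeasure \<mu> ((\<lambda>x. p + x) ` E) = emeasure \<mu> E" if "E \<in> sets borel" for p E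
    using left_haar_imp_left_invariant[OF \<mu>] that unfolding left_invariant_def by blast
  have box: "A \<times> B \<in> sets borel" if "A \<in> sets borel" "B \<in> sets borel" for A :: "'g set" and B :: "'h set"
    by (rule borel_Times[OF that])
  have bC: "C \<in> sets borel" and bD: "D \<in> sets borel" using C D by (auto intro: compact_borel)
  have m: "fst \<in> density \<mu> (indicator (UNIV \<times> D)) \<rightarrow>\<^sub>M borel" "snd \<in> density \<mu> (indicator (C \<times> UNIV)) \<rightarrow>\<^sub>M borel"
    using borel_measurable_continuous_onI[OF continuous_on_fst[OF continuous_on_id]]
      borel_measurable_continuous_onI[OF continuous_on_snd[OF continuous_on_id]] s
    by (simp_all cong: measurable_cong_sets)
  show e1: "emeasure ?M1 A = emeasure \<mu> (A \<times> D)" if "A \<in> sets borel" for A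
  proof -
    have "fst -` A \<inter> space \<mu> = A \<times> UNIV" using sp by auto
    then show ?thesis using that m(1) s box[OF that, of UNIV] box[of UNIV D] bD
      by (simp add: emeasure_distr emeasure_restricted Times_Int_Times)
  qed
  show e2: "emeasure ?M2 B = emeasure \<mu> (C \<times> B)" if "B \<in> sets borel" for B
  proof -
    have "snd -` B \<inter> space \<mu> = UNIV \<times> B" using sp by auto
    then show ?thesis using that m(2) s box[of UNIV B] box[of C UNIV] bC
      by (simp add: emeasure_distr emeasure_restricted Times_Int_Times)
  qed
  have tr: "(\<lambda>x. g + x) ` A \<in> sets borel" if "A \<in> sets borel" for g and A :: "'a::{topological_group_add, t2_space} set"
    unfolding left_translation_image using measurable_sets[OF borel_measurable_translation(1) that, of "- g"] by simp
  show "left_invariant ?M1"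
    unfolding left_invariant_def
  proof (intro conjI allI impI ballI)
    fix K :: "'g set" assume "compact K"
    then show "emeasure ?M1 K < \<infinity>"
      using left_haar_compact_finite[OF \<mu> compact_Times[OF \<open>compact K\<close> D]] by (simp add: e1 compact_borel)
  next
    fix g and A :: "'g set" assume A: "A \<in> sets borel"
    have "((\<lambda>x. g + x) ` A) \<times> D = (\<lambda>p. (g, 0) + p) ` (A \<times> D)" by (auto simp: image_iff)
    then show "emeasure ?M1 ((\<lambda>x. g + x) ` A) = emeasure ?M1 A"
      using inv[OF box[OF A bD]] by (simp add: e1 A tr)
  qed simp
  show "left_invariant ?M2"
    unfolding left_invariant_def
  proof (intro conjI allI impI ballI)
    fix K :: "'h set" assume "compact K"
    then show "emeasure ?M2 K < \<infinity>"
      using left_haar_compact_finite[OF \<mu> compact_Times[OF C \<open>compact K\<close>]] by (simp add: e2 compact_borel)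
  next
    fix g and A :: "'h set" assume A: "A \<in> sets borel"
    have "C \<times> ((\<lambda>x. g + x) ` A) = (\<lambda>p. (0, g) + p) ` (C \<times> A)" by (auto simp: image_iff)
    then show "emeasure ?M2 ((\<lambda>x. g + x) ` A) = emeasure ?M2 A"
      using inv[OF box[OF bC A]] by (simp add: e2 A tr)
  qed simp
qed

section \<open>The Haar measure of boxes in a product group\<close>

locale haar_product =
  fixes \<mu>1 :: "'g::{topological_group_add, t2_space} measure" and \<mu>2 :: "'h::{topological_group_add, t2_space} measure"
    and \<mu> :: "('g \<times> 'h) measure"
  assumes lc1: "locally_compact_group TYPE('g)" and lc2: "locally_compact_group TYPE('h)"
    and haar1: "left_haar_measure \<mu>1" and haar2: "left_haar_measure \<mu>2" and haar: "left_haar_measure \<mu>"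
begin

lemma sets_eq [simp, measurable_cong]: "sets \<mu>1 = sets borel" "sets \<mu>2 = sets borel" "sets \<mu> = sets borel"
  using haar1 haar2 haar by (auto dest: left_haar_sets)

lemma space_eq [simp]: "space \<mu>1 = UNIV" "space \<mu>2 = UNIV" "space \<mu> = UNIV"
  using haar1 haar2 haar by (auto dest: left_haar_space)

text \<open>In each variable separately the measure of a box is proportional to the Haar measure of
  that factor. The proportionality factor \<open>d\<close> depends on \<open>B\<close>; evaluation
  at the fixed side \<open>C\<close> gives \<open>d = k * emeasure \<mu>2 B\<close> with
  \<open>k = c / emeasure \<mu>1 C\<close>. It is not 0 because the box \<open>C \<times> D\<close>
  has nonempty interior.\<close>

lemma gdelta_boxes:
  obtains k :: real where "0 < k" "\<forall>A B. compact_gdelta A \<and> compact_gdelta B \<longrightarrow>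
    emeasure \<mu> (A \<times> B) = ennreal k * emeasure \<mu>1 A * emeasure \<mu>2 B"
proof -
  obtain C V where C: "compact_gdelta C" "open V" "{0::'g} \<subseteq> V" "V \<subseteq> C"
    using compact_gdelta_between[of "{0::'g}" UNIV] lc1 unfolding locally_compact_group_def
    by (metis compact_insert compact_empty open_UNIV subset_UNIV)
  obtain D W where D: "compact_gdelta D" "open W" "{0::'h} \<subseteq> W" "W \<subseteq> D"
    using compact_gdelta_between[of "{0::'h}" UNIV] lc2 unfolding locally_compact_group_def
    by (metis compact_insert compact_empty open_UNIV subset_UNIV)
  have "0 < emeasure \<mu>1 V" using C by (intro left_haar_pos[OF haar1]) auto
  also have "\<dots> \<le> emeasure \<mu>1 C" using C by (intro emeasure_mono) auto
  finally have C0: "0 < emeasure \<mu>1 C" .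
  have "0 < emeasure \<mu> (V \<times> W)" using C D by (intro left_haar_pos[OF haar] open_Times) auto
  also have "\<dots> \<le> emeasure \<mu> (C \<times> D)" using C D by (intro emeasure_mono) (auto intro: borel_Times)
  finally have CD0: "0 < emeasure \<mu> (C \<times> D)" .
  have Cfin: "emeasure \<mu>1 C < \<infinity>" using C by (intro left_haar_compact_finite[OF haar1]) (simp add: compact_gdelta_def)
  have ex: "\<exists>c. c \<noteq> \<infinity> \<and> (\<forall>A. compact_gdelta A \<longrightarrow> emeasure \<mu> (A \<times> B) = c * emeasure \<mu>1 A)"
    if "compact_gdelta B" for B
  proof -
    have cB: "compact B" using that by (simp add: compact_gdelta_def)
    show ?thesis
      by (rule compact_gdelta_proportional[OF lc1 left_invariant_slices(1)[OF haar compact_empty cB] haar1])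
        (metis left_invariant_slices(2)[OF haar compact_empty cB] compact_gdelta_borel)
  qed
  have cC: "compact C" using C by (simp add: compact_gdelta_def)
  obtain c where c: "c \<noteq> \<infinity>" "\<And>B. compact_gdelta B \<Longrightarrow> emeasure \<mu> (C \<times> B) = c * emeasure \<mu>2 B"
    using compact_gdelta_proportional[OF lc2 left_invariant_slices(3)[OF haar cC compact_empty] haar2]
      left_invariant_slices(4)[OF haar cC compact_empty] compact_gdelta_borel by metis
  define k where "k = c / emeasure \<mu>1 C"
  have kfin: "k \<noteq> \<infinity>" unfolding k_def using c(1) C0 by (auto simp: ennreal_divide_eq_top_iff)
  have boxes: "emeasure \<mu> (A \<times> B) = k * emeasure \<mu>1 A * emeasure \<mu>2 B" if AB: "compact_gdelta A" "compact_gdelta B" for A B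
  proof -
    obtain d where d: "d \<noteq> \<infinity>" "\<forall>A. compact_gdelta A \<longrightarrow> emeasure \<mu> (A \<times> B) = d * emeasure \<mu>1 A"
      using ex[OF AB(2)] by metis
    have "d * emeasure \<mu>1 C = c * emeasure \<mu>2 B" using d(2) c(2) C(1) AB(2) by metis
    then have "d * emeasure \<mu>1 C / emeasure \<mu>1 C = c * emeasure \<mu>2 B / emeasure \<mu>1 C" by simp
    then have "d = c * emeasure \<mu>2 B / emeasure \<mu>1 C"
      using C0 Cfin by (simp add: ennreal_mult_divide_eq)
    then have "d = k * emeasure \<mu>2 B" unfolding k_def by (simp add: divide_ennreal_def mult_ac)
    then show ?thesis using d(2) AB(1) by (simp add: mult_ac)
  qed
  have "k \<noteq> 0" using boxes[OF C(1) D(1)] CD0 by auto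
  then obtain r where "k = ennreal r" "0 < r" using kfin by (cases k) (auto simp: less_le)
  then show ?thesis using boxes that by metis
qed

definition k where "k = (SOME k::real. 0 < k \<and> (\<forall>A B. compact_gdelta A \<and> compact_gdelta B \<longrightarrow>
    emeasure \<mu> (A \<times> B) = ennreal k * emeasure \<mu>1 A * emeasure \<mu>2 B))"

lemma k: "0 < k" "compact_gdelta A \<Longrightarrow> compact_gdelta B \<Longrightarrow> emeasure \<mu> (A \<times> B) = ennreal k * emeasure \<mu>1 A * emeasure \<mu>2 B"
proof -
  have "\<exists>k::real. 0 < k \<and> (\<forall>A B. compact_gdelta A \<and> compact_gdelta B \<longrightarrow>
    emeasure \<mu> (A \<times> B) = ennreal k * emeasure \<mu>1 A * emeasure \<mu>2 B)"
    by (rule gdelta_boxes) metis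
  from someI_ex[OF this] show "0 < k" "compact_gdelta A \<Longrightarrow> compact_gdelta B \<Longrightarrow>
    emeasure \<mu> (A \<times> B) = ennreal k * emeasure \<mu>1 A * emeasure \<mu>2 B"
    unfolding k_def[symmetric] by auto
qed

text \<open>A compact subset of \<open>U \<times> V\<close> lies in the box of its projections, and
  compact \<open>G\<^sub>\<delta>\<close> sets fit between these and \<open>U\<close>,
  \<open>V\<close>. So inner regularity of \<mu> leads to boxes for which the formula is
  known.\<close>

lemma open_boxes_le:
  assumes U: "open U" and V: "open V"
  shows "emeasure \<mu> (U \<times> V) \<le> ennreal k * emeasure \<mu>1 U * emeasure \<mu>2 V"
proof -
  have "emeasure \<mu> (U \<times> V) = (SUP K\<in>{K. compact K \<and> K \<subseteq> U \<times> V}. emeasure \<mu> K)"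
    using haar open_Times[OF U V] unfolding left_haar_measure_def by metis
  also have "\<dots> \<le> ennreal k * emeasure \<mu>1 U * emeasure \<mu>2 V"
  proof (rule SUP_least)
    fix K assume "K \<in> {K. compact K \<and> K \<subseteq> U \<times> V}"
    then have K: "compact K" "K \<subseteq> U \<times> V" by auto
    have c: "compact (fst ` K)" "compact (snd ` K)"
      using K by (auto intro!: compact_continuous_image continuous_intros)
    have sub: "fst ` K \<subseteq> U" "snd ` K \<subseteq> V" using K by auto
    obtain A V1 where A: "compact_gdelta A" "open V1" "fst ` K \<subseteq> V1" "V1 \<subseteq> A" "A \<subseteq> U"
      by (rule compact_gdelta_between[OF lc1[unfolded locally_compact_group_def] c(1) U sub(1)])
    obtain B V2 where B: "compact_gdelta B" "open V2" "snd ` K \<subseteq> V2" "V2 \<subseteq> B" "B \<subseteq> V"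
      by (rule compact_gdelta_between[OF lc2[unfolded locally_compact_group_def] c(2) V sub(2)])
    have "K \<subseteq> A \<times> B" using A B by (force simp: mem_Times_iff)
    then have "emeasure \<mu> K \<le> emeasure \<mu> (A \<times> B)"
      using A B by (intro emeasure_mono) (auto intro: borel_Times)
    also have "\<dots> = ennreal k * emeasure \<mu>1 A * emeasure \<mu>2 B" by (rule k(2)[OF A(1) B(1)])
    also have "\<dots> \<le> ennreal k * emeasure \<mu>1 U * emeasure \<mu>2 V"
      using A B U V by (intro mult_mono emeasure_mono) auto
    finally show "emeasure \<mu> K \<le> ennreal k * emeasure \<mu>1 U * emeasure \<mu>2 V" .
  qed
  finally show ?thesis .
qed

text \<open>Outer regularity of the factors reduces this to open sides. The error terms disappear in
  the limit because both sides have finite measure.\<close>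

lemma boxes_le:
  assumes A: "A \<in> sets borel" "emeasure \<mu>1 A < \<infinity>" and B: "B \<in> sets borel" "emeasure \<mu>2 B < \<infinity>"
  shows "emeasure \<mu> (A \<times> B) \<le> ennreal k * emeasure \<mu>1 A * emeasure \<mu>2 B"
proof -
  have "\<exists>U V. open U \<and> open V \<and> A \<subseteq> U \<and> B \<subseteq> V \<and> emeasure \<mu>1 U \<le> emeasure \<mu>1 A + ennreal (1 / Suc n) \<and>
     emeasure \<mu>2 V \<le> emeasure \<mu>2 B + ennreal (1 / Suc n)" for n
  proof -
    have pos: "0 < ennreal (1 / Suc n)" by simp
    obtain U where U: "open U" "A \<subseteq> U" "emeasure \<mu>1 U < \<infinity>" "emeasure \<mu>1 (U - A) < ennreal (1 / Suc n)"
      by (rule left_haar_outer[OF haar1 A pos])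
    obtain V where V: "open V" "B \<subseteq> V" "emeasure \<mu>2 V < \<infinity>" "emeasure \<mu>2 (V - B) < ennreal (1 / Suc n)"
      by (rule left_haar_outer[OF haar2 B pos])
    have "emeasure \<mu>1 U = emeasure \<mu>1 A + emeasure \<mu>1 (U - A)"
      using U A by (subst plus_emeasure) (auto simp: Un_absorb1)
    moreover have "emeasure \<mu>2 V = emeasure \<mu>2 B + emeasure \<mu>2 (V - B)"
      using V B by (subst plus_emeasure) (auto simp: Un_absorb1)
    ultimately show ?thesis using U V by (intro exI[of _ U] exI[of _ V]) (auto intro: less_imp_le add_left_mono)
  qed
  then have le: "emeasure \<mu> (A \<times> B) \<le> ennreal k * (emeasure \<mu>1 A + ennreal (1 / Suc n)) * (emeasure \<mu>2 B + ennreal (1 / Suc n))" for n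
  proof -
    obtain U V where U: "open U" "open V" "A \<subseteq> U" "B \<subseteq> V" "emeasure \<mu>1 U \<le> emeasure \<mu>1 A + ennreal (1 / Suc n)"
     "emeasure \<mu>2 V \<le> emeasure \<mu>2 B + ennreal (1 / Suc n)"
      using \<open>\<And>n. \<exists>U V. _ n U V\<close>[of n] by metis
    have "emeasure \<mu> (A \<times> B) \<le> emeasure \<mu> (U \<times> V)" using U by (intro emeasure_mono) (auto intro: borel_Times)
    also have "\<dots> \<le> ennreal k * emeasure \<mu>1 U * emeasure \<mu>2 V" by (rule open_boxes_le[OF U(1,2)])
    also have "\<dots> \<le> ennreal k * (emeasure \<mu>1 A + ennreal (1 / Suc n)) * (emeasure \<mu>2 B + ennreal (1 / Suc n))"
      using U by (intro mult_mono) auto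
    finally show ?thesis .
  qed
  have z: "(\<lambda>n. ennreal (1 / Suc n)) \<longlonglongrightarrow> ennreal 0"
    by (intro tendsto_ennrealI) (use LIMSEQ_inverse_real_of_nat in \<open>simp add: inverse_eq_divide\<close>)
  have "(\<lambda>n. ennreal k * (emeasure \<mu>1 A + ennreal (1 / Suc n)) * (emeasure \<mu>2 B + ennreal (1 / Suc n)))
      \<longlonglongrightarrow> ennreal k * (emeasure \<mu>1 A + ennreal 0) * (emeasure \<mu>2 B + ennreal 0)"
    using A(2) B(2) by (intro tendsto_mult_ennreal tendsto_add z tendsto_const) (auto simp: ennreal_mult_eq_top_iff less_top)
  then show ?thesis using le by (intro LIMSEQ_le_const) auto
qed

text \<open>The upper bound is \<open>boxes_le\<close>. For the lower one the sides are enlarged by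
  null sets to compact \<open>G\<^sub>\<delta>\<close> sets; the enlarged box exceeds the given one
  by two boxes with a null side, and these are null by \<open>boxes_le\<close>.\<close>

lemma compact_boxes:
  assumes K: "compact K" and J: "compact J"
  shows "emeasure \<mu> (K \<times> J) = ennreal k * emeasure \<mu>1 K * emeasure \<mu>2 J"
proof (rule antisym)
  have Kb: "K \<in> sets borel" "J \<in> sets borel" using K J by (auto intro: compact_borel)
  have Kf: "emeasure \<mu>1 K < \<infinity>" "emeasure \<mu>2 J < \<infinity>"
    using left_haar_compact_finite[OF haar1 K] left_haar_compact_finite[OF haar2 J] by auto
  show "emeasure \<mu> (K \<times> J) \<le> ennreal k * emeasure \<mu>1 K * emeasure \<mu>2 J"
    by (intro boxes_le Kb Kf)
  obtain B where B: "compact_gdelta B" "K \<subseteq> B" "emeasure \<mu>1 (B - K) = 0" by (rule compact_gdelta_hull[OF lc1 haar1 K])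
  obtain C where C: "compact_gdelta C" "J \<subseteq> C" "emeasure \<mu>2 (C - J) = 0" by (rule compact_gdelta_hull[OF lc2 haar2 J])
  have Bf: "emeasure \<mu>1 B < \<infinity>" "emeasure \<mu>2 C < \<infinity>"
    using left_haar_compact_finite[OF haar1, of B] left_haar_compact_finite[OF haar2, of C] B C by (auto simp: compact_gdelta_def)
  have "ennreal k * emeasure \<mu>1 K * emeasure \<mu>2 J \<le> ennreal k * emeasure \<mu>1 B * emeasure \<mu>2 C"
    using B C by (intro mult_mono emeasure_mono) auto
  also have "\<dots> = emeasure \<mu> (B \<times> C)" by (rule k(2)[OF B(1) C(1), symmetric])
  also have "\<dots> \<le> emeasure \<mu> (K \<times> J \<union> ((B - K) \<times> C \<union> B \<times> (C - J)))"
    using B C Kb by (intro emeasure_mono) (auto intro!: sets.Un borel_Times)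
  also have "\<dots> \<le> emeasure \<mu> (K \<times> J) + emeasure \<mu> ((B - K) \<times> C \<union> B \<times> (C - J))"
    using B C Kb by (intro emeasure_subadditive) (auto intro!: sets.Un borel_Times)
  also have "\<dots> \<le> emeasure \<mu> (K \<times> J) + (emeasure \<mu> ((B - K) \<times> C) + emeasure \<mu> (B \<times> (C - J)))"
    using B C Kb by (intro add_left_mono emeasure_subadditive) (auto intro!: sets.Un borel_Times)
  also have "\<dots> \<le> emeasure \<mu> (K \<times> J) + (ennreal k * emeasure \<mu>1 (B - K) * emeasure \<mu>2 C + ennreal k * emeasure \<mu>1 B * emeasure \<mu>2 (C - J))"
    using B C Kb Bf by (intro add_mono boxes_le order_refl) auto
  also have "\<dots> = emeasure \<mu> (K \<times> J)" using B C by simp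
  finally show "ennreal k * emeasure \<mu>1 K * emeasure \<mu>2 J \<le> emeasure \<mu> (K \<times> J)" .
qed

lemma finite_boxes:
  assumes A: "A \<in> sets borel" "emeasure \<mu>1 A < \<infinity>" and B: "B \<in> sets borel" "emeasure \<mu>2 B < \<infinity>"
  shows "emeasure \<mu> (A \<times> B) = ennreal k * emeasure \<mu>1 A * emeasure \<mu>2 B"
proof (rule antisym)
  show "emeasure \<mu> (A \<times> B) \<le> ennreal k * emeasure \<mu>1 A * emeasure \<mu>2 B" by (rule boxes_le[OF A B])
  have "ennreal k * emeasure \<mu>1 A * emeasure \<mu>2 B =
    (SUP J\<in>{K. compact K \<and> K \<subseteq> B}. (SUP K\<in>{K. compact K \<and> K \<subseteq> A}. ennreal k * emeasure \<mu>1 K) * emeasure \<mu>2 J)"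
    unfolding left_haar_inner_SUP[OF haar1 A] left_haar_inner_SUP[OF haar2 B]
    by (subst SUP_mult_left_ennreal, subst SUP_mult_left_ennreal) (rule refl)
  also have "\<dots> = (SUP J\<in>{K. compact K \<and> K \<subseteq> B}. (SUP K\<in>{K. compact K \<and> K \<subseteq> A}. ennreal k * emeasure \<mu>1 K * emeasure \<mu>2 J))"
    by (subst SUP_mult_right_ennreal) (rule refl)
  also have "\<dots> \<le> emeasure \<mu> (A \<times> B)"
  proof (intro SUP_least)
    fix J K assume J: "J \<in> {K. compact K \<and> K \<subseteq> B}" and K: "K \<in> {K. compact K \<and> K \<subseteq> A}"
    then have "ennreal k * emeasure \<mu>1 K * emeasure \<mu>2 J = emeasure \<mu> (K \<times> J)" by (simp add: compact_boxes)
    also have "\<dots> \<le> emeasure \<mu> (A \<times> B)" using A B J K by (intro emeasure_mono) (auto intro: borel_Times)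
    finally show "ennreal k * emeasure \<mu>1 K * emeasure \<mu>2 J \<le> emeasure \<mu> (A \<times> B)" .
  qed
  finally show "ennreal k * emeasure \<mu>1 A * emeasure \<mu>2 B \<le> emeasure \<mu> (A \<times> B)" .
qed

lemma sigma_finite_set_incseq:
  assumes "sigma_finite_set M S"
  obtains A :: "nat \<Rightarrow> 'a set" where "incseq A" "range A \<subseteq> sets M" "\<forall>n. emeasure M (A n) < \<infinity>" "S = (\<Union>n. A n)"
proof -
  obtain A where A: "\<And>n::nat. A n \<in> sets M \<and> emeasure M (A n) < \<infinity>" "S = (\<Union>n. A n)"
    using assms unfolding sigma_finite_set_def by metis
  show ?thesis
  proof (rule that[of "\<lambda>n. \<Union>i\<le>n. A i"])
    show "incseq (\<lambda>n. \<Union>i\<le>n. A i)" by (intro incseq_SucI UN_mono) auto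
    show "range (\<lambda>n. \<Union>i\<le>n. A i) \<subseteq> sets M" using A(1) by auto
    show "\<forall>n. emeasure M (\<Union>i\<le>n. A i) < \<infinity>"
    proof
      fix n
      have "emeasure M (\<Union>i\<le>n. A i) \<le> (\<Sum>i\<le>n. emeasure M (A i))"
        using A(1) by (intro emeasure_subadditive_finite) auto
      also have "\<dots> < \<infinity>" using A(1) by simp
      finally show "emeasure M (\<Union>i\<le>n. A i) < \<infinity>" .
    qed
    show "S = (\<Union>n. \<Union>i\<le>n. A i)" unfolding A(2) by auto
  qed
qed

lemma boxes:
  assumes A: "sigma_finite_set \<mu>1 A" and B: "sigma_finite_set \<mu>2 B"
  shows "emeasure \<mu> (A \<times> B) = ennreal k * emeasure \<mu>1 A * emeasure \<mu>2 B"
proof -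
  obtain A' :: "nat \<Rightarrow> 'g set" where A': "incseq A'" "range A' \<subseteq> sets \<mu>1" "\<forall>n. emeasure \<mu>1 (A' n) < \<infinity>" "A = (\<Union>n. A' n)"
    by (rule sigma_finite_set_incseq[OF A])
  obtain B' :: "nat \<Rightarrow> 'h set" where B': "incseq B'" "range B' \<subseteq> sets \<mu>2" "\<forall>n. emeasure \<mu>2 (B' n) < \<infinity>" "B = (\<Union>n. B' n)"
    by (rule sigma_finite_set_incseq[OF B])
  have b: "A' n \<in> sets borel" "B' n \<in> sets borel" for n using A'(2) B'(2) by auto
  have Ab: "A \<in> sets borel" using sigma_finite_set_sets[OF A] by simp
  have 1: "emeasure \<mu> (A \<times> B' n) = ennreal k * emeasure \<mu>1 A * emeasure \<mu>2 (B' n)" for n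
  proof -
    have "A \<times> B' n = (\<Union>m. A' m \<times> B' n)" unfolding A'(4) by auto
    then have "emeasure \<mu> (A \<times> B' n) = (SUP m. emeasure \<mu> (A' m \<times> B' n))"
      using A'(1) b by (subst SUP_emeasure_incseq) (auto intro!: borel_Times simp: incseq_def)
    also have "\<dots> = (SUP m. ennreal k * emeasure \<mu>1 (A' m) * emeasure \<mu>2 (B' n))"
      using finite_boxes b A'(3) B'(3) by simp
    also have "\<dots> = ennreal k * (SUP m. emeasure \<mu>1 (A' m)) * emeasure \<mu>2 (B' n)"
      by (simp add: SUP_mult_right_ennreal SUP_mult_left_ennreal)
    also have "(SUP m. emeasure \<mu>1 (A' m)) = emeasure \<mu>1 A"
      unfolding A'(4) using A'(1,2) by (intro SUP_emeasure_incseq) auto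
    finally show ?thesis .
  qed
  have "A \<times> B = (\<Union>n. A \<times> B' n)" unfolding B'(4) by auto
  then have "emeasure \<mu> (A \<times> B) = (SUP n. emeasure \<mu> (A \<times> B' n))"
    using B'(1) b Ab by (subst SUP_emeasure_incseq) (auto intro!: borel_Times simp: incseq_def)
  also have "\<dots> = ennreal k * emeasure \<mu>1 A * (SUP n. emeasure \<mu>2 (B' n))"
    by (simp add: 1 SUP_mult_left_ennreal)
  also have "(SUP n. emeasure \<mu>2 (B' n)) = emeasure \<mu>2 B"
    unfolding B'(4) using B'(1,2) by (intro SUP_emeasure_incseq) auto
  finally show ?thesis .
qed

end

section \<open>Normed algebras, completions and tensor products\<close>

locale normed_algebra =
  fixes A :: "'a normed_alg" (structure)
  assumes zero_closed [simp]: "vzero A \<in> carrier A"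
    and add_closed [simp]: "x \<in> carrier A \<Longrightarrow> y \<in> carrier A \<Longrightarrow> vadd A x y \<in> carrier A"
    and scale_closed [simp]: "x \<in> carrier A \<Longrightarrow> vscale A a x \<in> carrier A"
    and mult_closed [simp]: "x \<in> carrier A \<Longrightarrow> y \<in> carrier A \<Longrightarrow> vmult A x y \<in> carrier A"
    and add_assoc: "x \<in> carrier A \<Longrightarrow> y \<in> carrier A \<Longrightarrow> z \<in> carrier A \<Longrightarrow> vadd A (vadd A x y) z = vadd A x (vadd A y z)"
    and add_commute: "x \<in> carrier A \<Longrightarrow> y \<in> carrier A \<Longrightarrow> vadd A x y = vadd A y x"
    and add_zero_left [simp]: "x \<in> carrier A \<Longrightarrow> vadd A (vzero A) x = x"
    and scale_one [simp]: "x \<in> carrier A \<Longrightarrow> vscale A 1 x = x"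
    and scale_zero [simp]: "x \<in> carrier A \<Longrightarrow> vscale A 0 x = vzero A"
    and scale_scale [simp]: "x \<in> carrier A \<Longrightarrow> vscale A a (vscale A b x) = vscale A (a * b) x"
    and scale_add: "x \<in> carrier A \<Longrightarrow> y \<in> carrier A \<Longrightarrow> vscale A a (vadd A x y) = vadd A (vscale A a x) (vscale A a y)"
    and add_scale: "x \<in> carrier A \<Longrightarrow> vscale A (a + b) x = vadd A (vscale A a x) (vscale A b x)"
    and mult_add_right: "x \<in> carrier A \<Longrightarrow> y \<in> carrier A \<Longrightarrow> z \<in> carrier A \<Longrightarrow>
      vmult A x (vadd A y z) = vadd A (vmult A x y) (vmult A x z)"
    and mult_add_left: "x \<in> carrier A \<Longrightarrow> y \<in> carrier A \<Longrightarrow> z \<in> carrier A \<Longrightarrow>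
      vmult A (vadd A y z) x = vadd A (vmult A y x) (vmult A z x)"
    and mult_scale_right: "x \<in> carrier A \<Longrightarrow> y \<in> carrier A \<Longrightarrow> vmult A x (vscale A a y) = vscale A a (vmult A x y)"
    and mult_scale_left: "x \<in> carrier A \<Longrightarrow> y \<in> carrier A \<Longrightarrow> vmult A (vscale A a x) y = vscale A a (vmult A x y)"
    and norm_nonneg [simp]: "x \<in> carrier A \<Longrightarrow> 0 \<le> vnorm A x"
    and norm_add: "x \<in> carrier A \<Longrightarrow> y \<in> carrier A \<Longrightarrow> vnorm A (vadd A x y) \<le> vnorm A x + vnorm A y"
    and norm_scale: "x \<in> carrier A \<Longrightarrow> vnorm A (vscale A a x) = norm a * vnorm A x"
    and norm_definite: "x \<in> carrier A \<Longrightarrow> vnorm A x = 0 \<Longrightarrow> x = vzero A"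
    and norm_mult: "x \<in> carrier A \<Longrightarrow> y \<in> carrier A \<Longrightarrow> vnorm A (vmult A x y) \<le> vnorm A x * vnorm A y"
begin

lemma bilinear_mult: "bilinear_mult A"
  by (simp add: bilinear_mult_def mult_add_right mult_add_left mult_scale_right mult_scale_left)

lemma add_zero_right [simp]: "x \<in> carrier A \<Longrightarrow> vadd A x (vzero A) = x"
  using add_commute[of x "vzero A"] by simp

lemma norm_zero [simp]: "vnorm A (vzero A) = 0"
  using norm_scale[of "vzero A" 0] by simp

lemma diff_closed [simp]: "x \<in> carrier A \<Longrightarrow> y \<in> carrier A \<Longrightarrow> vdiff A x y \<in> carrier A"
  by (simp add: vdiff_def)

lemma neg_add [simp]: "x \<in> carrier A \<Longrightarrow> vadd A (vscale A (- 1) x) x = vzero A"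
  using add_scale[of x "- 1" 1] by simp

lemma add_neg [simp]: "x \<in> carrier A \<Longrightarrow> vadd A x (vscale A (- 1) x) = vzero A"
  using add_scale[of x 1 "- 1"] by simp

lemma add_left_commute:
  "x \<in> carrier A \<Longrightarrow> y \<in> carrier A \<Longrightarrow> z \<in> carrier A \<Longrightarrow> vadd A x (vadd A y z) = vadd A y (vadd A x z)"
  by (metis add_assoc add_commute)

lemma neg_add_cancel [simp]:
  "x \<in> carrier A \<Longrightarrow> y \<in> carrier A \<Longrightarrow> vadd A (vscale A (- 1) x) (vadd A x y) = y"
  by (simp flip: add_assoc)

lemma add_diff_cancel: "x \<in> carrier A \<Longrightarrow> y \<in> carrier A \<Longrightarrow> vadd A (vdiff A x y) y = x"
  by (simp add: vdiff_def add_assoc)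

lemma diff_self [simp]: "x \<in> carrier A \<Longrightarrow> vdiff A x x = vzero A"
  by (simp add: vdiff_def)

lemma diff_eq_zeroD: "x \<in> carrier A \<Longrightarrow> y \<in> carrier A \<Longrightarrow> vdiff A x y = vzero A \<Longrightarrow> x = y"
  using add_diff_cancel[of x y] by simp

lemma norm_diff_commute: "x \<in> carrier A \<Longrightarrow> y \<in> carrier A \<Longrightarrow> vnorm A (vdiff A x y) = vnorm A (vdiff A y x)"
proof -
  assume xy: "x \<in> carrier A" "y \<in> carrier A"
  then have "vscale A (- 1) (vdiff A x y) = vdiff A y x"
    by (simp add: vdiff_def scale_add add_commute)
  then show ?thesis using norm_scale[of "vdiff A x y" "- 1"] xy by simp
qed

lemma norm_diff_triangle:
  assumes "x \<in> carrier A" "y \<in> carrier A" "z \<in> carrier A"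
  shows "vnorm A (vdiff A x z) \<le> vnorm A (vdiff A x y) + vnorm A (vdiff A y z)"
proof -
  have "vdiff A x z = vadd A (vdiff A x y) (vdiff A y z)"
    using assms by (simp add: vdiff_def add_assoc)
  then show ?thesis using norm_add[of "vdiff A x y" "vdiff A y z"] assms by simp
qed

lemma norm_le_diff:
  assumes "x \<in> carrier A" "y \<in> carrier A"
  shows "\<bar>vnorm A x - vnorm A y\<bar> \<le> vnorm A (vdiff A x y)"
  using norm_add[of "vdiff A x y" y] norm_add[of "vdiff A y x" x] norm_diff_commute[of x y] assms
  by (simp add: add_diff_cancel)

lemma norm_diff_add:
  assumes "x \<in> carrier A" "y \<in> carrier A" "x' \<in> carrier A" "y' \<in> carrier A"
  shows "vnorm A (vdiff A (vadd A x y) (vadd A x' y')) \<le> vnorm A (vdiff A x x') + vnorm A (vdiff A y y')"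
proof -
  have "vdiff A (vadd A x y) (vadd A x' y') = vadd A (vdiff A x x') (vdiff A y y')"
    using assms by (simp add: vdiff_def scale_add add_assoc add_left_commute)
  then show ?thesis using norm_add[of "vdiff A x x'" "vdiff A y y'"] assms by simp
qed

lemma norm_diff_scale:
  assumes "x \<in> carrier A" "x' \<in> carrier A"
  shows "vnorm A (vdiff A (vscale A a x) (vscale A a x')) = norm a * vnorm A (vdiff A x x')"
proof -
  have "vdiff A (vscale A a x) (vscale A a x') = vscale A a (vdiff A x x')"
    using assms by (simp add: vdiff_def scale_add)
  then show ?thesis using norm_scale assms by simp
qed

lemma norm_diff_mult:
  assumes "x \<in> carrier A" "y \<in> carrier A" "x' \<in> carrier A" "y' \<in> carrier A"
  shows "vnorm A (vdiff A (vmult A x y) (vmult A x' y')) \<le>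
    vnorm A (vdiff A x x') * vnorm A y + vnorm A x' * vnorm A (vdiff A y y')"
proof -
  have "vdiff A (vmult A x y) (vmult A x' y') = vadd A (vmult A (vdiff A x x') y) (vmult A x' (vdiff A y y'))"
    using assms by (simp add: vdiff_def mult_add_left mult_add_right mult_scale_left mult_scale_right add_assoc)
  then have "vnorm A (vdiff A (vmult A x y) (vmult A x' y')) \<le> vnorm A (vmult A (vdiff A x x') y) + vnorm A (vmult A x' (vdiff A y y'))"
    using norm_add assms by simp
  also have "\<dots> \<le> vnorm A (vdiff A x x') * vnorm A y + vnorm A x' * vnorm A (vdiff A y y')"
    using assms by (intro add_mono norm_mult) simp_all
  finally show ?thesis .
qed

definition converges :: "(nat \<Rightarrow> 'a) \<Rightarrow> 'a \<Rightarrow> bool" where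
  "converges s a \<longleftrightarrow> (\<forall>n. s n \<in> carrier A) \<and> a \<in> carrier A \<and> (\<lambda>n. vnorm A (vdiff A (s n) a)) \<longlonglongrightarrow> 0"

lemma convergesI:
  assumes "\<And>n. s n \<in> carrier A" "a \<in> carrier A" "b \<longlonglongrightarrow> 0" "\<And>n. vnorm A (vdiff A (s n) a) \<le> b n"
  shows "converges s a"
  unfolding converges_def using assms
  by (auto intro!: real_tendsto_sandwich[OF _ _ tendsto_const assms(3)])

lemma converges_unique:
  assumes "converges s a" "converges t b" "(\<lambda>n. vnorm A (vdiff A (s n) (t n))) \<longlonglongrightarrow> 0"
  shows "a = b"
proof -
  have c: "a \<in> carrier A" "b \<in> carrier A" "\<And>n. s n \<in> carrier A" "\<And>n. t n \<in> carrier A"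
    using assms by (auto simp: converges_def)
  have "vnorm A (vdiff A a b) \<le> vnorm A (vdiff A (s n) a) + vnorm A (vdiff A (s n) (t n)) + vnorm A (vdiff A (t n) b)" for n
    using norm_diff_triangle[of a "s n" b] norm_diff_triangle[of "s n" "t n" b] norm_diff_commute[of a "s n"] c by simp
  moreover have "(\<lambda>n. vnorm A (vdiff A (s n) a) + vnorm A (vdiff A (s n) (t n)) + vnorm A (vdiff A (t n) b)) \<longlonglongrightarrow> 0 + 0 + 0"
    using assms by (intro tendsto_add) (auto simp: converges_def)
  ultimately have "vnorm A (vdiff A a b) \<le> 0" by (intro LIMSEQ_le_const) auto
  then have "vnorm A (vdiff A a b) = 0" by (intro antisym norm_nonneg diff_closed c)
  then show ?thesis using diff_eq_zeroD[of a b] norm_definite[of "vdiff A a b"] c by simp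
qed

lemma converges_diff:
  assumes "converges s a" "converges t a"
  shows "(\<lambda>n. vnorm A (vdiff A (s n) (t n))) \<longlonglongrightarrow> 0"
proof -
  have c: "a \<in> carrier A" "\<And>n. s n \<in> carrier A" "\<And>n. t n \<in> carrier A"
    using assms by (auto simp: converges_def)
  have le: "norm (vnorm A (vdiff A (s n) (t n))) \<le> vnorm A (vdiff A (s n) a) + vnorm A (vdiff A (t n) a)" for n
    using norm_diff_triangle[of "s n" a "t n"] norm_diff_commute[of a "t n"] c(1) c(2)[of n] c(3)[of n] by simp
  have "(\<lambda>n. vnorm A (vdiff A (s n) a) + vnorm A (vdiff A (t n) a)) \<longlonglongrightarrow> 0 + 0"
    using assms by (intro tendsto_add) (auto simp: converges_def)
  then have "(\<lambda>n. vnorm A (vdiff A (s n) a) + vnorm A (vdiff A (t n) a)) \<longlonglongrightarrow> 0" by simp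
  then show ?thesis by (rule Lim_null_comparison[OF always_eventually[OF allI[OF le]]])
qed

lemma converges_norm: "converges s a \<Longrightarrow> (\<lambda>n. vnorm A (s n)) \<longlonglongrightarrow> vnorm A a"
  unfolding converges_def by (rule LIM_zero_cancel, rule Lim_null_comparison[rotated]) (auto simp: norm_le_diff)

lemma converges_cauchy:
  assumes "converges s a" "0 < e"
  shows "\<exists>N. \<forall>m\<ge>N. \<forall>n\<ge>N. vnorm A (vdiff A (s m) (s n)) < e"
proof -
  have c: "a \<in> carrier A" "\<And>n. s n \<in> carrier A" using assms by (auto simp: converges_def)
  have "(\<lambda>n. vnorm A (vdiff A (s n) a)) \<longlonglongrightarrow> 0" using assms by (simp add: converges_def)
  then have "\<forall>\<^sub>F n in sequentially. vnorm A (vdiff A (s n) a) < e / 2"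
    by (rule order_tendstoD(2)) (use assms(2) in simp)
  then obtain N where N: "\<And>n. n \<ge> N \<Longrightarrow> vnorm A (vdiff A (s n) a) < e / 2"
    unfolding eventually_sequentially by metis
  show ?thesis
  proof (intro exI allI impI)
    fix m n assume "m \<ge> N" "n \<ge> N"
    then show "vnorm A (vdiff A (s m) (s n)) < e"
      using N[of m] N[of n] norm_diff_triangle[of "s m" a "s n"] norm_diff_commute[of a "s n"] c by simp
  qed
qed

lemma converges_add:
  assumes "converges s a" "converges t b"
  shows "converges (\<lambda>n. vadd A (s n) (t n)) (vadd A a b)"
proof (rule convergesI)
  show "(\<lambda>n. vnorm A (vdiff A (s n) a) + vnorm A (vdiff A (t n) b)) \<longlonglongrightarrow> 0"
    using tendsto_add[of _ 0 sequentially _ 0] assms by (auto simp: converges_def)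
qed (use assms in \<open>auto simp: converges_def intro: norm_diff_add\<close>)

lemma converges_scale:
  assumes "converges s a"
  shows "converges (\<lambda>n. vscale A c (s n)) (vscale A c a)"
proof (rule convergesI)
  show "(\<lambda>n. norm c * vnorm A (vdiff A (s n) a)) \<longlonglongrightarrow> 0"
    using assms by (auto simp: converges_def intro: tendsto_mult_right_zero)
qed (use assms in \<open>auto simp: converges_def norm_diff_scale\<close>)

lemma converges_mult:
  assumes "converges s a" "converges t b"
  shows "converges (\<lambda>n. vmult A (s n) (t n)) (vmult A a b)"
proof (rule convergesI)
  have "(\<lambda>n. vnorm A (vdiff A (s n) a) * vnorm A (t n) + vnorm A a * vnorm A (vdiff A (t n) b)) \<longlonglongrightarrow> 0 * vnorm A b + vnorm A a * 0"
    using assms converges_norm[OF assms(2)] by (intro tendsto_add tendsto_mult tendsto_const) (auto simp: converges_def)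
  then show "(\<lambda>n. vnorm A (vdiff A (s n) a) * vnorm A (t n) + vnorm A a * vnorm A (vdiff A (t n) b)) \<longlonglongrightarrow> 0" by simp
qed (use assms in \<open>auto simp: converges_def intro: norm_diff_mult\<close>)

definition lsum :: "'a list \<Rightarrow> 'a" where "lsum xs = foldr (vadd A) xs (vzero A)"

lemma lsum_simps [simp]: "lsum [] = vzero A" "lsum (x # xs) = vadd A x (lsum xs)"
  by (simp_all add: lsum_def)

lemma lsum_closed [simp]: "set xs \<subseteq> carrier A \<Longrightarrow> lsum xs \<in> carrier A"
  by (induction xs) auto

lemma lsum_append: "set xs \<subseteq> carrier A \<Longrightarrow> set ys \<subseteq> carrier A \<Longrightarrow> lsum (xs @ ys) = vadd A (lsum xs) (lsum ys)"
  by (induction xs) (auto simp: add_assoc)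

lemma norm_lsum: "set xs \<subseteq> carrier A \<Longrightarrow> vnorm A (lsum xs) \<le> (\<Sum>x\<leftarrow>xs. vnorm A x)"
proof (induction xs)
  case (Cons x xs)
  then have "vnorm A (lsum (x # xs)) \<le> vnorm A x + vnorm A (lsum xs)" by (simp add: norm_add)
  then show ?case using Cons by simp
qed simp

lemma linear_form_zero: "linear_form A f \<Longrightarrow> f (vzero A) = 0"
  unfolding linear_form_def using scale_zero[OF zero_closed] by (metis mult_zero_left zero_closed)

lemma linear_form_lsum:
  assumes "linear_form A f" "set xs \<subseteq> carrier A"
  shows "f (lsum xs) = (\<Sum>x\<leftarrow>xs. f x)"
  using assms(2) by (induction xs) (use assms(1) in \<open>auto simp: linear_form_zero linear_form_def\<close>)

lemma linear_form_diff:
  assumes "linear_form A f" "x \<in> carrier A" "y \<in> carrier A"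
  shows "f (vdiff A x y) = f x - f y"
proof -
  have "f (vdiff A x y) = f x + f (vscale A (- 1) y)"
    using assms scale_closed[of y "- 1"] unfolding vdiff_def linear_form_def by blast
  also have "f (vscale A (- 1) y) = - f y" using assms unfolding linear_form_def by (metis mult_minus1)
  finally show ?thesis by simp
qed

end

lemma UN_eq_const: "X \<noteq> {} \<Longrightarrow> (\<And>x. x \<in> X \<Longrightarrow> F x = Y) \<Longrightarrow> (\<Union>x\<in>X. F x) = Y"
  by auto

lemma UN2_eq_const:
  "X \<noteq> {} \<Longrightarrow> X' \<noteq> {} \<Longrightarrow> (\<And>x x'. x \<in> X \<Longrightarrow> x' \<in> X' \<Longrightarrow> F x x' = Y) \<Longrightarrow> (\<Union>x\<in>X. \<Union>x'\<in>X'. F x x') = Y"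
  by (intro UN_eq_const) auto

lemma banach_alg_isoI:
  assumes map: "\<And>x. x \<in> carrier A \<Longrightarrow> \<phi> x \<in> carrier B"
    and surj: "\<And>y. y \<in> carrier B \<Longrightarrow> \<exists>x\<in>carrier A. \<phi> x = y"
    and inj: "\<And>x y. x \<in> carrier A \<Longrightarrow> y \<in> carrier A \<Longrightarrow> \<phi> x = \<phi> y \<Longrightarrow> x = y"
    and closed: "\<And>x y. x \<in> carrier A \<Longrightarrow> y \<in> carrier A \<Longrightarrow> vadd A x y \<in> carrier A \<and> vmult A x y \<in> carrier A"
      "\<And>c x. x \<in> carrier A \<Longrightarrow> vscale A c x \<in> carrier A"
    and add: "\<And>x y. x \<in> carrier A \<Longrightarrow> y \<in> carrier A \<Longrightarrow> \<phi> (vadd A x y) = vadd B (\<phi> x) (\<phi> y)"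
    and scale: "\<And>c x. x \<in> carrier A \<Longrightarrow> \<phi> (vscale A c x) = vscale B c (\<phi> x)"
    and mult: "\<And>x y. x \<in> carrier A \<Longrightarrow> y \<in> carrier A \<Longrightarrow> \<phi> (vmult A x y) = vmult B (\<phi> x) (\<phi> y)"
    and norm: "\<And>x. x \<in> carrier A \<Longrightarrow> vnorm B (\<phi> x) = vnorm A x"
  shows "A \<simeq>\<^sub>B B"
proof -
  define \<psi> where "\<psi> y = (SOME x. x \<in> carrier A \<and> \<phi> x = y)" for y
  have \<psi>: "\<psi> y \<in> carrier A \<and> \<phi> (\<psi> y) = y" if "y \<in> carrier B" for y
    unfolding \<psi>_def by (rule someI_ex) (use surj[OF that] in blast)
  have \<psi>\<phi>: "\<psi> (\<phi> x) = x" if "x \<in> carrier A" for x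
    using inj[of "\<psi> (\<phi> x)" x] \<psi>[OF map[OF that]] that by simp
  have "bounded_alg_hom A B \<phi>"
    unfolding bounded_alg_hom_def using map add scale mult norm by (intro conjI exI[of _ 1]) auto
  moreover have "bounded_alg_hom B A \<psi>"
    unfolding bounded_alg_hom_def
  proof (intro conjI ballI allI exI[of _ 1])
    fix x y assume xy: "x \<in> carrier B" "y \<in> carrier B"
    show "\<psi> (vadd B x y) = vadd A (\<psi> x) (\<psi> y)" "\<psi> (vmult B x y) = vmult A (\<psi> x) (\<psi> y)"
      using \<psi>[OF xy(1)] \<psi>[OF xy(2)] closed(1)[of "\<psi> x" "\<psi> y"] add[of "\<psi> x" "\<psi> y"] mult[of "\<psi> x" "\<psi> y"]
        \<psi>\<phi>[of "vadd A (\<psi> x) (\<psi> y)"] \<psi>\<phi>[of "vmult A (\<psi> x) (\<psi> y)"] by auto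
  next
    fix c x assume x: "x \<in> carrier B"
    show "\<psi> (vscale B c x) = vscale A c (\<psi> x)"
      using \<psi>[OF x] closed(2)[of "\<psi> x" c] scale[of "\<psi> x" c] \<psi>\<phi>[of "vscale A c (\<psi> x)"] by auto
  next
    fix x assume x: "x \<in> carrier B"
    show "\<psi> x \<in> carrier A" "vnorm A (\<psi> x) \<le> 1 * vnorm B x" using \<psi>[OF x] norm[of "\<psi> x"] by auto
  qed
  ultimately show ?thesis unfolding banach_alg_iso_def using \<psi> \<psi>\<phi> by blast
qed

text \<open>The isometry \<tau> has dense image in the complete algebra \<open>A\<close>. A Cauchy
  sequence in \<open>B\<close> therefore has a limit in \<open>A\<close>, and two of them are
  identified in the completion exactly if their limits agree; \<open>cv s a\<close> says that
  \<open>s\<close> represents \<open>a\<close>. The isomorphism sends \<open>a\<close> to the set of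
  all sequences representing it, which is a class of the quotient.\<close>

lemma completion_iso:
  fixes A :: "'a normed_alg" and B :: "'b normed_alg"
  assumes nA: "normed_algebra A"
    and complete: "\<And>s. (\<And>n. s n \<in> carrier A) \<Longrightarrow>
      (\<And>e. e > 0 \<Longrightarrow> \<exists>N. \<forall>m\<ge>N. \<forall>n\<ge>N. vnorm A (vdiff A (s m) (s n)) < e) \<Longrightarrow>
      \<exists>a\<in>carrier A. (\<lambda>n. vnorm A (vdiff A (s n) a)) \<longlonglongrightarrow> 0"
    and closed: "\<And>x y. x \<in> carrier B \<Longrightarrow> y \<in> carrier B \<Longrightarrow> vadd B x y \<in> carrier B \<and> vmult B x y \<in> carrier B"
      "\<And>c x. x \<in> carrier B \<Longrightarrow> vscale B c x \<in> carrier B"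
    and map: "\<And>x. x \<in> carrier B \<Longrightarrow> \<tau> x \<in> carrier A"
    and add: "\<And>x y. x \<in> carrier B \<Longrightarrow> y \<in> carrier B \<Longrightarrow> \<tau> (vadd B x y) = vadd A (\<tau> x) (\<tau> y)"
    and scale: "\<And>c x. x \<in> carrier B \<Longrightarrow> \<tau> (vscale B c x) = vscale A c (\<tau> x)"
    and mult: "\<And>x y. x \<in> carrier B \<Longrightarrow> y \<in> carrier B \<Longrightarrow> \<tau> (vmult B x y) = vmult A (\<tau> x) (\<tau> y)"
    and norm: "\<And>x. x \<in> carrier B \<Longrightarrow> vnorm A (\<tau> x) = vnorm B x"
    and dense: "\<And>a e. a \<in> carrier A \<Longrightarrow> e > 0 \<Longrightarrow> \<exists>x\<in>carrier B. vnorm A (vdiff A (\<tau> x) a) < e"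
  shows "A \<simeq>\<^sub>B completion_alg B"
proof -
  interpret normed_algebra A by (rule nA)
  define C where "C = cauchy_seqs B"
  define r where "r = {(s, t). s \<in> carrier C \<and> t \<in> carrier C \<and> (\<lambda>n. vnorm B (vdiff B (s n) (t n))) \<longlonglongrightarrow> 0}"
  have Q: "completion_alg B = quotient_alg C r"
    by (simp add: completion_alg_def C_def r_def)
  have nd: "vnorm B (vdiff B x y) = vnorm A (vdiff A (\<tau> x) (\<tau> y))" if "x \<in> carrier B" "y \<in> carrier B" for x y
    using that closed add[of x "vscale B (- 1) y"] scale[of y "- 1"] norm[of "vdiff B x y"] by (simp add: vdiff_def)
  define cv where "cv s a \<longleftrightarrow> (\<forall>n. s n \<in> carrier B) \<and> converges (\<lambda>n. \<tau> (s n)) a" for s a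
  have C_cv: "s \<in> carrier C \<longleftrightarrow> (\<exists>a. cv s a)" for s
  proof
    assume s: "s \<in> carrier C"
    then have sB: "\<And>n. s n \<in> carrier B" by (simp add: C_def cauchy_seqs_def)
    have "\<exists>N. \<forall>m\<ge>N. \<forall>n\<ge>N. vnorm A (vdiff A (\<tau> (s m)) (\<tau> (s n))) < e" if "e > 0" for e
      using s that sB unfolding C_def cauchy_seqs_def by (simp add: nd)
    from complete[OF map[OF sB] this] show "\<exists>a. cv s a"
      using sB map unfolding cv_def converges_def by metis
  next
    assume "\<exists>a. cv s a"
    then obtain a where a: "\<And>n. s n \<in> carrier B" "converges (\<lambda>n. \<tau> (s n)) a" by (auto simp: cv_def)
    then show "s \<in> carrier C" using converges_cauchy[OF a(2)] by (simp add: C_def cauchy_seqs_def nd)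
  qed
  have r_iff: "(s, t) \<in> r \<longleftrightarrow> cv t a" if "cv s a" for s t a
  proof
    assume "(s, t) \<in> r"
    then have t: "t \<in> carrier C" "(\<lambda>n. vnorm B (vdiff B (s n) (t n))) \<longlonglongrightarrow> 0" by (auto simp: r_def)
    then obtain b where b: "cv t b" using C_cv by auto
    have "a = b" using that b t(2) converges_unique[of "\<lambda>n. \<tau> (s n)" a "\<lambda>n. \<tau> (t n)" b]
      by (simp add: cv_def nd)
    then show "cv t a" using b by simp
  next
    assume t: "cv t a"
    then show "(s, t) \<in> r"
      using that C_cv[of s] C_cv[of t] converges_diff[of "\<lambda>n. \<tau> (s n)" a "\<lambda>n. \<tau> (t n)"]
      by (auto simp: r_def cv_def nd)
  qed
  have cls: "r `` {s} = {t. cv t a}" if "cv s a" for s a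
    using r_iff[OF that] by auto
  have ex: "\<exists>s. cv s a" if a: "a \<in> carrier A" for a
  proof -
    have "\<exists>x\<in>carrier B. vnorm A (vdiff A (\<tau> x) a) < 1 / real (Suc n)" for n
      using dense[OF a] by simp
    then obtain s where s: "\<And>n. s n \<in> carrier B" "\<And>n. vnorm A (vdiff A (\<tau> (s n)) a) < 1 / real (Suc n)" by metis
    have "converges (\<lambda>n. \<tau> (s n)) a"
    proof (rule convergesI)
      show "(\<lambda>n. 1 / real (Suc n)) \<longlonglongrightarrow> 0"
        using LIMSEQ_inverse_real_of_nat by (simp add: inverse_eq_divide)
    qed (use s a map in \<open>auto intro: less_imp_le\<close>)
    then show ?thesis using s by (auto simp: cv_def)
  qed
  have cvA: "a \<in> carrier A" if "cv s a" for s a using that by (simp add: cv_def converges_def)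
  have uniq: "a = b" if "cv s a" "cv s b" for s a b
  proof -
    have "(s, s) \<in> r" using r_iff[OF that(1)] that(1) by simp
    then show ?thesis
      using that converges_unique[of "\<lambda>n. \<tau> (s n)" a "\<lambda>n. \<tau> (s n)" b] by (simp add: cv_def r_def nd)
  qed
  define \<phi> where "\<phi> a = {t. cv t a}" for a
  show ?thesis
    unfolding Q
  proof (rule banach_alg_isoI[where \<phi> = \<phi>])
    fix a assume a: "a \<in> carrier A"
    obtain s where s: "cv s a" using ex[OF a] by auto
    show "\<phi> a \<in> carrier (quotient_alg C r)"
    proof -
      have "s \<in> carrier C" using s C_cv by metis
      from quotientI[OF this, of r] show ?thesis by (simp add: quotient_alg_def \<phi>_def cls[OF s])
    qed
    define t where "t = (SOME x. x \<in> \<phi> a)"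
    have "t \<in> \<phi> a" unfolding t_def by (rule someI[of _ s]) (use s in \<open>simp add: \<phi>_def\<close>)
    then have t: "cv t a" by (simp add: \<phi>_def)
    have "(\<lambda>n. vnorm A (\<tau> (t n))) \<longlonglongrightarrow> vnorm A a" using t by (intro converges_norm) (simp add: cv_def)
    then have "(\<lambda>n. vnorm B (t n)) \<longlonglongrightarrow> vnorm A a" using t norm by (simp add: cv_def)
    then show "vnorm (quotient_alg C r) (\<phi> a) = vnorm A a"
      by (simp add: quotient_alg_def t_def[symmetric] C_def cauchy_seqs_def limI)
    fix c
    have "cv (vscale C c x) (vscale A c a)" if "cv x a" for x
      using that converges_scale[of "\<lambda>n. \<tau> (x n)" a c] closed scale by (auto simp: cv_def C_def cauchy_seqs_def)
    then show "\<phi> (vscale A c a) = vscale (quotient_alg C r) c (\<phi> a)"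
      using s cls unfolding quotient_alg_def \<phi>_def normed_alg.simps
      by (intro UN_eq_const[symmetric]) auto
  next
    fix y assume "y \<in> carrier (quotient_alg C r)"
    then obtain s where s: "s \<in> carrier C" "y = r `` {s}" by (auto simp: quotient_alg_def elim: quotientE)
    then obtain a where "cv s a" using C_cv by auto
    then show "\<exists>x\<in>carrier A. \<phi> x = y" using s cls cvA by (auto simp: \<phi>_def)
  next
    fix a b assume ab: "a \<in> carrier A" "b \<in> carrier A"
    obtain s where s: "cv s a" using ex[OF ab(1)] by auto
    obtain t where t: "cv t b" using ex[OF ab(2)] by auto
    show "a = b" if "\<phi> a = \<phi> b" using that s uniq by (auto simp: \<phi>_def)
    have "cv (vadd C x y) (vadd A a b)" if "cv x a" "cv y b" for x y
      using that converges_add[of "\<lambda>n. \<tau> (x n)" a "\<lambda>n. \<tau> (y n)" b] closed add by (auto simp: cv_def C_def cauchy_seqs_def)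
    then show "\<phi> (vadd A a b) = vadd (quotient_alg C r) (\<phi> a) (\<phi> b)"
      using s t cls unfolding quotient_alg_def \<phi>_def normed_alg.simps
      by (intro UN2_eq_const[symmetric]) auto
    have "cv (vmult C x y) (vmult A a b)" if "cv x a" "cv y b" for x y
      using that converges_mult[of "\<lambda>n. \<tau> (x n)" a "\<lambda>n. \<tau> (y n)" b] closed mult by (auto simp: cv_def C_def cauchy_seqs_def)
    then show "\<phi> (vmult A a b) = vmult (quotient_alg C r) (\<phi> a) (\<phi> b)"
      using s t cls unfolding quotient_alg_def \<phi>_def normed_alg.simps
      by (intro UN2_eq_const[symmetric]) auto
  qed simp_all
qed


section \<open>Sums of elementary tensors and the projective norm\<close>

lemma tensor_sum_at: "bilinear_form A B \<beta> \<Longrightarrow> tensor_sum A B ps \<beta> = (\<Sum>(a, b)\<leftarrow>ps. \<beta> a b)"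
  by (simp add: tensor_sum_def elem_tensor_def)

lemma tensor_sum_off: "\<not> bilinear_form A B \<beta> \<Longrightarrow> tensor_sum A B ps \<beta> = 0"
  by (simp add: tensor_sum_def elem_tensor_def case_prod_unfold)

lemma tensor_sum_eqI:
  assumes "\<And>\<beta>. bilinear_form A B \<beta> \<Longrightarrow> (\<Sum>(a, b)\<leftarrow>ps. \<beta> a b) = (\<Sum>(a, b)\<leftarrow>qs. \<beta> a b)"
  shows "tensor_sum A B ps = tensor_sum A B qs"
proof
  fix \<beta>
  show "tensor_sum A B ps \<beta> = tensor_sum A B qs \<beta>"
    using assms[of \<beta>] by (cases "bilinear_form A B \<beta>") (simp_all add: tensor_sum_at tensor_sum_off)
qed

lemma sum_list_swap: "(\<Sum>x\<leftarrow>xs. \<Sum>y\<leftarrow>ys. f x y) = (\<Sum>y\<leftarrow>ys. \<Sum>x\<leftarrow>xs. f x y)" for f :: "_ \<Rightarrow> _ \<Rightarrow> complex"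
  by (induction xs) (simp_all add: sum_list_addf)

lemma bilinear_formD:
  assumes "bilinear_form A B \<beta>"
  shows "a \<in> carrier A \<Longrightarrow> linear_form B (\<beta> a)" "b \<in> carrier B \<Longrightarrow> linear_form A (\<lambda>a. \<beta> a b)"
  using assms by (simp_all add: bilinear_form_def)

lemma vmult_tensor_sum:
  assumes bA: "bilinear_mult A" and bB: "bilinear_mult B"
    and ps: "set ps \<subseteq> carrier A \<times> carrier B" and qs: "set qs \<subseteq> carrier A \<times> carrier B"
  shows "vmult (alg_tensor A B) (tensor_sum A B ps) (tensor_sum A B qs) =
    tensor_sum A B (concat (map (\<lambda>(a, b). map (\<lambda>(a', b'). (vmult A a a', vmult B b b')) qs) ps))"
proof
  fix \<beta>
  show "vmult (alg_tensor A B) (tensor_sum A B ps) (tensor_sum A B qs) \<beta> =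
    tensor_sum A B (concat (map (\<lambda>(a, b). map (\<lambda>(a', b'). (vmult A a a', vmult B b b')) qs) ps)) \<beta>"
  proof (cases "bilinear_form A B \<beta>")
    case True
    have inner: "bilinear_form A B (\<lambda>a' b'. \<beta> (vmult A a a') (vmult B b b'))"
      if "a \<in> carrier A" "b \<in> carrier B" for a b
      using True that bA bB by (simp add: bilinear_form_def linear_form_def bilinear_mult_def)
    \<comment> \<open>\<gamma> equals the sum over \<open>qs\<close> only on the carriers, but
      bilinearity is tested only there, so it passes from the sum to \<gamma>.\<close>
    define \<gamma> where "\<gamma> a b = tensor_sum A B qs (\<lambda>a' b'. \<beta> (vmult A a a') (vmult B b b'))" for a b
    have \<gamma>: "\<gamma> a b = (\<Sum>(a', b')\<leftarrow>qs. \<beta> (vmult A a a') (vmult B b b'))" if "a \<in> carrier A" "b \<in> carrier B" for a b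
      unfolding \<gamma>_def by (rule tensor_sum_at[OF inner[OF that]])
    have lin: "bilinear_form A B (\<lambda>a b. \<Sum>(a', b')\<leftarrow>qs. \<beta> (vmult A a a') (vmult B b b'))"
      using qs
    proof (induction qs)
      case Nil
      show ?case by (simp add: bilinear_form_def linear_form_def)
    next
      case (Cons q qs)
      obtain a' b' where q: "q = (a', b')" by fastforce
      have "bilinear_form A B (\<lambda>a b. \<beta> (vmult A a a') (vmult B b b'))"
        using True Cons.prems bA bB q by (simp add: bilinear_form_def linear_form_def bilinear_mult_def)
      moreover have "bilinear_form A B (\<lambda>a b. \<Sum>(a', b')\<leftarrow>qs. \<beta> (vmult A a a') (vmult B b b'))"
        using Cons by simp
      ultimately show ?case
        unfolding bilinear_form_def linear_form_def q by (simp add: algebra_simps)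
    qed
    have "bilinear_form A B \<gamma>"
      using lin bA bB unfolding bilinear_form_def linear_form_def bilinear_mult_def by (simp add: \<gamma>)
    then have "vmult (alg_tensor A B) (tensor_sum A B ps) (tensor_sum A B qs) \<beta> = (\<Sum>(a, b)\<leftarrow>ps. \<gamma> a b)"
      using True by (simp add: alg_tensor_def tensor_sum_at flip: \<gamma>_def)
    also have "\<dots> = (\<Sum>(a, b)\<leftarrow>ps. \<Sum>(a', b')\<leftarrow>qs. \<beta> (vmult A a a') (vmult B b b'))"
      using ps \<gamma> by (intro arg_cong[where f = sum_list] map_cong) auto
    also have "\<dots> = tensor_sum A B (concat (map (\<lambda>(a, b). map (\<lambda>(a', b'). (vmult A a a', vmult B b b')) qs) ps)) \<beta>"
      unfolding tensor_sum_at[OF True]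
      by (induction ps) (simp_all add: case_prod_unfold comp_def)
    finally show ?thesis .
  qed (simp add: alg_tensor_def tensor_sum_off)
qed

text \<open>
  The hypothesis \<open>basis\<close> says that finitely many elements of the first factor lie approximately in
  the span of vectors over which the norm of the tensor product is additive. This makes the
  canonical map from the projective tensor product isometric.
\<close>

lemma projective_tensor_iso:
  fixes A :: "'a normed_alg" and B :: "'b normed_alg" and C :: "'c normed_alg"
  assumes nA: "normed_algebra A" and nB: "normed_algebra B" and nC: "normed_algebra C"
    and complete: "\<And>s. (\<And>n. s n \<in> carrier C) \<Longrightarrow>
      (\<And>e. e > 0 \<Longrightarrow> \<exists>N. \<forall>m\<ge>N. \<forall>n\<ge>N. vnorm C (vdiff C (s m) (s n)) < e) \<Longrightarrow>
      \<exists>a\<in>carrier C. (\<lambda>n. vnorm C (vdiff C (s n) a)) \<longlonglongrightarrow> 0"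
    and T_closed: "\<And>a b. a \<in> carrier A \<Longrightarrow> b \<in> carrier B \<Longrightarrow> T a b \<in> carrier C"
    and T_add1: "\<And>a a' b. a \<in> carrier A \<Longrightarrow> a' \<in> carrier A \<Longrightarrow> b \<in> carrier B \<Longrightarrow> T (vadd A a a') b = vadd C (T a b) (T a' b)"
    and T_add2: "\<And>a b b'. a \<in> carrier A \<Longrightarrow> b \<in> carrier B \<Longrightarrow> b' \<in> carrier B \<Longrightarrow> T a (vadd B b b') = vadd C (T a b) (T a b')"
    and T_scale1: "\<And>c a b. a \<in> carrier A \<Longrightarrow> b \<in> carrier B \<Longrightarrow> T (vscale A c a) b = vscale C c (T a b)"
    and T_scale2: "\<And>c a b. a \<in> carrier A \<Longrightarrow> b \<in> carrier B \<Longrightarrow> T a (vscale B c b) = vscale C c (T a b)"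
    and T_mult: "\<And>a a' b b'. a \<in> carrier A \<Longrightarrow> a' \<in> carrier A \<Longrightarrow> b \<in> carrier B \<Longrightarrow> b' \<in> carrier B \<Longrightarrow>
      T (vmult A a a') (vmult B b b') = vmult C (T a b) (T a' b')"
    and T_norm: "\<And>a b. a \<in> carrier A \<Longrightarrow> b \<in> carrier B \<Longrightarrow> vnorm C (T a b) \<le> vnorm A a * vnorm B b"
    and separate: "\<And>x. x \<in> carrier C \<Longrightarrow> x \<noteq> vzero C \<Longrightarrow> \<exists>f. linear_form C f \<and> f x \<noteq> 0"
    and dense: "\<And>x e. x \<in> carrier C \<Longrightarrow> e > 0 \<Longrightarrow> \<exists>ps. set ps \<subseteq> carrier A \<times> carrier B \<and>
      vnorm C (vdiff C (normed_algebra.lsum C (map (\<lambda>(a, b). T a b) ps)) x) < e"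
    and basis: "\<And>as e. set as \<subseteq> carrier A \<Longrightarrow> e > 0 \<Longrightarrow> \<exists>es c. set es \<subseteq> carrier A \<and>
      (\<forall>a\<in>set as. vnorm A (vdiff A a (normed_algebra.lsum A (map (\<lambda>v. vscale A (c a v) v) es))) < e) \<and>
      (\<forall>u. u ` set es \<subseteq> carrier B \<longrightarrow> (\<Sum>v\<leftarrow>es. vnorm A v * vnorm B (u v)) \<le>
         vnorm C (normed_algebra.lsum C (map (\<lambda>v. T v (u v)) es)))"
  shows "C \<simeq>\<^sub>B A \<otimes>\<^sub>\<pi> B"
proof -
  interpret A: normed_algebra A by (rule nA)
  interpret B: normed_algebra B by (rule nB)
  interpret C: normed_algebra C by (rule nC)
  let ?AB = "carrier A \<times> carrier B"
  define ts where "ts = tensor_sum A B"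
  define S where "S ps = C.lsum (map (\<lambda>(a, b). T a b) ps)" for ps
  have S_map: "set (map (\<lambda>(a, b). T a b) ps) \<subseteq> carrier C" if "set ps \<subseteq> ?AB" for ps
    using that T_closed by auto
  have S_closed: "S ps \<in> carrier C" if "set ps \<subseteq> ?AB" for ps
    unfolding S_def by (rule C.lsum_closed[OF S_map[OF that]])
  have S_append: "S (ps @ qs) = vadd C (S ps) (S qs)" if "set ps \<subseteq> ?AB" "set qs \<subseteq> ?AB" for ps qs
    unfolding S_def map_append by (rule C.lsum_append[OF S_map[OF that(1)] S_map[OF that(2)]])
  have T_bilinear: "bilinear_form A B (\<lambda>a b. f (T a b))" if "linear_form C f" for f
    using that T_closed by (simp add: bilinear_form_def linear_form_def T_add1 T_add2 T_scale1 T_scale2)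
  \<comment> \<open>A linear form on \<open>C\<close> composed with \<open>T\<close> is a bilinear
    form, and equal tensors agree on it. Since linear forms separate the points of \<open>C\<close>,
    the value of \<open>S\<close> depends only on the tensor.\<close>
  have ts_S: "S ps = S qs" if ps: "set ps \<subseteq> ?AB" and qs: "set qs \<subseteq> ?AB" and eq: "ts ps = ts qs" for ps qs
  proof (rule ccontr)
    assume "S ps \<noteq> S qs"
    then have "vdiff C (S ps) (S qs) \<noteq> vzero C" using C.diff_eq_zeroD[OF S_closed[OF ps] S_closed[OF qs]] by blast
    then obtain f where f: "linear_form C f" "f (vdiff C (S ps) (S qs)) \<noteq> 0"
      using separate[OF C.diff_closed[OF S_closed[OF ps] S_closed[OF qs]]] by blast
    have at: "f (S ps) = ts ps (\<lambda>a b. f (T a b))" if "set ps \<subseteq> ?AB" for ps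
      unfolding S_def ts_def tensor_sum_at[OF T_bilinear[OF f(1)]] C.linear_form_lsum[OF f(1) S_map[OF that]]
      by (simp add: case_prod_unfold comp_def)
    show False using f(2) at[OF ps] at[OF qs] eq C.linear_form_diff[OF f(1) S_closed[OF ps] S_closed[OF qs]] by simp
  qed
  define \<tau> where "\<tau> u = S (SOME ps. set ps \<subseteq> ?AB \<and> ts ps = u)" for u
  have \<tau>: "\<tau> (ts ps) = S ps" if "set ps \<subseteq> ?AB" for ps
  proof -
    have "set (SOME qs. set qs \<subseteq> ?AB \<and> ts qs = ts ps) \<subseteq> ?AB \<and> ts (SOME qs. set qs \<subseteq> ?AB \<and> ts qs = ts ps) = ts ps"
      by (rule someI[of _ ps]) (use that in simp)
    then show ?thesis unfolding \<tau>_def using ts_S[OF _ that] by blast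
  qed
  let ?D = "alg_tensor A B"
  have D: "carrier ?D = ts ` {ps. set ps \<subseteq> ?AB}" by (simp add: alg_tensor_def ts_def)
  have D_elim: "\<exists>ps. set ps \<subseteq> ?AB \<and> u = ts ps" if "u \<in> carrier ?D" for u using that unfolding D by auto
  have D_intro: "ts ps \<in> carrier ?D" if "set ps \<subseteq> ?AB" for ps using that unfolding D by auto
  have add: "vadd ?D (ts ps) (ts qs) = ts (ps @ qs)" for ps qs
    by (auto simp: alg_tensor_def ts_def tensor_sum_def)
  have scale: "vscale ?D c (ts ps) = ts (map (\<lambda>(a, b). (vscale A c a, b)) ps)" if "set ps \<subseteq> ?AB" for c ps
  proof
    fix \<beta>
    show "vscale ?D c (ts ps) \<beta> = ts (map (\<lambda>(a, b). (vscale A c a, b)) ps) \<beta>"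
    proof (cases "bilinear_form A B \<beta>")
      case True
      have "(\<Sum>(a, b)\<leftarrow>ps. \<beta> (vscale A c a) b) = (\<Sum>(a, b)\<leftarrow>ps. c * \<beta> a b)"
        using that bilinear_formD(2)[OF True] by (intro arg_cong[where f = sum_list] map_cong) (auto simp: linear_form_def)
      also have "\<dots> = c * (\<Sum>(a, b)\<leftarrow>ps. \<beta> a b)"
        by (simp add: sum_list_const_mult case_prod_unfold)
      finally show ?thesis using True by (simp add: alg_tensor_def ts_def tensor_sum_at comp_def case_prod_unfold)
    qed (simp add: alg_tensor_def ts_def tensor_sum_off)
  qed
  have scale_in: "set (map (\<lambda>(a, b). (vscale A c a, b)) ps) \<subseteq> ?AB" if "set ps \<subseteq> ?AB" for c ps
    using that by auto
  define prd where "prd ps qs = concat (map (\<lambda>(a, b). map (\<lambda>(a', b'). (vmult A a a', vmult B b b')) qs) ps)" for ps qs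
  have mult: "vmult ?D (ts ps) (ts qs) = ts (prd ps qs)" if "set ps \<subseteq> ?AB" "set qs \<subseteq> ?AB" for ps qs
    unfolding ts_def prd_def by (rule vmult_tensor_sum[OF A.bilinear_mult B.bilinear_mult that])
  have prd_in: "set (prd ps qs) \<subseteq> ?AB" if "set ps \<subseteq> ?AB" "set qs \<subseteq> ?AB" for ps qs
    using that unfolding prd_def by (auto dest!: subsetD)
  have S_scale: "S (map (\<lambda>(a, b). (vscale A c a, b)) ps) = vscale C c (S ps)" if "set ps \<subseteq> ?AB" for c ps
    using that
  proof (induction ps)
    case Nil
    show ?case using C.scale_scale[of "vzero C" c 0] C.scale_zero[OF C.zero_closed] by (simp add: S_def)
  next
    case (Cons p ps)
    then show ?case using S_closed[of ps] T_closed T_scale1 C.scale_add[of "T (fst p) (snd p)" "S ps" c]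
      by (auto simp: S_def)
  qed
  have S_mult1: "S (map (\<lambda>(a', b'). (vmult A a a', vmult B b b')) qs) = vmult C (T a b) (S qs)"
    if "a \<in> carrier A" "b \<in> carrier B" "set qs \<subseteq> ?AB" for a b qs
    using that(3)
  proof (induction qs)
    case Nil
    have "vmult C (T a b) (vzero C) = vscale C 0 (vmult C (T a b) (vzero C))"
      using C.mult_scale_right[OF T_closed[OF that(1,2)] C.zero_closed, of 0] C.scale_zero[OF C.zero_closed] by simp
    also have "\<dots> = vzero C" using T_closed[OF that(1,2)] by simp
    finally show ?case by (simp add: S_def)
  next
    case (Cons q qs)
    then show ?case using S_closed[of qs] that(1,2) T_closed T_mult C.mult_add_right[of "T a b" "T (fst q) (snd q)" "S qs"]
      by (auto simp: S_def)
  qed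
  have S_mult: "S (prd ps qs) = vmult C (S ps) (S qs)" if "set ps \<subseteq> ?AB" "set qs \<subseteq> ?AB" for ps qs
    using that(1)
  proof (induction ps)
    case Nil
    have "vmult C (vzero C) (S qs) = vscale C 0 (vmult C (vzero C) (S qs))"
      using C.mult_scale_left[OF C.zero_closed S_closed[OF that(2)], of 0] C.scale_zero[OF C.zero_closed] by simp
    also have "\<dots> = vzero C" using S_closed[OF that(2)] by simp
    finally show ?case by (simp add: S_def prd_def)
  next
    case (Cons p ps)
    obtain a b where p: "p = (a, b)" by fastforce
    have ab: "a \<in> carrier A" "b \<in> carrier B" and ps: "set ps \<subseteq> ?AB" using Cons.prems p by auto
    have q: "set (map (\<lambda>(a', b'). (vmult A a a', vmult B b b')) qs) \<subseteq> ?AB" using that(2) ab by auto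
    have "prd (p # ps) qs = map (\<lambda>(a', b'). (vmult A a a', vmult B b b')) qs @ prd ps qs"
      by (simp add: prd_def p)
    then have "S (prd (p # ps) qs) = vadd C (vmult C (T a b) (S qs)) (vmult C (S ps) (S qs))"
      using S_append[OF q prd_in[OF ps that(2)]] S_mult1[OF ab that(2)] Cons.IH[OF ps] by simp
    also have "\<dots> = vmult C (vadd C (T a b) (S ps)) (S qs)"
      using C.mult_add_left[OF S_closed[OF that(2)] T_closed[OF ab] S_closed[OF ps]] by simp
    also have "vadd C (T a b) (S ps) = S (p # ps)" by (simp add: S_def p)
    finally show ?case .
  qed
  have S_norm: "vnorm C (S ps) \<le> (\<Sum>(a, b)\<leftarrow>ps. vnorm A a * vnorm B b)" if "set ps \<subseteq> ?AB" for ps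
  proof -
    have "vnorm C (S ps) \<le> (\<Sum>x\<leftarrow>map (\<lambda>(a, b). T a b) ps. vnorm C x)"
      unfolding S_def by (rule C.norm_lsum[OF S_map[OF that]])
    also have "\<dots> = (\<Sum>(a, b)\<leftarrow>ps. vnorm C (T a b))" by (simp add: comp_def case_prod_unfold)
    also have "\<dots> \<le> (\<Sum>(a, b)\<leftarrow>ps. vnorm A a * vnorm B b)"
      using that T_norm by (intro sum_list_mono) auto
    finally show ?thesis .
  qed
  have cost_nonneg: "0 \<le> (\<Sum>(a, b)\<leftarrow>ps. vnorm A a * vnorm B b)" if "set ps \<subseteq> ?AB" for ps
    using that by (intro sum_list_nonneg) auto
  \<comment> \<open>Every tensor has representations nearly as cheap as its norm in
    \<open>C\<close>. The first factors are approximated in the span of \<open>es\<close> and the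
    terms are collected by basis vectors into \<open>q1\<close>, whose cost is at most the norm of
    \<open>S q1\<close> by \<open>basis\<close>. The remainders form \<open>q2\<close>.\<close>
  have refine: "\<exists>qs. set qs \<subseteq> ?AB \<and> ts qs = ts ps \<and> (\<Sum>(a, b)\<leftarrow>qs. vnorm A a * vnorm B b) \<le> vnorm C (S ps) + e"
    if ps: "set ps \<subseteq> ?AB" and e: "e > 0" for ps e
  proof -
    define M where "M = (\<Sum>(a, b)\<leftarrow>ps. vnorm B b)"
    have M0: "0 \<le> M" unfolding M_def using ps by (intro sum_list_nonneg) auto
    \<comment> \<open>Two errors of at most \<open>d * M\<close> arise: the cost of
      \<open>q2\<close>, and the passage from the norm of \<open>S ps\<close> to that of
      \<open>S q1\<close>. The added 1 excludes a zero denominator.\<close>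
    define d where "d = e / (2 * (M + 1))"
    have d: "0 < d" using e M0 by (simp add: d_def)
    have "set (map fst ps) \<subseteq> carrier A" using ps by auto
    from basis[OF this d] obtain es where "\<exists>c. set es \<subseteq> carrier A \<and>
      (\<forall>a\<in>set (map fst ps). vnorm A (vdiff A a (A.lsum (map (\<lambda>v. vscale A (c a v) v) es))) < d) \<and>
      (\<forall>u. u ` set es \<subseteq> carrier B \<longrightarrow> (\<Sum>v\<leftarrow>es. vnorm A v * vnorm B (u v)) \<le> vnorm C (C.lsum (map (\<lambda>v. T v (u v)) es)))" ..
    then obtain c where es_c: "set es \<subseteq> carrier A \<and>
      (\<forall>a\<in>set (map fst ps). vnorm A (vdiff A a (A.lsum (map (\<lambda>v. vscale A (c a v) v) es))) < d) \<and>
      (\<forall>u. u ` set es \<subseteq> carrier B \<longrightarrow> (\<Sum>v\<leftarrow>es. vnorm A v * vnorm B (u v)) \<le> vnorm C (C.lsum (map (\<lambda>v. T v (u v)) es)))" ..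
    have es: "set es \<subseteq> carrier A" using es_c by (elim conjE)
    have approx: "vnorm A (vdiff A a (A.lsum (map (\<lambda>v. vscale A (c a v) v) es))) < d" if "a \<in> set (map fst ps)" for a
      using conjunct1[OF conjunct2[OF es_c]] that by (rule bspec)
    have add: "(\<Sum>v\<leftarrow>es. vnorm A v * vnorm B (u v)) \<le> vnorm C (C.lsum (map (\<lambda>v. T v (u v)) es))"
      if "u ` set es \<subseteq> carrier B" for u
      using conjunct2[OF conjunct2[OF es_c], THEN spec, THEN mp, OF that] .
    define s where "s a = A.lsum (map (\<lambda>v. vscale A (c a v) v) es)" for a
    have s_in: "set (map (\<lambda>v. vscale A (c a v) v) es) \<subseteq> carrier A" for a using es by auto
    have s_closed: "s a \<in> carrier A" for a unfolding s_def by (rule A.lsum_closed[OF s_in])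
    define u where "u v = B.lsum (map (\<lambda>(a, b). vscale B (c a v) b) ps)" for v
    have u_in: "set (map (\<lambda>(a, b). vscale B (c a v) b) ps) \<subseteq> carrier B" for v using ps by auto
    have u_closed: "u v \<in> carrier B" for v unfolding u_def by (rule B.lsum_closed[OF u_in])
    define q1 where "q1 = map (\<lambda>v. (v, u v)) es"
    define q2 where "q2 = map (\<lambda>(a, b). (vdiff A a (s a), b)) ps"
    have q1: "set q1 \<subseteq> ?AB" using es u_closed by (auto simp: q1_def)
    have q2: "set q2 \<subseteq> ?AB" using ps s_closed by (auto simp: q2_def)
    have q: "set (q1 @ q2) \<subseteq> ?AB" using q1 q2 by simp
    have eq: "ts (q1 @ q2) = ts ps"
      unfolding ts_def
    proof (rule tensor_sum_eqI)
      fix \<beta> assume \<beta>: "bilinear_form A B \<beta>"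
      have "(\<Sum>(a, b)\<leftarrow>q1. \<beta> a b) = (\<Sum>v\<leftarrow>es. \<Sum>(a, b)\<leftarrow>ps. c a v * \<beta> v b)"
        unfolding q1_def map_map comp_def prod.case
      proof (intro arg_cong[where f = sum_list] map_cong refl)
        fix v assume v: "v \<in> set es"
        have lin: "linear_form B (\<beta> v)" using bilinear_formD(1)[OF \<beta>] v es by auto
        have "\<beta> v (u v) = (\<Sum>(a, b)\<leftarrow>ps. \<beta> v (vscale B (c a v) b))"
          unfolding u_def B.linear_form_lsum[OF lin u_in] by (simp add: comp_def case_prod_unfold)
        also have "\<dots> = (\<Sum>(a, b)\<leftarrow>ps. c a v * \<beta> v b)"
          using ps lin by (intro arg_cong[where f = sum_list] map_cong) (auto simp: linear_form_def)
        finally show "\<beta> v (u v) = (\<Sum>(a, b)\<leftarrow>ps. c a v * \<beta> v b)" .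
      qed
      also have "\<dots> = (\<Sum>(a, b)\<leftarrow>ps. \<Sum>v\<leftarrow>es. c a v * \<beta> v b)"
        unfolding case_prod_unfold by (rule sum_list_swap)
      also have "\<dots> = (\<Sum>(a, b)\<leftarrow>ps. \<beta> (s a) b)"
      proof (intro arg_cong[where f = sum_list] map_cong refl, clarsimp)
        fix a b assume "(a, b) \<in> set ps"
        then have lin: "linear_form A (\<lambda>a. \<beta> a b)" using bilinear_formD(2)[OF \<beta>] ps by auto
        have "\<beta> (s a) b = (\<Sum>v\<leftarrow>es. \<beta> (vscale A (c a v) v) b)"
          unfolding s_def A.linear_form_lsum[OF lin s_in] by (simp add: comp_def)
        also have "\<dots> = (\<Sum>v\<leftarrow>es. c a v * \<beta> v b)"
          using es lin by (intro arg_cong[where f = sum_list] map_cong) (auto simp: linear_form_def)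
        finally show "(\<Sum>v\<leftarrow>es. c a v * \<beta> v b) = \<beta> (s a) b" by simp
      qed
      finally have 1: "(\<Sum>(a, b)\<leftarrow>q1. \<beta> a b) = (\<Sum>(a, b)\<leftarrow>ps. \<beta> (s a) b)" .
      have "(\<Sum>(a, b)\<leftarrow>q2. \<beta> a b) = (\<Sum>(a, b)\<leftarrow>ps. \<beta> a b - \<beta> (s a) b)"
        unfolding q2_def map_map
      proof (intro arg_cong[where f = sum_list] map_cong refl, clarsimp)
        fix a b assume ab: "(a, b) \<in> set ps"
        then have lin: "linear_form A (\<lambda>a. \<beta> a b)" using bilinear_formD(2)[OF \<beta>] ps by auto
        have "a \<in> carrier A" using ab ps by auto
        from A.linear_form_diff[OF lin this s_closed]
        show "\<beta> (vdiff A a (s a)) b = \<beta> a b - \<beta> (s a) b" .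
      qed
      then show "(\<Sum>(a, b)\<leftarrow>q1 @ q2. \<beta> a b) = (\<Sum>(a, b)\<leftarrow>ps. \<beta> a b)"
        using 1 by (simp add: case_prod_unfold sum_list_subtractf)
    qed
    have cost2: "(\<Sum>(a, b)\<leftarrow>q2. vnorm A a * vnorm B b) \<le> d * M"
    proof -
      have "(\<Sum>(a, b)\<leftarrow>q2. vnorm A a * vnorm B b) = (\<Sum>(a, b)\<leftarrow>ps. vnorm A (vdiff A a (s a)) * vnorm B b)"
        by (simp add: q2_def comp_def case_prod_unfold)
      also have "\<dots> \<le> (\<Sum>(a, b)\<leftarrow>ps. d * vnorm B b)"
      proof (intro sum_list_mono, clarsimp)
        fix a b assume ab: "(a, b) \<in> set ps"
        then have "a \<in> set (map fst ps)" "b \<in> carrier B" using ps by force+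
        then show "vnorm A (vdiff A a (s a)) * vnorm B b \<le> d * vnorm B b"
          using approx[of a] by (intro mult_right_mono) (simp_all add: s_def less_imp_le)
      qed
      also have "\<dots> = d * M" by (simp add: M_def sum_list_const_mult case_prod_unfold)
      finally show ?thesis .
    qed
    have "S ps = vadd C (S q1) (S q2)" using ts_S[OF q ps eq] S_append[OF q1 q2] by simp
    then have "vdiff C (S ps) (S q2) = S q1"
      using S_closed[OF q1] S_closed[OF q2] by (simp add: vdiff_def C.add_assoc)
    then have "vnorm C (S q1) \<le> vnorm C (S ps) + vnorm C (S q2)"
      using C.norm_add[OF S_closed[OF ps] C.scale_closed[OF S_closed[OF q2], of "- 1"]] C.norm_scale[OF S_closed[OF q2], of "- 1"]
      by (simp add: vdiff_def)
    moreover have "(\<Sum>(a, b)\<leftarrow>q1. vnorm A a * vnorm B b) \<le> vnorm C (S q1)"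
    proof -
      have "u ` set es \<subseteq> carrier B" using u_closed by auto
      from add[OF this] show ?thesis by (simp add: q1_def S_def comp_def)
    qed
    moreover have "vnorm C (S q2) \<le> d * M" using S_norm[OF q2] cost2 by simp
    ultimately have "(\<Sum>(a, b)\<leftarrow>q1 @ q2. vnorm A a * vnorm B b) \<le> vnorm C (S ps) + 2 * (d * M)"
      using cost2 by simp
    also have "2 * (d * M) \<le> e"
    proof -
      have "2 * (d * M) \<le> 2 * (d * (M + 1))" using d by simp
      also have "\<dots> = e" using M0 by (simp add: d_def field_simps)
      finally show ?thesis .
    qed
    finally show ?thesis using q eq by (intro exI[of _ "q1 @ q2"] conjI) simp_all
  qed
  have norm: "vnorm ?D (ts ps) = vnorm C (S ps)" if ps: "set ps \<subseteq> ?AB" for ps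
  proof -
    let ?R = "{qs. set qs \<subseteq> ?AB \<and> ts qs = ts ps}" and ?f = "\<lambda>qs. \<Sum>(a, b)\<leftarrow>qs. vnorm A a * vnorm B b"
    have "vnorm ?D (ts ps) = (INF qs\<in>?R. ?f qs)" by (simp add: alg_tensor_def ts_def)
    also have "\<dots> = vnorm C (S ps)"
    proof (rule antisym)
      have bdd: "bdd_below (?f ` ?R)" by (rule bdd_belowI2[of _ 0]) (auto intro: cost_nonneg)
      show "(INF qs\<in>?R. ?f qs) \<le> vnorm C (S ps)"
      proof (rule field_le_epsilon)
        fix e :: real assume "0 < e"
        from refine[OF ps this] obtain qs where "qs \<in> ?R" "?f qs \<le> vnorm C (S ps) + e" by blast
        then show "(INF qs\<in>?R. ?f qs) \<le> vnorm C (S ps) + e" using cINF_lower[OF bdd] by (meson order_trans)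
      qed
      show "vnorm C (S ps) \<le> (INF qs\<in>?R. ?f qs)"
      proof (rule cINF_greatest)
        show "?R \<noteq> {}" using ps by auto
        fix qs assume "qs \<in> ?R"
        then have "set qs \<subseteq> ?AB" "S qs = S ps" using ts_S[OF _ ps] by auto
        then show "vnorm C (S ps) \<le> ?f qs" using S_norm[of qs] by simp
      qed
    qed
    finally show ?thesis .
  qed
  show ?thesis
    unfolding projective_tensor_def
  proof (rule completion_iso[OF nC complete, where \<tau> = \<tau>])
    fix u assume "u \<in> carrier ?D"
    then obtain ps where ps: "set ps \<subseteq> ?AB" and u: "u = ts ps" using D_elim by blast
    show "\<tau> u \<in> carrier C" unfolding u \<tau>[OF ps] by (rule S_closed[OF ps])
    show "vnorm C (\<tau> u) = vnorm ?D u" unfolding u \<tau>[OF ps] norm[OF ps] ..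
    fix c
    show "vscale ?D c u \<in> carrier ?D" unfolding u scale[OF ps] by (rule D_intro[OF scale_in[OF ps]])
    show "\<tau> (vscale ?D c u) = vscale C c (\<tau> u)"
      unfolding u scale[OF ps] \<tau>[OF scale_in[OF ps]] \<tau>[OF ps] by (rule S_scale[OF ps])
  next
    fix u v assume "u \<in> carrier ?D" "v \<in> carrier ?D"
    then obtain ps qs where ps: "set ps \<subseteq> ?AB" and u: "u = ts ps" and qs: "set qs \<subseteq> ?AB" and v: "v = ts qs"
      using D_elim by metis
    have pq: "set (ps @ qs) \<subseteq> ?AB" using ps qs by simp
    show "vadd ?D u v \<in> carrier ?D \<and> vmult ?D u v \<in> carrier ?D"
      unfolding u v add mult[OF ps qs] using D_intro[OF pq] D_intro[OF prd_in[OF ps qs]] by simp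
    show "\<tau> (vadd ?D u v) = vadd C (\<tau> u) (\<tau> v)"
      unfolding u v add \<tau>[OF pq] \<tau>[OF ps] \<tau>[OF qs] by (rule S_append[OF ps qs])
    show "\<tau> (vmult ?D u v) = vmult C (\<tau> u) (\<tau> v)"
      unfolding u v mult[OF ps qs] \<tau>[OF prd_in[OF ps qs]] \<tau>[OF ps] \<tau>[OF qs] by (rule S_mult[OF ps qs])
  next
    fix x and e :: real assume "x \<in> carrier C" "e > 0"
    then obtain ps where ps: "set ps \<subseteq> ?AB" "vnorm C (vdiff C (S ps) x) < e" using dense unfolding S_def by blast
    then show "\<exists>u\<in>carrier ?D. vnorm C (vdiff C (\<tau> u) x) < e"
      using D_intro[OF ps(1)] \<tau>[OF ps(1)] by (intro bexI[of _ "ts ps"]) simp_all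
  qed
qed

text \<open>A compact \<open>G\<^sub>\<delta>\<close> subset of a product lies in the product
  \<sigma>-algebra by \<open>compact_gdelta_sets\<close>, although a general Borel set of the
  product may not.\<close>

lemma sets_baire_prod: "sets (baire :: ('a::t2_space \<times> 'b::t2_space) measure) \<subseteq> sets (borel \<Otimes>\<^sub>M borel)"
proof -
  have "W \<in> sets (borel \<Otimes>\<^sub>M borel)" if W: "compact_gdelta W" for W :: "('a \<times> 'b) set"
  proof -
    obtain P :: "nat \<Rightarrow> ('a \<times> 'b) set" where P: "\<And>n. open (P n)" "W = (\<Inter>n. P n)"
      using W unfolding compact_gdelta_def by metis
    show ?thesis
    proof (rule compact_gdelta_sets[where P = P and Q = "space (borel \<Otimes>\<^sub>M borel)"])
      show "open_base_in (borel \<Otimes>\<^sub>M borel :: ('a \<times> 'b) measure)"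
        by (intro open_base_in_pair open_base_in_borel refl)
      show "compact W" using W by (simp add: compact_gdelta_def)
      show "W = \<Inter> (range P) \<inter> space (borel \<Otimes>\<^sub>M borel)" using P(2) by (simp add: space_pair_measure)
    qed (use P(1) in \<open>simp_all add: sets.top\<close>)
  qed
  then have "{W. compact_gdelta W} \<subseteq> sets (borel \<Otimes>\<^sub>M borel :: ('a \<times> 'b) measure)" by auto
  from sets.sigma_sets_subset[OF this] show ?thesis
    unfolding sets_baire by (simp add: space_pair_measure)
qed

lemma measurable_baire_prod: "f \<in> borel_measurable baire \<Longrightarrow> f \<in> borel_measurable (borel \<Otimes>\<^sub>M borel)"
  for f :: "'a::t2_space \<times> 'b::t2_space \<Rightarrow> _"
  using sets_baire_prod by (auto simp: measurable_def space_pair_measure)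

lemma pair_borel_imp_borel: "f \<in> borel \<Otimes>\<^sub>M borel \<rightarrow>\<^sub>M N \<Longrightarrow> f \<in> borel \<rightarrow>\<^sub>M N"
proof -
  assume f: "f \<in> borel \<Otimes>\<^sub>M borel \<rightarrow>\<^sub>M N"
  have m: "(\<lambda>p::'a \<times> 'b. (fst p, snd p)) \<in> borel \<rightarrow>\<^sub>M (borel \<Otimes>\<^sub>M borel)"
    by (intro measurable_Pair borel_measurable_continuous_onI continuous_intros)
  from measurable_compose[OF m f] show ?thesis by simp
qed

section \<open>Tonelli and Fubini theorems for the Haar measure of the product\<close>

context haar_product begin

definition restr1 where "restr1 S = density \<mu>1 (indicator S)"
definition restr2 where "restr2 T = density \<mu>2 (indicator T)"

text \<open>Both measures agree on boxes by \<open>boxes\<close>, the factor \<open>1 / k\<close>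
  cancelling \<open>k\<close>. Since \<mu> is defined on the possibly larger Borel \<sigma>-algebra,
  it is first restricted to the product \<sigma>-algebra as its image under the identity.\<close>

lemma pair_restrictions:
  assumes S: "sigma_finite_set \<mu>1 S" and T: "sigma_finite_set \<mu>2 T"
  shows "restr1 S \<Otimes>\<^sub>M restr2 T =
    density (distr \<mu> (borel \<Otimes>\<^sub>M borel) (\<lambda>p. p)) (\<lambda>p. ennreal (1 / k * indicator (S \<times> T) p))"
    (is "_ = density ?D ?g")
proof (rule pair_measure_eqI)
  have Sb: "S \<in> sets borel" "T \<in> sets borel" using sigma_finite_set_sets[OF S] sigma_finite_set_sets[OF T] by auto
  have idm: "(\<lambda>p. p) \<in> \<mu> \<rightarrow>\<^sub>M (borel \<Otimes>\<^sub>M borel)"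
    using pair_borel_imp_borel[OF measurable_ident, unfolded id_def] by (simp cong: measurable_cong_sets)
  show "sigma_finite_measure (restr1 S)" "sigma_finite_measure (restr2 T)"
    unfolding restr1_def restr2_def by (intro sigma_finite_density S T)+
  show "sets (restr1 S \<Otimes>\<^sub>M restr2 T) = sets (density ?D ?g)"
    unfolding restr1_def restr2_def by (simp cong: sets_pair_measure_cong)
  fix A B assume "A \<in> sets (restr1 S)" "B \<in> sets (restr2 T)"
  then have AB: "A \<in> sets borel" "B \<in> sets borel" by (simp_all add: restr1_def restr2_def)
  have box: "A \<times> B \<in> sets (borel \<Otimes>\<^sub>M borel)" "S \<times> T \<in> sets (borel \<Otimes>\<^sub>M borel)" using AB Sb by auto
  have "emeasure (density ?D ?g) (A \<times> B) = (\<integral>\<^sup>+p. ennreal (1 / k) * indicator ((S \<inter> A) \<times> (T \<inter> B)) p \<partial>?D)"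
    using box by (subst emeasure_density) (auto intro!: nn_integral_cong split: split_indicator)
  also have "\<dots> = ennreal (1 / k) * emeasure ?D ((S \<inter> A) \<times> (T \<inter> B))"
    using AB Sb by (subst nn_integral_cmult_indicator) auto
  also have "emeasure ?D ((S \<inter> A) \<times> (T \<inter> B)) = emeasure \<mu> ((S \<inter> A) \<times> (T \<inter> B))"
    using AB Sb by (subst emeasure_distr[OF idm]) auto
  also have "\<dots> = ennreal k * emeasure \<mu>1 (S \<inter> A) * emeasure \<mu>2 (T \<inter> B)"
    using AB Sb by (intro boxes sigma_finite_set_subset[OF S] sigma_finite_set_subset[OF T]) auto
  also have "ennreal (1 / k) * \<dots> = emeasure \<mu>1 (S \<inter> A) * emeasure \<mu>2 (T \<inter> B)"
    using k(1) by (simp add: mult.assoc[symmetric] ennreal_mult[symmetric])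
  finally show "emeasure (restr1 S) A * emeasure (restr2 T) B = emeasure (density ?D ?g) (A \<times> B)"
    using AB Sb by (simp add: restr1_def restr2_def emeasure_restricted)
qed

lemma product_tonelli:
  fixes f :: "'g \<times> 'h \<Rightarrow> ennreal"
  assumes S: "sigma_finite_set \<mu>1 S" and T: "sigma_finite_set \<mu>2 T"
    and f: "f \<in> borel_measurable (borel \<Otimes>\<^sub>M borel)"
    and supp: "\<And>x y. f (x, y) \<noteq> 0 \<Longrightarrow> x \<in> S \<and> y \<in> T"
  shows "(\<integral>\<^sup>+p. f p \<partial>\<mu>) = ennreal k * (\<integral>\<^sup>+x. (\<integral>\<^sup>+y. f (x, y) \<partial>\<mu>2) \<partial>\<mu>1)"
    and "(\<integral>\<^sup>+p. f p \<partial>\<mu>) = ennreal k * (\<integral>\<^sup>+y. (\<integral>\<^sup>+x. f (x, y) \<partial>\<mu>1) \<partial>\<mu>2)"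
    and "(\<lambda>x. \<integral>\<^sup>+y. f (x, y) \<partial>\<mu>2) \<in> borel_measurable borel"
    and "(\<lambda>y. \<integral>\<^sup>+x. f (x, y) \<partial>\<mu>1) \<in> borel_measurable borel"
proof -
  have Sb: "S \<in> sets borel" "T \<in> sets borel" using sigma_finite_set_sets[OF S] sigma_finite_set_sets[OF T] by auto
  have idm: "(\<lambda>p. p) \<in> \<mu> \<rightarrow>\<^sub>M (borel \<Otimes>\<^sub>M borel)"
    using pair_borel_imp_borel[OF measurable_ident, unfolded id_def] by (simp cong: measurable_cong_sets)
  have fm: "f \<in> borel_measurable (\<mu>1 \<Otimes>\<^sub>M \<mu>2)"
    using f by (subst measurable_cong_sets[OF sets_pair_measure_cong]) auto
  have fb: "f \<in> borel_measurable \<mu>" using pair_borel_imp_borel[OF f] by (simp cong: measurable_cong_sets)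
  note ton = tonelli_support[OF S T fm supp]
  have "(\<integral>\<^sup>+x. (\<integral>\<^sup>+y. f (x, y) \<partial>\<mu>2) \<partial>\<mu>1) = (\<integral>\<^sup>+p. f p \<partial>(restr1 S \<Otimes>\<^sub>M restr2 T))"
    unfolding restr1_def restr2_def by (rule ton(3))
  also have "\<dots> = (\<integral>\<^sup>+p. ennreal (1 / k * indicator (S \<times> T) p) * f p \<partial>distr \<mu> (borel \<Otimes>\<^sub>M borel) (\<lambda>p. p))"
    unfolding pair_restrictions[OF S T] using Sb f by (intro nn_integral_density) auto
  also have "\<dots> = (\<integral>\<^sup>+p. ennreal (1 / k * indicator (S \<times> T) p) * f p \<partial>\<mu>)"
    using Sb f by (intro nn_integral_distr[OF idm]) auto
  also have "\<dots> = (\<integral>\<^sup>+p. ennreal (1 / k) * f p \<partial>\<mu>)"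
  proof (rule nn_integral_cong)
    fix p
    show "ennreal (1 / k * indicator (S \<times> T) p) * f p = ennreal (1 / k) * f p"
      using supp[of "fst p" "snd p"] by (cases "f p = 0") (auto simp: indicator_def mem_Times_iff)
  qed
  also have "\<dots> = ennreal (1 / k) * (\<integral>\<^sup>+p. f p \<partial>\<mu>)" by (rule nn_integral_cmult[OF fb])
  finally have "ennreal k * (\<integral>\<^sup>+x. (\<integral>\<^sup>+y. f (x, y) \<partial>\<mu>2) \<partial>\<mu>1) = ennreal k * (ennreal (1 / k) * (\<integral>\<^sup>+p. f p \<partial>\<mu>))" by simp
  also have "\<dots> = (\<integral>\<^sup>+p. f p \<partial>\<mu>)"
    using k(1) by (simp add: mult.assoc[symmetric] ennreal_mult[symmetric])
  finally show 1: "(\<integral>\<^sup>+p. f p \<partial>\<mu>) = ennreal k * (\<integral>\<^sup>+x. (\<integral>\<^sup>+y. f (x, y) \<partial>\<mu>2) \<partial>\<mu>1)" by simp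
  show "(\<integral>\<^sup>+p. f p \<partial>\<mu>) = ennreal k * (\<integral>\<^sup>+y. (\<integral>\<^sup>+x. f (x, y) \<partial>\<mu>1) \<partial>\<mu>2)"
    unfolding 1 by (simp add: ton(2))
  show "(\<lambda>x. \<integral>\<^sup>+y. f (x, y) \<partial>\<mu>2) \<in> borel_measurable borel" "(\<lambda>y. \<integral>\<^sup>+x. f (x, y) \<partial>\<mu>1) \<in> borel_measurable borel"
    using ton(1,4) by (simp_all cong: measurable_cong_sets)
qed

text \<open>No integrability is needed: if one factor is not integrable, both sides vanish.\<close>

lemma product_integral:
  fixes a :: "'g \<Rightarrow> complex" and b :: "'h \<Rightarrow> complex"
  assumes S: "sigma_finite_set \<mu>1 S" "{x. a x \<noteq> 0} \<subseteq> S" and T: "sigma_finite_set \<mu>2 T" "{y. b y \<noteq> 0} \<subseteq> T"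
    and a: "a \<in> borel_measurable borel" and b: "b \<in> borel_measurable borel"
  shows "(LINT p|\<mu>. a (fst p) * b (snd p)) = complex_of_real k * (LINT x|\<mu>1. a x) * (LINT y|\<mu>2. b y)"
proof -
  let ?F = "\<lambda>p. a (fst p) * b (snd p)"
  have Sb: "S \<in> sets borel" "T \<in> sets borel" using sigma_finite_set_sets[OF S(1)] sigma_finite_set_sets[OF T(1)] by auto
  have idm: "(\<lambda>p. p) \<in> \<mu> \<rightarrow>\<^sub>M (borel \<Otimes>\<^sub>M borel)"
    using pair_borel_imp_borel[OF measurable_ident, unfolded id_def] by (simp cong: measurable_cong_sets)
  have F: "?F \<in> borel_measurable (borel \<Otimes>\<^sub>M borel)"
    using a b by measurable
  interpret M1: sigma_finite_measure "restr1 S" unfolding restr1_def by (rule sigma_finite_density[OF S(1)])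
  interpret M2: sigma_finite_measure "restr2 T" unfolding restr2_def by (rule sigma_finite_density[OF T(1)])
  interpret pair_sigma_finite "restr1 S" "restr2 T" ..
  have s12: "sets (restr1 S) = sets borel" "sets (restr2 T) = sets borel" by (simp_all add: restr1_def restr2_def)
  have am: "a \<in> borel_measurable (restr1 S)" and bm: "b \<in> borel_measurable (restr2 T)"
    using a b s12 by (simp_all cong: measurable_cong_sets)
  have Fm: "?F \<in> borel_measurable (restr1 S \<Otimes>\<^sub>M restr2 T)"
    using F by (subst measurable_cong_sets[OF sets_pair_measure_cong]) (simp_all add: s12)
  have "(LINT p|(restr1 S \<Otimes>\<^sub>M restr2 T). ?F p) = (LINT p|distr \<mu> (borel \<Otimes>\<^sub>M borel) (\<lambda>p. p). (1 / k * indicator (S \<times> T) p) *\<^sub>R ?F p)"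
    unfolding pair_restrictions[OF S(1) T(1)] using Sb F k(1) by (intro integral_density) (auto intro!: AE_I2)
  also have "\<dots> = (LINT p|\<mu>. (1 / k * indicator (S \<times> T) p) *\<^sub>R ?F p)"
    using Sb F by (intro integral_distr[OF idm]) auto
  also have "\<dots> = (LINT p|\<mu>. complex_of_real (1 / k) * ?F p)"
  proof (rule Bochner_Integration.integral_cong[OF refl])
    fix p
    have "a (fst p) = 0 \<or> b (snd p) = 0 \<or> p \<in> S \<times> T" using S(2) T(2) by (auto simp: mem_Times_iff)
    then show "(1 / k * indicator (S \<times> T) p) *\<^sub>R ?F p = complex_of_real (1 / k) * ?F p"
      by (auto simp: scaleR_conv_of_real)
  qed
  also have "\<dots> = complex_of_real (1 / k) * (LINT p|\<mu>. ?F p)" by (rule integral_mult_right_zero)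
  finally have 1: "(LINT p|\<mu>. ?F p) = complex_of_real k * (LINT p|(restr1 S \<Otimes>\<^sub>M restr2 T). ?F p)"
    using k(1) by (simp add: field_simps)
  have 2: "(LINT p|(restr1 S \<Otimes>\<^sub>M restr2 T). ?F p) = (LINT x|restr1 S. a x) * (LINT y|restr2 T. b y)"
  proof (cases "integrable (restr1 S \<Otimes>\<^sub>M restr2 T) ?F")
    case True
    have "(LINT p|(restr1 S \<Otimes>\<^sub>M restr2 T). ?F p) = (LINT x|restr1 S. (LINT y|restr2 T. a x * b y))"
      using integral_fst'[OF True] by simp
    then show ?thesis by simp
  next
    case False
    have "\<not> (integrable (restr1 S) a \<and> integrable (restr2 T) b)"
    proof
      assume ab: "integrable (restr1 S) a \<and> integrable (restr2 T) b"
      have "(\<integral>\<^sup>+p. norm (?F p) \<partial>(restr1 S \<Otimes>\<^sub>M restr2 T)) = (\<integral>\<^sup>+x. (\<integral>\<^sup>+y. norm (?F (x, y)) \<partial>restr2 T) \<partial>restr1 S)"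
        by (rule M2.nn_integral_fst[symmetric]) (use Fm in measurable)
      also have "\<dots> = (\<integral>\<^sup>+x. ennreal (norm (a x)) * (\<integral>\<^sup>+y. norm (b y) \<partial>restr2 T) \<partial>restr1 S)"
        using bm by (intro nn_integral_cong) (simp add: norm_mult ennreal_mult nn_integral_cmult)
      also have "\<dots> = (\<integral>\<^sup>+x. norm (a x) \<partial>restr1 S) * (\<integral>\<^sup>+y. norm (b y) \<partial>restr2 T)"
        using am by (intro nn_integral_multc) simp
      also have "\<dots> < \<infinity>" using ab by (simp add: integrable_iff_bounded ennreal_mult_less_top)
      finally show False using False Fm by (simp add: integrable_iff_bounded)
    qed
    then have "(LINT x|restr1 S. a x) = 0 \<or> (LINT y|restr2 T. b y) = 0"
      using not_integrable_integral_eq[of "restr1 S" a] not_integrable_integral_eq[of "restr2 T" b] by auto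
    then show ?thesis using not_integrable_integral_eq[OF False] by auto
  qed
  have "(LINT x|density \<mu>1 (\<lambda>x. ennreal (indicator S x)). a x) = (LINT x|\<mu>1. indicator S x *\<^sub>R a x)"
    using a Sb by (intro integral_density) (auto cong: measurable_cong_sets)
  also have "\<dots> = (LINT x|\<mu>1. a x)"
    using S(2) by (intro Bochner_Integration.integral_cong) (auto simp: indicator_def)
  finally have 3: "(LINT x|restr1 S. a x) = (LINT x|\<mu>1. a x)" by (simp add: restr1_def ennreal_indicator)
  have "(LINT x|density \<mu>2 (\<lambda>x. ennreal (indicator T x)). b x) = (LINT x|\<mu>2. indicator T x *\<^sub>R b x)"
    using b Sb by (intro integral_density) (auto cong: measurable_cong_sets)
  also have "\<dots> = (LINT x|\<mu>2. b x)"
    using T(2) by (intro Bochner_Integration.integral_cong) (auto simp: indicator_def)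
  finally have 4: "(LINT x|restr2 T. b x) = (LINT x|\<mu>2. b x)" by (simp add: restr2_def ennreal_indicator)
  show ?thesis unfolding 1 2 3 4 by simp
qed

end

lemma locally_compact_group_prod:
  assumes "locally_compact_group TYPE('g::{topological_group_add, t2_space})"
    and "locally_compact_group TYPE('h::{topological_group_add, t2_space})"
  shows "locally_compact_group TYPE('g \<times> 'h)"
proof -
  have "locally_compact_space (prod_topology (euclidean :: 'g topology) (euclidean :: 'h topology))"
    using assms unfolding locally_compact_group_def
    by (intro iffD2[OF locally_compact_space_prod_topology] disjI2 conjI)
  then show ?thesis by (simp add: locally_compact_group_def)
qed

section \<open>Tensors of functions on the two groups\<close>

locale beurling_product =
  A: beurling \<mu>1 \<omega>1 c1 + B: beurling \<mu>2 \<omega>2 c2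
  for \<mu>1 :: "'g::{topological_group_add, t2_space} measure" and \<omega>1 c1
    and \<mu>2 :: "'h::{topological_group_add, t2_space} measure" and \<omega>2 c2 +
  fixes \<mu> :: "('g \<times> 'h) measure"
  assumes haar_prod: "left_haar_measure \<mu>"
begin

sublocale haar_product \<mu>1 \<mu>2 \<mu>
  by unfold_locales (fact A.lc B.lc A.haar B.haar haar_prod)+

lemma product_weight_eq: "(\<omega>1 \<times>\<^sub>w \<omega>2) p = \<omega>1 (fst p) * \<omega>2 (snd p)"
  by (simp add: product_weight_def case_prod_beta)

lemma product_weight_measurable: "(\<omega>1 \<times>\<^sub>w \<omega>2) \<in> borel_measurable (borel \<Otimes>\<^sub>M borel)"
  unfolding product_weight_def by measurable

sublocale P: beurling \<mu> "\<omega>1 \<times>\<^sub>w \<omega>2" "c1 * c2"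
proof unfold_locales
  show "locally_compact_group TYPE('g \<times> 'h)" by (rule locally_compact_group_prod[OF A.lc B.lc])
  show "left_haar_measure \<mu>" by (rule haar_prod)
  show "weight (\<omega>1 \<times>\<^sub>w \<omega>2)"
    unfolding weight_def
  proof (intro conjI allI)
    show "(\<omega>1 \<times>\<^sub>w \<omega>2) \<in> borel_measurable borel" by (rule pair_borel_imp_borel[OF product_weight_measurable])
    show "0 < (\<omega>1 \<times>\<^sub>w \<omega>2) x" for x using A.weight_pos B.weight_pos by (simp add: product_weight_eq)
    show "(\<omega>1 \<times>\<^sub>w \<omega>2) (x + y) \<le> (\<omega>1 \<times>\<^sub>w \<omega>2) x * (\<omega>1 \<times>\<^sub>w \<omega>2) y" for x y
      using mult_mono[OF A.weight_mult[of "fst x" "fst y"] B.weight_mult[of "snd x" "snd y"]]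
      by (simp add: product_weight_eq mult_ac)
  qed
  fix g x :: "'g \<times> 'h"
  have "\<omega>1 (fst g + fst x - fst g) * \<omega>2 (snd g + snd x - snd g) \<le> (c1 * \<omega>1 (fst x)) * (c2 * \<omega>2 (snd x))"
    by (intro mult_mono A.conj_bound B.conj_bound order_trans[OF A.weight_nonneg A.conj_bound]) auto
  then show "(\<omega>1 \<times>\<^sub>w \<omega>2) (g + x - g) \<le> c1 * c2 * (\<omega>1 \<times>\<^sub>w \<omega>2) x"
    by (simp add: product_weight_eq mult_ac)
qed

definition ten :: "('g \<Rightarrow> complex) \<Rightarrow> ('h \<Rightarrow> complex) \<Rightarrow> 'g \<times> 'h \<Rightarrow> complex" where
  "ten f h p = f (fst p) * h (snd p)"

lemma null_boxes:
  assumes "N \<in> sets borel" "emeasure \<mu>1 N = 0" "sigma_finite_set \<mu>2 T"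
  shows "N \<times> T \<in> null_sets \<mu>"
  using boxes[OF sigma_finite_setI[of N \<mu>1] assms(3)] assms sigma_finite_set_sets[OF assms(3)]
  by (auto intro!: null_setsI borel_Times)

lemma null_boxes':
  assumes "N \<in> sets borel" "emeasure \<mu>2 N = 0" "sigma_finite_set \<mu>1 T"
  shows "T \<times> N \<in> null_sets \<mu>"
  using boxes[OF assms(3) sigma_finite_setI[of N \<mu>2]] assms sigma_finite_set_sets[OF assms(3)]
  by (auto intro!: null_setsI borel_Times)

text \<open>A null set times the whole other group need not be null without \<sigma>-finiteness, so
  only boxes with one null and one \<sigma>-finite side are discarded. At a remaining point with an
  exceptional coordinate the other coordinate is not exceptional and lies off the support, so both
  tensors vanish there.\<close>

lemma ten_cong:
  assumes f: "f \<in> A.L" "AE x in \<mu>1. f x = f2 x" and h: "h \<in> B.L" "AE x in \<mu>2. h x = h2 x"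
  shows "AE p in \<mu>. ten f h p = ten f2 h2 p"
proof -
  obtain f' where f': "f' \<in> borel_measurable borel" "AE x in \<mu>1. f x = f' x" "sigma_finite_set \<mu>1 {x. f' x \<noteq> 0}"
    by (rule A.L_borel[OF f(1)])
  obtain h' where h': "h' \<in> borel_measurable borel" "AE x in \<mu>2. h x = h' x" "sigma_finite_set \<mu>2 {x. h' x \<noteq> 0}"
    by (rule B.L_borel[OF h(1)])
  let ?S = "{x. f' x \<noteq> 0}" and ?T = "{x. h' x \<noteq> 0}"
  have "AE x in \<mu>1. f x = f' x \<and> f2 x = f' x" using f(2) f'(2) by eventually_elim simp
  then obtain N where N0: "{x\<in>space \<mu>1. \<not> (f x = f' x \<and> f2 x = f' x)} \<subseteq> N" "emeasure \<mu>1 N = 0" "N \<in> sets \<mu>1"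
    by (rule AE_E)
  have N: "{x. \<not> (f x = f' x \<and> f2 x = f' x)} \<subseteq> N" "N \<in> sets borel" "emeasure \<mu>1 N = 0"
    using N0 by simp_all
  have "AE x in \<mu>2. h x = h' x \<and> h2 x = h' x" using h(2) h'(2) by eventually_elim simp
  then obtain M where M0: "{x\<in>space \<mu>2. \<not> (h x = h' x \<and> h2 x = h' x)} \<subseteq> M" "emeasure \<mu>2 M = 0" "M \<in> sets \<mu>2"
    by (rule AE_E)
  have M: "{x. \<not> (h x = h' x \<and> h2 x = h' x)} \<subseteq> M" "M \<in> sets borel" "emeasure \<mu>2 M = 0"
    using M0 by simp_all
  have fN: "f x = f' x" "f2 x = f' x" if "x \<notin> N" for x using N(1) that by auto
  have hM: "h x = h' x" "h2 x = h' x" if "x \<notin> M" for x using M(1) that by auto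
  have Msf: "sigma_finite_set \<mu>2 M" using M by (intro sigma_finite_setI) auto
  have "AE p in \<mu>. p \<notin> N \<times> ?T" by (rule AE_not_in[OF null_boxes[OF N(2,3) h'(3)]])
  moreover have "AE p in \<mu>. p \<notin> N \<times> M" by (rule AE_not_in[OF null_boxes[OF N(2,3) Msf]])
  moreover have "AE p in \<mu>. p \<notin> ?S \<times> M" by (rule AE_not_in[OF null_boxes'[OF M(2,3) f'(3)]])
  ultimately show ?thesis
  proof eventually_elim
    fix p assume p: "p \<notin> N \<times> ?T" "p \<notin> N \<times> M" "p \<notin> ?S \<times> M"
    show "ten f h p = ten f2 h2 p"
    proof (cases "fst p \<in> N")
      case True
      then have "snd p \<notin> M" "h' (snd p) = 0" using p by (auto simp: mem_Times_iff)
      then show ?thesis using hM by (simp add: ten_def)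
    next
      case False
      show ?thesis
      proof (cases "snd p \<in> M")
        case True
        then have "f' (fst p) = 0" using p by (auto simp: mem_Times_iff)
        then show ?thesis using fN False by (simp add: ten_def)
      qed (use fN hM False in \<open>simp add: ten_def\<close>)
    qed
  qed
qed

lemma ten_borel:
  assumes "f \<in> borel_measurable borel" "h \<in> borel_measurable borel"
  shows "ten f h \<in> borel_measurable (borel \<Otimes>\<^sub>M borel)"
  unfolding ten_def[abs_def] using assms by measurable

lemma ten_L:
  assumes f: "f \<in> A.L" and h: "h \<in> B.L"
  shows "ten f h \<in> P.L" "P.nrm (ten f h) = k * A.nrm f * B.nrm h"
proof -
  obtain f' where f': "f' \<in> borel_measurable borel" "AE x in \<mu>1. f x = f' x" "sigma_finite_set \<mu>1 {x. f' x \<noteq> 0}"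
    by (rule A.L_borel[OF f])
  obtain h' where h': "h' \<in> borel_measurable borel" "AE x in \<mu>2. h x = h' x" "sigma_finite_set \<mu>2 {x. h' x \<noteq> 0}"
    by (rule B.L_borel[OF h])
  have eq: "AE p in \<mu>. ten f h p = ten f' h' p" by (rule ten_cong[OF f f'(2) h h'(2)])
  have m: "ten f' h' \<in> borel_measurable (borel \<Otimes>\<^sub>M borel)" by (rule ten_borel[OF f'(1) h'(1)])
  have "ten f' h' \<in> borel_measurable \<mu>" using pair_borel_imp_borel[OF m] by (simp cong: measurable_cong_sets)
  then have mf: "ten f h \<in> borel_measurable (completion \<mu>)"
    by (intro borel_measurable_completion_AE[OF _ eq] measurable_completion)
  have am: "(\<lambda>x. ennreal (norm (f' x) * \<omega>1 x)) \<in> borel_measurable \<mu>1" "(\<lambda>x. ennreal (norm (h' x) * \<omega>2 x)) \<in> borel_measurable \<mu>2"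
    using f'(1) h'(1) by (auto intro!: measurable_compose[OF _ measurable_ennreal] borel_measurable_times cong: measurable_cong_sets)
  have "P.nn (ten f h) = P.nn (ten f' h')" by (rule P.nn_cong[OF eq])
  also have "\<dots> = ennreal k * (\<integral>\<^sup>+x. (\<integral>\<^sup>+y. norm (ten f' h' (x, y)) * (\<omega>1 \<times>\<^sub>w \<omega>2) (x, y) \<partial>\<mu>2) \<partial>\<mu>1)"
    unfolding P.nn_def
  proof (rule product_tonelli(1)[OF f'(3) h'(3)])
    show "(\<lambda>p. ennreal (norm (ten f' h' p) * (\<omega>1 \<times>\<^sub>w \<omega>2) p)) \<in> borel_measurable (borel \<Otimes>\<^sub>M borel)"
      using m product_weight_measurable by measurable
    show "x \<in> {x. f' x \<noteq> 0} \<and> y \<in> {x. h' x \<noteq> 0}" if "ennreal (norm (ten f' h' (x, y)) * (\<omega>1 \<times>\<^sub>w \<omega>2) (x, y)) \<noteq> 0" for x y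
      using that by (auto simp: ten_def)
  qed
  also have "(\<integral>\<^sup>+x. (\<integral>\<^sup>+y. norm (ten f' h' (x, y)) * (\<omega>1 \<times>\<^sub>w \<omega>2) (x, y) \<partial>\<mu>2) \<partial>\<mu>1) =
    (\<integral>\<^sup>+x. ennreal (norm (f' x) * \<omega>1 x) * (\<integral>\<^sup>+y. ennreal (norm (h' y) * \<omega>2 y) \<partial>\<mu>2) \<partial>\<mu>1)"
    unfolding nn_integral_cmult[OF am(2), symmetric]
    by (simp add: ten_def norm_mult product_weight_eq mult_ac flip: ennreal_mult)
  also have "\<dots> = A.nn f' * B.nn h'"
    unfolding nn_integral_multc[OF am(1)] A.nn_def B.nn_def ..
  finally have nn: "P.nn (ten f h) = ennreal (k * A.nrm f * B.nrm h)"
    using k(1) by (simp add: A.nn_cong[OF f'(2), symmetric] B.nn_cong[OF h'(2), symmetric] A.nn_nrm[OF f] B.nn_nrm[OF h] ennreal_mult mult.assoc)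
  then show *: "ten f h \<in> P.L" using mf by (simp add: P.L_iff)
  show "P.nrm (ten f h) = k * A.nrm f * B.nrm h"
    using nn k(1) by (simp add: P.nn_nrm[OF *])
qed

lemma ten_Z:
  assumes f: "f \<in> A.Z" and h: "h \<in> B.Z"
  shows "ten f h \<in> P.Z"
proof -
  have "AE p in \<mu>. ten f h (- g + p + g) = ten f h p" for g
  proof -
    have 1: "AE x in \<mu>1. f x = f (- fst g + x + fst g)" "AE y in \<mu>2. h y = h (- snd g + y + snd g)"
      using f h by (simp_all add: A.Z_def B.Z_def eq_commute)
    have "AE p in \<mu>. ten f h p = ten (\<lambda>x. f (- fst g + x + fst g)) (\<lambda>y. h (- snd g + y + snd g)) p"
      by (rule ten_cong[OF A.Z_subset_L[OF f] 1(1) B.Z_subset_L[OF h] 1(2)])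
    then show ?thesis by (simp add: ten_def eq_commute)
  qed
  then show ?thesis using ten_L(1)[OF A.Z_subset_L[OF f] B.Z_subset_L[OF h]] by (simp add: P.Z_def del: split_paired_All)
qed

text \<open>At a fixed point the kernel on the product group is the product of the two kernels, so
  \<open>product_integral\<close> applies and contributes the factor \<open>k\<close>. The equality
  holds at every point, also where an integral has the default value 0.\<close>

lemma ten_conv:
  assumes f: "f \<in> A.L" "f2 \<in> A.L" and h: "h \<in> B.L" "h2 \<in> B.L"
  shows "P.conv (ten f h) (ten f2 h2) = (\<lambda>p. complex_of_real k * ten (A.conv f f2) (B.conv h h2) p)"
proof -
  obtain f' S where f': "f' \<in> borel_measurable baire" "sigma_compact S" "{x. f' x \<noteq> 0} \<subseteq> S"
    "AE x in \<mu>1. f x = f' x" by (rule A.L_baire[OF f(1)])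
  obtain f2' S2 where f2': "f2' \<in> borel_measurable baire" "sigma_compact S2" "{x. f2' x \<noteq> 0} \<subseteq> S2"
    "AE x in \<mu>1. f2 x = f2' x" by (rule A.L_baire[OF f(2)])
  obtain h' T where h': "h' \<in> borel_measurable baire" "sigma_compact T" "{x. h' x \<noteq> 0} \<subseteq> T"
    "AE x in \<mu>2. h x = h' x" by (rule B.L_baire[OF h(1)])
  obtain h2' T2 where h2': "h2' \<in> borel_measurable baire" "sigma_compact T2" "{x. h2' x \<noteq> 0} \<subseteq> T2"
    "AE x in \<mu>2. h2 x = h2' x" by (rule B.L_baire[OF h(2)])
  have "P.conv (ten f h) (ten f2 h2) = P.conv (ten f' h') (ten f2' h2')"
    by (intro P.conv_cong ten_L f h ten_cong f' f2' h' h2')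
  also have "\<dots> = (\<lambda>p. complex_of_real k * ten (A.conv f f2) (B.conv h h2) p)"
  proof
    fix x :: "'g \<times> 'h"
    define a where "a y = f' y * f2' (- y + fst x)" for y
    define b where "b y = h' y * h2' (- y + snd x)" for y
    have am: "a \<in> borel_measurable borel" unfolding a_def
      by (rule borel_measurable_convolution(2)[OF A.haar f'(1) f2'(1) f'(2,3)])
    have bm: "b \<in> borel_measurable borel" unfolding b_def
      by (rule borel_measurable_convolution(2)[OF B.haar h'(1) h2'(1) h'(2,3)])
    have supp: "{x. a x \<noteq> 0} \<subseteq> S" "{x. b x \<noteq> 0} \<subseteq> T" using f'(3) h'(3) by (auto simp: a_def b_def)
    have "(\<lambda>p. a (fst p) * b (snd p)) \<in> borel_measurable (borel \<Otimes>\<^sub>M borel)" using am bm by measurable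
    then have m: "(\<lambda>p. a (fst p) * b (snd p)) \<in> borel_measurable \<mu>"
      using pair_borel_imp_borel by (simp cong: measurable_cong_sets)
    have "P.conv (ten f' h') (ten f2' h2') x = (LINT y|completion \<mu>. a (fst y) * b (snd y))"
      unfolding P.conv_def' a_def b_def by (simp add: ten_def mult_ac)
    also have "\<dots> = (LINT y|\<mu>. a (fst y) * b (snd y))" by (rule integral_completion[OF m])
    also have "\<dots> = complex_of_real k * (LINT x|\<mu>1. a x) * (LINT y|\<mu>2. b y)"
      by (rule product_integral[OF left_haar_sigma_compact[OF A.haar f'(2)] supp(1) left_haar_sigma_compact[OF B.haar h'(2)] supp(2) am bm])
    also have "(LINT x|\<mu>1. a x) = A.conv f f2 (fst x)"
      unfolding a_def by (rule A.conv_version(1)[OF f' f2'(1,4), symmetric])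
    also have "(LINT x|\<mu>2. b x) = B.conv h h2 (snd x)"
      unfolding b_def by (rule B.conv_version(1)[OF h' h2'(1,4), symmetric])
    finally show "P.conv (ten f' h') (ten f2' h2') x = complex_of_real k * ten (A.conv f f2) (B.conv h h2) x"
      unfolding ten_def[of "A.conv f f2"] by (simp only: mult.assoc)
  qed
  finally show ?thesis .
qed

end

section \<open>Approximation by simple functions\<close>

context beurling begin

lemma L_sum:
  assumes "finite V" "\<And>v. v \<in> V \<Longrightarrow> f v \<in> L"
  shows "(\<lambda>x. \<Sum>v\<in>V. f v x) \<in> L \<and> nrm (\<lambda>x. \<Sum>v\<in>V. f v x) \<le> (\<Sum>v\<in>V. nrm (f v))"
  using assms
proof (induction V rule: finite_induct)
  case empty
  show ?case using L_scale[OF L_zero, of 0] L_zero by simp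
next
  case (insert v V)
  then have 1: "f v \<in> L" "(\<lambda>x. \<Sum>v\<in>V. f v x) \<in> L" "nrm (\<lambda>x. \<Sum>v\<in>V. f v x) \<le> (\<Sum>v\<in>V. nrm (f v))" by auto
  show ?case using L_add[OF 1(1,2)] 1(3) insert(1,2) by simp
qed

lemma Z_sum:
  assumes "finite V" "\<And>v. v \<in> V \<Longrightarrow> f v \<in> Z"
  shows "(\<lambda>x. \<Sum>v\<in>V. f v x) \<in> Z"
  using assms by (induction V rule: finite_induct) (simp_all add: Z_zero Z_add)

text \<open>The given function differs from one with \<sigma>-finite support on a Borel null set,
  and this set is itself \<sigma>-finite.\<close>

lemma L_borel_support:
  assumes f: "f \<in> L" "f \<in> borel_measurable borel"
  shows "sigma_finite_set \<mu> {x. f x \<noteq> 0}"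
proof -
  obtain g where g: "g \<in> borel_measurable borel" "AE x in \<mu>. f x = g x" "sigma_finite_set \<mu> {x. g x \<noteq> 0}"
    by (rule L_borel[OF f(1)])
  have m: "{x. f x \<noteq> g x} \<in> sets borel" "{x. f x \<noteq> 0} \<in> sets borel"
  proof -
    have "{x\<in>space borel. f x \<noteq> g x} \<in> sets borel" "{x\<in>space borel. f x \<noteq> 0} \<in> sets borel"
      using f(2) g(1) by measurable
    then show "{x. f x \<noteq> g x} \<in> sets borel" "{x. f x \<noteq> 0} \<in> sets borel" by simp_all
  qed
  have "emeasure \<mu> {x. f x \<noteq> g x} = 0"
    using AE_iff_measurable[of "{x. f x \<noteq> g x}" \<mu> "\<lambda>x. f x = g x"] m(1) g(2) by simp
  then have "sigma_finite_set \<mu> ({x. g x \<noteq> 0} \<union> {x. f x \<noteq> g x})"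
    using m by (intro sigma_finite_set_Un[OF g(3)] sigma_finite_setI) simp_all
  then show ?thesis by (rule sigma_finite_set_subset) (use m in auto)
qed

lemma L_mono:
  assumes f: "f \<in> L" and g: "g \<in> borel_measurable (completion \<mu>)" and le: "\<And>x. norm (g x) \<le> C * norm (f x)" and C: "0 \<le> C"
  shows "g \<in> L"
proof -
  have "nn g \<le> nn (\<lambda>x. complex_of_real C * f x)"
    unfolding nn_def using le C by (intro nn_integral_mono ennreal_leI mult_right_mono) (simp_all add: norm_mult)
  also have "\<dots> < \<infinity>" using L_scale(1)[OF f] by (simp add: L_iff)
  finally show ?thesis using g by (simp add: L_iff)
qed

text \<open>Simple functions approximating the identity on the complex plane are composed with
  \<open>f\<close>, so the approximants are functions of the values of \<open>f\<close> and inherit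
  its invariance. The bound \<open>2 * norm v\<close> yields the dominating function
  \<open>3 * (norm (f x) * \<omega> x)\<close>.\<close>

lemma simple_composition_approx:
  assumes f: "f \<in> L" "f \<in> borel_measurable borel" and e: "e > 0"
  obtains q :: "complex \<Rightarrow> complex" where "finite (range q)" "q \<in> borel_measurable borel" "\<forall>v. norm (q v) \<le> 2 * norm v"
    "nrm (\<lambda>x. f x - q (f x)) < e"
proof -
  obtain Q :: "nat \<Rightarrow> complex \<Rightarrow> complex" where Q0: "(\<forall>i. simple_function borel (Q i)) \<and> (\<forall>x\<in>space borel. (\<lambda>i. Q i x) \<longlonglongrightarrow> x) \<and>
    (\<forall>i. \<forall>x\<in>space borel. dist (Q i x) 0 \<le> 2 * dist x 0)"
    using borel_measurable_implies_sequence_metric[of "\<lambda>x::complex. x" borel 0] by (simp del: dist_0_norm) metis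
  have Q: "simple_function borel (Q i)" "(\<lambda>i. Q i v) \<longlonglongrightarrow> v" "norm (Q i v) \<le> 2 * norm v" for i v
    using Q0 by simp_all
  have Qm: "Q i \<in> borel_measurable borel" for i using borel_measurable_simple_function[OF Q(1)] .
  have fc: "f \<in> borel_measurable (completion \<mu>)" by (rule L_measurable[OF f(1)])
  have Qf: "(\<lambda>x. Q i (f x)) \<in> borel_measurable (completion \<mu>)" for i
    by (rule measurable_compose[OF fc Qm])
  have "(\<lambda>i. LINT x|completion \<mu>. norm (f x - Q i (f x)) * \<omega> x) \<longlonglongrightarrow> (LINT x|completion \<mu>. 0)"
  proof (rule integral_dominated_convergence[where w = "\<lambda>x. 3 * (norm (f x) * \<omega> x)"])
    show "(\<lambda>x. norm (f x - Q i (f x)) * \<omega> x) \<in> borel_measurable (completion \<mu>)" for i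
      using fc Qf[of i] by (intro borel_measurable_times weight_measurable_mu) measurable
    show "integrable (completion \<mu>) (\<lambda>x. 3 * (norm (f x) * \<omega> x))"
      using f(1) by (intro integrable_mult_right) (simp add: L_def beurling_fun_def)
    show "AE x in completion \<mu>. (\<lambda>i. norm (f x - Q i (f x)) * \<omega> x) \<longlonglongrightarrow> 0"
    proof (rule AE_I2)
      fix x
      have "(\<lambda>i. norm (f x - Q i (f x)) * \<omega> x) \<longlonglongrightarrow> norm (f x - f x) * \<omega> x"
        by (intro tendsto_intros Q(2))
      then show "(\<lambda>i. norm (f x - Q i (f x)) * \<omega> x) \<longlonglongrightarrow> 0" by simp
    qed
    show "AE x in completion \<mu>. norm (norm (f x - Q i (f x)) * \<omega> x) \<le> 3 * (norm (f x) * \<omega> x)" for i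
    proof (rule AE_I2)
      fix x
      have "norm (f x - Q i (f x)) \<le> 3 * norm (f x)"
        using norm_triangle_ineq4[of "f x" "Q i (f x)"] Q(3)[of i "f x"] by simp
      then have "norm (f x - Q i (f x)) * \<omega> x \<le> 3 * norm (f x) * \<omega> x" by (rule mult_right_mono) simp
      then show "norm (norm (f x - Q i (f x)) * \<omega> x) \<le> 3 * (norm (f x) * \<omega> x)" by (simp add: abs_mult)
    qed
  qed simp
  then have "(\<lambda>i. nrm (\<lambda>x. f x - Q i (f x))) \<longlonglongrightarrow> 0" by (simp add: nrm_def beurling_fun_def)
  then have "\<forall>\<^sub>F i in sequentially. nrm (\<lambda>x. f x - Q i (f x)) < e" using e by (rule order_tendstoD(2))
  then obtain i where "nrm (\<lambda>x. f x - Q i (f x)) < e" by (auto simp: eventually_sequentially)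
  moreover have "finite (range (Q i))" using simple_functionD(1)[OF Q(1)[of i]] by simp
  ultimately show ?thesis using that[of "Q i"] Qm Q(3) by simp
qed

abbreviation ind :: "'g set \<Rightarrow> 'g \<Rightarrow> complex" where "ind E \<equiv> indicator E"

text \<open>The level sets of finitely many simple functions of the given functions; invariance is inherited.\<close>

lemma simple_approx:
  assumes F: "finite F" "F \<subseteq> L" "F \<subseteq> borel_measurable borel" and e: "e > 0"
  obtains V d where "finite V" "\<forall>E\<in>V. E \<in> sets borel \<and> ind E \<in> L" "disjoint V" "F \<subseteq> Z \<longrightarrow> (\<forall>E\<in>V. ind E \<in> Z)"
    "\<forall>f\<in>F. nrm (\<lambda>x. f x - (\<Sum>E\<in>V. d f E * ind E x)) < e"
proof -
  define good where "good f q \<longleftrightarrow> finite (range q) \<and> q \<in> borel_measurable borel \<and> (\<forall>v. norm (q v) \<le> 2 * norm v) \<and>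
    nrm (\<lambda>x. f x - q (f x)) < e" for f and q :: "complex \<Rightarrow> complex"
  have "\<exists>q. f \<in> F \<longrightarrow> good f q" for f
  proof (cases "f \<in> F")
    case True
    then have "f \<in> L" "f \<in> borel_measurable borel" using F by auto
    then obtain q :: "complex \<Rightarrow> complex" where "finite (range q)" "q \<in> borel_measurable borel" "\<forall>v. norm (q v) \<le> 2 * norm v"
      "nrm (\<lambda>x. f x - q (f x)) < e" by (rule simple_composition_approx[OF _ _ e])
    then show ?thesis unfolding good_def by blast
  qed simp
  then obtain q where q0: "\<And>f. f \<in> F \<Longrightarrow> good f (q f)" by metis
  have q: "finite (range (q f))" "q f \<in> borel_measurable borel" "norm (q f v) \<le> 2 * norm v"
    "nrm (\<lambda>x. f x - q f (f x)) < e" if "f \<in> F" for f v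
    using q0[OF that] by (auto simp: good_def)
  define s where "s x = restrict (\<lambda>f. q f (f x)) F" for x
  define E where "E t = {y. s y = t}" for t
  \<comment> \<open>The zero vector is left out because the indicator of its level set need not lie
    in \<open>L\<close>, whereas the other indicators are dominated by multiples of the functions
    \<open>q f (f x)\<close>.\<close>
  define R where "R = range s - {restrict (\<lambda>f. 0) F}"
  define V where "V = E ` R"
  have s_at: "s x f = q f (f x)" if "f \<in> F" for x f using that by (simp add: s_def)
  have "range s \<subseteq> (\<Pi>\<^sub>E f\<in>F. range (q f))" by (auto simp: s_def)
  then have "finite (range s)" using finite_PiE[OF F(1) q(1)] by (rule finite_subset)
  then have finR: "finite R" by (simp add: R_def)
  have finV: "finite V" using finR by (simp add: V_def)
  have Eb: "E t \<in> sets borel" if "t \<in> R" for t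
  proof -
    have "E t = (\<Inter>f\<in>F. {y. q f (f y) = t f}) \<inter> space borel"
    proof (intro equalityI subsetI)
      fix y assume "y \<in> (\<Inter>f\<in>F. {y. q f (f y) = t f}) \<inter> space borel"
      then have "\<And>f. f \<in> F \<Longrightarrow> s y f = t f" by (simp add: s_at)
      moreover have "\<And>f. f \<notin> F \<Longrightarrow> s y f = t f" using that by (auto simp: R_def s_def)
      ultimately have "s y = t" by blast
      then show "y \<in> E t" by (simp add: E_def)
    qed (auto simp: E_def s_at)
    moreover have "{y. q f (f y) = t f} \<in> sets borel" if "f \<in> F" for f
    proof -
      have "(\<lambda>y. q f (f y)) \<in> borel_measurable borel" using q(2)[OF that] F(3) that by (auto intro: measurable_compose)
      from measurable_sets[OF this, of "{t f}"] show ?thesis by (simp add: vimage_def)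
    qed
    ultimately show ?thesis using F(1) by (cases "F = {}") auto
  qed
  have sL: "(\<lambda>x. q f (f x)) \<in> L" if "f \<in> F" for f
  proof (rule L_mono)
    show "f \<in> L" using F that by auto
    show "(\<lambda>x. q f (f x)) \<in> borel_measurable (completion \<mu>)"
      by (rule measurable_compose[OF L_measurable[OF \<open>f \<in> L\<close>] q(2)[OF that]])
    show "norm (q f (f x)) \<le> 2 * norm (f x)" for x using q(3)[OF that] .
  qed simp
  have EL: "ind (E t) \<in> L" if t: "t \<in> R" for t
  proof -
    obtain x where x: "t = s x" using t by (auto simp: R_def)
    have "\<exists>f\<in>F. t f \<noteq> 0"
    proof (rule ccontr)
      assume "\<not> (\<exists>f\<in>F. t f \<noteq> 0)"
      then have "t = restrict (\<lambda>f. 0) F" unfolding x s_def by (auto simp: fun_eq_iff)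
      then show False using t by (simp add: R_def)
    qed
    then obtain f where f: "f \<in> F" "t f \<noteq> 0" by auto
    show ?thesis
    proof (rule L_mono[OF sL[OF f(1)]])
      have "ind (E t) \<in> borel_measurable \<mu>" using Eb[OF t] by simp
      then show "ind (E t) \<in> borel_measurable (completion \<mu>)" by (rule measurable_completion)
      show "norm (ind (E t) y) \<le> 1 / norm (t f) * norm (q f (f y))" for y
      proof (cases "y \<in> E t")
        case True
        then have "q f (f y) = t f" using s_at[OF f(1), of y] by (simp add: E_def)
        then show ?thesis using True f(2) by simp
      qed simp
    qed simp
  qed
  \<comment> \<open>For a given \<open>g\<close>, the finitely many functions are invariant off one
    common null set, and there a point and its conjugate lie in the same level set.\<close>
  have EZ: "ind (E t) \<in> Z" if t: "t \<in> R" and FZ: "F \<subseteq> Z" for t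
  proof -
    have "AE x in \<mu>. ind (E t) (- g + x + g) = ind (E t) x" for g
    proof -
      have "AE x in \<mu>. \<forall>f\<in>F. f (- g + x + g) = f x"
        by (rule AE_finite_allI[OF F(1)]) (use FZ in \<open>auto simp: Z_def\<close>)
      then show ?thesis
      proof eventually_elim
        fix x assume "\<forall>f\<in>F. f (- g + x + g) = f x"
        then have "s (- g + x + g) = s x" by (auto simp: s_def fun_eq_iff)
        then show "ind (E t) (- g + x + g) = ind (E t) x" by (simp add: E_def indicator_def)
      qed
    qed
    then show ?thesis using EL[OF t] by (simp add: Z_def)
  qed
  have disj: "disjoint V" unfolding V_def disjoint_def by (auto simp: E_def)
  \<comment> \<open>On a level set the value is constant, so any point of it can be used to read off
    the coefficient.\<close>
  define d where "d f A = q f (f (SOME x. x \<in> A))" for f and A :: "'g set"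
  have sum: "(\<Sum>A\<in>V. d f A * ind A x) = q f (f x)" if f: "f \<in> F" for f x
  proof (cases "s x \<in> R")
    case True
    have xE: "x \<in> E (s x)" by (simp add: E_def)
    have "(SOME y. y \<in> E (s x)) \<in> E (s x)" using xE by (rule someI)
    then have "s (SOME y. y \<in> E (s x)) = s x" by (simp add: E_def)
    then have cx: "d f (E (s x)) = q f (f x)" using s_at[OF f] unfolding d_def by metis
    have "(\<Sum>A\<in>V. d f A * ind A x) = (\<Sum>A\<in>{E (s x)}. d f A * ind A x)"
    proof (rule sum.mono_neutral_right[OF finV])
      show "{E (s x)} \<subseteq> V" using True by (simp add: V_def)
      show "\<forall>A\<in>V - {E (s x)}. d f A * ind A x = 0"
      proof
        fix A assume "A \<in> V - {E (s x)}"
        then have "x \<notin> A" by (auto simp: V_def E_def)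
        then show "d f A * ind A x = 0" by simp
      qed
    qed
    then show ?thesis using cx xE by simp
  next
    case False
    then have z: "s x = restrict (\<lambda>f. 0) F" by (simp add: R_def)
    then have "q f (f x) = 0" using s_at[OF f, of x] f by simp
    moreover have "x \<notin> A" if "A \<in> V" for A using that z by (auto simp: V_def E_def R_def)
    ultimately show ?thesis by simp
  qed
  show ?thesis
  proof (rule that[of V d])
    show "\<forall>E\<in>V. E \<in> sets borel \<and> ind E \<in> L" using Eb EL by (auto simp: V_def)
    show "F \<subseteq> Z \<longrightarrow> (\<forall>E\<in>V. ind E \<in> Z)" using EZ by (auto simp: V_def)
    show "\<forall>f\<in>F. nrm (\<lambda>x. f x - (\<Sum>E\<in>V. d f E * ind E x)) < e" using sum q(4) by simp
  qed (fact finV disj)+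
qed

end

section \<open>Density of elementary tensors\<close>

context haar_product begin

lemma slice_integral_measurable:
  fixes H :: "'g \<times> 'h \<Rightarrow> complex"
  assumes S: "sigma_finite_set \<mu>1 S" and H: "H \<in> borel_measurable (borel \<Otimes>\<^sub>M borel)"
    and supp: "\<And>x y. H (x, y) \<noteq> 0 \<Longrightarrow> x \<in> S"
  shows "(\<lambda>y. LINT x|\<mu>1. H (x, y)) \<in> borel_measurable borel"
proof -
  interpret M1: sigma_finite_measure "restr1 S" unfolding restr1_def by (rule sigma_finite_density[OF S])
  have Sb: "S \<in> sets borel" using sigma_finite_set_sets[OF S] by simp
  have s1: "sets (restr1 S) = sets borel" by (simp add: restr1_def)
  have "(\<lambda>p. (snd p, fst p)) \<in> borel \<Otimes>\<^sub>M restr1 S \<rightarrow>\<^sub>M (borel \<Otimes>\<^sub>M borel)"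
    using s1 by (intro measurable_Pair) (simp_all cong: measurable_cong_sets)
  from measurable_compose[OF this H]
  have "(\<lambda>(y, x). H (x, y)) \<in> borel_measurable (borel \<Otimes>\<^sub>M restr1 S)" by (simp add: case_prod_beta)
  from M1.borel_measurable_lebesgue_integral[OF this]
  have "(\<lambda>y. LINT x|restr1 S. H (x, y)) \<in> borel_measurable borel" by simp
  also have "(\<lambda>y. LINT x|restr1 S. H (x, y)) = (\<lambda>y. LINT x|\<mu>1. H (x, y))"
  proof
    fix y
    have "(\<lambda>x. H (x, y)) \<in> borel_measurable borel"
      using measurable_compose[OF measurable_Pair2'[of y borel borel] H] by simp
    then have "(LINT x|density \<mu>1 (\<lambda>x. ennreal (indicator S x)). H (x, y)) = (LINT x|\<mu>1. indicator S x *\<^sub>R H (x, y))"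
      using Sb by (intro integral_density) (auto cong: measurable_cong_sets)
    also have "\<dots> = (LINT x|\<mu>1. H (x, y))"
      using supp by (intro Bochner_Integration.integral_cong) (auto simp: indicator_def)
    finally show "(LINT x|restr1 S. H (x, y)) = (LINT x|\<mu>1. H (x, y))" by (simp add: restr1_def ennreal_indicator)
  qed
  finally show ?thesis .
qed

end

context beurling begin

text \<open>Borel representatives, in contrast to functions measurable only for the completion, have
  tensors that are measurable for the product \<sigma>-algebra.\<close>

definition Lb :: "('g \<Rightarrow> complex) set" where "Lb = L \<inter> borel_measurable borel"

lemma LbD: "f \<in> Lb \<Longrightarrow> f \<in> L" "f \<in> Lb \<Longrightarrow> f \<in> borel_measurable borel"
  by (auto simp: Lb_def)

text \<open>Dividing by the weight prepares for \<open>approximable\<close>, where tensors are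
  multiplied by the weight again and a multiple of an indicator remains.\<close>

lemma weighted_indicator_Lb:
  assumes A: "A \<in> sets borel" "emeasure \<mu> A < \<infinity>"
  shows "(\<lambda>x. z * ind A x / complex_of_real (\<omega> x)) \<in> Lb"
proof -
  have b: "(\<lambda>x. z * ind A x / complex_of_real (\<omega> x)) \<in> borel_measurable borel"
    using A by measurable
  then have "(\<lambda>x. z * ind A x / complex_of_real (\<omega> x)) \<in> borel_measurable \<mu>" by (simp cong: measurable_cong_sets)
  then have m: "(\<lambda>x. z * ind A x / complex_of_real (\<omega> x)) \<in> borel_measurable (completion \<mu>)" by (rule measurable_completion)
  have "nn (\<lambda>x. z * ind A x / complex_of_real (\<omega> x)) = (\<integral>\<^sup>+x. ennreal (norm z) * indicator A x \<partial>\<mu>)"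
    unfolding nn_def by (intro nn_integral_cong) (simp add: norm_divide norm_mult indicator_def)
  also have "\<dots> < \<infinity>" using A by (simp add: nn_integral_cmult_indicator ennreal_mult_less_top)
  finally show ?thesis using b m by (simp add: Lb_def L_iff)
qed

end

context beurling_product begin

abbreviation \<omega> where "\<omega> \<equiv> \<omega>1 \<times>\<^sub>w \<omega>2"

definition tsum :: "(('g \<Rightarrow> complex) \<times> ('h \<Rightarrow> complex)) list \<Rightarrow> 'g \<times> 'h \<Rightarrow> complex" where
  "tsum ps p = (\<Sum>(a, b)\<leftarrow>ps. ten a b p)"

lemma tsum_simps [simp]: "tsum [] p = 0" "tsum ((a, b) # ps) p = ten a b p + tsum ps p" "tsum (ps @ qs) p = tsum ps p + tsum qs p"
  by (simp_all add: tsum_def)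

lemma tsum_L: "set ps \<subseteq> A.L \<times> B.L \<Longrightarrow> tsum ps \<in> P.L"
proof (induction ps)
  case Nil
  then show ?case using P.L_zero by (simp add: tsum_def[abs_def])
next
  case (Cons q ps)
  then show ?case using P.L_add(1)[OF ten_L(1)[of "fst q" "snd q"], of "tsum ps"]
    by (cases q) (auto simp: tsum_def[abs_def])
qed

lemma tsum_borel: "set ps \<subseteq> A.Lb \<times> B.Lb \<Longrightarrow> tsum ps \<in> borel_measurable (borel \<Otimes>\<^sub>M borel)"
proof (induction ps)
  case Nil
  then show ?case by (simp add: tsum_def[abs_def])
next
  case (Cons q ps)
  then have "ten (fst q) (snd q) \<in> borel_measurable (borel \<Otimes>\<^sub>M borel)" by (intro ten_borel) (auto dest: A.LbD B.LbD)
  moreover have "tsum ps \<in> borel_measurable (borel \<Otimes>\<^sub>M borel)" using Cons by simp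
  ultimately have "(\<lambda>p. ten (fst q) (snd q) p + tsum ps p) \<in> borel_measurable (borel \<Otimes>\<^sub>M borel)" by measurable
  then show ?case by (cases q) (simp add: tsum_def[abs_def])
qed

lemma box_tensor:
  assumes "A \<in> sets borel" "emeasure \<mu>1 A < \<infinity>" "B \<in> sets borel" "emeasure \<mu>2 B < \<infinity>"
  shows "\<exists>ps. set ps \<subseteq> A.Lb \<times> B.Lb \<and> (\<forall>p. tsum ps p * complex_of_real (\<omega> p) = z * indicator (A \<times> B) p)"
proof -
  let ?a = "\<lambda>x. z * A.ind A x / complex_of_real (\<omega>1 x)" and ?b = "\<lambda>y. 1 * B.ind B y / complex_of_real (\<omega>2 y)"
  have "?a \<in> A.Lb" "?b \<in> B.Lb"
    by (rule A.weighted_indicator_Lb[OF assms(1,2)], rule B.weighted_indicator_Lb[OF assms(3,4)])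
  then show ?thesis
    by (intro exI[of _ "[(?a, ?b)]"] conjI) (auto simp: ten_def product_weight_eq indicator_def)
qed

lemma indicator_inclusion_exclusion:
  fixes z :: complex
  shows "z * indicator (X \<inter> Y) p + (- z * indicator (X \<inter> (Y \<inter> W)) p + z * indicator (Y \<inter> W) p) = z * indicator ((W \<union> X) \<inter> Y) p"
  by (simp add: indicator_def)

text \<open>Adding a box \<open>U \<times> V\<close> to the union is inclusion-exclusion: the
  overlap lies in \<open>(A \<inter> U) \<times> (B \<inter> V)\<close>, to which the induction
  hypothesis applies with coefficient \<open>- z\<close>. Hence \<open>A\<close>, \<open>B\<close>
  and \<open>z\<close> vary in the induction.\<close>

lemma finite_boxes_tensor:
  assumes "finite D" "\<forall>(U, V)\<in>D. open U \<and> open V"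
    and "A \<in> sets borel" "emeasure \<mu>1 A < \<infinity>" "B \<in> sets borel" "emeasure \<mu>2 B < \<infinity>"
  shows "\<exists>ps. set ps \<subseteq> A.Lb \<times> B.Lb \<and>
    (\<forall>p. tsum ps p * complex_of_real (\<omega> p) = z * indicator ((\<Union>(U, V)\<in>D. U \<times> V) \<inter> A \<times> B) p)"
  using assms
proof (induction D arbitrary: A B z rule: finite_induct)
  case empty
  show ?case by (intro exI[of _ "[]"]) simp
next
  case (insert q D)
  obtain U V where q: "q = (U, V)" by fastforce
  have UV: "open U" "open V" using insert.prems(1) q by simp_all
  have D: "\<forall>(U, V)\<in>D. open U \<and> open V" using insert.prems(1) by simp
  have AU: "A \<inter> U \<in> sets borel" "B \<inter> V \<in> sets borel" using insert.prems UV by auto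
  have fin: "emeasure \<mu>1 (A \<inter> U) < \<infinity>" "emeasure \<mu>2 (B \<inter> V) < \<infinity>"
  proof -
    have "emeasure \<mu>1 (A \<inter> U) \<le> emeasure \<mu>1 A" "emeasure \<mu>2 (B \<inter> V) \<le> emeasure \<mu>2 B"
      using insert.prems by (simp_all add: emeasure_mono)
    then show "emeasure \<mu>1 (A \<inter> U) < \<infinity>" "emeasure \<mu>2 (B \<inter> V) < \<infinity>"
      using insert.prems by (simp_all add: order_le_less_trans)
  qed
  obtain p1 where p1: "set p1 \<subseteq> A.Lb \<times> B.Lb"
    "\<forall>p. tsum p1 p * complex_of_real (\<omega> p) = z * indicator ((\<Union>(U, V)\<in>D. U \<times> V) \<inter> A \<times> B) p"
    using insert.IH[OF D insert.prems(2-5), of z] by (elim exE conjE) (rule that)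
  obtain p2 where p2: "set p2 \<subseteq> A.Lb \<times> B.Lb"
    "\<forall>p. tsum p2 p * complex_of_real (\<omega> p) = - z * indicator ((\<Union>(U, V)\<in>D. U \<times> V) \<inter> (A \<inter> U) \<times> (B \<inter> V)) p"
    using insert.IH[OF D AU(1) fin(1) AU(2) fin(2), of "- z"] by (elim exE conjE) (rule that)
  obtain p3 where p3: "set p3 \<subseteq> A.Lb \<times> B.Lb"
    "\<forall>p. tsum p3 p * complex_of_real (\<omega> p) = z * indicator ((A \<inter> U) \<times> (B \<inter> V)) p"
    using box_tensor[OF AU(1) fin(1) AU(2) fin(2), of z] by (elim exE conjE) (rule that)
  show ?case
  proof (intro exI[of _ "p1 @ p2 @ p3"] conjI allI)
    show "set (p1 @ p2 @ p3) \<subseteq> A.Lb \<times> B.Lb" using p1 p2 p3 by simp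
    fix p
    have box: "(A \<inter> U) \<times> (B \<inter> V) = A \<times> B \<inter> U \<times> V" by (rule Times_Int_Times[symmetric])
    have un: "(\<Union>(U, V)\<in>insert (U, V) D. U \<times> V) = U \<times> V \<union> (\<Union>(U, V)\<in>D. U \<times> V)" by simp
    have "tsum (p1 @ p2 @ p3) p * complex_of_real (\<omega> p) = z * indicator ((\<Union>(U, V)\<in>D. U \<times> V) \<inter> A \<times> B) p +
      (- z * indicator ((\<Union>(U, V)\<in>D. U \<times> V) \<inter> (A \<inter> U) \<times> (B \<inter> V)) p + z * indicator ((A \<inter> U) \<times> (B \<inter> V)) p)"
      by (simp only: tsum_simps distrib_right p1(2)[rule_format] p2(2)[rule_format] p3(2)[rule_format])
    also have "\<dots> = z * indicator ((\<Union>(U, V)\<in>insert q D. U \<times> V) \<inter> A \<times> B) p"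
      unfolding q box un by (rule indicator_inclusion_exclusion)
    finally show "tsum (p1 @ p2 @ p3) p * complex_of_real (\<omega> p) = z * indicator ((\<Union>(U, V)\<in>insert q D. U \<times> V) \<inter> A \<times> B) p" .
  qed
qed

text \<open>Multiplication by the weight turns the weighted norm into the ordinary
  \<open>L^1\<close> norm, for which induction over integrable functions is available.\<close>

definition approximable :: "('g \<times> 'h \<Rightarrow> complex) \<Rightarrow> bool" where
  "approximable u \<longleftrightarrow> (\<forall>e>0. \<exists>ps. set ps \<subseteq> A.Lb \<times> B.Lb \<and>
    (\<integral>\<^sup>+p. norm (u p - tsum ps p * complex_of_real (\<omega> p)) \<partial>\<mu>) < ennreal e)"

lemma approximableD:
  "approximable u \<Longrightarrow> 0 < e \<Longrightarrow> \<exists>ps. set ps \<subseteq> A.Lb \<times> B.Lb \<and>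
    (\<integral>\<^sup>+p. norm (u p - tsum ps p * complex_of_real (\<omega> p)) \<partial>\<mu>) < ennreal e"
  unfolding approximable_def by (elim allE impE)

lemma tsum_weight_borel: "set ps \<subseteq> A.Lb \<times> B.Lb \<Longrightarrow> (\<lambda>p. tsum ps p * complex_of_real (\<omega> p)) \<in> borel_measurable \<mu>"
  using pair_borel_imp_borel[OF tsum_borel[of ps]] by (auto cong: measurable_cong_sets intro!: borel_measurable_times)

text \<open>Regularity of \<mu> replaces \<open>E\<close> by a compact set, and this by a finite
  union of open boxes inside an open set of nearly the same measure. In this way even Borel sets
  outside the product \<sigma>-algebra are reached.\<close>

lemma approximable_indicator:
  assumes E: "E \<in> sets \<mu>" "emeasure \<mu> E < \<infinity>"
  shows "approximable (\<lambda>p. indicator E p *\<^sub>R z)"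
  unfolding approximable_def
proof (intro allI impI)
  fix e :: real assume e: "0 < e"
  \<comment> \<open>The approximant can differ from the given function only on \<open>E - K\<close>
    and \<open>U - K\<close>, each of measure below \<open>d\<close>, hence the 2. The added 1
    avoids a zero denominator.\<close>
  define d where "d = e / (2 * (norm z + 1))"
  have nz: "0 < norm z + 1" using norm_ge_zero[of z] by linarith
  have d0: "0 < d" unfolding d_def using e nz by (intro divide_pos_pos) simp_all
  then have d: "0 < ennreal d" by simp
  have Eb: "E \<in> sets borel" using E by simp
  obtain K where K: "compact K" "K \<subseteq> E" "emeasure \<mu> (E - K) < ennreal d" by (rule left_haar_inner[OF haar Eb E(2) d])
  have Kb: "K \<in> sets borel" by (rule compact_borel[OF K(1)])
  obtain U where U: "open U" "K \<subseteq> U" "emeasure \<mu> U < \<infinity>" "emeasure \<mu> (U - K) < ennreal d"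
    by (rule left_haar_outer[OF haar Kb left_haar_compact_finite[OF haar K(1)] d])
  obtain D where D: "finite D" "\<And>A B. (A, B) \<in> D \<Longrightarrow> open A \<and> open B" 
    "K \<subseteq> (\<Union>(A, B)\<in>D. A \<times> B)" "(\<Union>(A, B)\<in>D. A \<times> B) \<subseteq> U"
    by (rule compact_open_boxes[OF K(1) U(1,2)]) metis
  have D': "\<forall>(A, B)\<in>D. open A \<and> open B" using D(2) by auto
  have c: "compact (fst ` K)" "compact (snd ` K)"
    using K by (auto intro!: compact_continuous_image continuous_intros)
  \<comment> \<open>Cutting with the box of the projections of \<open>K\<close> gives the sides
    finite measure and keeps \<open>K\<close> covered.\<close>
  let ?R = "(\<Union>(A, B)\<in>D. A \<times> B) \<inter> (fst ` K) \<times> (snd ` K)"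
  obtain ps where ps: "set ps \<subseteq> A.Lb \<times> B.Lb" "\<forall>p. tsum ps p * complex_of_real (\<omega> p) = z * indicator ?R p"
    using finite_boxes_tensor[OF D(1) D' compact_borel[OF c(1)] left_haar_compact_finite[OF haar1 c(1)]
      compact_borel[OF c(2)] left_haar_compact_finite[OF haar2 c(2)], of z] by (elim exE conjE) (rule that)
  have KR: "K \<subseteq> ?R" 
  proof
    fix p assume "p \<in> K"
    then have "fst p \<in> fst ` K" "snd p \<in> snd ` K" "p \<in> (\<Union>(A, B)\<in>D. A \<times> B)" using D(3) by auto
    then show "p \<in> ?R" by (simp only: Int_iff mem_Times_iff)
  qed
  have RU: "?R \<subseteq> U" using D(4) by blast
  have m: "E - K \<in> sets \<mu>" "U - K \<in> sets \<mu>" using E Kb U by auto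
  have "(\<integral>\<^sup>+p. norm (indicator E p *\<^sub>R z - tsum ps p * complex_of_real (\<omega> p)) \<partial>\<mu>)
    \<le> (\<integral>\<^sup>+p. ennreal (norm z) * indicator (E - K) p + ennreal (norm z) * indicator (U - K) p \<partial>\<mu>)"
  proof (rule nn_integral_mono)
    fix p
    show "ennreal (norm (indicator E p *\<^sub>R z - tsum ps p * complex_of_real (\<omega> p))) \<le>
      ennreal (norm z) * indicator (E - K) p + ennreal (norm z) * indicator (U - K) p"
      using KR RU K(2) unfolding ps(2)[rule_format]
      by (cases "p \<in> E"; cases "p \<in> ?R"; cases "p \<in> K"; cases "p \<in> U") (auto simp: indicator_def)
  qed
  also have "\<dots> = ennreal (norm z) * emeasure \<mu> (E - K) + ennreal (norm z) * emeasure \<mu> (U - K)"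
    using m by (subst nn_integral_add) (simp_all add: nn_integral_cmult_indicator)
  also have "\<dots> \<le> ennreal (norm z) * ennreal d + ennreal (norm z) * ennreal d"
    using K(3) U(4) by (intro add_mono mult_left_mono) auto
  also have "\<dots> = ennreal (2 * norm z * d)"
    using d0 by (simp flip: ennreal_mult ennreal_plus)
  also have "\<dots> < ennreal e"
  proof (rule ennreal_lessI[OF e])
    have "2 * norm z * d < 2 * (norm z + 1) * d" using d0 by simp
    also have "\<dots> = d * (2 * (norm z + 1))" by (simp add: mult_ac)
    also have "\<dots> = e" unfolding d_def
    proof -
      have "2 * (norm z + 1) \<noteq> 0" using nz by simp
      then show "e / (2 * (norm z + 1)) * (2 * (norm z + 1)) = e" by (metis nonzero_eq_divide_eq)
    qed
    finally show "2 * norm z * d < e" .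
  qed
  finally show "\<exists>ps. set ps \<subseteq> A.Lb \<times> B.Lb \<and>
    (\<integral>\<^sup>+p. norm (indicator E p *\<^sub>R z - tsum ps p * complex_of_real (\<omega> p)) \<partial>\<mu>) < ennreal e"
    using ps(1) by blast
qed

lemma approximable_integrable:
  assumes "integrable \<mu> u"
  shows "approximable u"
  using assms
proof (induction rule: integrable_induct)
  case (base E z)
  then show ?case by (intro approximable_indicator) simp_all
next
  case (add f g)
  show ?case
    unfolding approximable_def
  proof (intro allI impI)
    fix e :: real assume e: "0 < e"
    then have e2: "0 < e / 2" by simp
    obtain ps where ps: "set ps \<subseteq> A.Lb \<times> B.Lb" "(\<integral>\<^sup>+p. norm (f p - tsum ps p * complex_of_real (\<omega> p)) \<partial>\<mu>) < ennreal (e / 2)"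
      using approximableD[OF add.IH(1) e2] by (elim exE conjE) (rule that)
    obtain qs where qs: "set qs \<subseteq> A.Lb \<times> B.Lb" "(\<integral>\<^sup>+p. norm (g p - tsum qs p * complex_of_real (\<omega> p)) \<partial>\<mu>) < ennreal (e / 2)"
      using approximableD[OF add.IH(2) e2] by (elim exE conjE) (rule that)
    have m0: "f \<in> borel_measurable \<mu>" "g \<in> borel_measurable \<mu>" using add.hyps(1,2) by auto
    have fm: "(\<lambda>p. ennreal (norm (f p - tsum ps p * complex_of_real (\<omega> p)))) \<in> borel_measurable \<mu>"
      "(\<lambda>p. ennreal (norm (g p - tsum qs p * complex_of_real (\<omega> p)))) \<in> borel_measurable \<mu>"
      by (intro measurable_compose[OF _ measurable_ennreal] measurable_compose[OF _ borel_measurable_norm]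
        borel_measurable_diff m0 tsum_weight_borel ps(1) qs(1))+
    have "(\<integral>\<^sup>+p. norm (f p + g p - tsum (ps @ qs) p * complex_of_real (\<omega> p)) \<partial>\<mu>) \<le>
      (\<integral>\<^sup>+p. ennreal (norm (f p - tsum ps p * complex_of_real (\<omega> p))) + ennreal (norm (g p - tsum qs p * complex_of_real (\<omega> p))) \<partial>\<mu>)"
    proof (rule nn_integral_mono)
      fix p
      have "f p + g p - tsum (ps @ qs) p * complex_of_real (\<omega> p) =
        (f p - tsum ps p * complex_of_real (\<omega> p)) + (g p - tsum qs p * complex_of_real (\<omega> p))"
        by (simp add: algebra_simps)
      then show "ennreal (norm (f p + g p - tsum (ps @ qs) p * complex_of_real (\<omega> p))) \<le>
        ennreal (norm (f p - tsum ps p * complex_of_real (\<omega> p))) + ennreal (norm (g p - tsum qs p * complex_of_real (\<omega> p)))"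
        by (metis ennreal_leI ennreal_plus norm_ge_zero norm_triangle_ineq)
    qed
    also have "\<dots> = (\<integral>\<^sup>+p. norm (f p - tsum ps p * complex_of_real (\<omega> p)) \<partial>\<mu>) + (\<integral>\<^sup>+p. norm (g p - tsum qs p * complex_of_real (\<omega> p)) \<partial>\<mu>)"
      by (rule nn_integral_add[OF fm])
    also have "\<dots> < ennreal (e / 2) + ennreal (e / 2)" using ps(2) qs(2) by (rule add_strict_mono)
    also have "\<dots> = ennreal e" using e by (simp flip: ennreal_plus)
    finally show "\<exists>ps. set ps \<subseteq> A.Lb \<times> B.Lb \<and> (\<integral>\<^sup>+p. norm (f p + g p - tsum ps p * complex_of_real (\<omega> p)) \<partial>\<mu>) < ennreal e"
      using ps(1) qs(1) by (intro exI[of _ "ps @ qs"]) simp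
  qed
next
  case (lim f s)
  show ?case
    unfolding approximable_def
  proof (intro allI impI)
    fix e :: real assume e: "0 < e"
    then have e2: "0 < e / 2" by simp
    have sm: "s i \<in> borel_measurable \<mu>" for i using lim.hyps(1)[of i] by auto
    have fmm: "f \<in> borel_measurable \<mu>" using lim.hyps(4) by auto
    have w: "(\<integral>\<^sup>+p. ennreal (2 * norm (f p)) \<partial>\<mu>) < \<infinity>"
      using lim.hyps(4) fmm by (simp add: integrable_iff_bounded ennreal_mult nn_integral_cmult ennreal_mult_less_top)
    have "(\<lambda>i. \<integral>\<^sup>+p. norm (f p - s i p) \<partial>\<mu>) \<longlonglongrightarrow> 0"
    proof (rule Bochner_Integration.nn_integral_dominated_convergence_norm[OF sm fmm _ _ w])
      show "(\<lambda>p. 2 * norm (f p)) \<in> borel_measurable \<mu>" using fmm by measurable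
      show "AE p in \<mu>. norm (s i p) \<le> 2 * norm (f p)" for i by (intro AE_I2 lim.hyps(3))
      show "AE p in \<mu>. (\<lambda>i. s i p) \<longlonglongrightarrow> f p" by (intro AE_I2 lim.hyps(2))
    qed
    then have "(\<lambda>i. \<integral>\<^sup>+p. norm (s i p - f p) \<partial>\<mu>) \<longlonglongrightarrow> 0" by (simp add: norm_minus_commute)
    then have "\<forall>\<^sub>F i in sequentially. (\<integral>\<^sup>+p. norm (s i p - f p) \<partial>\<mu>) < ennreal (e / 2)"
      by (rule order_tendstoD(2)) (use e in simp)
    then obtain i where i: "(\<integral>\<^sup>+p. norm (s i p - f p) \<partial>\<mu>) < ennreal (e / 2)" by (auto simp: eventually_sequentially)
    obtain ps where ps: "set ps \<subseteq> A.Lb \<times> B.Lb" "(\<integral>\<^sup>+p. norm (s i p - tsum ps p * complex_of_real (\<omega> p)) \<partial>\<mu>) < ennreal (e / 2)"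
      using approximableD[OF lim.IH[of i] e2] by (elim exE conjE) (rule that)
    have fm: "(\<lambda>p. ennreal (norm (s i p - f p))) \<in> borel_measurable \<mu>"
      "(\<lambda>p. ennreal (norm (s i p - tsum ps p * complex_of_real (\<omega> p)))) \<in> borel_measurable \<mu>"
      by (intro measurable_compose[OF _ measurable_ennreal] measurable_compose[OF _ borel_measurable_norm]
        borel_measurable_diff sm fmm tsum_weight_borel ps(1))+
    have "(\<integral>\<^sup>+p. norm (f p - tsum ps p * complex_of_real (\<omega> p)) \<partial>\<mu>) \<le>
      (\<integral>\<^sup>+p. ennreal (norm (s i p - f p)) + ennreal (norm (s i p - tsum ps p * complex_of_real (\<omega> p))) \<partial>\<mu>)"
    proof (rule nn_integral_mono)
      fix p
      have "norm (f p - tsum ps p * complex_of_real (\<omega> p)) \<le> norm (s i p - f p) + norm (s i p - tsum ps p * complex_of_real (\<omega> p))"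
        using norm_triangle_ineq4[of "s i p - tsum ps p * complex_of_real (\<omega> p)" "s i p - f p"] by (simp add: add.commute)
      then show "ennreal (norm (f p - tsum ps p * complex_of_real (\<omega> p))) \<le>
        ennreal (norm (s i p - f p)) + ennreal (norm (s i p - tsum ps p * complex_of_real (\<omega> p)))"
        by (metis ennreal_leI ennreal_plus norm_ge_zero)
    qed
    also have "\<dots> = (\<integral>\<^sup>+p. norm (s i p - f p) \<partial>\<mu>) + (\<integral>\<^sup>+p. norm (s i p - tsum ps p * complex_of_real (\<omega> p)) \<partial>\<mu>)"
      by (rule nn_integral_add[OF fm])
    also have "\<dots> < ennreal (e / 2) + ennreal (e / 2)" using i ps(2) by (rule add_strict_mono)
    also have "\<dots> = ennreal e" using e by (simp flip: ennreal_plus)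
    finally show "\<exists>ps. set ps \<subseteq> A.Lb \<times> B.Lb \<and> (\<integral>\<^sup>+p. norm (f p - tsum ps p * complex_of_real (\<omega> p)) \<partial>\<mu>) < ennreal e"
      using ps(1) by blast
  qed
qed

lemma tensors_dense:
  assumes F: "F \<in> P.L" and e: "0 < e"
  shows "\<exists>ps. set ps \<subseteq> A.Lb \<times> B.Lb \<and> P.nrm (\<lambda>p. F p - tsum ps p) < e"
proof -
  obtain F' where F': "F' \<in> borel_measurable borel" "AE p in \<mu>. F p = F' p" "sigma_finite_set \<mu> {p. F' p \<noteq> 0}"
    by (rule P.L_borel[OF F])
  have F'L: "F' \<in> P.L" by (rule P.L_cong[OF F F'(2)])
  let ?u = "\<lambda>p. F' p * complex_of_real (\<omega> p)"
  have um: "?u \<in> borel_measurable \<mu>" using F'(1) P.weight_measurable by (simp cong: measurable_cong_sets)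
  have int: "integrable \<mu> ?u"
    using um F'L by (simp add: integrable_iff_bounded P.L_iff P.nn_def norm_mult)
  obtain ps where ps: "set ps \<subseteq> A.Lb \<times> B.Lb" "(\<integral>\<^sup>+p. norm (?u p - tsum ps p * complex_of_real (\<omega> p)) \<partial>\<mu>) < ennreal e"
    using approximableD[OF approximable_integrable[OF int] e] by (elim exE conjE) (rule that)
  have tL: "tsum ps \<in> P.L" using ps(1) by (intro tsum_L) (auto dest: A.LbD B.LbD)
  have dL: "(\<lambda>p. F p - tsum ps p) \<in> P.L" by (rule P.L_diff[OF F tL])
  have "P.nn (\<lambda>p. F p - tsum ps p) = P.nn (\<lambda>p. F' p - tsum ps p)"
    by (rule P.nn_cong[OF eventually_mono[OF F'(2)]]) simp
  also have "\<dots> = (\<integral>\<^sup>+p. norm (?u p - tsum ps p * complex_of_real (\<omega> p)) \<partial>\<mu>)"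
    unfolding P.nn_def by (simp add: norm_mult flip: left_diff_distrib)
  finally have "ennreal (P.nrm (\<lambda>p. F p - tsum ps p)) < ennreal e" using ps(2) by (simp add: P.nn_nrm[OF dL])
  then show ?thesis using ps(1) by (auto simp: ennreal_less_iff)
qed

end

lemma sigma_compact_image:
  assumes "sigma_compact S" "continuous_on UNIV f"
  shows "sigma_compact (f ` S)"
proof -
  obtain K :: "nat \<Rightarrow> _" where K: "\<And>n. compact (K n)" "S = (\<Union>n. K n)"
    using assms(1) unfolding sigma_compact_def by metis
  have "f ` S = (\<Union>n. f ` K n)" unfolding K(2) by auto
  then show ?thesis
    unfolding sigma_compact_def
    by (intro exI[of _ "\<lambda>n. f ` K n"]) (auto intro!: compact_continuous_image continuous_on_subset[OF assms(2)] K(1))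
qed

context beurling_product begin

text \<open>
  Averaging over the sets \<open>E \<in> V\<close> in the first variable is a contraction which fixes
  \<open>\<Sum> 1\<^sub>E \<otimes> u\<^sub>E\<close>; it replaces the second factors by central functions.
\<close>

lemma averaging:
  assumes F: "F \<in> P.Z" and V: "finite V" "\<forall>E\<in>V. E \<in> sets borel \<and> A.ind E \<in> A.L" "disjoint V"
    and u: "\<forall>E\<in>V. u E \<in> B.Lb"
  obtains w where "\<forall>E\<in>V. w E \<in> B.Z \<inter> B.Lb"
    "P.nrm (\<lambda>p. F p - (\<Sum>E\<in>V. ten (A.ind E) (w E) p)) \<le> 2 * P.nrm (\<lambda>p. F p - (\<Sum>E\<in>V. ten (A.ind E) (u E) p))"
proof -
  note FL = P.Z_subset_L[OF F]
  obtain F' S0 where F': "F' \<in> borel_measurable baire" "sigma_compact S0" "{p. F' p \<noteq> 0} \<subseteq> S0"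
    "AE p in \<mu>. F p = F' p" by (rule P.L_baire[OF FL])
  have F'Z: "F' \<in> P.Z" by (rule P.Z_cong[OF F F'(4)])
  have F'm: "F' \<in> borel_measurable (borel \<Otimes>\<^sub>M borel)" by (rule measurable_baire_prod[OF F'(1)])
  \<comment> \<open>Projections of a \<sigma>-compact set are \<sigma>-compact, so \<open>F'\<close>
    lives on a box with \<sigma>-finite sides, as Tonelli's theorem demands.\<close>
  define S where "S = fst ` S0"
  define T where "T = snd ` S0"
  have Sc: "sigma_compact S" "sigma_compact T"
    unfolding S_def T_def by (intro sigma_compact_image F' continuous_intros)+
  have Ssf: "sigma_finite_set \<mu>1 S" "sigma_finite_set \<mu>2 T"
    using Sc left_haar_sigma_compact[OF haar1] left_haar_sigma_compact[OF haar2] by auto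
  have FS: "x \<in> S \<and> y \<in> T" if "F' (x, y) \<noteq> 0" for x y
    using that F'(3) unfolding S_def T_def by force
  have w1m: "\<omega>1 \<in> borel_measurable borel" and w2m: "\<omega>2 \<in> borel_measurable borel" by simp_all
  have Em: "E \<in> sets borel" "A.ind E \<in> A.L" if "E \<in> V" for E using V(2) that by auto
  have Esf: "sigma_finite_set \<mu>1 E" if "E \<in> V" for E
  proof -
    have "sigma_finite_set \<mu>1 {x. A.ind E x \<noteq> 0}"
      by (rule A.L_borel_support[OF Em(2)[OF that]]) (use Em(1)[OF that] in simp)
    then show ?thesis by (simp add: indicator_def)
  qed
  \<comment> \<open>\<open>w E\<close> is the mean of \<open>F'\<close> over \<open>E\<close> in the
    first variable, for the measure weighted by \<open>\<omega>1\<close>, which gives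
    \<open>E\<close> the mass \<open>n E\<close>. If \<open>n E = 0\<close>, division by zero makes
    \<open>w E\<close> zero, and a tensor with the indicator of \<open>E\<close> is null
    anyway.\<close>
  define n where "n E = A.nrm (A.ind E)" for E
  have n0: "0 \<le> n E" for E by (simp add: n_def)
  define g where "g E y = (LINT x|\<mu>1. A.ind E x * F' (x, y) * complex_of_real (\<omega>1 x))" for E y
  define w where "w E = (\<lambda>y. (1 / complex_of_real (n E)) * g E y)" for E
  have Hm: "(\<lambda>p. A.ind E (fst p) * F' p * complex_of_real (\<omega>1 (fst p))) \<in> borel_measurable (borel \<Otimes>\<^sub>M borel)"
    if "E \<in> V" for E
    using F'm Em(1)[OF that] w1m by measurable
  have Hy: "(\<lambda>x. A.ind E x * F' (x, y) * complex_of_real (\<omega>1 x)) \<in> borel_measurable \<mu>1" if "E \<in> V" for E y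
    using measurable_compose[OF measurable_Pair2'[of y borel borel] Hm[OF that]] by (simp cong: measurable_cong_sets)
  have gm: "g E \<in> borel_measurable borel" if "E \<in> V" for E
    unfolding g_def using slice_integral_measurable[OF Ssf(1) Hm[OF that]] FS by auto
  have gb: "ennreal (norm (g E y)) \<le> (\<integral>\<^sup>+x. norm (F' (x, y)) * \<omega>1 x \<partial>\<mu>1)" if "E \<in> V" for E y
  proof (cases "integrable \<mu>1 (\<lambda>x. A.ind E x * F' (x, y) * complex_of_real (\<omega>1 x))")
    case True
    then have "ennreal (norm (g E y)) \<le> (\<integral>\<^sup>+x. norm (A.ind E x * F' (x, y) * complex_of_real (\<omega>1 x)) \<partial>\<mu>1)"
      unfolding g_def by (rule integral_norm_bound_ennreal)
    also have "\<dots> \<le> (\<integral>\<^sup>+x. norm (F' (x, y)) * \<omega>1 x \<partial>\<mu>1)"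
      by (intro nn_integral_mono ennreal_leI) (simp add: norm_mult indicator_def)
    finally show ?thesis .
  next
    case False
    then show ?thesis by (simp add: g_def not_integrable_integral_eq)
  qed
  have slice_m: "(\<lambda>x. ennreal (norm (H (x, y)) * \<omega>1 x)) \<in> borel_measurable \<mu>1" if "H \<in> borel_measurable (borel \<Otimes>\<^sub>M borel)"
    for H :: "'g \<times> 'h \<Rightarrow> complex" and y
  proof -
    have "(\<lambda>x. H (x, y)) \<in> borel_measurable borel"
      using measurable_compose[OF measurable_Pair2'[of y borel borel] that] by simp
    then have "(\<lambda>x. ennreal (norm (H (x, y)) * \<omega>1 x)) \<in> borel_measurable borel" using w1m by measurable
    then show ?thesis by (simp cong: measurable_cong_sets)
  qed
  have nn_slices: "P.nn H = ennreal k * (\<integral>\<^sup>+y. (\<integral>\<^sup>+x. norm (H (x, y)) * \<omega>1 x \<partial>\<mu>1) * \<omega>2 y \<partial>\<mu>2)"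
    if "H \<in> borel_measurable (borel \<Otimes>\<^sub>M borel)" "sigma_finite_set \<mu>1 S'" "sigma_finite_set \<mu>2 T'"
      "\<And>x y. H (x, y) \<noteq> 0 \<Longrightarrow> x \<in> S' \<and> y \<in> T'" for H :: "'g \<times> 'h \<Rightarrow> complex" and S' T'
  proof -
    have "P.nn H = ennreal k * (\<integral>\<^sup>+y. (\<integral>\<^sup>+x. norm (H (x, y)) * \<omega> (x, y) \<partial>\<mu>1) \<partial>\<mu>2)"
      unfolding P.nn_def
    proof (rule product_tonelli(2)[OF that(2,3)])
      show "(\<lambda>p. ennreal (norm (H p) * \<omega> p)) \<in> borel_measurable (borel \<Otimes>\<^sub>M borel)"
        using that(1) product_weight_measurable by measurable
      show "x \<in> S' \<and> y \<in> T'" if "ennreal (norm (H (x, y)) * \<omega> (x, y)) \<noteq> 0" for x y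
        using that \<open>\<And>x y. H (x, y) \<noteq> 0 \<Longrightarrow> x \<in> S' \<and> y \<in> T'\<close>[of x y] by (cases "H (x, y) = 0") simp_all
    qed
    also have "(\<integral>\<^sup>+y. (\<integral>\<^sup>+x. norm (H (x, y)) * \<omega> (x, y) \<partial>\<mu>1) \<partial>\<mu>2) =
      (\<integral>\<^sup>+y. (\<integral>\<^sup>+x. norm (H (x, y)) * \<omega>1 x \<partial>\<mu>1) * \<omega>2 y \<partial>\<mu>2)"
      unfolding nn_integral_multc[OF slice_m[OF that(1)], symmetric]
      by (simp add: product_weight_eq mult_ac flip: ennreal_mult)
    finally show ?thesis .
  qed
  have gL: "g E \<in> B.L" if "E \<in> V" for E
  proof -
    have "B.nn (g E) \<le> (\<integral>\<^sup>+y. (\<integral>\<^sup>+x. norm (F' (x, y)) * \<omega>1 x \<partial>\<mu>1) * \<omega>2 y \<partial>\<mu>2)"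
      unfolding B.nn_def using gb[OF that] by (intro nn_integral_mono) (simp add: ennreal_mult mult_right_mono)
    moreover have "ennreal k * (\<integral>\<^sup>+y. (\<integral>\<^sup>+x. norm (F' (x, y)) * \<omega>1 x \<partial>\<mu>1) * \<omega>2 y \<partial>\<mu>2) < \<infinity>"
      using nn_slices[OF F'm Ssf FS] P.Z_subset_L[OF F'Z] by (simp add: P.L_iff)
    ultimately have "B.nn (g E) < \<infinity>" using k(1) by (auto simp: ennreal_mult_less_top intro: order_le_less_trans)
    moreover have "g E \<in> borel_measurable \<mu>2" using gm[OF that] by (simp cong: measurable_cong_sets)
    ultimately show ?thesis by (simp add: B.L_iff measurable_completion)
  qed
  have gZ: "g E \<in> B.Z" if E: "E \<in> V" for E
  proof -
    have "AE y in \<mu>2. g E (- h + y + h) = g E y" for h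
    proof -
      let ?c = "\<lambda>y. - h + y + h"
      \<comment> \<open>Invariance of \<open>F'\<close> under conjugation by \<open>(0, h)\<close>
        says that \<open>H\<close> is null. Tonelli's theorem passes this to almost every slice, so
        the means over \<open>E\<close> at \<open>y\<close> and at its conjugate agree.\<close>
      define H where "H = (\<lambda>p. F' (fst p, ?c (snd p)) - F' p)"
      have cm: "?c \<in> borel \<rightarrow>\<^sub>M borel" by (intro borel_measurable_continuous_onI continuous_intros)
      have "(\<lambda>p::'g \<times> 'h. (fst p, ?c (snd p))) \<in> borel \<Otimes>\<^sub>M borel \<rightarrow>\<^sub>M (borel \<Otimes>\<^sub>M borel)"
        using measurable_compose[OF measurable_snd cm] by (intro measurable_Pair) simp_all
      from measurable_compose[OF this F'm] have Hm': "H \<in> borel_measurable (borel \<Otimes>\<^sub>M borel)"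
        unfolding H_def using F'm by measurable
      have T': "sigma_finite_set \<mu>2 (T \<union> (\<lambda>y. h + y + - h) ` T)"
        by (intro sigma_finite_set_Un Ssf left_haar_sigma_compact[OF haar2] sigma_compact_image Sc continuous_intros)
      have supp: "x \<in> S \<and> y \<in> T \<union> (\<lambda>y. h + y + - h) ` T" if "H (x, y) \<noteq> 0" for x y
      proof (cases "F' (x, y) = 0")
        case True
        then have "F' (x, ?c y) \<noteq> 0" using that by (simp add: H_def)
        then have "x \<in> S" "?c y \<in> T" using FS by auto
        moreover have "y = h + ?c y + - h" by (simp only: add.assoc add_minus_cancel right_minus add_0_right)
        ultimately show ?thesis by blast
      qed (use FS in auto)
      have "AE p in \<mu>. F' (- (0, h) + p + (0, h)) = F' p" using F'Z unfolding P.Z_def by blast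
      then have "AE p in \<mu>. H p = 0" by eventually_elim (simp add: H_def plus_prod_def uminus_prod_def)
      then have "P.nn H = P.nn (\<lambda>p. 0)" by (rule P.nn_cong)
      then have "P.nn H = 0" by (simp add: P.nn_def)
      then have z: "(\<integral>\<^sup>+y. (\<integral>\<^sup>+x. norm (H (x, y)) * \<omega>1 x \<partial>\<mu>1) * \<omega>2 y \<partial>\<mu>2) = 0"
        using nn_slices[OF Hm' Ssf(1) T' supp] k(1) by simp
      have nm: "(\<lambda>p. ennreal (norm (H p) * \<omega>1 (fst p))) \<in> borel_measurable (borel \<Otimes>\<^sub>M borel)"
        using Hm' w1m by measurable
      have "(\<lambda>y. \<integral>\<^sup>+x. ennreal (norm (H (x, y)) * \<omega>1 (fst (x, y))) \<partial>\<mu>1) \<in> borel_measurable borel"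
        by (rule product_tonelli(4)[OF Ssf(1) T' nm]) (use supp in force)
      then have "(\<lambda>y. (\<integral>\<^sup>+x. ennreal (norm (H (x, y)) * \<omega>1 x) \<partial>\<mu>1) * \<omega>2 y) \<in> borel_measurable \<mu>2"
        using w2m by (simp cong: measurable_cong_sets)
      from nn_integral_0_iff_AE[OF this] z
      have "AE y in \<mu>2. (\<integral>\<^sup>+x. norm (H (x, y)) * \<omega>1 x \<partial>\<mu>1) * \<omega>2 y = 0" by simp
      then show ?thesis
      proof eventually_elim
        fix y assume "(\<integral>\<^sup>+x. norm (H (x, y)) * \<omega>1 x \<partial>\<mu>1) * \<omega>2 y = 0"
        then have "(\<integral>\<^sup>+x. norm (H (x, y)) * \<omega>1 x \<partial>\<mu>1) = 0" by simp
        then have "AE x in \<mu>1. ennreal (norm (H (x, y)) * \<omega>1 x) = 0"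
          using nn_integral_0_iff_AE[OF slice_m[OF Hm']] by simp
        then have ae: "AE x in \<mu>1. A.ind E x * F' (x, ?c y) * complex_of_real (\<omega>1 x) = A.ind E x * F' (x, y) * complex_of_real (\<omega>1 x)"
          by eventually_elim (simp add: H_def ennreal_eq_0_iff mult_le_0_iff)
        show "g E (?c y) = g E y"
          unfolding g_def by (rule integral_cong_AE[OF Hy[OF E] Hy[OF E] ae])
      qed
    qed
    then show ?thesis using gL[OF E] by (simp add: B.Z_def)
  qed
  have wZ: "w E \<in> B.Z \<inter> B.Lb" if "E \<in> V" for E
  proof -
    have "w E \<in> B.Z" unfolding w_def by (rule B.Z_scale[OF gZ[OF that]])
    moreover have "w E \<in> borel_measurable borel" unfolding w_def using gm[OF that] by measurable
    ultimately show ?thesis by (simp add: B.Lb_def B.Z_subset_L)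
  qed
  define I where "I E y = (\<integral>\<^sup>+x. indicator E x * norm (u E y - F' (x, y)) * \<omega>1 x \<partial>\<mu>1)" for E y
  \<comment> \<open>The mass \<open>n E\<close> times \<open>u E y - w E y\<close> is the weighted
    integral of \<open>u E y - F' (x, y)\<close> over \<open>E\<close>. This is the contraction
    property for a single set.\<close>
  have key: "ennreal (n E * norm (u E y - w E y)) \<le> I E y" if E: "E \<in> V" for E y
  proof (cases "n E = 0 \<or> I E y = \<infinity>")
    case False
    then have nz: "n E \<noteq> 0" and Ifin: "I E y < \<infinity>" by (auto simp: less_top)
    define d where "d x = A.ind E x * (u E y - F' (x, y)) * complex_of_real (\<omega>1 x)" for x
    define e where "e x = complex_of_real (indicator E x * \<omega>1 x)" for x
    have nE: "has_bochner_integral \<mu>1 e (complex_of_real (n E))"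
    proof -
      have "(\<integral>\<^sup>+x. ennreal (indicator E x * \<omega>1 x) \<partial>\<mu>1) = A.nn (A.ind E)"
        unfolding A.nn_def by (intro nn_integral_cong) (simp add: indicator_def)
      also have "\<dots> = ennreal (n E)" using A.nn_nrm[OF Em(2)[OF E]] by (simp add: n_def)
      finally have "has_bochner_integral \<mu>1 (\<lambda>x. indicator E x * \<omega>1 x) (n E)"
        using Em(1)[OF E] w1m n0[of E] by (intro has_bochner_integral_nn_integral) (auto cong: measurable_cong_sets)
      then show ?thesis unfolding e_def by (rule has_bochner_integral_of_real)
    qed
    have em: "e \<in> borel_measurable \<mu>1" using nE by (auto simp: has_bochner_integral_iff)
    have dm: "d \<in> borel_measurable \<mu>1"
    proof -
      have "d = (\<lambda>x. u E y * e x - A.ind E x * F' (x, y) * complex_of_real (\<omega>1 x))"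
        by (auto simp: d_def e_def indicator_def algebra_simps)
      then show ?thesis using em Hy[OF E, of y] by simp
    qed
    have Id: "I E y = (\<integral>\<^sup>+x. norm (d x) \<partial>\<mu>1)"
      unfolding I_def d_def by (intro nn_integral_cong) (simp add: norm_mult indicator_def)
    have di: "integrable \<mu>1 d" using dm Ifin by (simp add: integrable_iff_bounded Id)
    have ei: "integrable \<mu>1 e" using nE by (simp add: has_bochner_integral_iff)
    have "g E y = (LINT x|\<mu>1. u E y * e x - d x)"
      unfolding g_def by (intro Bochner_Integration.integral_cong refl) (simp add: d_def e_def indicator_def algebra_simps)
    also have "\<dots> = u E y * complex_of_real (n E) - (LINT x|\<mu>1. d x)"
      using di ei nE by (simp add: has_bochner_integral_iff)
    finally have gE: "g E y = u E y * complex_of_real (n E) - (LINT x|\<mu>1. d x)" .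
    have "complex_of_real (n E) * w E y = g E y" using nz by (simp add: w_def)
    then have "complex_of_real (n E) * (u E y - w E y) = (LINT x|\<mu>1. d x)"
      by (simp add: right_diff_distrib gE mult.commute)
    then have "n E * norm (u E y - w E y) = norm (LINT x|\<mu>1. d x)"
      using n0[of E] by (metis abs_of_nonneg norm_mult norm_of_real)
    then show ?thesis unfolding Id using integral_norm_bound_ennreal[OF di] by simp
  qed (use n0 in auto)
  define G where "G = (\<lambda>p. F' p - (\<Sum>E\<in>V. ten (A.ind E) (u E) p))"
  have uL: "u E \<in> B.L" "u E \<in> borel_measurable borel" if "E \<in> V" for E using u that B.LbD by auto
  have tm: "ten (A.ind E) (u E) \<in> borel_measurable (borel \<Otimes>\<^sub>M borel)" if "E \<in> V" for E
    by (rule ten_borel) (use Em(1)[OF that] uL(2)[OF that] in simp_all)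
  have Gm: "G \<in> borel_measurable (borel \<Otimes>\<^sub>M borel)"
    unfolding G_def using F'm tm by (intro borel_measurable_diff borel_measurable_sum)
  have fin_UN: "sigma_finite_set M (\<Union>E\<in>W. X E)" if "finite W" "\<And>E. E \<in> W \<Longrightarrow> sigma_finite_set M (X E)"
    for M :: "'z measure" and W :: "'g set set" and X
    using that
  proof (induction W rule: finite_induct)
    case empty
    show ?case by (rule sigma_finite_setI) simp_all
  next
    case (insert E W)
    then show ?case by (simp add: sigma_finite_set_Un)
  qed
  define S' where "S' = S \<union> (\<Union>E\<in>V. E)"
  define T' where "T' = T \<union> (\<Union>E\<in>V. {y. u E y \<noteq> 0})"
  have S': "sigma_finite_set \<mu>1 S'" unfolding S'_def
    by (intro sigma_finite_set_Un Ssf fin_UN V Esf)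
  have T': "sigma_finite_set \<mu>2 T'" unfolding T'_def
    by (intro sigma_finite_set_Un Ssf fin_UN V B.L_borel_support uL)
  have Gsupp: "x \<in> S' \<and> y \<in> T'" if "G (x, y) \<noteq> 0" for x y
  proof (cases "F' (x, y) = 0")
    case True
    then have "(\<Sum>E\<in>V. ten (A.ind E) (u E) (x, y)) \<noteq> 0" using that by (simp add: G_def)
    then obtain E where "E \<in> V" "ten (A.ind E) (u E) (x, y) \<noteq> 0" by (meson sum.not_neutral_contains_not_neutral)
    then show ?thesis unfolding S'_def T'_def by (auto simp: ten_def indicator_def split: if_splits)
  next
    case False
    then show ?thesis using FS unfolding S'_def T'_def by auto
  qed
  \<comment> \<open>By disjointness at most one of the sets contains \<open>x\<close>, and on it the
    difference \<open>u E y - F' (x, y)\<close> is \<open>G (x, y)\<close> up to sign.\<close>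
  have Ipoint: "(\<Sum>E\<in>V. indicator E x * norm (u E y - F' (x, y)) * \<omega>1 x) \<le> norm (G (x, y)) * \<omega>1 x" for x y
  proof (cases "\<exists>E\<in>V. x \<in> E")
    case True
    then obtain E where E: "E \<in> V" "x \<in> E" by auto
    have other: "x \<notin> E'" if "E' \<in> V - {E}" for E' using V(3) E that unfolding disjoint_def by auto
    have "(\<Sum>E\<in>V. indicator E x * norm (u E y - F' (x, y)) * \<omega>1 x) = (\<Sum>E\<in>{E}. indicator E x * norm (u E y - F' (x, y)) * \<omega>1 x)"
      using E other by (intro sum.mono_neutral_right V) auto
    moreover have "(\<Sum>E\<in>V. ten (A.ind E) (u E) (x, y)) = (\<Sum>E\<in>{E}. ten (A.ind E) (u E) (x, y))"
      using E other by (intro sum.mono_neutral_right V) (auto simp: ten_def)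
    ultimately show ?thesis using E by (simp add: G_def ten_def norm_minus_commute)
  next
    case False
    then have "(\<Sum>E\<in>V. indicator E x * norm (u E y - F' (x, y)) * \<omega>1 x) = 0" by (intro sum.neutral) auto
    then show ?thesis by simp
  qed
  have Jm: "(\<lambda>p. ennreal (indicator E (fst p) * norm (u E (snd p) - F' p) * \<omega>1 (fst p))) \<in> borel_measurable (borel \<Otimes>\<^sub>M borel)"
    if "E \<in> V" for E
    using F'm Em(1)[OF that] uL(2)[OF that] w1m by measurable
  have Jy: "(\<lambda>x. ennreal (indicator E x * norm (u E y - F' (x, y)) * \<omega>1 x)) \<in> borel_measurable \<mu>1" if "E \<in> V" for E y
    using measurable_compose[OF measurable_Pair2'[of y borel borel] Jm[OF that]] by (simp cong: measurable_cong_sets)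
  have Im: "I E \<in> borel_measurable \<mu>2" if "E \<in> V" for E
  proof -
    have "(\<lambda>p. ennreal (indicator E (fst p) * norm (u E (snd p) - F' p) * \<omega>1 (fst p))) \<in> borel_measurable (\<mu>1 \<Otimes>\<^sub>M \<mu>2)"
      using Jm[OF that] by (subst measurable_cong_sets[OF sets_pair_measure_cong]) auto
    from borel_measurable_nn_integral_support[OF Esf[OF that] this]
    show ?thesis unfolding I_def by (auto simp: indicator_def split: if_splits)
  qed
  have dL: "(\<lambda>y. u E y - w E y) \<in> B.L" if "E \<in> V" for E
    using B.L_diff[OF uL(1)[OF that]] wZ[OF that] B.LbD by auto
  \<comment> \<open>The change from the tensors with \<open>u\<close> to those with
    \<open>w\<close>. Its norm is at most the norm of \<open>G\<close>, hence the factor 2 in the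
    conclusion.\<close>
  define R where "R = (\<lambda>p. \<Sum>E\<in>V. ten (A.ind E) (\<lambda>y. u E y - w E y) p)"
  have RL: "R \<in> P.L" "P.nrm R \<le> (\<Sum>E\<in>V. P.nrm (ten (A.ind E) (\<lambda>y. u E y - w E y)))"
    unfolding R_def using P.L_sum[OF V(1), of "\<lambda>E. ten (A.ind E) (\<lambda>y. u E y - w E y)"] ten_L(1)[OF Em(2) dL] by auto
  have "ennreal (P.nrm R) \<le> ennreal (\<Sum>E\<in>V. k * n E * B.nrm (\<lambda>y. u E y - w E y))"
    using RL(2) ten_L(2)[OF Em(2) dL] by (intro ennreal_leI) (simp add: n_def)
  also have "\<dots> = (\<Sum>E\<in>V. ennreal k * (ennreal (n E) * B.nn (\<lambda>y. u E y - w E y)))"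
    using k(1) n0 dL by (subst sum_ennreal[symmetric]) (auto simp: B.nn_nrm ennreal_mult mult.assoc intro!: sum.cong)
  also have "\<dots> \<le> (\<Sum>E\<in>V. ennreal k * (\<integral>\<^sup>+y. I E y * \<omega>2 y \<partial>\<mu>2))"
  proof (intro sum_mono mult_left_mono)
    fix E assume E: "E \<in> V"
    have "ennreal (n E) * B.nn (\<lambda>y. u E y - w E y) = (\<integral>\<^sup>+y. ennreal (n E) * ennreal (norm (u E y - w E y) * \<omega>2 y) \<partial>completion \<mu>2)"
      unfolding B.nn_def nn_integral_completion[of \<mu>2, symmetric]
      by (rule nn_integral_cmult[OF B.nn_borel[OF B.L_measurable[OF dL[OF E]]], symmetric])
    also have "\<dots> = (\<integral>\<^sup>+y. ennreal (n E * norm (u E y - w E y)) * ennreal (\<omega>2 y) \<partial>\<mu>2)"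
      using n0[of E] by (simp add: nn_integral_completion mult.assoc flip: ennreal_mult)
    also have "\<dots> \<le> (\<integral>\<^sup>+y. I E y * \<omega>2 y \<partial>\<mu>2)"
      by (intro nn_integral_mono mult_right_mono key[OF E]) simp
    finally show "ennreal (n E) * B.nn (\<lambda>y. u E y - w E y) \<le> (\<integral>\<^sup>+y. I E y * \<omega>2 y \<partial>\<mu>2)" .
  qed simp
  also have "\<dots> = ennreal k * (\<integral>\<^sup>+y. (\<Sum>E\<in>V. I E y * \<omega>2 y) \<partial>\<mu>2)"
    using Im by (subst nn_integral_sum) (auto simp: sum_distrib_left intro!: borel_measurable_times_ennreal)
  also have "\<dots> \<le> ennreal k * (\<integral>\<^sup>+y. (\<integral>\<^sup>+x. norm (G (x, y)) * \<omega>1 x \<partial>\<mu>1) * \<omega>2 y \<partial>\<mu>2)"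
  proof (intro mult_left_mono nn_integral_mono)
    fix y
    have "(\<Sum>E\<in>V. I E y) = (\<integral>\<^sup>+x. (\<Sum>E\<in>V. ennreal (indicator E x * norm (u E y - F' (x, y)) * \<omega>1 x)) \<partial>\<mu>1)"
      unfolding I_def using Jy by (intro nn_integral_sum[symmetric]) auto
    also have "\<dots> \<le> (\<integral>\<^sup>+x. norm (G (x, y)) * \<omega>1 x \<partial>\<mu>1)"
      using Ipoint by (intro nn_integral_mono) (simp add: sum_ennreal ennreal_leI)
    finally have "(\<Sum>E\<in>V. I E y) * \<omega>2 y \<le> (\<integral>\<^sup>+x. norm (G (x, y)) * \<omega>1 x \<partial>\<mu>1) * \<omega>2 y"
      by (rule mult_right_mono) simp
    then show "(\<Sum>E\<in>V. I E y * \<omega>2 y) \<le> (\<integral>\<^sup>+x. norm (G (x, y)) * \<omega>1 x \<partial>\<mu>1) * \<omega>2 y"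
      by (simp add: sum_distrib_right)
  qed simp
  also have "\<dots> = P.nn G" by (rule nn_slices[OF Gm S' T' Gsupp, symmetric])
  also have "P.nn G = P.nn (\<lambda>p. F p - (\<Sum>E\<in>V. ten (A.ind E) (u E) p))"
    unfolding G_def by (rule P.nn_cong[OF eventually_mono[OF F'(4)]]) simp
  also have "\<dots> = ennreal (P.nrm (\<lambda>p. F p - (\<Sum>E\<in>V. ten (A.ind E) (u E) p)))"
    using P.L_sum[OF V(1), of "\<lambda>E. ten (A.ind E) (u E)"] ten_L(1)[OF Em(2) uL(1)] FL by (intro P.nn_nrm P.L_diff) auto
  finally have Rle: "P.nrm R \<le> P.nrm (\<lambda>p. F p - (\<Sum>E\<in>V. ten (A.ind E) (u E) p))" by simp
  have "(\<lambda>p. F p - (\<Sum>E\<in>V. ten (A.ind E) (w E) p)) = (\<lambda>p. (F p - (\<Sum>E\<in>V. ten (A.ind E) (u E) p)) + R p)"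
    by (auto simp: R_def ten_def algebra_simps sum_subtractf)
  moreover have "P.nrm (\<lambda>p. (F p - (\<Sum>E\<in>V. ten (A.ind E) (u E) p)) + R p) \<le>
    P.nrm (\<lambda>p. F p - (\<Sum>E\<in>V. ten (A.ind E) (u E) p)) + P.nrm R"
    using P.L_sum[OF V(1), of "\<lambda>E. ten (A.ind E) (u E)"] ten_L(1)[OF Em(2) uL(1)] FL
    by (intro P.L_add(2) RL(1) P.L_diff) auto
  ultimately show ?thesis using that[of w] wZ Rle by simp
qed

end

context beurling begin

lemma nrm_minus: "nrm (\<lambda>x. f x - g x) = nrm (\<lambda>x. g x - f x)"
  by (simp add: nrm_def beurling_fun_def norm_minus_commute)

text \<open>Null sets are removed so that distinct members of \<open>V\<close> have distinct classes.\<close>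

lemma simple_approx_nonnull:
  assumes F: "finite F" "F \<subseteq> L" "F \<subseteq> borel_measurable borel" and e: "e > 0"
  obtains V d where "finite V" "\<forall>E\<in>V. E \<in> sets borel \<and> ind E \<in> L \<and> nrm (ind E) \<noteq> 0" "disjoint V"
    "F \<subseteq> Z \<longrightarrow> (\<forall>E\<in>V. ind E \<in> Z)"
    "\<forall>f\<in>F. nrm (\<lambda>x. f x - (\<Sum>E\<in>V. d f E * ind E x)) < e"
proof -
  obtain V d where V: "finite V" "\<forall>E\<in>V. E \<in> sets borel \<and> ind E \<in> L" "disjoint V" "F \<subseteq> Z \<longrightarrow> (\<forall>E\<in>V. ind E \<in> Z)"
    "\<forall>f\<in>F. nrm (\<lambda>x. f x - (\<Sum>E\<in>V. d f E * ind E x)) < e"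
    by (rule simple_approx[OF F e])
  define V' where "V' = {E\<in>V. nrm (ind E) \<noteq> 0}"
  have "AE x in \<mu>. \<forall>E\<in>V - V'. ind E x = 0"
  proof (rule AE_finite_allI)
    fix E assume "E \<in> V - V'"
    then show "AE x in \<mu>. ind E x = 0" using nrm_eq_0[of "ind E"] V(2) by (auto simp: V'_def)
  qed (use V(1) in simp)
  then have eq: "AE x in \<mu>. f x - (\<Sum>E\<in>V. d f E * ind E x) = f x - (\<Sum>E\<in>V'. d f E * ind E x)" for f
  proof eventually_elim
    fix x assume "\<forall>E\<in>V - V'. ind E x = 0"
    then have "(\<Sum>E\<in>V. d f E * ind E x) = (\<Sum>E\<in>V'. d f E * ind E x)"
      by (intro sum.mono_neutral_right V(1)) (auto simp: V'_def)
    then show "f x - (\<Sum>E\<in>V. d f E * ind E x) = f x - (\<Sum>E\<in>V'. d f E * ind E x)" by simp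
  qed
  have close: "nrm (\<lambda>x. f x - (\<Sum>E\<in>V'. d f E * ind E x)) < e" if f: "f \<in> F" for f
  proof -
    have "(\<lambda>x. f x - (\<Sum>E\<in>V. d f E * ind E x)) \<in> L"
      using F f V L_sum[OF V(1), of "\<lambda>E x. d f E * ind E x"] by (intro L_diff) (auto intro: L_scale)
    from nrm_cong[OF this eq] have "nrm (\<lambda>x. f x - (\<Sum>E\<in>V. d f E * ind E x)) = nrm (\<lambda>x. f x - (\<Sum>E\<in>V'. d f E * ind E x))" .
    moreover have "nrm (\<lambda>x. f x - (\<Sum>E\<in>V. d f E * ind E x)) < e" using V(5) f by blast
    ultimately show ?thesis by (simp only:)
  qed
  show ?thesis
  proof (rule that[of V' d])
    show "finite V'" using V(1) by (simp add: V'_def)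
    show "\<forall>E\<in>V'. E \<in> sets borel \<and> ind E \<in> L \<and> nrm (ind E) \<noteq> 0" using V(2) by (simp add: V'_def)
    show "disjoint V'" using V(3) by (auto simp: V'_def disjoint_def)
    show "F \<subseteq> Z \<longrightarrow> (\<forall>E\<in>V'. ind E \<in> Z)" using V(4) by (simp add: V'_def)
    show "\<forall>f\<in>F. nrm (\<lambda>x. f x - (\<Sum>E\<in>V'. d f E * ind E x)) < e" using close by blast
  qed
qed

end

context beurling_product begin

lemma nrm_tsum: "set ps \<subseteq> A.L \<times> B.L \<Longrightarrow> P.nrm (tsum ps) \<le> (\<Sum>(a, b)\<leftarrow>ps. k * A.nrm a * B.nrm b)"
proof (induction ps)
  case Nil
  have "P.nrm (\<lambda>p. 0) = 0" using P.nrm_eq_0[OF P.L_zero] by simp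
  then show ?case by (simp add: tsum_def[abs_def])
next
  case (Cons q ps)
  obtain a b where q: "q = (a, b)" by fastforce
  have ab: "a \<in> A.L" "b \<in> B.L" and ps: "set ps \<subseteq> A.L \<times> B.L" using Cons.prems q by auto
  have "P.nrm (\<lambda>p. ten a b p + tsum ps p) \<le> P.nrm (ten a b) + P.nrm (tsum ps)"
    by (rule P.L_add(2)[OF ten_L(1)[OF ab] tsum_L[OF ps]])
  moreover have "tsum (q # ps) = (\<lambda>p. ten a b p + tsum ps p)" by (auto simp: q)
  ultimately show ?case using Cons.IH[OF ps] ten_L(2)[OF ab] by (simp add: q)
qed

text \<open>By disjointness at most one summand is nonzero at each point, so the modulus of the sum
  is the sum of the moduli. This supplies the norm condition on the basis vectors in
  \<open>projective_tensor_iso\<close>.\<close>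

lemma disjoint_nrm:
  assumes V: "finite V" "\<forall>E\<in>V. A.ind E \<in> A.L" "disjoint V" and u: "\<forall>E\<in>V. u E \<in> B.L"
  shows "P.nrm (\<lambda>p. \<Sum>E\<in>V. ten (A.ind E) (u E) p) = (\<Sum>E\<in>V. k * A.nrm (A.ind E) * B.nrm (u E))"
proof -
  have L: "ten (A.ind E) (u E) \<in> P.L" "P.nrm (ten (A.ind E) (u E)) = k * A.nrm (A.ind E) * B.nrm (u E)" if "E \<in> V" for E
    using ten_L V u that by auto
  have sL: "(\<lambda>p. \<Sum>E\<in>V. ten (A.ind E) (u E) p) \<in> P.L" using P.L_sum[OF V(1) L(1)] by simp
  have pt: "norm (\<Sum>E\<in>V. ten (A.ind E) (u E) p) = (\<Sum>E\<in>V. norm (ten (A.ind E) (u E) p))" for p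
  proof (cases "\<exists>E\<in>V. fst p \<in> E")
    case True
    then obtain E where E: "E \<in> V" "fst p \<in> E" by auto
    have "fst p \<notin> E'" if "E' \<in> V - {E}" for E' using V(3) E that unfolding disjoint_def by auto
    then have z: "\<forall>E'\<in>V - {E}. ten (A.ind E') (u E') p = 0" by (simp add: ten_def)
    have "(\<Sum>E\<in>V. ten (A.ind E) (u E) p) = (\<Sum>E\<in>{E}. ten (A.ind E) (u E) p)"
      using E z by (intro sum.mono_neutral_right V(1)) auto
    moreover have "(\<Sum>E\<in>V. norm (ten (A.ind E) (u E) p)) = (\<Sum>E\<in>{E}. norm (ten (A.ind E) (u E) p))"
      using E z by (intro sum.mono_neutral_right V(1)) auto
    ultimately show ?thesis by simp
  next
    case False
    then have "\<forall>E\<in>V. ten (A.ind E) (u E) p = 0" by (auto simp: ten_def)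
    then show ?thesis by simp
  qed
  have "P.nn (\<lambda>p. \<Sum>E\<in>V. ten (A.ind E) (u E) p) = (\<integral>\<^sup>+p. (\<Sum>E\<in>V. ennreal (norm (ten (A.ind E) (u E) p) * \<omega> p)) \<partial>completion \<mu>)"
    unfolding P.nn_def nn_integral_completion[of \<mu>, symmetric] pt by (simp add: sum_distrib_right)
  also have "\<dots> = (\<Sum>E\<in>V. \<integral>\<^sup>+p. ennreal (norm (ten (A.ind E) (u E) p) * \<omega> p) \<partial>completion \<mu>)"
    by (intro nn_integral_sum P.nn_borel P.L_measurable L)
  also have "\<dots> = (\<Sum>E\<in>V. ennreal (P.nrm (ten (A.ind E) (u E))))"
    using P.nn_nrm[OF L(1)] by (simp add: P.nn_def nn_integral_completion)
  also have "\<dots> = ennreal (\<Sum>E\<in>V. k * A.nrm (A.ind E) * B.nrm (u E))"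
    using L(2) k(1) by (subst sum_ennreal) auto
  finally show ?thesis
    using k(1) by (simp add: P.nn_nrm[OF sL] sum_nonneg)
qed

text \<open>Making the first factors simple raises the error from \<open>e\<close> to at most
  \<open>2 * e\<close>, and averaging at most doubles it again, hence 4. Central first factors stay
  central, so a second application with the variables exchanged does not spoil the first.\<close>

lemma centralise_second:
  assumes F: "F \<in> P.Z" and ps: "set ps \<subseteq> A.Lb \<times> B.Lb" and e: "P.nrm (\<lambda>p. F p - tsum ps p) < e"
  obtains qs where "set qs \<subseteq> A.Lb \<times> (B.Z \<inter> B.Lb)" "P.nrm (\<lambda>p. F p - tsum qs p) < 4 * e"
    "fst ` set ps \<subseteq> A.Z \<longrightarrow> fst ` set qs \<subseteq> A.Z"
proof -
  have e0: "0 < e" using e P.nrm_nonneg[of "\<lambda>p. F p - tsum ps p"] by linarith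
  have psL: "set ps \<subseteq> A.L \<times> B.L" using ps by (auto dest: A.LbD B.LbD)
  define M where "M = (\<Sum>(a, b)\<leftarrow>ps. k * B.nrm b)"
  have M0: "0 \<le> M" unfolding M_def using k(1) by (intro sum_list_nonneg) auto
  \<comment> \<open>\<open>M\<close> bounds the effect of changing every first factor by norm 1, so
    an accuracy of \<open>r\<close> costs less than \<open>e\<close>; the added 1 keeps the
    denominator positive.\<close>
  define r where "r = e / (M + 1)"
  have r: "0 < r" using e0 M0 by (simp add: r_def)
  have rM: "r * M < e"
  proof -
    have "r * M < r * (M + 1)" using r by simp
    also have "\<dots> = e" using M0 by (simp add: r_def)
    finally show ?thesis .
  qed
  have fin: "finite (fst ` set ps)" by simp
  have sub: "fst ` set ps \<subseteq> A.L" "fst ` set ps \<subseteq> borel_measurable borel" using ps by (auto simp: A.Lb_def)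
  obtain V d where V: "finite V" "\<forall>E\<in>V. E \<in> sets borel \<and> A.ind E \<in> A.L" "disjoint V"
    "fst ` set ps \<subseteq> A.Z \<longrightarrow> (\<forall>E\<in>V. A.ind E \<in> A.Z)"
    "\<forall>f\<in>fst ` set ps. A.nrm (\<lambda>x. f x - (\<Sum>E\<in>V. d f E * A.ind E x)) < r"
    by (rule A.simple_approx[OF fin sub r])
  define s where "s a x = (\<Sum>E\<in>V. d a E * A.ind E x)" for a x
  \<comment> \<open>The second factor collected at the set \<open>E\<close> once every first factor
    \<open>a\<close> is replaced by its simple approximation \<open>s a\<close>.\<close>
  define v where "v ps E y = (\<Sum>(a, b)\<leftarrow>ps. d a E * b y)" for ps :: "(('g \<Rightarrow> complex) \<times> ('h \<Rightarrow> complex)) list" and E y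
  have vLb: "v ps E \<in> B.Lb" if "set ps \<subseteq> A.Lb \<times> B.Lb" for ps E
    using that
  proof (induction ps)
    case Nil
    then show ?case using B.L_zero by (simp add: v_def[abs_def] B.Lb_def)
  next
    case (Cons q ps)
    obtain a b where q: "q = (a, b)" by fastforce
    have b: "b \<in> B.L" "b \<in> borel_measurable borel" using Cons.prems q B.LbD by auto
    have IH: "v ps E \<in> B.L" "v ps E \<in> borel_measurable borel" using Cons B.LbD by auto
    have "(\<lambda>y. d a E * b y + v ps E y) \<in> B.L" by (intro B.L_add B.L_scale b IH)
    moreover have "(\<lambda>y. d a E * b y + v ps E y) \<in> borel_measurable borel" using b IH by measurable
    moreover have "v (q # ps) E = (\<lambda>y. d a E * b y + v ps E y)" by (auto simp: v_def q)
    ultimately show ?case by (simp add: B.Lb_def)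
  qed
  have split: "tsum ps p = tsum (map (\<lambda>(a, b). (\<lambda>x. a x - s a x, b)) ps) p + (\<Sum>E\<in>V. ten (A.ind E) (v ps E) p)" for ps p
  proof (induction ps)
    case (Cons q ps)
    obtain a b where q: "q = (a, b)" by fastforce
    have "(\<Sum>E\<in>V. ten (A.ind E) (v (q # ps) E) p) = s a (fst p) * b (snd p) + (\<Sum>E\<in>V. ten (A.ind E) (v ps E) p)"
      by (simp add: v_def q ten_def s_def sum.distrib distrib_left sum_distrib_right sum_distrib_left mult_ac)
    then show ?case using Cons by (simp add: q ten_def algebra_simps)
  qed (simp add: v_def ten_def)
  define rs where "rs = map (\<lambda>(a, b). (\<lambda>x. a x - s a x, b)) ps"
  have sL: "s a \<in> A.L" for a
    unfolding s_def using A.L_sum[OF V(1), of "\<lambda>E x. d a E * A.ind E x"] V(2) A.L_scale by auto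
  have rsL: "set rs \<subseteq> A.L \<times> B.L" unfolding rs_def using psL sL by (auto intro: A.L_diff)
  have "P.nrm (tsum rs) \<le> (\<Sum>(a, b)\<leftarrow>ps. k * A.nrm (\<lambda>x. a x - s a x) * B.nrm b)"
    using nrm_tsum[OF rsL] by (simp add: rs_def comp_def case_prod_unfold)
  also have "\<dots> \<le> (\<Sum>(a, b)\<leftarrow>ps. r * (k * B.nrm b))"
  proof (intro sum_list_mono, clarsimp)
    fix a b assume "(a, b) \<in> set ps"
    then have "A.nrm (\<lambda>x. a x - s a x) \<le> r" using V(5) unfolding s_def by (force intro: less_imp_le)
    then have "A.nrm (\<lambda>x. a x - s a x) * (k * B.nrm b) \<le> r * (k * B.nrm b)"
      using k(1) by (intro mult_right_mono) auto
    then show "k * A.nrm (\<lambda>x. a x - s a x) * B.nrm b \<le> r * (k * B.nrm b)" by (simp add: mult_ac)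
  qed
  also have "\<dots> = r * M" by (simp add: M_def sum_list_const_mult case_prod_unfold)
  finally have rs: "P.nrm (tsum rs) < e" using rM by simp
  have diffL: "(\<lambda>p. F p - tsum ps p) \<in> P.L" by (intro P.L_diff P.Z_subset_L F tsum_L psL)
  have "(\<lambda>p. F p - (\<Sum>E\<in>V. ten (A.ind E) (v ps E) p)) = (\<lambda>p. (F p - tsum ps p) + tsum rs p)"
    using split[of ps] by (auto simp: rs_def)
  then have "P.nrm (\<lambda>p. F p - (\<Sum>E\<in>V. ten (A.ind E) (v ps E) p)) < 2 * e"
    using P.L_add(2)[OF diffL tsum_L[OF rsL]] rs e by simp
  moreover have "\<forall>E\<in>V. v ps E \<in> B.Lb" using vLb[OF ps] by simp
  then obtain w where w: "\<forall>E\<in>V. w E \<in> B.Z \<inter> B.Lb"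
    "P.nrm (\<lambda>p. F p - (\<Sum>E\<in>V. ten (A.ind E) (w E) p)) \<le> 2 * P.nrm (\<lambda>p. F p - (\<Sum>E\<in>V. ten (A.ind E) (v ps E) p))"
    by (rule averaging[OF F V(1-3)])
  ultimately have close: "P.nrm (\<lambda>p. F p - (\<Sum>E\<in>V. ten (A.ind E) (w E) p)) < 4 * e" by simp
  obtain es where es: "set es = V" "distinct es" using finite_distinct_list[OF V(1)] by auto
  define qs where "qs = map (\<lambda>E. (A.ind E, w E)) es"
  have ts: "tsum qs p = (\<Sum>E\<in>V. ten (A.ind E) (w E) p)" for p
    using es by (simp add: tsum_def qs_def comp_def sum_list_distinct_conv_sum_set)
  show ?thesis
  proof (rule that[of qs])
    show "set qs \<subseteq> A.Lb \<times> (B.Z \<inter> B.Lb)" using w(1) V(2) es(1) by (auto simp: qs_def A.Lb_def)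
    show "P.nrm (\<lambda>p. F p - tsum qs p) < 4 * e" using close by (simp add: ts)
    show "fst ` set ps \<subseteq> A.Z \<longrightarrow> fst ` set qs \<subseteq> A.Z" using V(4) es(1) by (auto simp: qs_def)
  qed
qed

section \<open>Density of central tensors by exchanging the two groups\<close>

lemma left_haar_swap: "left_haar_measure (distr \<mu> borel prod.swap)"
proof (rule left_haar_distr[OF haar, where \<theta>' = prod.swap])
  show "continuous_on UNIV (prod.swap :: 'g \<times> 'h \<Rightarrow> _)" "continuous_on UNIV (prod.swap :: 'h \<times> 'g \<Rightarrow> _)"
    unfolding prod.swap_def by (intro continuous_intros)+
  show "\<exists>g'. \<forall>x. prod.swap (g' + x) = g + prod.swap x" for g :: "'h \<times> 'g"
    by (intro exI[of _ "prod.swap g"]) (simp add: prod_eq_iff)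
qed simp_all

lemma central_tensors_dense:
  assumes F: "F \<in> P.Z" and e: "0 < e"
  shows "\<exists>ps. set ps \<subseteq> A.Z \<times> B.Z \<and> P.nrm (\<lambda>p. F p - tsum ps p) < e"
proof -
  \<comment> \<open>The same setting with the groups exchanged. Its Haar measure is the image of
    \<mu> under the swap, so norms are preserved.\<close>
  interpret Q: beurling_product \<mu>2 \<omega>2 c2 \<mu>1 \<omega>1 c1 "distr \<mu> borel prod.swap"
    by unfold_locales (rule left_haar_swap)
  obtain F' where F': "F' \<in> borel_measurable borel" "AE p in \<mu>. F p = F' p"
    using P.L_borel[OF P.Z_subset_L[OF F]] by metis
  have F'Z: "F' \<in> P.Z" by (rule P.Z_cong[OF F F'(2)])
  have sw0: "(prod.swap :: 'g \<times> 'h \<Rightarrow> 'h \<times> 'g) \<in> borel \<rightarrow>\<^sub>M borel" "(prod.swap :: 'h \<times> 'g \<Rightarrow> 'g \<times> 'h) \<in> borel \<rightarrow>\<^sub>M borel"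
    unfolding prod.swap_def by (intro borel_measurable_continuous_onI continuous_intros)+
  have sw: "(prod.swap :: 'g \<times> 'h \<Rightarrow> 'h \<times> 'g) \<in> \<mu> \<rightarrow>\<^sub>M borel" using sw0(1) by (simp cong: measurable_cong_sets)
  have weq: "Q.\<omega> (prod.swap p) = \<omega> p" for p by (simp add: Q.product_weight_eq product_weight_eq mult.commute)
  have nn_swap: "Q.P.nn (\<lambda>q. H (prod.swap q)) = P.nn H" if H: "H \<in> borel_measurable borel" for H
  proof -
    have "(\<lambda>q. H (prod.swap q)) \<in> borel_measurable borel" by (rule measurable_compose[OF sw0(2) H])
    then have m: "(\<lambda>q. ennreal (norm (H (prod.swap q)) * Q.\<omega> q)) \<in> borel_measurable borel"
      using Q.P.weight_measurable by measurable
    show ?thesis unfolding Q.P.nn_def P.nn_def using nn_integral_distr[OF sw, of "\<lambda>q. ennreal (norm (H (prod.swap q)) * Q.\<omega> q)"] m by (simp add: weq)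
  qed
  have L_swap: "(\<lambda>q. H (prod.swap q)) \<in> Q.P.L" "Q.P.nrm (\<lambda>q. H (prod.swap q)) = P.nrm H"
    if H: "H \<in> P.L" "H \<in> borel_measurable borel" for H
  proof -
    have "(\<lambda>q. H (prod.swap q)) \<in> borel_measurable borel" by (rule measurable_compose[OF sw0(2) H(2)])
    then have "(\<lambda>q. H (prod.swap q)) \<in> borel_measurable (completion (distr \<mu> borel prod.swap))"
      by (intro measurable_completion) simp
    then show *: "(\<lambda>q. H (prod.swap q)) \<in> Q.P.L" using nn_swap[OF H(2)] H(1) by (simp add: Q.P.L_iff P.L_iff)
    show "Q.P.nrm (\<lambda>q. H (prod.swap q)) = P.nrm H"
      using nn_swap[OF H(2)] by (simp add: Q.P.nn_nrm[OF *] P.nn_nrm[OF H(1)])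
  qed
  define F2 where "F2 q = F' (prod.swap q)" for q
  have F2m: "F2 \<in> borel_measurable borel" unfolding F2_def by (rule measurable_compose[OF sw0(2) F'(1)])
  have F2Z: "F2 \<in> Q.P.Z"
  proof -
    have "AE q in distr \<mu> borel prod.swap. F2 (- g + q + g) = F2 q" for g
    proof -
      have cm: "(\<lambda>q::'h \<times> 'g. - g + q + g) \<in> borel \<rightarrow>\<^sub>M borel" by (intro borel_measurable_continuous_onI continuous_intros)
      have "(\<lambda>q. F2 (- g + q + g)) \<in> borel_measurable borel" by (rule measurable_compose[OF cm F2m])
      then have "{q \<in> space borel. F2 (- g + q + g) = F2 q} \<in> sets borel" using F2m by measurable
      then have "(AE q in distr \<mu> borel prod.swap. F2 (- g + q + g) = F2 q) \<longleftrightarrow>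
        (AE p in \<mu>. F2 (- g + prod.swap p + g) = F2 (prod.swap p))"
        by (rule AE_distr_iff[OF sw])
      also have "\<dots> \<longleftrightarrow> (AE p in \<mu>. F' (- prod.swap g + p + prod.swap g) = F' p)"
      proof -
        have "prod.swap (- g + prod.swap p + g) = - prod.swap g + p + prod.swap g" for p by (simp add: prod_eq_iff)
        then show ?thesis by (simp add: F2_def)
      qed
      finally show ?thesis using F'Z unfolding P.Z_def by blast
    qed
    then show ?thesis using L_swap(1)[OF P.Z_subset_L[OF F'Z] F'(1)] unfolding Q.P.Z_def F2_def by blast
  qed
  \<comment> \<open>Each of the two applications of \<open>centralise_second\<close> multiplies the
    error bound by 4.\<close>
  define e0 where "e0 = e / 16"
  have e0: "0 < e0" using e by (simp add: e0_def)
  obtain ps where ps: "set ps \<subseteq> A.Lb \<times> B.Lb" "P.nrm (\<lambda>p. F' p - tsum ps p) < e0"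
    using tensors_dense[OF P.Z_subset_L[OF F'Z] e0] by (elim exE conjE) (rule that)
  obtain qs where qs: "set qs \<subseteq> A.Lb \<times> (B.Z \<inter> B.Lb)" "P.nrm (\<lambda>p. F' p - tsum qs p) < 4 * e0"
    by (rule centralise_second[OF F'Z ps])
  have qsLb: "set qs \<subseteq> A.Lb \<times> B.Lb" using qs by auto
  define qs2 where "qs2 = map prod.swap qs"
  have ts2: "Q.tsum qs2 q = tsum qs (prod.swap q)" for q
    unfolding qs2_def Q.tsum_def tsum_def by (induction qs) (auto simp: ten_def Q.ten_def)
  have qs2: "set qs2 \<subseteq> B.Lb \<times> A.Lb" "fst ` set qs2 \<subseteq> B.Z" using qs(1) by (auto simp: qs2_def)
  have dm: "(\<lambda>p. F' p - tsum qs p) \<in> P.L" "(\<lambda>p. F' p - tsum qs p) \<in> borel_measurable borel"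
  proof -
    have "set qs \<subseteq> A.L \<times> B.L" using qsLb by (auto dest: A.LbD B.LbD)
    then show "(\<lambda>p. F' p - tsum qs p) \<in> P.L" by (intro P.L_diff P.Z_subset_L F'Z tsum_L)
    show "(\<lambda>p. F' p - tsum qs p) \<in> borel_measurable borel"
      using F'(1) pair_borel_imp_borel[OF tsum_borel[OF qsLb]] by measurable
  qed
  have "Q.P.nrm (\<lambda>q. F2 q - Q.tsum qs2 q) < 4 * e0"
    using L_swap(2)[OF dm] qs(2) by (simp add: F2_def ts2)
  then obtain rs where rs: "set rs \<subseteq> B.Lb \<times> (A.Z \<inter> A.Lb)" "Q.P.nrm (\<lambda>q. F2 q - Q.tsum rs q) < 4 * (4 * e0)"
    "fst ` set qs2 \<subseteq> B.Z \<longrightarrow> fst ` set rs \<subseteq> B.Z"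
    by (rule Q.centralise_second[OF F2Z qs2(1)])
  define rs2 where "rs2 = map prod.swap rs"
  have ts3: "Q.tsum rs q = tsum rs2 (prod.swap q)" for q
    unfolding rs2_def Q.tsum_def tsum_def by (induction rs) (auto simp: ten_def Q.ten_def)
  have rs2: "set rs2 \<subseteq> A.Lb \<times> B.Lb" "set rs2 \<subseteq> A.Z \<times> B.Z" using rs(1,3) qs2(2) by (force simp: rs2_def)+
  have dm2: "(\<lambda>p. F' p - tsum rs2 p) \<in> P.L" "(\<lambda>p. F' p - tsum rs2 p) \<in> borel_measurable borel"
  proof -
    have "set rs2 \<subseteq> A.L \<times> B.L" using rs2(1) by (auto dest: A.LbD B.LbD)
    then show "(\<lambda>p. F' p - tsum rs2 p) \<in> P.L" by (intro P.L_diff P.Z_subset_L F'Z tsum_L)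
    show "(\<lambda>p. F' p - tsum rs2 p) \<in> borel_measurable borel"
      using F'(1) pair_borel_imp_borel[OF tsum_borel[OF rs2(1)]] by measurable
  qed
  have "P.nrm (\<lambda>p. F' p - tsum rs2 p) < e"
    using L_swap(2)[OF dm2] rs(2) by (simp add: F2_def ts3 e0_def)
  moreover have "P.nrm (\<lambda>p. F' p - tsum rs2 p) = P.nrm (\<lambda>p. F p - tsum rs2 p)"
    by (rule P.nrm_cong[OF dm2(1) eventually_mono[OF F'(2)]]) simp
  ultimately show ?thesis using rs2(2) by auto
qed

end

section \<open>Classes of central functions\<close>

context beurling begin

definition cls :: "('g \<Rightarrow> complex) \<Rightarrow> ('g \<Rightarrow> complex) set" where
  "cls f = {h \<in> L. AE x in \<mu>. f x = h x}"

abbreviation ZA :: "('g \<Rightarrow> complex) set normed_alg" where "ZA \<equiv> central_beurling_alg \<mu> \<omega>"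

definition ae_rel :: "(('g \<Rightarrow> complex) \<times> ('g \<Rightarrow> complex)) set" where
  "ae_rel = {(f, h). f \<in> L \<and> h \<in> L \<and> (AE x in completion \<mu>. f x = h x)}"

lemma ae_rel_image: "f \<in> L \<Longrightarrow> ae_rel `` {f} = cls f"
  by (auto simp: ae_rel_def cls_def AE_completion_iff)

lemma ZA_ops:
  "vzero ZA = ae_rel `` {\<lambda>x. 0}"
  "vadd ZA X Y = (\<Union>f\<in>X. \<Union>h\<in>Y. ae_rel `` {\<lambda>x. f x + h x})"
  "vscale ZA a X = (\<Union>f\<in>X. ae_rel `` {\<lambda>x. a * f x})"
  "vmult ZA X Y = (\<Union>f\<in>X. \<Union>h\<in>Y. ae_rel `` {conv f h})"
  "vnorm ZA X = nrm (SOME f. f \<in> X)"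
  by (simp_all add: central_beurling_alg_def beurling_alg_def quotient_alg_def L_def conv_def nrm_def
    ae_rel_def[unfolded L_def, symmetric]) (simp_all add: beurling_fun_def)

lemma cls_self: "f \<in> L \<Longrightarrow> f \<in> cls f"
  by (simp add: cls_def)

lemma cls_nonempty: "f \<in> L \<Longrightarrow> cls f \<noteq> {}"
  using cls_self by blast

lemma clsD: "h \<in> cls f \<Longrightarrow> h \<in> L" "h \<in> cls f \<Longrightarrow> AE x in \<mu>. f x = h x"
  by (auto simp: cls_def)

lemma cls_eqI:
  assumes "AE x in \<mu>. f x = h x"
  shows "cls f = cls h"
proof -
  have "(AE x in \<mu>. f x = k x) \<longleftrightarrow> (AE x in \<mu>. h x = k x)" for k
  proof
    assume "AE x in \<mu>. f x = k x"
    with assms show "AE x in \<mu>. h x = k x" by eventually_elim simp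
  next
    assume "AE x in \<mu>. h x = k x"
    with assms show "AE x in \<mu>. f x = k x" by eventually_elim simp
  qed
  then show ?thesis by (simp add: cls_def)
qed

lemma cls_eqD: "h \<in> L \<Longrightarrow> cls f = cls h \<Longrightarrow> AE x in \<mu>. f x = h x"
  using cls_self[of h] clsD(2)[of h f] by simp

lemma some_cls:
  assumes "f \<in> L"
  shows "(SOME h. h \<in> cls f) \<in> L" "AE x in \<mu>. f x = (SOME h. h \<in> cls f) x"
  using clsD[OF someI[of "\<lambda>h. h \<in> cls f", OF cls_self[OF assms]]] by auto

text \<open>The definition asks every representative of a class to be central; by
  \<open>Z_cong\<close> this holds as soon as one of them is.\<close>

lemma carrier_ZA: "carrier ZA = cls ` Z"
proof -
  have c: "carrier ZA = {X \<in> L // ae_rel. \<forall>f\<in>X. \<forall>g. AE x in completion \<mu>. f (- g + x + g) = f x}"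
    by (simp add: central_beurling_alg_def beurling_alg_def quotient_alg_def L_def ae_rel_def[unfolded L_def, symmetric])
  have q: "L // ae_rel = cls ` L" by (auto simp: quotient_def ae_rel_image)
  show ?thesis
  proof (intro equalityI subsetI)
    fix X assume "X \<in> carrier ZA"
    then obtain f where f: "f \<in> L" "X = cls f" "\<forall>h\<in>X. \<forall>g. AE x in completion \<mu>. h (- g + x + g) = h x"
      unfolding c q by auto
    then have "f \<in> Z" using cls_self[of f] by (auto simp: Z_def AE_completion_iff)
    then show "X \<in> cls ` Z" using f(2) by blast
  next
    fix X assume "X \<in> cls ` Z"
    then obtain f where f: "f \<in> Z" "X = cls f" by auto
    have "\<forall>g. AE x in \<mu>. h (- g + x + g) = h x" if "h \<in> X" for h
      using Z_cong[OF f(1) clsD(2)] that f(2) by (simp add: Z_def)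
    then show "X \<in> carrier ZA" unfolding c q using f Z_subset_L by (auto simp: AE_completion_iff)
  qed
qed

lemma cls_carrier [simp]: "f \<in> Z \<Longrightarrow> cls f \<in> carrier ZA"
  by (simp add: carrier_ZA)

lemma zero_cls: "vzero ZA = cls (\<lambda>x. 0)"
  by (simp add: ZA_ops ae_rel_image L_zero)

lemma add_cls: "f \<in> Z \<Longrightarrow> h \<in> Z \<Longrightarrow> vadd ZA (cls f) (cls h) = cls (\<lambda>x. f x + h x)"
  unfolding ZA_ops
proof (rule UN2_eq_const)
  fix f' h' assume *: "f' \<in> cls f" "h' \<in> cls h"
  have "AE x in \<mu>. f x + h x = f' x + h' x"
    using clsD(2)[OF *(1)] clsD(2)[OF *(2)] by eventually_elim simp
  from cls_eqI[OF this] show "ae_rel `` {\<lambda>x. f' x + h' x} = cls (\<lambda>x. f x + h x)"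
    by (simp add: ae_rel_image L_add clsD[OF *(1)] clsD[OF *(2)])
qed (auto intro: cls_nonempty[OF Z_subset_L, THEN notE])

lemma scale_cls: "f \<in> Z \<Longrightarrow> vscale ZA a (cls f) = cls (\<lambda>x. a * f x)"
  unfolding ZA_ops
proof (rule UN_eq_const)
  fix f' assume *: "f' \<in> cls f"
  have "AE x in \<mu>. a * f x = a * f' x"
    using clsD(2)[OF *(1)] by eventually_elim simp
  from cls_eqI[OF this] show "ae_rel `` {\<lambda>x. a * f' x} = cls (\<lambda>x. a * f x)"
    by (simp add: ae_rel_image L_scale clsD[OF *(1)])
qed (auto intro: cls_nonempty[OF Z_subset_L, THEN notE])

lemma mult_cls: "f \<in> Z \<Longrightarrow> h \<in> Z \<Longrightarrow> vmult ZA (cls f) (cls h) = cls (conv f h)"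
  unfolding ZA_ops
proof (rule UN2_eq_const)
  fix f' h' assume Z: "f \<in> Z" "h \<in> Z" and *: "f' \<in> cls f" "h' \<in> cls h"
  have "conv f h = conv f' h'"
    by (rule conv_cong[OF Z_subset_L[OF Z(1)] Z_subset_L[OF Z(2)] clsD(2)[OF *(1)] clsD(2)[OF *(2)]])
  then show "ae_rel `` {conv f' h'} = cls (conv f h)"
    by (simp add: ae_rel_image conv_L clsD[OF *(1)] clsD[OF *(2)])
qed (auto intro: cls_nonempty[OF Z_subset_L, THEN notE])

lemma norm_cls: "f \<in> Z \<Longrightarrow> vnorm ZA (cls f) = nrm f"
  unfolding ZA_ops using nrm_cong[OF Z_subset_L some_cls(2)[OF Z_subset_L]] by simp

lemma Z_diff: "f \<in> Z \<Longrightarrow> h \<in> Z \<Longrightarrow> (\<lambda>x. f x - h x) \<in> Z"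
  using Z_add[of f "\<lambda>x. (- 1) * h x"] Z_scale[of h "- 1"] by simp

lemma diff_cls: "f \<in> Z \<Longrightarrow> h \<in> Z \<Longrightarrow> vdiff ZA (cls f) (cls h) = cls (\<lambda>x. f x - h x)"
  using Z_scale[of h "- 1"] by (simp add: vdiff_def scale_cls add_cls)

lemmas cls_ops = zero_cls add_cls scale_cls mult_cls norm_cls diff_cls
lemmas Z_ops = Z_zero Z_add Z_scale Z_conv Z_diff

lemma carrier_ZAE:
  assumes "X \<in> carrier ZA"
  obtains f where "f \<in> Z" "X = cls f"
  using assms by (auto simp: carrier_ZA)

lemma normed_algebra_ZA: "normed_algebra ZA"
proof -
  note L = Z_subset_L
  \<comment> \<open>Convolution is additive only almost everywhere as a function, which suffices for
    an equality of classes.\<close>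
  have add: "cls (conv f (\<lambda>x. h x + k x)) = cls (\<lambda>x. conv f h x + conv f k x)"
    "cls (conv (\<lambda>x. h x + k x) f) = cls (\<lambda>x. conv h f x + conv k f x)" if "f \<in> Z" "h \<in> Z" "k \<in> Z" for f h k
    using that by (intro cls_eqI conv_add_right conv_add_left L; simp)+
  have def: "cls f = cls (\<lambda>x. 0)" if "f \<in> Z" "nrm f = 0" for f
    using nrm_eq_0[OF L[OF that(1)]] that(2) by (intro cls_eqI) simp
  show ?thesis
    by unfold_locales
      (auto elim!: carrier_ZAE simp: cls_ops Z_ops add def conv_scale add.assoc add.commute add.left_commute
        mult.assoc distrib_left distrib_right intro: L L_add(2)[OF L L] L_scale(2)[OF L] conv_L(2)[OF L L])
qed

lemma ZA_complete:
  assumes s: "\<And>n. s n \<in> carrier ZA"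
    and Cauchy: "\<And>e. e > 0 \<Longrightarrow> \<exists>N. \<forall>m\<ge>N. \<forall>n\<ge>N. vnorm ZA (vdiff ZA (s m) (s n)) < e"
  shows "\<exists>X\<in>carrier ZA. (\<lambda>n. vnorm ZA (vdiff ZA (s n) X)) \<longlonglongrightarrow> 0"
proof -
  have "\<forall>n. \<exists>f. f \<in> Z \<and> s n = cls f" using s by (auto simp: carrier_ZA)
  then obtain f where f: "\<And>n. f n \<in> Z" "\<And>n. s n = cls (f n)" by metis
  have C: "\<exists>N. \<forall>m\<ge>N. \<forall>n\<ge>N. nrm (\<lambda>x. f m x - f n x) < e" if "e > 0" for e
    using Cauchy[OF that] by (simp add: f diff_cls norm_cls Z_diff)
  obtain k where k: "k \<in> L" "(\<lambda>n. nrm (\<lambda>x. f n x - k x)) \<longlonglongrightarrow> 0" "(\<forall>n. f n \<in> Z) \<longrightarrow> k \<in> Z"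
    by (rule L_complete[OF Z_subset_L[OF f(1)] C])
  then have "k \<in> Z" using f(1) by blast
  then show ?thesis using k(2) by (intro bexI[of _ "cls k"]) (simp_all add: f diff_cls norm_cls Z_diff)
qed

lemma lsum_cls:
  assumes "finite V" "distinct vs" "set vs = V" "\<And>v. v \<in> V \<Longrightarrow> f v \<in> Z"
  shows "normed_algebra.lsum ZA (map (\<lambda>v. cls (f v)) vs) = cls (\<lambda>x. \<Sum>v\<in>V. f v x)"
proof -
  interpret N: normed_algebra ZA by (rule normed_algebra_ZA)
  have "N.lsum (map (\<lambda>v. cls (f v)) vs) = cls (\<lambda>x. \<Sum>v\<in>set vs. f v x)"
    if "distinct vs" "\<And>v. v \<in> set vs \<Longrightarrow> f v \<in> Z" for vs
    using that
  proof (induction vs)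
    case (Cons v vs)
    have "(\<lambda>x. \<Sum>v\<in>set vs. f v x) \<in> Z" using Cons.prems by (intro Z_sum) auto
    then show ?case using Cons by (simp add: add_cls)
  qed (simp add: zero_cls)
  then show ?thesis using assms by auto
qed

text \<open>Integration against \<omega> times the conjugate phase of \<open>F\<close> is a linear
  form on classes whose value at the class of \<open>F\<close> is the norm of \<open>F\<close>.
  Where \<open>F\<close> vanishes, the quotient in \<open>s\<close> is 0 by division by
  zero.\<close>

lemma ZA_separate:
  assumes X: "X \<in> carrier ZA" "X \<noteq> vzero ZA"
  shows "\<exists>\<phi>. linear_form ZA \<phi> \<and> \<phi> X \<noteq> 0"
proof -
  obtain F where F: "F \<in> Z" "X = cls F" by (rule carrier_ZAE[OF X(1)])
  let ?M = "completion \<mu>"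
  define s where "s x = cnj (F x) / complex_of_real (norm (F x)) * complex_of_real (\<omega> x)" for x
  define \<phi> where "\<phi> Y = (LINT x|?M. (SOME f. f \<in> Y) x * s x)" for Y
  have Fm: "F \<in> borel_measurable ?M" by (rule L_measurable[OF Z_subset_L[OF F(1)]])
  have sm: "s \<in> borel_measurable ?M"
  proof -
    have "(\<lambda>x. cnj (F x)) \<in> borel_measurable ?M"
      by (rule measurable_compose[OF Fm borel_measurable_continuous_onI]) (intro continuous_intros)
    moreover have "(\<lambda>x. complex_of_real (norm (F x))) \<in> borel_measurable ?M"
      by (rule measurable_compose[OF measurable_compose[OF Fm borel_measurable_norm] borel_measurable_of_real])
    moreover have "(\<lambda>x. complex_of_real (\<omega> x)) \<in> borel_measurable ?M"
      by (rule measurable_compose[OF weight_measurable_mu(2) borel_measurable_of_real])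
    ultimately show ?thesis
      unfolding s_def[abs_def] by (intro borel_measurable_times borel_measurable_divide)
  qed
  have int: "integrable ?M (\<lambda>x. f x * s x)" if "f \<in> L" for f
  proof (rule Bochner_Integration.integrable_bound)
    show "integrable ?M (\<lambda>x. norm (f x) * \<omega> x)" using that by (simp add: L_def beurling_fun_def)
    show "(\<lambda>x. f x * s x) \<in> borel_measurable ?M" by (intro borel_measurable_times L_measurable that sm)
    show "AE x in ?M. norm (f x * s x) \<le> norm (norm (f x) * \<omega> x)"
      by (rule AE_I2) (auto simp: s_def norm_mult norm_divide intro: mult_left_mono)
  qed
  have \<phi>: "\<phi> (cls f) = (LINT x|?M. f x * s x)" if "f \<in> L" for f
    unfolding \<phi>_def
  proof (rule integral_cong_AE)
    show "AE x in ?M. (SOME h. h \<in> cls f) x * s x = f x * s x"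
      using AE_completion[OF some_cls(2)[OF that]] by eventually_elim simp
  qed (intro borel_measurable_times L_measurable that sm some_cls)+
  have "linear_form ZA \<phi>"
    unfolding linear_form_def
  proof (intro conjI ballI allI)
    fix X Y assume "X \<in> carrier ZA" "Y \<in> carrier ZA"
    then obtain f h where "f \<in> Z" "X = cls f" "h \<in> Z" "Y = cls h" by (elim carrier_ZAE)
    then show "\<phi> (vadd ZA X Y) = \<phi> X + \<phi> Y"
      using int by (simp add: add_cls \<phi> Z_subset_L L_add distrib_right)
  next
    fix a X assume "X \<in> carrier ZA"
    then obtain f where "f \<in> Z" "X = cls f" by (elim carrier_ZAE)
    then show "\<phi> (vscale ZA a X) = a * \<phi> X"
      by (simp add: scale_cls \<phi> Z_subset_L L_scale mult.assoc)
  qed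
  moreover have "\<phi> X = complex_of_real (nrm F)"
  proof -
    have "F x * s x = complex_of_real (norm (F x) * \<omega> x)" for x
      by (cases "F x = 0") (simp_all add: s_def complex_norm_square[symmetric] power2_eq_square field_simps)
    then have "\<phi> X = (LINT x|?M. complex_of_real (norm (F x) * \<omega> x))"
      using \<phi>[OF Z_subset_L[OF F(1)]] F(2) by simp
    also have "\<dots> = complex_of_real (nrm F)"
      unfolding integral_complex_of_real by (simp add: nrm_def beurling_fun_def)
    finally show ?thesis .
  qed
  moreover have "nrm F \<noteq> 0"
  proof
    assume "nrm F = 0"
    then have "cls F = cls (\<lambda>x. 0)" using nrm_eq_0[OF Z_subset_L[OF F(1)]] by (intro cls_eqI) simp
    then show False using X(2) F(2) by (simp add: zero_cls)
  qed
  ultimately show ?thesis by auto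
qed

end

section \<open>The tensor map on classes and the isomorphism\<close>

context beurling_product begin

text \<open>The choice of representatives is immaterial by \<open>tcls_cls\<close>. The factor
  \<open>1 / k\<close> undoes the \<open>k\<close> that the Haar measure of the product contributes
  to norms in \<open>ten_L\<close> and to convolutions in \<open>ten_conv\<close>.\<close>

definition tcls :: "('g \<Rightarrow> complex) set \<Rightarrow> ('h \<Rightarrow> complex) set \<Rightarrow> ('g \<times> 'h \<Rightarrow> complex) set" where
  "tcls X Y = P.cls (\<lambda>p. complex_of_real (1 / k) * ten (SOME f. f \<in> X) (SOME h. h \<in> Y) p)"

lemma scaled_ten_Z: "f \<in> A.Z \<Longrightarrow> h \<in> B.Z \<Longrightarrow> (\<lambda>p. complex_of_real (1 / k) * ten f h p) \<in> P.Z"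
  by (intro P.Z_scale ten_Z)

lemma tcls_cls:
  assumes f: "f \<in> A.Z" and h: "h \<in> B.Z"
  shows "tcls (A.cls f) (B.cls h) = P.cls (\<lambda>p. complex_of_real (1 / k) * ten f h p)"
  unfolding tcls_def
proof (rule P.cls_eqI[symmetric])
  note fL = A.Z_subset_L[OF f] and hL = B.Z_subset_L[OF h]
  show "AE p in \<mu>. complex_of_real (1 / k) * ten f h p =
      complex_of_real (1 / k) * ten (SOME g. g \<in> A.cls f) (SOME g. g \<in> B.cls h) p"
    using ten_cong[OF fL A.some_cls(2)[OF fL] hL B.some_cls(2)[OF hL]] by eventually_elim simp
qed

lemma central_dense_classes:
  assumes X: "X \<in> carrier P.ZA" and e: "0 < e"
  shows "\<exists>ps. set ps \<subseteq> carrier A.ZA \<times> carrier B.ZA \<and>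
    vnorm P.ZA (vdiff P.ZA (normed_algebra.lsum P.ZA (map (\<lambda>(a, b). tcls a b) ps)) X) < e"
proof -
  interpret N: normed_algebra P.ZA by (rule P.normed_algebra_ZA)
  obtain F where F: "F \<in> P.Z" "X = P.cls F" by (rule P.carrier_ZAE[OF X])
  obtain ps where ps: "set ps \<subseteq> A.Z \<times> B.Z" "P.nrm (\<lambda>p. F p - tsum ps p) < e"
    using central_tensors_dense[OF F(1) e] by (elim exE conjE) (rule that)
  \<comment> \<open>The factor \<open>k\<close> in the first components cancels the
    \<open>1 / k\<close> built into \<open>tcls\<close>.\<close>
  define lift where "lift = map (\<lambda>(a, b). (A.cls (\<lambda>x. complex_of_real k * a x), B.cls b))"
  have "tsum ps \<in> P.Z \<and> set (lift ps) \<subseteq> carrier A.ZA \<times> carrier B.ZA \<and>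
    N.lsum (map (\<lambda>(a, b). tcls a b) (lift ps)) = P.cls (tsum ps)"
    using ps(1)
  proof (induction ps)
    case Nil
    have "tsum [] = (\<lambda>p. 0)" by (simp add: fun_eq_iff)
    then show ?case by (simp add: lift_def P.zero_cls P.Z_zero)
  next
    case (Cons q ps)
    obtain a b where q: "q = (a, b)" by fastforce
    have ab: "a \<in> A.Z" "b \<in> B.Z" using Cons.prems q by auto
    have ka: "(\<lambda>x. complex_of_real k * a x) \<in> A.Z" by (rule A.Z_scale[OF ab(1)])
    have "tcls (A.cls (\<lambda>x. complex_of_real k * a x)) (B.cls b) = P.cls (ten a b)"
      unfolding tcls_cls[OF ka ab(2)] using k(1) by (intro P.cls_eqI) (simp add: ten_def)
    moreover have "tsum (q # ps) = (\<lambda>p. ten a b p + tsum ps p)" by (auto simp: q)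
    moreover have "tsum ps \<in> P.Z" "set (lift ps) \<subseteq> carrier A.ZA \<times> carrier B.ZA"
      "N.lsum (map (\<lambda>(a, b). tcls a b) (lift ps)) = P.cls (tsum ps)"
      using Cons by auto
    moreover have "lift (q # ps) = (A.cls (\<lambda>x. complex_of_real k * a x), B.cls b) # lift ps"
      by (simp add: lift_def q)
    ultimately show ?case using ka ab by (simp add: P.add_cls ten_Z P.Z_add)
  qed
  then show ?thesis using ps(2) F P.nrm_minus[of "tsum ps" F]
    by (intro exI[of _ "lift ps"]) (simp add: P.diff_cls P.norm_cls P.Z_diff)
qed

text \<open>The basis vectors are the classes of the indicators from
  \<open>simple_approx_nonnull\<close>, for which \<open>disjoint_nrm\<close> gives additivity of
  the norm. Coefficients are indexed by classes rather than by sets, so the passage from a set to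
  its class must be injective.\<close>

lemma classes_basis:
  assumes as: "set as \<subseteq> carrier A.ZA" and e: "0 < e"
  shows "\<exists>es c. set es \<subseteq> carrier A.ZA \<and>
    (\<forall>a\<in>set as. vnorm A.ZA (vdiff A.ZA a (normed_algebra.lsum A.ZA (map (\<lambda>v. vscale A.ZA (c a v) v) es))) < e) \<and>
    (\<forall>u. u ` set es \<subseteq> carrier B.ZA \<longrightarrow> (\<Sum>v\<leftarrow>es. vnorm A.ZA v * vnorm B.ZA (u v)) \<le>
       vnorm P.ZA (normed_algebra.lsum P.ZA (map (\<lambda>v. tcls v (u v)) es)))"
proof -
  have "\<exists>f. f \<in> A.Z \<and> f \<in> borel_measurable borel \<and> X = A.cls f" if "X \<in> set as" for X
  proof -
    have "X \<in> carrier A.ZA" using as that by blast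
    then obtain f where f: "f \<in> A.Z" "X = A.cls f" by (rule A.carrier_ZAE)
    obtain g where g: "g \<in> borel_measurable borel" "AE x in \<mu>1. f x = g x"
      by (rule A.L_borel[OF A.Z_subset_L[OF f(1)]])
    show ?thesis using g f A.Z_cong[OF f(1) g(2)] A.cls_eqI[OF g(2)] by blast
  qed
  then obtain rep where rep: "\<forall>X\<in>set as. rep X \<in> A.Z \<and> rep X \<in> borel_measurable borel \<and> X = A.cls (rep X)"
    by metis
  have F: "finite (rep ` set as)" "rep ` set as \<subseteq> A.L" "rep ` set as \<subseteq> borel_measurable borel" "rep ` set as \<subseteq> A.Z"
    using rep A.Z_subset_L by auto
  obtain V d where V: "finite V" "\<forall>E\<in>V. E \<in> sets borel \<and> A.ind E \<in> A.L \<and> A.nrm (A.ind E) \<noteq> 0" "disjoint V"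
    "rep ` set as \<subseteq> A.Z \<longrightarrow> (\<forall>E\<in>V. A.ind E \<in> A.Z)"
    "\<forall>f\<in>rep ` set as. A.nrm (\<lambda>x. f x - (\<Sum>E\<in>V. d f E * A.ind E x)) < e"
    by (rule A.simple_approx_nonnull[OF F(1-3) e])
  have EZ: "A.ind E \<in> A.Z" "A.ind E \<in> A.L" if "E \<in> V" for E using V(2,4) F(4) that by auto
  obtain vs where vs: "set vs = V" "distinct vs" using finite_distinct_list[OF V(1)] by auto
  define ci where "ci E = A.cls (A.ind E)" for E
  \<comment> \<open>Disjoint sets whose indicators agree almost everywhere are both null, and null
    sets were removed from \<open>V\<close>.\<close>
  have inj: "inj_on ci V"
  proof (rule inj_onI, rule ccontr)
    fix E E' assume E: "E \<in> V" "E' \<in> V" "ci E = ci E'" "E \<noteq> E'"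
    then have "E \<inter> E' = {}" using V(3) by (auto simp: disjoint_def)
    moreover have "AE x in \<mu>1. A.ind E x = A.ind E' x"
      using A.cls_eqD[OF EZ(2)[OF E(2)]] E(3) by (simp add: ci_def)
    ultimately have "AE x in \<mu>1. A.ind E x = 0"
      by (elim eventually_mono) (auto simp: indicator_def split: if_splits)
    then show False using V(2) E(1) A.nrm_eq_0[OF EZ(2)[OF E(1)]] by auto
  qed
  define c where "c X v = d (rep X) (inv_into V ci v)" for X v
  define es where "es = map ci vs"
  have approx: "vnorm A.ZA (vdiff A.ZA X (normed_algebra.lsum A.ZA (map (\<lambda>v. vscale A.ZA (c X v) v) es))) < e"
    if X: "X \<in> set as" for X
  proof -
    have "map (\<lambda>v. vscale A.ZA (c X v) v) es = map (\<lambda>E. A.cls (\<lambda>x. d (rep X) E * A.ind E x)) vs"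
      unfolding es_def map_map
    proof (rule map_cong[OF refl])
      fix E assume "E \<in> set vs"
      then have "E \<in> V" by (simp add: vs)
      then show "((\<lambda>v. vscale A.ZA (c X v) v) \<circ> ci) E = A.cls (\<lambda>x. d (rep X) E * A.ind E x)"
        using inv_into_f_f[OF inj] A.scale_cls[OF EZ(1)] by (simp add: c_def ci_def)
    qed
    then have 1: "normed_algebra.lsum A.ZA (map (\<lambda>v. vscale A.ZA (c X v) v) es) = A.cls (\<lambda>x. \<Sum>E\<in>V. d (rep X) E * A.ind E x)"
      using A.lsum_cls[OF V(1) vs(2,1), of "\<lambda>E x. d (rep X) E * A.ind E x"] A.Z_scale[OF EZ(1)] by simp
    have 2: "(\<lambda>x. \<Sum>E\<in>V. d (rep X) E * A.ind E x) \<in> A.Z"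
      by (intro A.Z_sum V(1) A.Z_scale EZ)
    have 3: "rep X \<in> A.Z" "A.cls (rep X) = X" using rep X by auto
    have "vnorm A.ZA (vdiff A.ZA X (normed_algebra.lsum A.ZA (map (\<lambda>v. vscale A.ZA (c X v) v) es))) =
      A.nrm (\<lambda>x. rep X x - (\<Sum>E\<in>V. d (rep X) E * A.ind E x))"
      using A.norm_cls[OF A.Z_diff[OF 3(1) 2]] A.diff_cls[OF 3(1) 2] by (simp only: 1 3(2))
    moreover have "A.nrm (\<lambda>x. rep X x - (\<Sum>E\<in>V. d (rep X) E * A.ind E x)) < e"
      using V(5) X by blast
    ultimately show ?thesis by (simp only:)
  qed
  have ell1: "(\<Sum>v\<leftarrow>es. vnorm A.ZA v * vnorm B.ZA (u v)) \<le>
    vnorm P.ZA (normed_algebra.lsum P.ZA (map (\<lambda>v. tcls v (u v)) es))" if u: "u ` set es \<subseteq> carrier B.ZA" for u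
  proof -
    have "\<exists>f. f \<in> B.Z \<and> u (ci E) = B.cls f" if "E \<in> V" for E
    proof -
      have "u (ci E) \<in> carrier B.ZA" using u that vs by (auto simp: es_def)
      then show ?thesis by (elim B.carrier_ZAE) blast
    qed
    then obtain w where w: "\<And>E. E \<in> V \<Longrightarrow> w E \<in> B.Z" "\<And>E. E \<in> V \<Longrightarrow> u (ci E) = B.cls (w E)" by metis
    have tZ: "(\<lambda>p. complex_of_real (1 / k) * ten (A.ind E) (w E) p) \<in> P.Z" if "E \<in> V" for E
      by (rule scaled_ten_Z[OF EZ(1)[OF that] w(1)[OF that]])
    have "map (\<lambda>v. tcls v (u v)) es = map (\<lambda>E. P.cls (\<lambda>p. complex_of_real (1 / k) * ten (A.ind E) (w E) p)) vs"
      unfolding es_def map_map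
    proof (rule map_cong[OF refl])
      fix E assume "E \<in> set vs"
      then have "E \<in> V" by (simp add: vs)
      then show "((\<lambda>v. tcls v (u v)) \<circ> ci) E = P.cls (\<lambda>p. complex_of_real (1 / k) * ten (A.ind E) (w E) p)"
        using tcls_cls[OF EZ(1) w(1)] w(2) by (simp add: ci_def)
    qed
    then have "normed_algebra.lsum P.ZA (map (\<lambda>v. tcls v (u v)) es) =
      P.cls (\<lambda>p. \<Sum>E\<in>V. complex_of_real (1 / k) * ten (A.ind E) (w E) p)"
      using P.lsum_cls[OF V(1) vs(2,1) tZ] by simp
    also have "\<dots> = P.cls (\<lambda>p. complex_of_real (1 / k) * (\<Sum>E\<in>V. ten (A.ind E) (w E) p))"
      by (simp only: sum_distrib_left)
    finally have "vnorm P.ZA (normed_algebra.lsum P.ZA (map (\<lambda>v. tcls v (u v)) es)) =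
      P.nrm (\<lambda>p. complex_of_real (1 / k) * (\<Sum>E\<in>V. ten (A.ind E) (w E) p))"
      by (simp only:) (intro P.norm_cls P.Z_scale P.Z_sum V(1) ten_Z EZ(1) w(1))
    also have "\<dots> = 1 / k * (\<Sum>E\<in>V. k * A.nrm (A.ind E) * B.nrm (w E))"
    proof -
      have sL: "(\<lambda>p. \<Sum>E\<in>V. ten (A.ind E) (w E) p) \<in> P.L"
        by (rule P.Z_subset_L[OF P.Z_sum[OF V(1) ten_Z[OF EZ(1) w(1)]]])
      have "P.nrm (\<lambda>p. \<Sum>E\<in>V. ten (A.ind E) (w E) p) = (\<Sum>E\<in>V. k * A.nrm (A.ind E) * B.nrm (w E))"
        using disjoint_nrm[OF V(1) _ V(3)] EZ(2) w(1) B.Z_subset_L by blast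
      then show ?thesis using P.L_scale(2)[OF sL, of "complex_of_real (1 / k)"] k(1) by (simp add: norm_divide)
    qed
    also have "\<dots> = (\<Sum>E\<in>V. A.nrm (A.ind E) * B.nrm (w E))"
      using k(1) by (simp add: sum_distrib_left mult.assoc)
    also have "\<dots> = (\<Sum>v\<leftarrow>es. vnorm A.ZA v * vnorm B.ZA (u v))"
      unfolding es_def map_map comp_def sum_list_distinct_conv_sum_set[OF vs(2)] vs(1)
    proof (rule sum.cong[OF refl])
      fix E assume E: "E \<in> V"
      have "vnorm A.ZA (ci E) = A.nrm (A.ind E)" unfolding ci_def by (rule A.norm_cls[OF EZ(1)[OF E]])
      moreover have "vnorm B.ZA (u (ci E)) = B.nrm (w E)" unfolding w(2)[OF E] by (rule B.norm_cls[OF w(1)[OF E]])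
      ultimately show "A.nrm (A.ind E) * B.nrm (w E) = vnorm A.ZA (ci E) * vnorm B.ZA (u (ci E))" by simp
    qed
    finally show ?thesis by simp
  qed
  have "set es \<subseteq> carrier A.ZA" using EZ(1) vs by (auto simp: es_def ci_def)
  then show ?thesis using approx ell1 by blast
qed

lemma tensor_iso: "P.ZA \<simeq>\<^sub>B A.ZA \<otimes>\<^sub>\<pi> B.ZA"
proof (rule projective_tensor_iso[where T = tcls])
  have eqI: "P.cls f = P.cls h" if "\<And>p. f p = h p" for f h
    using that by (intro P.cls_eqI) simp
  let ?i = "complex_of_real (1 / k)"
  note tens = tcls_cls A.cls_ops B.cls_ops P.cls_ops scaled_ten_Z scaled_ten_Z[simplified] A.Z_ops B.Z_ops P.Z_ops
  show "tcls X Y \<in> carrier P.ZA" if "X \<in> carrier A.ZA" "Y \<in> carrier B.ZA" for X Y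
    using that by (elim A.carrier_ZAE B.carrier_ZAE) (simp add: tens)
  show "tcls (vadd A.ZA X X') Y = vadd P.ZA (tcls X Y) (tcls X' Y)"
    if "X \<in> carrier A.ZA" "X' \<in> carrier A.ZA" "Y \<in> carrier B.ZA" for X X' Y
    using that by (elim A.carrier_ZAE B.carrier_ZAE) (simp add: tens, intro eqI, simp add: ten_def algebra_simps add_divide_distrib)
  show "tcls X (vadd B.ZA Y Y') = vadd P.ZA (tcls X Y) (tcls X Y')"
    if "X \<in> carrier A.ZA" "Y \<in> carrier B.ZA" "Y' \<in> carrier B.ZA" for X Y Y'
    using that by (elim A.carrier_ZAE B.carrier_ZAE) (simp add: tens, intro eqI, simp add: ten_def algebra_simps add_divide_distrib)
  show "tcls (vscale A.ZA a X) Y = vscale P.ZA a (tcls X Y)"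
    if "X \<in> carrier A.ZA" "Y \<in> carrier B.ZA" for a X Y
    using that by (elim A.carrier_ZAE B.carrier_ZAE) (simp add: tens, intro eqI, simp add: ten_def algebra_simps add_divide_distrib)
  show "tcls X (vscale B.ZA a Y) = vscale P.ZA a (tcls X Y)"
    if "X \<in> carrier A.ZA" "Y \<in> carrier B.ZA" for a X Y
    using that by (elim A.carrier_ZAE B.carrier_ZAE) (simp add: tens, intro eqI, simp add: ten_def algebra_simps add_divide_distrib)
  show "tcls (vmult A.ZA X X') (vmult B.ZA Y Y') = vmult P.ZA (tcls X Y) (tcls X' Y')"
    if XY: "X \<in> carrier A.ZA" "X' \<in> carrier A.ZA" "Y \<in> carrier B.ZA" "Y' \<in> carrier B.ZA" for X X' Y Y'
  proof -
    obtain f f' h h' where Z: "f \<in> A.Z" "f' \<in> A.Z" "h \<in> B.Z" "h' \<in> B.Z"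
      and eq: "X = A.cls f" "X' = A.cls f'" "Y = B.cls h" "Y' = B.cls h'"
      using XY by (elim A.carrier_ZAE B.carrier_ZAE)
    have "P.conv (\<lambda>p. ?i * ten f h p) (\<lambda>p. ?i * ten f' h' p) = (\<lambda>p. ?i * ten (A.conv f f') (B.conv h h') p)"
      unfolding P.conv_scale
        ten_conv[OF A.Z_subset_L[OF Z(1)] A.Z_subset_L[OF Z(2)] B.Z_subset_L[OF Z(3)] B.Z_subset_L[OF Z(4)]]
      using k(1) by simp
    then show ?thesis
      using Z scaled_ten_Z[OF Z(1,3)] scaled_ten_Z[OF Z(2,4)]
      by (simp only: eq A.mult_cls B.mult_cls P.mult_cls tcls_cls A.Z_conv B.Z_conv)
  qed
  show "vnorm P.ZA (tcls X Y) \<le> vnorm A.ZA X * vnorm B.ZA Y" if XY: "X \<in> carrier A.ZA" "Y \<in> carrier B.ZA" for X Y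
  proof -
    obtain f h where Z: "f \<in> A.Z" "h \<in> B.Z" and eq: "X = A.cls f" "Y = B.cls h"
      using XY by (elim A.carrier_ZAE B.carrier_ZAE)
    note L = A.Z_subset_L[OF Z(1)] B.Z_subset_L[OF Z(2)]
    have "P.nrm (\<lambda>p. ?i * ten f h p) = A.nrm f * B.nrm h"
      using k(1) P.L_scale(2)[OF ten_L(1)[OF L], of ?i] ten_L(2)[OF L] by (simp add: norm_divide)
    then show ?thesis
      using Z by (simp only: eq tcls_cls P.norm_cls[OF scaled_ten_Z[OF Z]] A.norm_cls B.norm_cls order_refl)
  qed
qed (intro A.normed_algebra_ZA B.normed_algebra_ZA P.normed_algebra_ZA; assumption?
  | rule P.ZA_complete P.ZA_separate central_dense_classes classes_basis; assumption)+

end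

theorem proposition2p2:
  fixes \<mu>\<^sub>1 :: "'g::{topological_group_add, t2_space} measure"
    and \<mu>\<^sub>2 :: "'h::{topological_group_add, t2_space} measure"
    and \<mu> :: "('g \<times> 'h) measure"
    and \<omega>\<^sub>1 :: "'g \<Rightarrow> real" and \<omega>\<^sub>2 :: "'h \<Rightarrow> real" and c :: real
  assumes "locally_compact_group TYPE('g)" and "FC_minus_group TYPE('g)"
    and "locally_compact_group TYPE('h)" and "FC_minus_group TYPE('h)"
    and "left_haar_measure \<mu>\<^sub>1" and "left_haar_measure \<mu>\<^sub>2" and "left_haar_measure \<mu>"
    and "weight \<omega>\<^sub>1" and "weight \<omega>\<^sub>2"
    and "0 < c"
    and "\<And>x g. \<omega>\<^sub>1 (g + x - g) \<le> c * \<omega>\<^sub>1 x"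
    and "\<And>x g. \<omega>\<^sub>2 (g + x - g) \<le> c * \<omega>\<^sub>2 x"
  shows "central_beurling_alg \<mu> (\<omega>\<^sub>1 \<times>\<^sub>w \<omega>\<^sub>2) \<simeq>\<^sub>B
    central_beurling_alg \<mu>\<^sub>1 \<omega>\<^sub>1 \<otimes>\<^sub>\<pi> central_beurling_alg \<mu>\<^sub>2 \<omega>\<^sub>2"
proof -
  interpret beurling_product \<mu>\<^sub>1 \<omega>\<^sub>1 c \<mu>\<^sub>2 \<omega>\<^sub>2 c \<mu>
    using assms by unfold_locales
  show ?thesis by (rule tensor_iso)
qed

end
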